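(* There exist $C>0$, $\gamma\in(0,1)$, $\varepsilon_0>0$, $t\in\mathbb N$ and $L_0>0$ such that, for every $\delta>0$ sufficiently small and every $L>L_0$, setting $$V_L(z,\bar z):=d(z,\bar z)^{-\frac{\varepsilon_0}{\log L}}\mathbf 1_{\{d(z,\bar z)\le L^{-t}\}}+\mathbf 1_{\{d(z,\bar z)>L^{-t}\}},$$ we have, for every $n\ge1$ and every $\phi\in L^\infty_{V_L}\bigl((\mathbb T^2\times\mathbb T^2)\setminus\Delta\bigr)$, $$\left\|\mathcal P_2^n\phi-\int_{\mathbb T^2\times\mathbb T^2}\phi\,d(m\otimes m)\right\|_{V_L}\le C\gamma^n\|\phi\|_{V_L}.$$ Equivalently, for every $(z,\bar z)\notin\Delta$, $$\left|\mathcal P_2^n\phi(z,\bar z)-\int\phi\,d(m\otimes m)\right|\le C\gamma^n\bigl(1+V_L(z,\bar z)\bigr)\|\phi\|_{V_L}.$$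
   Context: For $L>0$ and $\delta>0$ put $\sigma:=L^{-\delta}$ and $f(x):=L\cos(2\pi x)$. Let $\Omega:=[-\sigma,\sigma]^{\mathbb N_0}$ with the product probability measure $\mathbb P$ whose coordinate marginals are uniform on $[-\sigma,\sigma]$; $\mathbb E$ is the corresponding expectation. For $\omega=(\omega_n)_{n\ge0}\in\Omega$ let $$f_\omega(x,y)=f_{\omega_0}(x,y)=\bigl(f(x+\omega_0)-y,\;x+\omega_0\bigr)\pmod 1,\qquad (x,y)\in\mathbb T^2 .$$ $m$ is normalized Lebesgue measure on $\mathbb T^2$, $d$ is the standard distance on $\mathbb T^2$, and $\Delta=\{(z,\bar z)\in\mathbb T^2\times\mathbb T^2:z=\bar z\}$. The two-point motion is the Markov chain $(z_{n+1},\bar z_{n+1})=(f_{\omega_n}(z_n),f_{\omega_n}(\bar z_n))$ on $(\mathbb T^2\times\mathbb T^2)\setminus\Delta$, with Koopman operator $\mathcal P_2\phi(z,\bar z):=\mathbb E[\phi(f_\omega(z),f_\omega(\bar z))]$. For measurable $V:(\mathbb T^2\times\mathbb T^2)\setminus\Delta\to[0,\infty)$, $$\|\varphi\|_V:=\sup_{(z,\bar z)\notin\Delta}\frac{|\varphi(z,\bar z)|}{1+V(z,\bar z)},$$ and $L^\infty_V((\mathbb T^2\times\mathbb T^2)\setminus\Delta)$ is the space of measurable real functions $\phi$ on $(\mathbb T^2\times\mathbb T^2)\setminus\Delta$ with $\|\phi\|_V<\infty$. *)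

theory Defs
  imports "HOL-Probability.Probability"
begin

text \<open>
  The torus \<open>(\<real>/\<int>)\<^sup>2\<close> is modelled by its fundamental domain \<open>[0,1)\<^sup>2\<close>; reduction mod 1 is
  \<^const>\<open>frac\<close>. Functions on (subsets of) the torus are total functions on \<open>\<real>\<^sup>2\<close> whose values
  outside the fundamental domain are irrelevant.
\<close>

definition torus :: "(real \<times> real) set"
  where "torus = {0..<1} \<times> {0..<1}"

definition torus_measure :: "(real \<times> real) measure"
  where "torus_measure = restrict_space lborel torus"

text \<open>The quotient distance induced by the Euclidean distance of the plane.\<close>

definition torus_dist :: "real \<times> real \<Rightarrow> real \<times> real \<Rightarrow> real"
  where "torus_dist z w = (INF (k, l) \<in> (UNIV :: (int \<times> int) set). dist z (w + (of_int k, of_int l)))"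

definition off_diagonal :: "((real \<times> real) \<times> (real \<times> real)) set"
  where "off_diagonal = {(z, w). z \<in> torus \<and> w \<in> torus \<and> z \<noteq> w}"

definition f_std :: "real \<Rightarrow> real \<Rightarrow> real"
  where "f_std L x = L * cos (2 * pi * x)"

definition f_rand :: "real \<Rightarrow> real \<Rightarrow> real \<times> real \<Rightarrow> real \<times> real"
  where "f_rand L w = (\<lambda>(x, y). (frac (f_std L (x + w) - y), frac (x + w)))"

definition noise_size :: "real \<Rightarrow> real \<Rightarrow> real"
  where "noise_size L \<delta> = L powr (- \<delta>)"

definition noise_marginal :: "real \<Rightarrow> real measure"
  where "noise_marginal \<sigma> = uniform_measure (restrict_space lborel {-\<sigma>..\<sigma>}) {-\<sigma>..\<sigma>}"

definition noise_measure :: "real \<Rightarrow> (nat \<Rightarrow> real) measure"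
  where "noise_measure \<sigma> = Pi\<^sub>M UNIV (\<lambda>_. noise_marginal \<sigma>)"

definition koopman2 ::
    "real \<Rightarrow> real \<Rightarrow> ((real \<times> real) \<times> (real \<times> real) \<Rightarrow> real) \<Rightarrow> (real \<times> real) \<times> (real \<times> real) \<Rightarrow> real"
  where "koopman2 L \<delta> \<phi> = (\<lambda>(z, w).
    \<integral>\<omega>. \<phi> (f_rand L (\<omega> 0) z, f_rand L (\<omega> 0) w) \<partial>noise_measure (noise_size L \<delta>))"

text \<open>The supremum is taken in \<^typ>\<open>ennreal\<close>, so that it is infinite for unbounded quotients.\<close>

definition weighted_norm ::
    "((real \<times> real) \<times> (real \<times> real) \<Rightarrow> real) \<Rightarrow> ((real \<times> real) \<times> (real \<times> real) \<Rightarrow> real) \<Rightarrow> ennreal"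
  where "weighted_norm V \<phi> = (SUP p \<in> off_diagonal. ennreal (\<bar>\<phi> p\<bar> / (1 + V p)))"

definition weighted_Linf ::
    "((real \<times> real) \<times> (real \<times> real) \<Rightarrow> real) \<Rightarrow> ((real \<times> real) \<times> (real \<times> real) \<Rightarrow> real) set"
  where "weighted_Linf V =
    {\<phi> \<in> borel_measurable (restrict_space (torus_measure \<Otimes>\<^sub>M torus_measure) off_diagonal).
      weighted_norm V \<phi> < \<infinity>}"

definition lyapunov_V :: "real \<Rightarrow> nat \<Rightarrow> real \<Rightarrow> (real \<times> real) \<times> (real \<times> real) \<Rightarrow> real"
  where "lyapunov_V \<epsilon>\<^sub>0 t L = (\<lambda>(z, w).
    if torus_dist z w \<le> L powr (- real t) then torus_dist z w powr (- \<epsilon>\<^sub>0 / ln L) else 1)"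

text \<open>
  The mean of \<open>\<phi>\<close> over the product of two tori. As \<open>\<phi>\<close> is only specified off the diagonal, which has
  full measure, the integral is taken there; arbitrary values on the diagonal could otherwise
  destroy measurability.
\<close>

definition pair_mean :: "((real \<times> real) \<times> (real \<times> real) \<Rightarrow> real) \<Rightarrow> real"
  where "pair_mean \<phi> = (LINT p : off_diagonal | (torus_measure \<Otimes>\<^sub>M torus_measure). \<phi> p)"

text \<open>The dynamics stays on the torus and off the diagonal, so that iterates of \<^const>\<open>koopman2\<close> only
  see the values of \<open>\<phi>\<close> on \<^const>\<open>off_diagonal\<close>.\<close>

lemma f_rand_off_diagonal:
  assumes "(z, w) \<in> off_diagonal"
  shows "(f_rand L a z, f_rand L a w) \<in> off_diagonal"
proof -
  obtain x y x' y' where zw: "z = (x, y)" "w = (x', y')"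
    by (cases z, cases w) auto
  have b: "0 \<le> x" "x < 1" "0 \<le> y" "y < 1" "0 \<le> x'" "x' < 1" "0 \<le> y'" "y' < 1"
    using assms unfolding zw off_diagonal_def torus_def by auto
  have eqI: "u = v" if "0 \<le> u" "u < 1" "0 \<le> v" "v < 1" "u - v = of_int k" for u v :: real and k
  proof -
    have "-1 < (of_int k :: real)" "(of_int k :: real) < 1" using that by linarith+
    then have k: "k = 0" by linarith
    from that(5) show ?thesis unfolding k by simp
  qed
  have "z = w" if eq: "f_rand L a z = f_rand L a w"
  proof -
    from eq have 1: "frac (x + a) = frac (x' + a)"
      and 2: "frac (f_std L (x + a) - y) = frac (f_std L (x' + a) - y')"
      unfolding zw f_rand_def by auto
    have "x - x' = of_int (\<lfloor>x + a\<rfloor> - \<lfloor>x' + a\<rfloor>)" using 1 unfolding frac_def by simp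
    then have x: "x = x'" using eqI b by blast
    have "y' - y = of_int (\<lfloor>f_std L (x + a) - y\<rfloor> - \<lfloor>f_std L (x' + a) - y'\<rfloor>)"
      using 2 unfolding frac_def x by simp
    then have "y' = y" using eqI b by blast
    with x zw show ?thesis by simp
  qed
  moreover have "z \<noteq> w" using assms unfolding off_diagonal_def by auto
  moreover have "f_rand L a u \<in> torus" for u
    unfolding f_rand_def torus_def by (cases u) (auto simp: frac_lt_1)
  ultimately show ?thesis unfolding off_diagonal_def by auto
qed

lemma space_noise_measure: "space (noise_measure \<sigma>) = (\<Pi>\<^sub>E _\<in>UNIV. {-\<sigma>..\<sigma>})"
  unfolding noise_measure_def noise_marginal_def by (simp add: space_PiM space_restrict_space)

end

theory Submission
  imports Defs "HOL-Real_Asymp.Real_Asymp"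
begin

text \<open>
  Over a step with noise \<open>\<omega>\<close> the vertical difference of two orbits becomes, modulo 1,
  \<open>A sin (2\<pi>\<omega> + \<theta>) - h\<close>, where the old vertical difference \<open>h\<close> does not depend on \<open>\<omega>\<close> and \<open>\<bar>A\<bar>\<close> is
  comparable to \<open>L\<close> times the horizontal difference. Since \<open>sin\<close> is near any given value only on
  a small set, within two steps the distance of the orbits grows by a factor \<open>L\<^sup>1\<^sup>/\<^sup>2\<close> with
  probability close to 1. This multiplies \<open>V = d powr (- 1 / ln L)\<close> by at most \<open>exp (-1/2)\<close>, which gives
  a drift inequality for \<open>V\<close>, and after a number of steps independent of \<open>L\<close> the orbits are
  separated by almost a constant if they started off a small neighbourhood of the diagonal.

  From separated points the law after four steps has a density bounded by a small power of \<open>L\<close>, up to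
  a small mass. The averages of a bounded function \<open>\<Phi>\<close>, on the other hand, converge to its mean in
  \<open>L\<^sup>1\<close> at a rate given by a larger negative power of \<open>L\<close>. Indeed, two averages make them Lipschitz
  under simultaneous translations of both vertical coordinates, so on a short piece of the noise
  interval the translation of the old horizontal coordinates, which become the vertical ones of the
  next step, can be neglected, and only the pair \<open>(f (x + \<omega>), f (x' + \<omega>))\<close> matters. The Fourier
  coefficients of its law are oscillatory integrals, small by van der Corput's lemma. The
  density bound turns this into convergence that is uniform on sublevel sets of \<open>V\<close>. Together with
  the drift, it makes a fixed power of the transition operator contract functions of mean zero in a
  norm weighted by \<open>1 + V / 100\<close>.
\<close>

section \<open>Integrals of periodic functions\<close>

text \<open>The exponents leave little room. Each of the four density steps costs a factor
  \<open>1 / \<sigma>\<close>, the mixing estimate costs one more, and excluding degenerate sets of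
  size \<open>\<epsilon>\<close> costs \<open>1 / \<epsilon>\<^sup>2\<close>; the decay in the mean
  is only \<open>L powr (-1/24)\<close>. With \<open>\<epsilon> = L powr (-1/60)\<close> and
  \<open>1 / \<sigma> \<le> L powr (1/1000)\<close> the product still tends to 0, because 1/30 +
  5/1000 < 1/24. With the witnesses \<open>\<epsilon>\<^sub>0 = 1\<close> and \<open>t = 1\<close>,
  the value of \<open>V\<close> near the diagonal is \<open>exp a\<close> for a pair at distance
  \<open>L powr (- a)\<close>. Stretching by a fixed power of \<open>L\<close> therefore changes
  \<open>V\<close> by a factor that does not involve \<open>L\<close>, and neither do the level 135,
  the number of steps and the rate. Twenty steps are needed: \<open>V \<le> 135\<close> still allows
  distances as small as \<open>L powr (-6)\<close>; one step makes the horizontal difference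
  visible, eleven enlarge it, four smooth the law and four mix. The motion is studied on the plane,
  acting on functions of period 1, so that shifts and reflections of a coordinate need no reduction
  mod 1. The diagonal is an invariant null set, on which the test functions get the value 0.\<close>

definition unif :: "real \<Rightarrow> real \<Rightarrow> real measure"
  where "unif a b = uniform_measure lborel {a..b}"

abbreviation circ :: "real measure"
  where "circ \<equiv> unif 0 1"

definition per1 :: "(real \<Rightarrow> 'a) \<Rightarrow> bool"
  where "per1 F \<longleftrightarrow> (\<forall>y. F (y + 1) = F y)"

lemma sets_unif [measurable_cong, simp]: "sets (unif a b) = sets borel"
  and space_unif [simp]: "space (unif a b) = UNIV"
  by (simp_all add: unif_def)

lemma prob_space_unif: "a < b \<Longrightarrow> prob_space (unif a b)"
  unfolding unif_def by (rule prob_space_uniform_measure) auto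

lemma prob_space_circ [simp]: "prob_space circ"
  by (rule prob_space_unif) simp

lemma nn_integral_unif:
  assumes [measurable]: "f \<in> borel_measurable borel" and "a < b"
  shows "(\<integral>\<^sup>+x. f x \<partial>unif a b) = (\<integral>\<^sup>+x. f x * indicator {a..b} x \<partial>lborel) * ennreal (1 / (b - a))"
  using assms(2) unfolding unif_def
  by (subst nn_integral_uniform_measure)
     (auto simp: divide_ennreal_def inverse_ennreal inverse_eq_divide)

lemma nn_integral_circ:
  assumes [measurable]: "f \<in> borel_measurable borel"
  shows "(\<integral>\<^sup>+x. f x \<partial>circ) = (\<integral>\<^sup>+x. f x * indicator {0..1} x \<partial>lborel)"
  by (subst nn_integral_unif) auto

lemma per1_of_int:
  assumes "per1 F" shows "F (y + of_int k) = F y"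
proof (induction k rule: int_induct[where k = 0])
  case base then show ?case by simp
next
  case (step1 i)
  have "F (y + of_int (i + 1)) = F ((y + of_int i) + 1)" by (simp add: algebra_simps)
  with step1 assms show ?case by (simp add: per1_def)
next
  case (step2 i)
  have "F ((y + of_int (i - 1)) + 1) = F (y + of_int (i - 1))" using assms unfolding per1_def by blast
  then have "F (y + of_int i) = F (y + of_int (i - 1))" by (simp add: algebra_simps)
  with step2 show ?case by metis
qed

lemma per1_frac: "per1 F \<Longrightarrow> F (frac y) = F y"
  using per1_of_int[of F y "- \<lfloor>y\<rfloor>"] by (simp add: frac_def)

lemma nn_integral_interval_shift:
  fixes F :: "real \<Rightarrow> ennreal"
  assumes [measurable]: "F \<in> borel_measurable borel"
  shows "(\<integral>\<^sup>+y. F (c + y) * indicator {a..b} y \<partial>lborel) = (\<integral>\<^sup>+y. F y * indicator {c + a..c + b} y \<partial>lborel)"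
  by (subst (2) nn_integral_real_affine[where c = 1 and t = c])
     (auto intro!: nn_integral_cong split: split_indicator)

lemma nn_integral_Icc_split:
  fixes F :: "real \<Rightarrow> ennreal"
  assumes [measurable]: "F \<in> borel_measurable borel" and "a \<le> b" "b \<le> c"
  shows "(\<integral>\<^sup>+y. F y * indicator {a..c} y \<partial>lborel) =
    (\<integral>\<^sup>+y. F y * indicator {a..b} y \<partial>lborel) + (\<integral>\<^sup>+y. F y * indicator {b..c} y \<partial>lborel)"
proof -
  have "(\<integral>\<^sup>+y. F y * indicator {a..c} y \<partial>lborel) =
      (\<integral>\<^sup>+y. F y * indicator {a..b} y + F y * indicator {b..c} y \<partial>lborel)"
  proof (rule nn_integral_cong_AE)
    have "AE y in lborel. y \<noteq> b" by (rule AE_lborel_singleton)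
    then show "AE y in lborel. F y * indicator {a..c} y =
        F y * indicator {a..b} y + F y * indicator {b..c} y"
    proof eventually_elim
      case (elim y)
      then show ?case using assms(2,3) by (auto split: split_indicator)
    qed
  qed
  then show ?thesis by (simp add: nn_integral_add)
qed

lemma nn_integral_period:
  fixes F :: "real \<Rightarrow> ennreal"
  assumes [measurable]: "F \<in> borel_measurable borel" and per: "per1 F"
  shows "(\<integral>\<^sup>+y. F y * indicator {c..c + 1} y \<partial>lborel) = (\<integral>\<^sup>+y. F y \<partial>circ)"
proof -
  let ?I = "\<lambda>a b. \<integral>\<^sup>+y. F y * indicator {a..b} y \<partial>lborel"
  have sh: "?I (of_int k + a) (of_int k + b) = ?I a b" for k :: int and a b
    using nn_integral_interval_shift[OF assms(1), of "of_int k" a b] per1_of_int[OF per, of _ k]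
    by (simp add: add.commute)
  \<comment> \<open>An integer shift moves the left end into [0,1); the piece beyond 1 is then
    brought back by one more period.\<close>
  define e where "e = frac c"
  have e: "0 \<le> e" "e < 1" by (simp_all add: e_def frac_lt_1)
  have "?I c (c + 1) = ?I e (e + 1)"
    using sh[of "\<lfloor>c\<rfloor>" e "e + 1"] by (simp add: e_def frac_def)
  also have "\<dots> = ?I e 1 + ?I 1 (e + 1)" using e by (intro nn_integral_Icc_split) auto
  also have "?I 1 (e + 1) = ?I 0 e" using sh[of 1 0 e] by (simp add: add.commute)
  also have "?I e 1 + ?I 0 e = ?I 0 1"
    using e nn_integral_Icc_split[of F 0 e 1] by (simp add: add.commute)
  finally show ?thesis by (simp add: nn_integral_circ)
qed

lemma nn_integral_circ_shift:
  fixes F :: "real \<Rightarrow> ennreal"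
  assumes [measurable]: "F \<in> borel_measurable borel" and per: "per1 F"
  shows "(\<integral>\<^sup>+y. F (c + y) \<partial>circ) = (\<integral>\<^sup>+y. F y \<partial>circ)"
  using nn_integral_period[OF assms, of c] nn_integral_interval_shift[OF assms(1), of c 0 1]
  by (simp add: nn_integral_circ)

lemma nn_integral_circ_reflect:
  fixes F :: "real \<Rightarrow> ennreal"
  assumes [measurable]: "F \<in> borel_measurable borel" and per: "per1 F"
  shows "(\<integral>\<^sup>+y. F (c - y) \<partial>circ) = (\<integral>\<^sup>+y. F y \<partial>circ)"
proof -
  have "(\<integral>\<^sup>+y. F y \<partial>circ) = (\<integral>\<^sup>+y. F y * indicator {c - 1..(c - 1) + 1} y \<partial>lborel)"
    using nn_integral_period[OF assms, of "c - 1"] by simp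
  also have "\<dots> = (\<integral>\<^sup>+y. F (c - y) * indicator {0..1} y \<partial>lborel)"
    by (subst nn_integral_real_affine[where c = "-1" and t = c])
       (auto intro!: nn_integral_cong split: split_indicator)
  finally show ?thesis by (simp add: nn_integral_circ)
qed

lemma nn_integral_periods:
  fixes F :: "real \<Rightarrow> ennreal"
  assumes [measurable]: "F \<in> borel_measurable borel" and per: "per1 F"
  shows "(\<integral>\<^sup>+y. F y * indicator {c..c + real n} y \<partial>lborel) = of_nat n * (\<integral>\<^sup>+y. F y \<partial>circ)"
proof (induction n)
  case 0
  have "(\<integral>\<^sup>+y. F y * indicator {c..c + real 0} y \<partial>lborel) = (\<integral>\<^sup>+y. 0 \<partial>(lborel :: real measure))"
    by (rule nn_integral_cong_AE, rule AE_mp[OF AE_lborel_singleton[of c]])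
       (auto split: split_indicator)
  then show ?case by simp
next
  case (Suc n)
  have "(\<integral>\<^sup>+y. F y * indicator {c..c + real (Suc n)} y \<partial>lborel) =
      (\<integral>\<^sup>+y. F y * indicator {c..c + real n} y \<partial>lborel) +
      (\<integral>\<^sup>+y. F y * indicator {c + real n..(c + real n) + 1} y \<partial>lborel)"
    by (subst nn_integral_Icc_split[where b = "c + real n"]) (auto simp: algebra_simps)
  also have "\<dots> = of_nat n * (\<integral>\<^sup>+y. F y \<partial>circ) + (\<integral>\<^sup>+y. F y \<partial>circ)"
    unfolding Suc.IH nn_integral_period[OF assms] ..
  finally show ?case by (simp add: algebra_simps)
qed

text \<open>The interval is covered by \<open>\<lceil>2 * B\<rceil>\<close> whole periods starting
  at \<open>- B\<close>. Growth of the bound linear in \<open>B\<close> is what later cancels the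
  Jacobian of a scaling by \<open>B\<close>.\<close>

lemma nn_integral_symmetric_le:
  fixes F :: "real \<Rightarrow> ennreal"
  assumes [measurable]: "F \<in> borel_measurable borel" and per: "per1 F" and "0 \<le> B"
  shows "(\<integral>\<^sup>+y. F y * indicator {-B..B} y \<partial>lborel) \<le> ennreal (2 * (B + 1)) * (\<integral>\<^sup>+y. F y \<partial>circ)"
proof -
  define n where "n = nat \<lceil>2 * B\<rceil>"
  have n: "2 * B \<le> real n" "real n \<le> 2 * (B + 1)" using assms(3) unfolding n_def by (simp_all, linarith)
  have "(\<integral>\<^sup>+y. F y * indicator {-B..B} y \<partial>lborel) \<le> (\<integral>\<^sup>+y. F y * indicator {-B..-B + real n} y \<partial>lborel)"
    using n by (intro nn_integral_mono mult_left_mono) (auto split: split_indicator)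
  also have "\<dots> = of_nat n * (\<integral>\<^sup>+y. F y \<partial>circ)" by (rule nn_integral_periods[OF assms(1,2)])
  also have "\<dots> \<le> ennreal (2 * (B + 1)) * (\<integral>\<^sup>+y. F y \<partial>circ)"
    using n by (intro mult_right_mono) (auto simp: ennreal_of_nat_eq_real_of_nat intro!: ennreal_leI)
  finally show ?thesis .
qed

text \<open>The noise has density \<open>1 / (2 * \<sigma>)\<close> on an interval contained in two
  periods. This comparison with the uniform law on the circle is where the density and probability
  estimates lose their factors \<open>1 / \<sigma>\<close>.\<close>

lemma nn_integral_noise_le:
  fixes F :: "real \<Rightarrow> ennreal"
  assumes [measurable]: "F \<in> borel_measurable borel" and per: "per1 F" and s: "0 < \<sigma>" "\<sigma> \<le> 1"
  shows "(\<integral>\<^sup>+y. F y \<partial>unif (-\<sigma>) \<sigma>) \<le> ennreal (1 / \<sigma>) * (\<integral>\<^sup>+y. F y \<partial>circ)"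
proof -
  have "(\<integral>\<^sup>+y. F y \<partial>unif (-\<sigma>) \<sigma>) = (\<integral>\<^sup>+y. F y * indicator {-\<sigma>..\<sigma>} y \<partial>lborel) * ennreal (1 / (2 * \<sigma>))"
    using s by (subst nn_integral_unif) auto
  also have "(\<integral>\<^sup>+y. F y * indicator {-\<sigma>..\<sigma>} y \<partial>lborel) \<le> (\<integral>\<^sup>+y. F y * indicator {-1..-1 + real 2} y \<partial>lborel)"
    using s by (intro nn_integral_mono mult_left_mono) (auto split: split_indicator)
  also have "\<dots> = 2 * (\<integral>\<^sup>+y. F y \<partial>circ)"
    using nn_integral_periods[OF assms(1,2), of "-1" 2] by simp
  finally have "(\<integral>\<^sup>+y. F y \<partial>unif (-\<sigma>) \<sigma>) \<le> 2 * (\<integral>\<^sup>+y. F y \<partial>circ) * ennreal (1 / (2 * \<sigma>))"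
    by (simp add: mult_right_mono)
  also have "2 * (\<integral>\<^sup>+y. F y \<partial>circ) * ennreal (1 / (2 * \<sigma>)) = (ennreal 2 * ennreal (1 / (2 * \<sigma>))) * (\<integral>\<^sup>+y. F y \<partial>circ)"
    by (simp add: mult_ac)
  also have "ennreal 2 * ennreal (1 / (2 * \<sigma>)) = ennreal (1 / \<sigma>)"
    using s by (subst ennreal_mult[symmetric]) auto
  finally show ?thesis .
qed

section \<open>Sublevel sets of trigonometric functions\<close>

definition nd :: "real \<Rightarrow> real"
  where "nd x = \<bar>x - of_int (round x)\<bar>"

lemma nd_le: "nd x \<le> \<bar>x - of_int k\<bar>"
  unfolding nd_def by (rule round_diff_minimal)

lemma nd_nonneg [simp]: "0 \<le> nd x"
  by (simp add: nd_def)

lemma nd_le_half: "nd x \<le> 1 / 2"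
  using of_int_round_abs_le[of x] by (simp add: nd_def abs_minus_commute)

lemma nd_obtain: obtains k where "nd x = \<bar>x - of_int k\<bar>"
  by (auto simp: nd_def)

lemma nd_le_abs: "nd x \<le> \<bar>x\<bar>"
  using nd_le[of x 0] by simp

lemma nd_triangle: "nd (x + y) \<le> nd x + nd y"
proof -
  obtain k l where "nd x = \<bar>x - of_int k\<bar>" "nd y = \<bar>y - of_int l\<bar>"
    by (metis nd_obtain)
  moreover have "nd (x + y) \<le> \<bar>(x + y) - of_int (k + l)\<bar>" by (rule nd_le)
  ultimately show ?thesis by simp
qed

lemma nd_minus [simp]: "nd (- x) = nd x"
proof -
  have "nd (- y) \<le> nd y" for y
  proof -
    obtain k where "nd y = \<bar>y - of_int k\<bar>" by (rule nd_obtain)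
    with nd_le[of "- y" "- k"] show ?thesis by simp
  qed
  from this[of x] this[of "- x"] show ?thesis by simp
qed

lemma nd_minus_commute: "nd (x - y) = nd (y - x)"
  using nd_minus[of "x - y"] by simp

lemma nd_add_int [simp]: "nd (x + of_int k) = nd x"
proof -
  have *: "nd (x + of_int k) \<le> nd x" for x k
    using nd_triangle[of x "of_int k"] nd_le[of "of_int k" k] nd_nonneg[of "of_int k"] by simp
  show ?thesis using *[of x k] *[of "x + of_int k" "- k"] by simp
qed

lemma nd_add_1 [simp]: "nd (x + 1) = nd x"
  using nd_add_int[of x 1] by simp

lemma measurable_nd [measurable]: "nd \<in> borel_measurable borel"
  unfolding nd_def round_def by measurable

text \<open>Jordan's inequality: the sine is concave on a quarter period, hence lies above its
  chord.\<close>

lemma jordan_sin: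
  assumes "0 \<le> t" "t \<le> 1 / 2" shows "2 * t \<le> sin (pi * t)"
proof -
  have "convex_on {0..1/2} (\<lambda>t. - sin (pi * t))"
  proof (rule f''_ge0_imp_convex)
    show "((\<lambda>t. - sin (pi * t)) has_real_derivative - (pi * cos (pi * x))) (at x)" for x
      by (auto intro!: derivative_eq_intros)
    show "((\<lambda>x. - (pi * cos (pi * x))) has_real_derivative pi * pi * sin (pi * x)) (at x)" for x
      by (auto intro!: derivative_eq_intros)
    show "0 \<le> pi * pi * sin (pi * x)" if "x \<in> {0..1/2}" for x
    proof -
      have "pi * x \<le> pi * 1" using that by (intro mult_left_mono) auto
      then have "0 \<le> sin (pi * x)" using that by (intro sin_ge_zero) auto
      then show ?thesis by simp
    qed
  qed auto
  then have "- sin (pi * t) \<le> (- sin (pi * (1/2)) - - sin (pi * 0)) / (1/2 - 0) * (t - 0) + - sin (pi * 0)"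
    by (rule convex_onD_Icc') (use assms in auto)
  then show ?thesis by (simp add: sin_pi_half)
qed

text \<open>Both sides are even and 1-periodic in \<open>x\<close>. With Jordan's inequality this
  makes \<open>\<bar>sin (pi * x)\<bar>\<close> and \<open>nd x\<close> comparable from both sides,
  which later compares amplitudes with distances.\<close>

lemma abs_sin_pi_nd: "\<bar>sin (pi * x)\<bar> = sin (pi * nd x)"
proof -
  obtain k where k: "nd x = \<bar>x - of_int k\<bar>" by (rule nd_obtain)
  have "sin (pi * x) = sin (pi * (x - of_int k) + of_int k * pi)" by (simp add: algebra_simps)
  also have "\<dots> = sin (pi * (x - of_int k)) * cos (of_int k * pi)"
    by (simp add: sin_add mult.commute[of _ pi] sin_npi_int)
  finally have "\<bar>sin (pi * x)\<bar> = \<bar>sin (pi * (x - of_int k))\<bar>"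
    by (simp add: abs_mult mult.commute[of _ pi] cos_npi_int)
  also have "\<dots> = \<bar>sin (pi * nd x)\<bar>" unfolding k
  proof (cases "x \<ge> of_int k")
    case False
    have "sin (pi * (x - of_int k)) = - sin (pi * (of_int k - x))"
      by (simp add: algebra_simps flip: sin_minus)
    with False show "\<bar>sin (pi * (x - of_int k))\<bar> = \<bar>sin (pi * \<bar>x - of_int k\<bar>)\<bar>" by simp
  qed simp
  also have "\<dots> = sin (pi * nd x)"
  proof -
    have "pi * nd x \<le> pi * 1" using nd_le_half[of x] by (intro mult_left_mono) (linarith, simp)
    then show ?thesis by (simp add: sin_ge_zero)
  qed
  finally show ?thesis .
qed

lemma abs_sin_ge_nd: "2 * nd x \<le> \<bar>sin (pi * x)\<bar>"
  unfolding abs_sin_pi_nd by (intro jordan_sin nd_nonneg nd_le_half)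

lemma abs_sin_le_nd: "\<bar>sin (pi * x)\<bar> \<le> pi * nd x"
  unfolding abs_sin_pi_nd by (intro sin_x_le_x) simp

lemma nn_integral_nd_less: "0 \<le> r \<Longrightarrow> (\<integral>\<^sup>+u. indicator {u. nd u \<le> r} u \<partial>circ) \<le> ennreal (2 * r)"
proof -
  assume r: "0 \<le> r"
  have "(\<integral>\<^sup>+u. indicator {u. nd u \<le> r} u \<partial>circ) = (\<integral>\<^sup>+u. indicator {u. nd u \<le> r} u * indicator {0..1} u \<partial>lborel)"
    by (rule nn_integral_circ) measurable
  also have "\<dots> \<le> (\<integral>\<^sup>+u. indicator {0..r} u + indicator {1-r..1} u \<partial>lborel)"
  proof (rule nn_integral_mono)
    fix u :: real
    show "indicator {u. nd u \<le> r} u * indicator {0..1} u \<le> (indicator {0..r} u + indicator {1-r..1} u :: ennreal)"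
    proof (cases "nd u \<le> r \<and> 0 \<le> u \<and> u \<le> 1")
      case True
      have "round u = 0 \<or> round u = 1" using True unfolding round_def by linarith
      then show ?thesis using True unfolding nd_def by (auto split: split_indicator)
    qed (auto split: split_indicator)
  qed
  also have "\<dots> = ennreal (2 * r)" using r by (simp add: nn_integral_add flip: ennreal_plus)
  finally show ?thesis .
qed

text \<open>By Jordan's inequality twice the shifted variable must lie within
  \<open>\<eta> / 2\<close> of an integer. In one period this leaves a neighbourhood of 1/2 of
  length \<open>\<eta> / 2\<close> and two end pieces of length \<open>\<eta> / 4\<close>.\<close>

lemma nn_integral_sin_small:
  assumes "0 \<le> \<eta>"
  shows "(\<integral>\<^sup>+u. indicator {u. \<bar>sin (2 * pi * u + \<theta>)\<bar> \<le> \<eta>} u \<partial>circ) \<le> ennreal \<eta>"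
proof -
  define F :: "real \<Rightarrow> ennreal" where "F = indicator {u. nd (2 * u) \<le> \<eta> / 2}"
  have [measurable]: "F \<in> borel_measurable borel" unfolding F_def by measurable
  have per: "per1 F"
    using nd_add_int[of _ 2] by (simp add: per1_def F_def indicator_def distrib_left)
  have "(\<integral>\<^sup>+u. indicator {u. \<bar>sin (2 * pi * u + \<theta>)\<bar> \<le> \<eta>} u \<partial>circ) \<le> (\<integral>\<^sup>+u. F (\<theta> / (2 * pi) + u) \<partial>circ)"
  proof (rule nn_integral_mono)
    fix u
    have "sin (2 * pi * u + \<theta>) = sin (pi * (2 * (\<theta> / (2 * pi) + u)))" by (simp add: distrib_left add.commute mult.assoc mult.left_commute)
    with abs_sin_ge_nd[of "2 * (\<theta> / (2 * pi) + u)"]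
    show "indicator {u. \<bar>sin (2 * pi * u + \<theta>)\<bar> \<le> \<eta>} u \<le> F (\<theta> / (2 * pi) + u)"
      by (auto simp: F_def indicator_def)
  qed
  also have "\<dots> = (\<integral>\<^sup>+u. F u \<partial>circ)" by (rule nn_integral_circ_shift[OF _ per]) measurable
  also have "\<dots> = (\<integral>\<^sup>+u. F u * indicator {0..1} u \<partial>lborel)" by (rule nn_integral_circ) measurable
  also have "\<dots> \<le> (\<integral>\<^sup>+u. indicator {0..\<eta>/4} u + indicator {1/2-\<eta>/4..1/2+\<eta>/4} u + indicator {1-\<eta>/4..1} u \<partial>lborel)"
  proof (rule nn_integral_mono)
    fix u :: real
    show "F u * indicator {0..1} u \<le> (indicator {0..\<eta>/4} u + indicator {1/2-\<eta>/4..1/2+\<eta>/4} u + indicator {1-\<eta>/4..1} u :: ennreal)"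
    proof (cases "nd (2 * u) \<le> \<eta> / 2 \<and> 0 \<le> u \<and> u \<le> 1")
      case True
      have "round (2 * u) = 0 \<or> round (2 * u) = 1 \<or> round (2 * u) = 2" using True unfolding round_def by linarith
      then have "u \<le> \<eta>/4 \<or> (1/2-\<eta>/4 \<le> u \<and> u \<le> 1/2+\<eta>/4) \<or> 1-\<eta>/4 \<le> u"
      proof (elim disjE)
        assume "round (2 * u) = 0" with True have "\<bar>2 * u\<bar> \<le> \<eta>/2" unfolding nd_def by auto
        then have "u \<le> \<eta>/4" by linarith
        then show ?thesis by blast
      next
        assume "round (2 * u) = 1" with True have "\<bar>2 * u - 1\<bar> \<le> \<eta>/2" unfolding nd_def by auto
        then have "1/2-\<eta>/4 \<le> u \<and> u \<le> 1/2+\<eta>/4" by linarith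
        then show ?thesis by blast
      next
        assume "round (2 * u) = 2" with True have "\<bar>2 * u - 2\<bar> \<le> \<eta>/2" unfolding nd_def by auto
        then have "1-\<eta>/4 \<le> u" by linarith
        then show ?thesis by blast
      qed
      then show ?thesis using True by (auto split: split_indicator simp: F_def)
    qed (auto split: split_indicator simp: F_def)
  qed
  also have "\<dots> = ennreal \<eta>" using assms by (simp add: nn_integral_add flip: ennreal_plus)
  finally show ?thesis .
qed

lemma nn_integral_cos_small:
  assumes "0 \<le> \<eta>"
  shows "(\<integral>\<^sup>+u. indicator {u. \<bar>cos (2 * pi * u + \<theta>)\<bar> \<le> \<eta>} u \<partial>circ) \<le> ennreal \<eta>"
  using nn_integral_sin_small[OF assms, of "\<theta> + pi / 2"] by (simp add: sin_add add.assoc[symmetric])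

text \<open>Substitution \<open>s = sin (2 * pi * u)\<close> on the increasing branch [-1/4, 1/4]:
  where the cosine is at least \<open>\<eta>\<close>, the Jacobian is at least
  \<open>2 * pi * \<eta>\<close>. The decreasing branch contributes the same amount, hence
  \<open>1 / (pi * \<eta>)\<close>.\<close>

lemma nn_integral_sin_subst:
  fixes F :: "real \<Rightarrow> ennreal"
  assumes [measurable]: "F \<in> borel_measurable borel" and "0 < \<eta>"
  shows "(\<integral>\<^sup>+u. indicator {u. \<eta> \<le> \<bar>cos (2 * pi * u + \<theta>)\<bar>} u * F (sin (2 * pi * u + \<theta>)) \<partial>circ)
    \<le> ennreal (1 / (pi * \<eta>)) * (\<integral>\<^sup>+s. F s * indicator {-1..1} s \<partial>lborel)"
proof -
  define G where "G u = indicator {u. \<eta> \<le> \<bar>cos (2 * pi * u)\<bar>} u * F (sin (2 * pi * u))" for u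
  have [measurable]: "G \<in> borel_measurable borel" unfolding G_def by measurable
  have per: "per1 G" unfolding G_def per1_def by (simp add: ring_distribs indicator_def)
  have half: "(\<integral>\<^sup>+u. G u * indicator {-1/4..1/4} u \<partial>lborel) \<le>
      ennreal (1 / (2 * pi * \<eta>)) * (\<integral>\<^sup>+s. F s * indicator {-1..1} s \<partial>lborel)"
  proof -
    have cosn: "0 \<le> cos (2 * pi * x)" if "x \<in> {-1/4..1/4}" for x
    proof -
      have "pi * (4 * x) \<le> pi * 1" using that by (intro mult_left_mono) auto
      moreover have "pi * (-1) \<le> pi * (4 * x)" using that by (intro mult_left_mono) auto
      ultimately show ?thesis by (intro cos_ge_zero) auto
    qed
    have e: "sin (2 * pi * (-1/4)) = -1" "sin (2 * pi * (1/4)) = 1"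
      using sin_pi_half by (simp_all add: sin_minus flip: minus_divide_left)
    have "(\<integral>\<^sup>+s. F s * indicator {-1..1} s \<partial>lborel) =
      (\<integral>\<^sup>+s. F s * indicator {sin (2 * pi * (-1/4))..sin (2 * pi * (1/4))} s \<partial>lborel)"
      unfolding e ..
    also have "\<dots> = (\<integral>\<^sup>+x. F (sin (2 * pi * x)) * ennreal (2 * pi * cos (2 * pi * x)) * indicator {-1/4..1/4} x \<partial>lborel)"
      by (rule nn_integral_substitution_aux)
         (auto intro!: derivative_eq_intros continuous_intros mult_nonneg_nonneg cosn[simplified] simp del: mult_le_0_iff zero_le_mult_iff)
    finally have eq: "(\<integral>\<^sup>+s. F s * indicator {-1..1} s \<partial>lborel) =
      (\<integral>\<^sup>+x. F (sin (2 * pi * x)) * ennreal (2 * pi * cos (2 * pi * x)) * indicator {-1/4..1/4} x \<partial>lborel)" .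
    have "(\<integral>\<^sup>+u. G u * indicator {-1/4..1/4} u \<partial>lborel) \<le>
      (\<integral>\<^sup>+x. ennreal (1 / (2 * pi * \<eta>)) * (F (sin (2 * pi * x)) * ennreal (2 * pi * cos (2 * pi * x)) * indicator {-1/4..1/4} x) \<partial>lborel)"
    proof (rule nn_integral_mono)
      fix x :: real
      show "G x * indicator {-1/4..1/4} x \<le> ennreal (1 / (2 * pi * \<eta>)) * (F (sin (2 * pi * x)) * ennreal (2 * pi * cos (2 * pi * x)) * indicator {-1/4..1/4} x)"
      proof (cases "x \<in> {-1/4..1/4} \<and> \<eta> \<le> \<bar>cos (2 * pi * x)\<bar>")
        case True
        then have c: "\<eta> \<le> cos (2 * pi * x)" using cosn[of x] by auto
        have "1 \<le> ennreal (1 / (2 * pi * \<eta>)) * ennreal (2 * pi * cos (2 * pi * x))"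
          using c assms(2) by (subst ennreal_mult[symmetric]) (auto simp: field_simps simp flip: ennreal_1 intro!: ennreal_leI)
        then have "1 * F (sin (2 * pi * x)) \<le> (ennreal (1 / (2 * pi * \<eta>)) * ennreal (2 * pi * cos (2 * pi * x))) * F (sin (2 * pi * x))"
          by (rule mult_right_mono) simp
        then show ?thesis using True by (simp add: G_def mult_ac)
      qed (auto simp: G_def)
    qed
    also have "\<dots> = ennreal (1 / (2 * pi * \<eta>)) * (\<integral>\<^sup>+s. F s * indicator {-1..1} s \<partial>lborel)"
      unfolding eq by (rule nn_integral_cmult) measurable
    finally show ?thesis .
  qed
  \<comment> \<open>The reflection of \<open>u\<close> to \<open>1/2 - u\<close> exchanges the two
    monotone branches: it preserves the sine and the modulus of the cosine.\<close>
  have refl: "(\<integral>\<^sup>+u. G u * indicator {1/4..3/4} u \<partial>lborel) = (\<integral>\<^sup>+u. G u * indicator {-1/4..1/4} u \<partial>lborel)"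
  proof -
    have s: "sin (2 * pi * (1 / 2 - x)) = sin (2 * pi * x)" "cos (2 * pi * (1 / 2 - x)) = - cos (2 * pi * x)" for x
      by (simp_all add: algebra_simps sin_diff cos_diff)
    show ?thesis
      by (subst nn_integral_real_affine[where c = "-1" and t = "1/2"])
         (auto intro!: nn_integral_cong simp: G_def s split: split_indicator)
  qed
  have "(\<integral>\<^sup>+u. indicator {u. \<eta> \<le> \<bar>cos (2 * pi * u + \<theta>)\<bar>} u * F (sin (2 * pi * u + \<theta>)) \<partial>circ) =
      (\<integral>\<^sup>+u. G (\<theta> / (2 * pi) + u) \<partial>circ)"
    by (auto intro!: nn_integral_cong simp: G_def ring_distribs add.commute indicator_def)
  also have "\<dots> = (\<integral>\<^sup>+u. G u \<partial>circ)" by (rule nn_integral_circ_shift[OF _ per]) measurable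
  also have "\<dots> = (\<integral>\<^sup>+u. G u * indicator {-1/4..-1/4 + 1} u \<partial>lborel)"
    by (rule nn_integral_period[OF _ per, symmetric]) measurable
  also have "\<dots> = (\<integral>\<^sup>+u. G u * indicator {-1/4..1/4} u \<partial>lborel) + (\<integral>\<^sup>+u. G u * indicator {1/4..3/4} u \<partial>lborel)"
    by (subst nn_integral_Icc_split[where b = "1/4"]) auto
  also have "\<dots> \<le> ennreal (1 / (2 * pi * \<eta>)) * (\<integral>\<^sup>+s. F s * indicator {-1..1} s \<partial>lborel) +
      ennreal (1 / (2 * pi * \<eta>)) * (\<integral>\<^sup>+s. F s * indicator {-1..1} s \<partial>lborel)"
    unfolding refl by (intro add_mono half)
  also have "\<dots> = (ennreal (1 / (2 * pi * \<eta>)) + ennreal (1 / (2 * pi * \<eta>))) * (\<integral>\<^sup>+s. F s * indicator {-1..1} s \<partial>lborel)"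
    by (simp add: distrib_right)
  also have "ennreal (1 / (2 * pi * \<eta>)) + ennreal (1 / (2 * pi * \<eta>)) = ennreal (1 / (pi * \<eta>))"
    using assms(2) by (subst ennreal_plus[symmetric]) auto
  finally show ?thesis .
qed

text \<open>Off the set where the cosine is small, the law of
  \<open>A * sin (2 * pi * u + \<theta>) - c\<close> mod 1 has a bounded density. Scaling by
  \<open>A\<close> divides densities by \<open>\<bar>A\<bar>\<close>, but the image wraps around the
  circle about \<open>2 * \<bar>A\<bar>\<close> times; the two effects cancel, so the bound stays
  finite as \<open>\<bar>A\<bar>\<close> grows.\<close>

lemma nn_integral_push:
  fixes \<Phi> :: "real \<Rightarrow> ennreal"
  assumes [measurable]: "\<Phi> \<in> borel_measurable borel" and per: "per1 \<Phi>" and "0 < \<eta>" "A \<noteq> 0"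
  shows "(\<integral>\<^sup>+u. indicator {u. \<eta> \<le> \<bar>cos (2 * pi * u + \<theta>)\<bar>} u * \<Phi> (A * sin (2 * pi * u + \<theta>) - c) \<partial>circ)
    \<le> ennreal ((\<bar>A\<bar> + 1) / (\<eta> * \<bar>A\<bar>)) * (\<integral>\<^sup>+b. \<Phi> b \<partial>circ)"
proof -
  define \<Psi> where "\<Psi> b = \<Phi> (b - c)" for b
  have [measurable]: "\<Psi> \<in> borel_measurable borel" unfolding \<Psi>_def by measurable
  have perP: "per1 \<Psi>" using per unfolding per1_def \<Psi>_def by (metis add_diff_eq add.commute diff_add_eq)
  have "\<Psi> = (\<lambda>b. \<Phi> (- c + b))" by (auto simp: \<Psi>_def)
  then have IP: "(\<integral>\<^sup>+b. \<Psi> b \<partial>circ) = (\<integral>\<^sup>+b. \<Phi> b \<partial>circ)"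
    using nn_integral_circ_shift[OF assms(1) per, of "-c"] by simp
  have "ennreal \<bar>A\<bar> * (\<integral>\<^sup>+s. \<Psi> (A * s) * indicator {-1..1} s \<partial>lborel) =
      (\<integral>\<^sup>+b. \<Psi> b * indicator {-\<bar>A\<bar>..\<bar>A\<bar>} b \<partial>lborel)"
  proof (subst (2) nn_integral_real_affine[where c = A and t = 0])
    have "A * s \<in> {-\<bar>A\<bar>..\<bar>A\<bar>} \<longleftrightarrow> s \<in> {-1..1}" for s
    proof -
      have "A * s \<in> {-\<bar>A\<bar>..\<bar>A\<bar>} \<longleftrightarrow> \<bar>A * s\<bar> \<le> \<bar>A\<bar> * 1" by auto
      also have "\<dots> \<longleftrightarrow> \<bar>s\<bar> \<le> 1" unfolding abs_mult using assms(4) by (subst mult_le_cancel_left) auto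
      finally show ?thesis by auto
    qed
    then have "indicator {-\<bar>A\<bar>..\<bar>A\<bar>} (A * s) = (indicator {-1..1} s :: ennreal)" for s
      by (simp add: indicator_def)
    then show "ennreal \<bar>A\<bar> * (\<integral>\<^sup>+s. \<Psi> (A * s) * indicator {-1..1} s \<partial>lborel) =
      ennreal \<bar>A\<bar> * (\<integral>\<^sup>+x. \<Psi> (0 + A * x) * indicator {-\<bar>A\<bar>..\<bar>A\<bar>} (0 + A * x) \<partial>lborel)"
      by simp
  qed (use assms(4) in auto)
  also have "\<dots> \<le> ennreal (2 * (\<bar>A\<bar> + 1)) * (\<integral>\<^sup>+b. \<Phi> b \<partial>circ)"
    unfolding IP[symmetric] by (rule nn_integral_symmetric_le[OF _ perP]) auto
  finally have *: "ennreal \<bar>A\<bar> * (\<integral>\<^sup>+s. \<Psi> (A * s) * indicator {-1..1} s \<partial>lborel) \<le>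
      ennreal (2 * (\<bar>A\<bar> + 1)) * (\<integral>\<^sup>+b. \<Phi> b \<partial>circ)" .
  have "(\<integral>\<^sup>+u. indicator {u. \<eta> \<le> \<bar>cos (2 * pi * u + \<theta>)\<bar>} u * \<Phi> (A * sin (2 * pi * u + \<theta>) - c) \<partial>circ)
      \<le> ennreal (1 / (pi * \<eta>)) * (\<integral>\<^sup>+s. \<Psi> (A * s) * indicator {-1..1} s \<partial>lborel)"
    using nn_integral_sin_subst[of "\<lambda>s. \<Psi> (A * s)" \<eta> \<theta>] assms(3) by (simp add: \<Psi>_def)
  also have "\<dots> = ennreal (1 / (pi * \<eta> * \<bar>A\<bar>)) * (ennreal \<bar>A\<bar> * (\<integral>\<^sup>+s. \<Psi> (A * s) * indicator {-1..1} s \<partial>lborel))"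
    using assms(3,4) by (subst mult.assoc[symmetric], subst ennreal_mult[symmetric]) auto
  also have "\<dots> \<le> ennreal (1 / (pi * \<eta> * \<bar>A\<bar>)) * (ennreal (2 * (\<bar>A\<bar> + 1)) * (\<integral>\<^sup>+b. \<Phi> b \<partial>circ))"
    by (intro mult_left_mono *) simp
  also have "\<dots> = ennreal (1 / (pi * \<eta> * \<bar>A\<bar>) * (2 * (\<bar>A\<bar> + 1))) * (\<integral>\<^sup>+b. \<Phi> b \<partial>circ)"
    using assms(3,4) by (subst mult.assoc[symmetric], subst ennreal_mult[symmetric]) auto
  also have "\<dots> \<le> ennreal ((\<bar>A\<bar> + 1) / (\<eta> * \<bar>A\<bar>)) * (\<integral>\<^sup>+b. \<Phi> b \<partial>circ)"
  proof (intro mult_right_mono ennreal_leI)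
    have "1 / (pi * \<eta> * \<bar>A\<bar>) * (2 * (\<bar>A\<bar> + 1)) = (2 / pi) * ((\<bar>A\<bar> + 1) / (\<eta> * \<bar>A\<bar>))" by simp
    also have "\<dots> \<le> 1 * ((\<bar>A\<bar> + 1) / (\<eta> * \<bar>A\<bar>))"
      using assms(3) pi_gt3 by (intro mult_right_mono) auto
    finally show "1 / (pi * \<eta> * \<bar>A\<bar>) * (2 * (\<bar>A\<bar> + 1)) \<le> (\<bar>A\<bar> + 1) / (\<eta> * \<bar>A\<bar>)" by simp
  qed simp
  finally show ?thesis .
qed

text \<open>The choice \<open>\<eta> = sqrt \<epsilon>\<close> balances the set of small cosine, of
  measure \<open>\<eta>\<close>, against the density bound times the target length, which is at most
  \<open>4 * \<epsilon> / \<eta>\<close>. The factor \<open>min 1 \<bar>A\<bar>\<close> accounts for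
  small amplitudes, where the values only spread over an interval of length
  \<open>2 * \<bar>A\<bar>\<close>. For \<open>A = 0\<close> the strict inequality makes the set
  empty.\<close>

lemma nn_integral_nd_small:
  assumes "0 < \<epsilon>"
  shows "(\<integral>\<^sup>+u. indicator {u. nd (A * sin (2 * pi * u + \<theta>) - c) < \<epsilon> * min 1 \<bar>A\<bar>} u \<partial>circ) \<le> ennreal (5 * sqrt \<epsilon>)"
proof (cases "A = 0")
  case True
  then show ?thesis using nd_nonneg by (simp add: not_less)
next
  case False
  define \<eta> where "\<eta> = sqrt \<epsilon>"
  have eta: "0 < \<eta>" using assms by (simp add: \<eta>_def)
  define r where "r = \<epsilon> * min 1 \<bar>A\<bar>"
  have r: "0 \<le> r" using assms by (simp add: r_def)
  define \<Phi> :: "real \<Rightarrow> ennreal" where "\<Phi> = indicator {u. nd u \<le> r}"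
  have [measurable]: "\<Phi> \<in> borel_measurable borel" unfolding \<Phi>_def by measurable
  have per: "per1 \<Phi>" by (simp add: \<Phi>_def per1_def indicator_def)
  have "(\<integral>\<^sup>+u. indicator {u. nd (A * sin (2 * pi * u + \<theta>) - c) < \<epsilon> * min 1 \<bar>A\<bar>} u \<partial>circ) \<le>
     (\<integral>\<^sup>+u. indicator {u. \<bar>cos (2 * pi * u + \<theta>)\<bar> \<le> \<eta>} u +
        indicator {u. \<eta> \<le> \<bar>cos (2 * pi * u + \<theta>)\<bar>} u * \<Phi> (A * sin (2 * pi * u + \<theta>) - c) \<partial>circ)"
    by (rule nn_integral_mono) (auto simp: \<Phi>_def r_def split: split_indicator)
  also have "\<dots> = (\<integral>\<^sup>+u. indicator {u. \<bar>cos (2 * pi * u + \<theta>)\<bar> \<le> \<eta>} u \<partial>circ) +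
     (\<integral>\<^sup>+u. indicator {u. \<eta> \<le> \<bar>cos (2 * pi * u + \<theta>)\<bar>} u * \<Phi> (A * sin (2 * pi * u + \<theta>) - c) \<partial>circ)"
    by (rule nn_integral_add) measurable
  also have "\<dots> \<le> ennreal \<eta> + ennreal ((\<bar>A\<bar> + 1) / (\<eta> * \<bar>A\<bar>)) * (\<integral>\<^sup>+b. \<Phi> b \<partial>circ)"
    using eta False by (intro add_mono nn_integral_cos_small nn_integral_push per) auto
  also have "\<dots> \<le> ennreal \<eta> + ennreal ((\<bar>A\<bar> + 1) / (\<eta> * \<bar>A\<bar>)) * ennreal (2 * r)"
    unfolding \<Phi>_def by (intro add_mono mult_left_mono nn_integral_nd_less r) auto
  also have "ennreal ((\<bar>A\<bar> + 1) / (\<eta> * \<bar>A\<bar>)) * ennreal (2 * r) = ennreal ((\<bar>A\<bar> + 1) / (\<eta> * \<bar>A\<bar>) * (2 * r))"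
    using eta r by (intro ennreal_mult[symmetric]) auto
  also have "ennreal \<eta> + \<dots> = ennreal (\<eta> + (\<bar>A\<bar> + 1) / (\<eta> * \<bar>A\<bar>) * (2 * r))"
    using eta r by (intro ennreal_plus[symmetric]) auto
  also have "\<dots> \<le> ennreal (5 * sqrt \<epsilon>)"
  proof (rule ennreal_leI)
    have "(\<bar>A\<bar> + 1) * min 1 \<bar>A\<bar> \<le> 2 * \<bar>A\<bar>"
      by (cases "\<bar>A\<bar> \<le> 1") (auto simp: min_def intro!: mult_right_mono)
    then have "(\<bar>A\<bar> + 1) * min 1 \<bar>A\<bar> / \<bar>A\<bar> \<le> 2" using False by (simp add: field_simps)
    then have "(\<bar>A\<bar> + 1) * min 1 \<bar>A\<bar> / \<bar>A\<bar> * (2 * \<epsilon> / \<eta>) \<le> 2 * (2 * \<epsilon> / \<eta>)"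
      using eta assms by (intro mult_right_mono) auto
    also have "2 * (2 * \<epsilon> / \<eta>) = 4 * \<eta>" using assms unfolding \<eta>_def by (simp add: field_simps)
    finally show "\<eta> + (\<bar>A\<bar> + 1) / (\<eta> * \<bar>A\<bar>) * (2 * r) \<le> 5 * sqrt \<epsilon>"
      unfolding r_def \<eta>_def[symmetric] by (simp add: mult_ac)
  qed
  finally show ?thesis .
qed

section \<open>Oscillatory integrals\<close>

lemma unif_eq_density:
  assumes "a < b"
  shows "unif a b = density lborel (\<lambda>x. ennreal (indicator {a..b} x / (b - a)))"
proof -
  have "1 / ennreal (b - a) = ennreal (1 / (b - a))"
    using divide_ennreal[of 1 "b - a"] assms by simp
  then show ?thesis
    unfolding unif_def uniform_measure_def using assms
    by (intro density_cong) (auto simp: indicator_def)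
qed

lemma integral_unif:
  fixes f :: "real \<Rightarrow> 'b :: {banach, second_countable_topology}"
  assumes [measurable]: "f \<in> borel_measurable borel" and "a < b"
  shows "(\<integral>x. f x \<partial>unif a b) = (1 / (b - a)) *\<^sub>R (\<integral>x. indicator {a..b} x *\<^sub>R f x \<partial>lborel)"
  using assms(2) unfolding unif_eq_density[OF assms(2)]
  by (subst integral_density) (auto simp: scaleR_scaleR[symmetric] divide_inverse mult.commute simp del: scaleR_scaleR simp flip: integral_scaleR_right)

lemma integrable_unif_bounded:
  fixes f :: "real \<Rightarrow> 'b :: {banach, second_countable_topology}"
  assumes [measurable]: "f \<in> borel_measurable borel" and "a < b" and "\<And>x. norm (f x) \<le> B"
  shows "integrable (unif a b) f"
proof -
  interpret prob_space "unif a b" by (rule prob_space_unif[OF assms(2)])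
  show ?thesis by (rule integrable_const_bound[where B = B]) (use assms(3) in auto)
qed

lemma integral_unif_FTC:
  fixes F :: "real \<Rightarrow> 'b :: euclidean_space"
  assumes "a < b" and "\<And>x. (F has_vector_derivative f x) (at x)" and cont: "continuous_on UNIV f"
  shows "(\<integral>x. f x \<partial>unif a b) = (1 / (b - a)) *\<^sub>R (F b - F a)"
proof -
  have [measurable]: "f \<in> borel_measurable borel" by (rule borel_measurable_continuous_onI[OF cont])
  have "(\<integral>x. indicator {a..b} x *\<^sub>R f x \<partial>lborel) = F b - F a"
    by (rule integral_FTC_Icc)
       (use assms in \<open>auto intro: has_vector_derivative_at_within continuous_on_subset\<close>)
  then show ?thesis using assms(1) by (simp add: integral_unif)
qed

lemma sublevel_unif:
  assumes "a < b" "b - a \<le> 2" "0 \<le> \<eta>"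
  shows "measure (unif a b) {u. \<bar>sin (2 * pi * u + \<theta>)\<bar> \<le> \<eta>} \<le> 2 * \<eta> / (b - a)"
proof -
  interpret prob_space "unif a b" by (rule prob_space_unif[OF assms(1)])
  define F :: "real \<Rightarrow> ennreal" where "F = indicator {u. \<bar>sin (2 * pi * u + \<theta>)\<bar> \<le> \<eta>}"
  have [measurable]: "F \<in> borel_measurable borel" unfolding F_def by measurable
  have per: "per1 F"
  proof -
    have "sin (2 * pi * (u + 1) + \<theta>) = sin (2 * pi * u + \<theta>)" for u
      using sin_periodic[of "2 * pi * u + \<theta>"] by (simp add: algebra_simps)
    then show ?thesis by (simp add: per1_def F_def indicator_def)
  qed
  have "ennreal (measure (unif a b) {u. \<bar>sin (2 * pi * u + \<theta>)\<bar> \<le> \<eta>}) = (\<integral>\<^sup>+u. F u \<partial>unif a b)"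
    unfolding F_def by (subst nn_integral_indicator) (auto simp: emeasure_eq_measure)
  also have "\<dots> = (\<integral>\<^sup>+u. F u * indicator {a..b} u \<partial>lborel) * ennreal (1 / (b - a))"
    using assms by (intro nn_integral_unif) auto
  also have "\<dots> \<le> (\<integral>\<^sup>+u. F u * indicator {a..a + real 2} u \<partial>lborel) * ennreal (1 / (b - a))"
    using assms by (intro mult_right_mono nn_integral_mono mult_left_mono) (auto split: split_indicator)
  also have "(\<integral>\<^sup>+u. F u * indicator {a..a + real 2} u \<partial>lborel) = of_nat 2 * (\<integral>\<^sup>+u. F u \<partial>circ)"
    by (rule nn_integral_periods[OF _ per]) measurable
  also have "\<dots> \<le> of_nat 2 * ennreal \<eta>"
    unfolding F_def by (intro mult_left_mono nn_integral_sin_small assms) auto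
  also have "of_nat 2 * ennreal \<eta> = ennreal (2 * \<eta>)"
    using assms(3) by (simp add: ennreal_mult)
  also have "ennreal (2 * \<eta>) * ennreal (1 / (b - a)) = ennreal (2 * \<eta> * (1 / (b - a)))"
    using assms by (intro ennreal_mult[symmetric]) auto
  finally have "ennreal (measure (unif a b) {u. \<bar>sin (2 * pi * u + \<theta>)\<bar> \<le> \<eta>}) \<le> ennreal (2 * \<eta> / (b - a))"
    by (simp add: mult_right_mono)
  then show ?thesis using assms by (simp add: ennreal_le_iff)
qed

text \<open>Integration by parts with a regularised multiplier: instead of dividing by the
  derivative \<open>d\<close> of the phase and cutting out its zeros, multiply by
  \<open>d / (d\<^sup>2 + l\<^sup>2)\<close>, which is smooth everywhere. The part missed by this
  multiplier is concentrated near the stationary points, whose neighbourhood is small by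
  \<open>sublevel_unif\<close>.\<close>

lemma van_der_Corput_cos:
  assumes ab: "a < b" "b - a \<le> 2" and R: "1 \<le> R"
  shows "norm (\<integral>t. cis (R * cos (2 * pi * t + \<theta>)) \<partial>unif a b) \<le> 200 * R powr (-1/6) / (b - a)"
proof -
  interpret prob_space "unif a b" by (rule prob_space_unif[OF ab(1)])
  \<comment> \<open>The exponent 2/3 makes every error term at most a constant times
    \<open>R powr (-1/6)\<close>: the boundary terms are of order \<open>1 / l\<close>, the term
    with the derivative of the multiplier of order \<open>R / l\<^sup>2\<close>.\<close>
  define l where "l = R powr (2/3)"
  have l: "0 < l" using R by (simp add: l_def)
  define \<phi> where "\<phi> t = R * cos (2 * pi * t + \<theta>)" for t
  define d where "d t = - (2 * pi * R * sin (2 * pi * t + \<theta>))" for t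
  define d2 where "d2 t = - (4 * pi\<^sup>2 * R * cos (2 * pi * t + \<theta>))" for t
  define D where "D t = (d t)\<^sup>2 + l\<^sup>2" for t
  have D: "0 < D t" for t using l by (simp add: D_def add_nonneg_pos)
  then have D0: "D t \<noteq> 0" for t by (metis less_irrefl)
  have phi': "(\<phi> has_real_derivative d t) (at t)" for t
    unfolding \<phi>_def d_def by (auto intro!: derivative_eq_intros)
  have d': "(d has_real_derivative d2 t) (at t)" for t
    unfolding d2_def d_def by (auto intro!: derivative_eq_intros simp: power2_eq_square)
  define q where "q t = d t / D t" for t
  define q' where "q' t = d2 t * (l\<^sup>2 - (d t)\<^sup>2) / (D t)\<^sup>2" for t
  have q': "(q has_real_derivative q' t) (at t)" for t
  proof -
    have "(D has_real_derivative 2 * d t * d2 t) (at t)"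
      unfolding D_def by (auto intro!: derivative_eq_intros d')
    then have "(q has_real_derivative ((d2 t * D t - d t * (2 * d t * d2 t)) / (D t * D t))) (at t)"
      unfolding q_def by (intro DERIV_divide d' D0)
    moreover have "d2 t * D t - d t * (2 * d t * d2 t) = d2 t * (l\<^sup>2 - (d t)\<^sup>2)"
      unfolding D_def by algebra
    ultimately show ?thesis by (simp add: q'_def power2_eq_square)
  qed
  have q_le: "\<bar>q t\<bar> \<le> 1 / (2 * l)" for t
  proof -
    have "2 * \<bar>d t\<bar> * l \<le> D t" using sum_squares_bound[of "\<bar>d t\<bar>" l] by (simp add: D_def)
    then have "\<bar>d t\<bar> * (2 * l) \<le> D t" by (simp add: mult_ac)
    then have "\<bar>d t\<bar> \<le> D t / (2 * l)" using l by (subst pos_le_divide_eq) auto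
    then have "\<bar>d t\<bar> \<le> (1 / (2 * l)) * D t" by simp
    then have "\<bar>d t\<bar> / D t \<le> 1 / (2 * l)" using D[of t] by (subst pos_divide_le_eq) auto
    then show ?thesis using D[of t] by (simp add: q_def)
  qed
  have q'_le: "\<bar>q' t\<bar> \<le> 40 * R / l\<^sup>2" for t
  proof -
    have 1: "\<bar>d2 t\<bar> \<le> 40 * R"
    proof -
      have "pi\<^sup>2 \<le> 3.15\<^sup>2" using pi_approx by (intro power_mono) auto
      then have "4 * pi\<^sup>2 \<le> 40" by (simp add: power2_eq_square)
      then have "4 * pi\<^sup>2 * R * \<bar>cos (2 * pi * t + \<theta>)\<bar> \<le> 40 * R * 1"
        using R by (intro mult_mono) auto
      then show ?thesis using R by (simp add: d2_def abs_mult)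
    qed
    have "\<bar>l\<^sup>2 - (d t)\<^sup>2\<bar> \<le> D t" by (simp add: D_def abs_le_iff)
    then have "\<bar>l\<^sup>2 - (d t)\<^sup>2\<bar> / (D t)\<^sup>2 \<le> D t / (D t)\<^sup>2" by (intro divide_right_mono) auto
    also have "\<dots> = 1 / D t" using D0[of t] by (simp add: power2_eq_square)
    also have "\<dots> \<le> 1 / l\<^sup>2" using l by (intro divide_left_mono) (auto simp: D_def add_nonneg_pos)
    finally have "\<bar>d2 t\<bar> * (\<bar>l\<^sup>2 - (d t)\<^sup>2\<bar> / (D t)\<^sup>2) \<le> 40 * R * (1 / l\<^sup>2)"
      using 1 R by (intro mult_mono) auto
    then show ?thesis by (simp add: q'_def abs_mult)
  qed
  have cphi: "continuous_on UNIV \<phi>" and cd: "continuous_on UNIV d" and cd2: "continuous_on UNIV d2"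
    unfolding \<phi>_def d_def d2_def by (intro continuous_intros)+
  have cq: "continuous_on UNIV q" and cq': "continuous_on UNIV q'"
    unfolding q_def q'_def D_def using D0 unfolding D_def by (intro continuous_intros cd cd2; auto)+
  have ccis: "continuous_on UNIV (\<lambda>t. cis (\<phi> t))" unfolding cis_conv_exp by (intro continuous_intros cphi)
  note [measurable] = borel_measurable_continuous_onI[OF cq] borel_measurable_continuous_onI[OF cq']
    borel_measurable_continuous_onI[OF cphi] borel_measurable_continuous_onI[OF cd] borel_measurable_continuous_onI[OF ccis]
  define E where "E t = cis (\<phi> t) * of_real (q t)" for t
  define E' where "E' t = \<i> * of_real (d t * q t) * cis (\<phi> t) + of_real (q' t) * cis (\<phi> t)" for t
  have E': "(E has_vector_derivative E' t) (at t)" for t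
  proof -
    have c: "((\<lambda>t. cis (\<phi> t)) has_vector_derivative (d t *\<^sub>R (\<i> * cis (\<phi> t)))) (at t)"
      using has_derivative_cis[OF phi'[unfolded has_field_derivative_def]]
      by (simp add: has_vector_derivative_def mult.commute)
    have "(E has_vector_derivative (cis (\<phi> t) * of_real (q' t) + (d t *\<^sub>R (\<i> * cis (\<phi> t))) * of_real (q t))) (at t)"
      unfolding E_def
      by (intro has_vector_derivative_mult c has_vector_derivative_of_real q')
    then show ?thesis by (simp add: E'_def scaleR_conv_of_real mult_ac add.commute)
  qed
  have cE': "continuous_on UNIV E'"
    unfolding E'_def by (intro continuous_intros cd cq cq' ccis)
  have EE: "(\<integral>t. E' t \<partial>unif a b) = (1 / (b - a)) *\<^sub>R (E b - E a)"
    by (rule integral_unif_FTC[OF ab(1) E' cE'])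
  have dq: "d t * q t = 1 - l\<^sup>2 / D t" for t
  proof -
    have "d t * q t = (D t - l\<^sup>2) / D t" by (simp add: q_def D_def power2_eq_square)
    then show ?thesis using D0[of t] by (simp add: diff_divide_distrib)
  qed
  \<comment> \<open>The defect of the regularisation: \<open>d * q = 1 - r\<close>. It is at most 1,
    and at most \<open>l\<^sup>2 / d\<^sup>2\<close> away from the stationary points.\<close>
  define r where "r t = l\<^sup>2 / D t" for t
  have r01: "0 \<le> r t" "r t \<le> 1" for t using D[of t] by (simp_all add: r_def D_def)
  have [measurable]: "r \<in> borel_measurable borel" unfolding r_def D_def by measurable
  have split: "cis (\<phi> t) = - \<i> * E' t + (\<i> * of_real (q' t) * cis (\<phi> t) + of_real (r t) * cis (\<phi> t))" for t
    unfolding E'_def dq r_def by (simp add: algebra_simps)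
  have [measurable]: "E' \<in> borel_measurable borel" by (rule borel_measurable_continuous_onI[OF cE'])
  have q1: "\<bar>d t * q t\<bar> \<le> 1" for t using r01[of t] unfolding dq r_def by simp
  have nE': "norm (E' t) \<le> 1 + 40 * R / l\<^sup>2" for t
    unfolding E'_def using q1[of t] q'_le[of t]
    by (intro order_trans[OF norm_triangle_ineq] add_mono) (simp_all add: norm_mult abs_mult)
  have iE': "integrable (unif a b) E'" by (rule integrable_unif_bounded[OF _ ab(1) nE']) measurable
  have i2: "integrable (unif a b) (\<lambda>t. \<i> * of_real (q' t) * cis (\<phi> t))"
    by (rule integrable_unif_bounded[OF _ ab(1), where B = "40 * R / l\<^sup>2"]) (use q'_le in \<open>auto simp: norm_mult\<close>)
  have i3: "integrable (unif a b) (\<lambda>t. of_real (r t) * cis (\<phi> t))"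
    by (rule integrable_unif_bounded[OF _ ab(1), where B = 1]) (use r01 in \<open>auto simp: norm_mult\<close>)
  have ir: "integrable (unif a b) r"
    by (rule integrable_unif_bounded[OF _ ab(1), where B = 1]) (use r01 in auto)
  have "(\<integral>t. cis (\<phi> t) \<partial>unif a b) = (\<integral>t. - \<i> * E' t + (\<i> * of_real (q' t) * cis (\<phi> t) + of_real (r t) * cis (\<phi> t)) \<partial>unif a b)"
    by (rule Bochner_Integration.integral_cong[OF refl split])
  also have "\<dots> = - \<i> * (\<integral>t. E' t \<partial>unif a b) + ((\<integral>t. \<i> * of_real (q' t) * cis (\<phi> t) \<partial>unif a b) + (\<integral>t. of_real (r t) * cis (\<phi> t) \<partial>unif a b))"
    using iE' i2 i3 by simp
  finally have eq: "(\<integral>t. cis (\<phi> t) \<partial>unif a b) = - \<i> * (\<integral>t. E' t \<partial>unif a b) + ((\<integral>t. \<i> * of_real (q' t) * cis (\<phi> t) \<partial>unif a b) + (\<integral>t. of_real (r t) * cis (\<phi> t) \<partial>unif a b))" .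
  have n1: "norm (- \<i> * (\<integral>t. E' t \<partial>unif a b)) \<le> 1 / l / (b - a)"
  proof -
    have "norm (E b - E a) \<le> 1 / (2 * l) + 1 / (2 * l)"
      using q_le[of a] q_le[of b] by (intro order_trans[OF norm_triangle_ineq4] add_mono) (auto simp: E_def norm_mult)
    then have "norm (E b - E a) / (b - a) \<le> (1 / l) / (b - a)" using ab by (intro divide_right_mono) auto
    then show ?thesis using ab unfolding EE by (simp add: norm_mult)
  qed
  have n2: "norm (\<integral>t. \<i> * of_real (q' t) * cis (\<phi> t) \<partial>unif a b) \<le> 40 * R / l\<^sup>2"
  proof -
    have "norm (\<integral>t. \<i> * of_real (q' t) * cis (\<phi> t) \<partial>unif a b) \<le> (\<integral>t. norm (\<i> * of_real (q' t) * cis (\<phi> t)) \<partial>unif a b)"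
      by (rule integral_norm_bound)
    also have "\<dots> \<le> (\<integral>t. 40 * R / l\<^sup>2 \<partial>unif a b)"
      using q'_le by (intro integral_mono integrable_norm i2) (auto simp: norm_mult)
    finally show ?thesis by (simp add: prob_space[simplified])
  qed
  \<comment> \<open>Where the sine exceeds this threshold,
    \<open>\<bar>d\<bar> \<ge> R * \<eta>\<close>, so the defect is at most
    \<open>R powr (4/3 - 5/3)\<close> there; the remaining set has measure of order
    \<open>\<eta>\<close> over the interval length.\<close>
  define \<eta> where "\<eta> = R powr (-1/6)"
  have eta: "0 < \<eta>" using R by (simp add: \<eta>_def)
  define S where "S = {u. \<bar>sin (2 * pi * u + \<theta>)\<bar> \<le> \<eta>}"
  have [measurable]: "S \<in> sets borel" unfolding S_def by measurable
  have rb: "r t \<le> indicator S t + l\<^sup>2 / (R * \<eta>)\<^sup>2" for t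
  proof (cases "t \<in> S")
    case True
    then show ?thesis using r01(2)[of t] by (simp add: add_increasing2)
  next
    case False
    then have "\<eta> \<le> \<bar>sin (2 * pi * t + \<theta>)\<bar>" by (simp add: S_def)
    then have "1 * R * \<eta> \<le> 2 * pi * R * \<bar>sin (2 * pi * t + \<theta>)\<bar>"
      using R eta pi_gt3 by (intro mult_mono) auto
    then have "R * \<eta> \<le> \<bar>d t\<bar>" using R by (simp add: d_def abs_mult)
    then have "(R * \<eta>)\<^sup>2 \<le> \<bar>d t\<bar>\<^sup>2" using R eta by (intro power_mono) auto
    then have "(R * \<eta>)\<^sup>2 \<le> D t" by (simp add: D_def add_increasing2)
    then have "r t \<le> l\<^sup>2 / (R * \<eta>)\<^sup>2" unfolding r_def using R eta D[of t] by (intro divide_left_mono) auto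
    then show ?thesis by (simp add: indicator_def)
  qed
  have n3: "norm (\<integral>t. of_real (r t) * cis (\<phi> t) \<partial>unif a b) \<le> 2 * \<eta> / (b - a) + l\<^sup>2 / (R * \<eta>)\<^sup>2"
  proof -
    have "norm (\<integral>t. of_real (r t) * cis (\<phi> t) \<partial>unif a b) \<le> (\<integral>t. norm (of_real (r t) * cis (\<phi> t)) \<partial>unif a b)"
      by (rule integral_norm_bound)
    also have "\<dots> = (\<integral>t. r t \<partial>unif a b)" using r01 by (simp add: norm_mult)
    also have "\<dots> \<le> (\<integral>t. indicator S t + l\<^sup>2 / (R * \<eta>)\<^sup>2 \<partial>unif a b)"
      by (intro integral_mono ir rb Bochner_Integration.integrable_add) (auto simp: less_top[symmetric] emeasure_eq_measure)
    also have "\<dots> = measure (unif a b) S + l\<^sup>2 / (R * \<eta>)\<^sup>2"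
      by (subst Bochner_Integration.integral_add) (auto simp: emeasure_eq_measure prob_space[simplified])
    also have "\<dots> \<le> 2 * \<eta> / (b - a) + l\<^sup>2 / (R * \<eta>)\<^sup>2"
      unfolding S_def using sublevel_unif[OF ab, of \<eta> \<theta>] eta by simp
    finally show ?thesis .
  qed
  have p1: "1 / l \<le> \<eta>"
    using R by (simp add: l_def \<eta>_def powr_mono flip: powr_minus_divide)
  have l2: "l\<^sup>2 = R powr (4/3)" using R by (simp add: l_def powr_power)
  have p2: "R / l\<^sup>2 \<le> \<eta>"
  proof -
    have "R / l\<^sup>2 = R powr (1 - 4/3)" using R unfolding l2 by (subst powr_diff) auto
    also have "\<dots> \<le> \<eta>" unfolding \<eta>_def using R by (intro powr_mono) auto
    finally show ?thesis .
  qed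
  have p3: "l\<^sup>2 / (R * \<eta>)\<^sup>2 \<le> \<eta>"
  proof -
    have "R * \<eta> = R powr (5/6)" using R powr_add[of R 1 "-1/6"] by (simp add: \<eta>_def)
    then have e: "(R * \<eta>)\<^sup>2 = R powr (5/3)" using R by (simp add: powr_power)
    have "l\<^sup>2 / (R * \<eta>)\<^sup>2 = R powr (4/3 - 5/3)" unfolding l2 e by (rule powr_diff[symmetric])
    also have "\<dots> \<le> \<eta>" unfolding \<eta>_def using R by (intro powr_mono) auto
    finally show ?thesis .
  qed
  have "norm (\<integral>t. cis (\<phi> t) \<partial>unif a b) \<le> 1 / l / (b - a) + (40 * R / l\<^sup>2 + (2 * \<eta> / (b - a) + l\<^sup>2 / (R * \<eta>)\<^sup>2))"
    unfolding eq by (intro order_trans[OF norm_triangle_ineq] add_mono n1 n2 n3)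
  also have "\<dots> \<le> \<eta> / (b - a) + (40 * \<eta> + (2 * \<eta> / (b - a) + \<eta>))"
    using p1 p2 p3 ab by (intro add_mono divide_right_mono) auto
  also have "\<dots> = 3 * (\<eta> / (b - a)) + 41 * \<eta>" by simp
  also have "\<dots> = (3 * \<eta> + 41 * \<eta> * (b - a)) / (b - a)" using ab by (simp add: add_divide_distrib)
  also have "\<dots> \<le> (3 * \<eta> + 41 * \<eta> * 2) / (b - a)"
    using ab eta by (intro divide_right_mono add_mono mult_left_mono) auto
  also have "\<dots> \<le> (200 * \<eta>) / (b - a)" using ab eta by (intro divide_right_mono) auto
  finally show ?thesis by (simp add: \<phi>_def \<eta>_def)
qed

section \<open>Fourier analysis on the torus\<close>

lemma measurable_fst_borel [measurable]:
  "(fst :: 'a::second_countable_topology \<times> 'b::second_countable_topology \<Rightarrow> 'a) \<in> borel_measurable borel"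
  and measurable_snd_borel [measurable]:
  "(snd :: 'a \<times> 'b \<Rightarrow> 'b) \<in> borel_measurable borel"
  by (intro borel_measurable_continuous_onI continuous_intros)+

definition torus2 :: "(real \<times> real) measure"
  where "torus2 = circ \<Otimes>\<^sub>M circ"

definition per2 :: "(real \<times> real \<Rightarrow> 'a) \<Rightarrow> bool"
  where "per2 G \<longleftrightarrow> (\<forall>x y. G (x + 1, y) = G (x, y) \<and> G (x, y + 1) = G (x, y))"

lemma sets_torus2 [measurable_cong, simp]: "sets torus2 = sets borel"
proof -
  have "sets torus2 = sets (borel \<Otimes>\<^sub>M borel)" unfolding torus2_def by (rule sets_pair_measure_cong) simp_all
  also have "(borel \<Otimes>\<^sub>M borel :: (real \<times> real) measure) = borel" by (rule borel_prod)
  finally show ?thesis .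
qed

lemma space_torus2 [simp]: "space torus2 = UNIV"
  by (simp add: torus2_def space_pair_measure)

lemma pair_sigma_finite_circ: "pair_sigma_finite circ circ"
  by (simp add: pair_sigma_finite_def prob_space_imp_sigma_finite)

lemma prob_space_torus2 [simp]: "prob_space torus2"
proof -
  interpret pair_prob_space circ circ by (simp add: pair_prob_space_def pair_sigma_finite_circ)
  show ?thesis unfolding torus2_def by (rule prob_space_axioms)
qed

lemma nn_integral_torus2:
  assumes "f \<in> borel_measurable borel"
  shows "(\<integral>\<^sup>+p. f p \<partial>torus2) = (\<integral>\<^sup>+x. \<integral>\<^sup>+y. f (x, y) \<partial>circ \<partial>circ)"
    and "(\<integral>\<^sup>+p. f p \<partial>torus2) = (\<integral>\<^sup>+y. \<integral>\<^sup>+x. f (x, y) \<partial>circ \<partial>circ)"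
proof -
  interpret pair_sigma_finite circ circ by (rule pair_sigma_finite_circ)
  have m: "f \<in> borel_measurable (circ \<Otimes>\<^sub>M circ)"
    using assms unfolding torus2_def[symmetric] by measurable
  show "(\<integral>\<^sup>+p. f p \<partial>torus2) = (\<integral>\<^sup>+x. \<integral>\<^sup>+y. f (x, y) \<partial>circ \<partial>circ)"
    unfolding torus2_def by (rule sigma_finite_measure.nn_integral_fst[OF prob_space_imp_sigma_finite[OF prob_space_circ] m, symmetric])
  show "(\<integral>\<^sup>+p. f p \<partial>torus2) = (\<integral>\<^sup>+y. \<integral>\<^sup>+x. f (x, y) \<partial>circ \<partial>circ)"
    unfolding torus2_def by (rule nn_integral_snd[OF m, symmetric])
qed

lemma integrable_torus2_bounded:
  fixes f :: "real \<times> real \<Rightarrow> 'b :: {banach, second_countable_topology}"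
  assumes [measurable]: "f \<in> borel_measurable borel" and "\<And>x. norm (f x) \<le> B"
  shows "integrable torus2 f"
proof -
  interpret prob_space torus2 by simp
  show ?thesis by (rule integrable_const_bound[where B = B]) (use assms(2) in auto)
qed

lemma integral_torus2:
  fixes f :: "real \<times> real \<Rightarrow> 'b :: {banach, second_countable_topology}"
  assumes "f \<in> borel_measurable borel" and "\<And>x. norm (f x) \<le> B"
  shows "(\<integral>p. f p \<partial>torus2) = (\<integral>x. \<integral>y. f (x, y) \<partial>circ \<partial>circ)"
proof -
  interpret pair_sigma_finite circ circ by (rule pair_sigma_finite_circ)
  show ?thesis using integrable_torus2_bounded[OF assms] unfolding torus2_def
    by (rule integral_fst'[symmetric])
qed

lemma nn_integral_torus2_reflect:
  assumes [measurable]: "f \<in> borel_measurable borel" and per: "per2 f"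
  shows "(\<integral>\<^sup>+p. f (a - p) \<partial>torus2) = (\<integral>\<^sup>+p. f p \<partial>torus2)"
proof -
  obtain u v where a: "a = (u, v)" by (cases a)
  have [measurable]: "(\<lambda>p. f (a - p)) \<in> borel_measurable borel" by measurable
  have p2: "per1 (\<lambda>y. f (x, y))" and p1: "per1 (\<lambda>x. f (x, y))" for x y
    using per by (simp_all add: per1_def per2_def)
  have "(\<integral>\<^sup>+p. f (a - p) \<partial>torus2) = (\<integral>\<^sup>+x. \<integral>\<^sup>+y. f (u - x, v - y) \<partial>circ \<partial>circ)"
    by (subst nn_integral_torus2) (auto simp: a)
  also have "\<dots> = (\<integral>\<^sup>+x. \<integral>\<^sup>+y. f (u - x, y) \<partial>circ \<partial>circ)"
    by (intro nn_integral_cong nn_integral_circ_reflect p2) measurable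
  also have "\<dots> = (\<integral>\<^sup>+y. \<integral>\<^sup>+x. f (u - x, y) \<partial>circ \<partial>circ)"
    using nn_integral_torus2[of "\<lambda>p. f (u - fst p, snd p)"] by (simp add: measurable_compose[OF _ assms(1)])
  also have "\<dots> = (\<integral>\<^sup>+y. \<integral>\<^sup>+x. f (x, y) \<partial>circ \<partial>circ)"
    by (intro nn_integral_cong nn_integral_circ_reflect p1) measurable
  also have "\<dots> = (\<integral>\<^sup>+p. f p \<partial>torus2)" by (rule nn_integral_torus2(2)[symmetric]) measurable
  finally show ?thesis .
qed

section \<open>Characters and trigonometric polynomials on the two-torus\<close>

definition ch :: "int \<times> int \<Rightarrow> real \<times> real \<Rightarrow> complex"
  where "ch k p = cis (2 * pi * (of_int (fst k) * fst p + of_int (snd k) * snd p))"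

lemma norm_ch [simp]: "norm (ch k p) = 1"
  by (simp add: ch_def)

lemma ch_zero [simp]: "ch 0 p = 1" "ch (0, 0) p = 1"
  by (simp_all add: ch_def)

lemma ch_add: "ch (k + l) p = ch k p * ch l p"
  by (simp add: ch_def cis_mult algebra_simps)

lemma ch_diff_arg: "ch k (p - q) = ch k p * cnj (ch k q)"
  by (simp add: ch_def cis_cnj cis_mult algebra_simps)

lemma ch_mult_cnj: "ch k p * cnj (ch l p) = ch (k - l) p"
  by (simp add: ch_def cis_cnj cis_mult algebra_simps)

lemma measurable_cis [measurable]: "cis \<in> borel_measurable borel"
proof -
  have "continuous_on UNIV cis" unfolding cis_conv_exp by (intro continuous_intros)
  then show ?thesis by (rule borel_measurable_continuous_onI)
qed

lemma measurable_ch [measurable]: "ch k \<in> borel_measurable borel"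
  unfolding ch_def by measurable

lemma integral_circ_cis:
  "(\<integral>x. cis (2 * pi * (of_int m * x)) \<partial>circ) = (if m = 0 then 1 else 0)"
proof (cases "m = 0")
  case True
  interpret prob_space circ by simp
  show ?thesis using True prob_space by simp
next
  case False
  define w where "w = 2 * pi * real_of_int m"
  have w: "w \<noteq> 0" using False by (simp add: w_def)
  have "((\<lambda>x. cis (w * x) / (\<i> * of_real w)) has_vector_derivative cis (w * x)) (at x)" for x
  proof -
    have "((\<lambda>x. w * x) has_derivative (\<lambda>h. w * h)) (at x)" by (auto intro!: derivative_eq_intros)
    from has_derivative_cis[OF this]
    have "((\<lambda>x. cis (w * x)) has_vector_derivative (\<i> * of_real w) * cis (w * x)) (at x)"
      by (simp add: has_vector_derivative_def scaleR_conv_of_real mult_ac)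
    from has_vector_derivative_divide[OF this, of "\<i> * of_real w"] show ?thesis using w by simp
  qed
  then have "(\<integral>x. cis (w * x) \<partial>circ) = (1 / (1 - 0)) *\<^sub>R (cis (w * 1) / (\<i> * of_real w) - cis (w * 0) / (\<i> * of_real w))"
    by (rule integral_unif_FTC[rotated]) (auto simp: cis_conv_exp intro!: continuous_intros)
  also have "cis (w * 1) = 1" using cis_multiple_2pi[of "of_int m"] by (simp add: w_def)
  finally show ?thesis using False by (simp add: w_def mult.assoc)
qed

lemma integral_ch: "(\<integral>p. ch k p \<partial>torus2) = (if k = 0 then 1 else 0)"
proof -
  obtain m n where k: "k = (m, n)" by (cases k)
  have "(\<integral>p. ch k p \<partial>torus2) = (\<integral>x. \<integral>y. ch k (x, y) \<partial>circ \<partial>circ)"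
    by (rule integral_torus2[where B = 1]) auto
  also have "\<dots> = (\<integral>x. \<integral>y. cis (2 * pi * (of_int m * x)) * cis (2 * pi * (of_int n * y)) \<partial>circ \<partial>circ)"
    by (intro Bochner_Integration.integral_cong refl) (simp add: k ch_def cis_mult distrib_left)
  also have "\<dots> = (if m = 0 then 1 else 0) * (if n = 0 then 1 else 0)"
    by (simp add: integral_circ_cis)
  finally show ?thesis by (auto simp: k zero_prod_def)
qed

definition tp :: "(real \<times> real \<Rightarrow> complex) \<Rightarrow> bool"
  where "tp T \<longleftrightarrow> (\<exists>K c. finite K \<and> (\<forall>p. T p = (\<Sum>k\<in>K. c k * ch k p)))"

lemma parseval:
  assumes "finite K"
  shows "(\<integral>p. (norm (\<Sum>k\<in>K. c k * ch k p))\<^sup>2 \<partial>torus2) = (\<Sum>k\<in>K. (norm (c k))\<^sup>2)"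
proof -
  have int: "integrable torus2 (\<lambda>p. a * ch k p)" for a k
    by (rule integrable_torus2_bounded[where B = "norm a"]) (auto simp: norm_mult)
  have "of_real (\<integral>p. (norm (\<Sum>k\<in>K. c k * ch k p))\<^sup>2 \<partial>torus2) =
      (\<integral>p. complex_of_real ((norm (\<Sum>k\<in>K. c k * ch k p))\<^sup>2) \<partial>torus2)"
    by (rule integral_complex_of_real[symmetric])
  also have "\<dots> = (\<integral>p. (\<Sum>k\<in>K. \<Sum>l\<in>K. c k * cnj (c l) * ch (k - l) p) \<partial>torus2)"
    by (intro Bochner_Integration.integral_cong refl, subst complex_norm_square)
       (simp add: cnj_sum sum_product ch_mult_cnj[symmetric] mult_ac)
  also have "\<dots> = (\<Sum>k\<in>K. \<Sum>l\<in>K. c k * cnj (c l) * (\<integral>p. ch (k - l) p \<partial>torus2))"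
    by (simp add: Bochner_Integration.integral_sum Bochner_Integration.integrable_sum int)
  also have "\<dots> = (\<Sum>k\<in>K. \<Sum>l\<in>K. if l = k then c k * cnj (c l) else 0)"
    by (intro sum.cong refl) (auto simp: integral_ch)
  also have "\<dots> = (\<Sum>k\<in>K. c k * cnj (c k))"
    using assms by simp
  also have "\<dots> = of_real (\<Sum>k\<in>K. (norm (c k))\<^sup>2)"
    by (simp only: of_real_sum complex_norm_square)
  finally show ?thesis by (simp only: of_real_eq_iff)
qed

text \<open>Pairing with the curve multiplies the coefficient of a character by the Fourier coefficient of
  the law of the curve, so Parseval turns a uniform bound on the latter into an operator bound.\<close>

lemma tp_equidistribution:
  assumes "prob_space \<nu>" and [measurable]: "\<alpha> \<in> borel_measurable \<nu>"
    and \<rho>: "\<And>k. k \<noteq> 0 \<Longrightarrow> norm (\<integral>t. ch k (\<alpha> t) \<partial>\<nu>) \<le> \<rho>" "0 < \<rho>"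
    and "tp T" and B: "\<And>p. norm (T p) \<le> B" "0 < B"
  shows "(\<integral>y. norm ((\<integral>t. T (\<alpha> t - y) \<partial>\<nu>) - (\<integral>p. T p \<partial>torus2)) \<partial>torus2) \<le> \<rho> * B"
proof -
  interpret nu: prob_space \<nu> by fact
  interpret tor: prob_space torus2 by simp
  obtain K c where K: "finite K" and T: "\<And>p. T p = (\<Sum>k\<in>K. c k * ch k p)"
    using assms(5) unfolding tp_def by blast
  define \<mu> where "\<mu> k = (\<integral>t. ch k (\<alpha> t) \<partial>\<nu>)" for k
  have int: "integrable torus2 (\<lambda>p. a * ch k p)" for a k
    by (rule integrable_torus2_bounded[where B = "norm a"]) (auto simp: norm_mult)
  have intn: "integrable \<nu> (\<lambda>t. a * ch k (\<alpha> t))" for a k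
    by (rule nu.integrable_const_bound[where B = "norm a"]) (auto simp: norm_mult)
  have I0: "(\<integral>p. T p \<partial>torus2) = (\<Sum>k\<in>K. if k = 0 then c k else 0)"
    unfolding T by (subst Bochner_Integration.integral_sum) (auto simp: int integral_ch intro!: sum.cong)
  \<comment> \<open>The conjugate of the error is taken so that it becomes a trigonometric
    polynomial in \<open>y\<close> itself, to which \<open>parseval\<close> applies. The zero mode
    drops out because its Fourier coefficient under the curve is 1, that is, it reproduces the
    mean.\<close>
  define S where "S y = (\<Sum>k\<in>K. (if k = 0 then 0 else cnj (c k * \<mu> k)) * ch k y)" for y
  have [measurable]: "S \<in> borel_measurable borel" unfolding S_def by measurable
  have eq: "(\<integral>t. T (\<alpha> t - y) \<partial>\<nu>) - (\<integral>p. T p \<partial>torus2) = cnj (S y)" for y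
  proof -
    have "(\<integral>t. T (\<alpha> t - y) \<partial>\<nu>) = (\<integral>t. (\<Sum>k\<in>K. (c k * cnj (ch k y)) * ch k (\<alpha> t)) \<partial>\<nu>)"
      unfolding T by (intro Bochner_Integration.integral_cong refl sum.cong) (simp add: ch_diff_arg mult_ac)
    also have "\<dots> = (\<Sum>k\<in>K. (c k * cnj (ch k y)) * \<mu> k)"
      by (subst Bochner_Integration.integral_sum) (simp_all add: intn \<mu>_def)
    finally have "(\<integral>t. T (\<alpha> t - y) \<partial>\<nu>) - (\<integral>p. T p \<partial>torus2) =
        (\<Sum>k\<in>K. (c k * cnj (ch k y)) * \<mu> k - (if k = 0 then c k else 0))"
      unfolding I0 by (simp add: sum_subtractf)
    also have "\<dots> = (\<Sum>k\<in>K. (if k = 0 then 0 else c k * \<mu> k) * cnj (ch k y))"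
      by (intro sum.cong refl) (auto simp: \<mu>_def nu.prob_space)
    also have "\<dots> = cnj (S y)" unfolding S_def by (auto simp: cnj_sum intro!: sum.cong)
    finally show ?thesis .
  qed
  have "(\<Sum>k\<in>K. (norm (c k))\<^sup>2) = (\<integral>p. (norm (T p))\<^sup>2 \<partial>torus2)"
    unfolding T by (rule parseval[OF K, symmetric])
  also have "\<dots> \<le> (\<integral>p. B\<^sup>2 \<partial>torus2)"
  proof (rule integral_mono)
    have [measurable]: "T \<in> borel_measurable borel" unfolding T by measurable
    show "integrable torus2 (\<lambda>p. (norm (T p))\<^sup>2)"
      by (rule integrable_torus2_bounded[where B = "B\<^sup>2"]) (auto intro!: power_mono B)
  qed (auto intro!: power_mono B)
  finally have cB: "(\<Sum>k\<in>K. (norm (c k))\<^sup>2) \<le> B\<^sup>2" by (simp add: tor.prob_space[simplified])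
  have "(\<integral>y. (norm (S y))\<^sup>2 \<partial>torus2) = (\<Sum>k\<in>K. (norm (if k = 0 then 0 else cnj (c k * \<mu> k)))\<^sup>2)"
    unfolding S_def by (rule parseval[OF K])
  also have "\<dots> \<le> (\<Sum>k\<in>K. \<rho>\<^sup>2 * (norm (c k))\<^sup>2)"
  proof (rule sum_mono)
    fix k
    show "(norm (if k = 0 then 0 else cnj (c k * \<mu> k)))\<^sup>2 \<le> \<rho>\<^sup>2 * (norm (c k))\<^sup>2"
    proof (cases "k = 0")
      case False
      have "(norm (\<mu> k))\<^sup>2 \<le> \<rho>\<^sup>2" unfolding \<mu>_def by (intro power_mono \<rho> False) auto
      then show ?thesis using False
        by (simp add: norm_mult power_mult_distrib mult.commute mult_right_mono)
    qed simp
  qed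
  also have "\<dots> \<le> \<rho>\<^sup>2 * B\<^sup>2"
    unfolding sum_distrib_left[symmetric] by (intro mult_left_mono cB) auto
  finally have S2: "(\<integral>y. (norm (S y))\<^sup>2 \<partial>torus2) \<le> (\<rho> * B)\<^sup>2" by (simp add: power_mult_distrib)
  define M where "M = (\<Sum>k\<in>K. norm (if k = 0 then 0 else cnj (c k * \<mu> k)))"
  have SM: "norm (S y) \<le> M" for y
    unfolding S_def M_def by (rule order_trans[OF norm_sum]) (auto simp: norm_mult intro!: sum_mono)
  then have "0 \<le> M" using norm_ge_zero order_trans by blast
  have iS: "integrable torus2 S" by (rule integrable_torus2_bounded[OF _ SM]) measurable
  have iS2: "integrable torus2 (\<lambda>y. (norm (S y))\<^sup>2)"
    by (rule integrable_torus2_bounded[where B = "M\<^sup>2"]) (auto intro!: power_mono SM)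
  define s where "s = \<rho> * B"
  have s: "0 < s" using \<rho> B by (simp add: s_def)
  \<comment> \<open>Passage from the square mean to the mean by the pointwise inequality
    \<open>2 * a * s \<le> a\<^sup>2 + s\<^sup>2\<close>, with \<open>s\<close> the expected size of
    the result.\<close>
  have "(\<integral>y. norm (S y) \<partial>torus2) \<le> (\<integral>y. (norm (S y))\<^sup>2 / (2 * s) + s / 2 \<partial>torus2)"
  proof (rule integral_mono)
    show "norm (S y) \<le> (norm (S y))\<^sup>2 / (2 * s) + s / 2" for y
      using sum_squares_bound[of "norm (S y)" s] s by (simp add: field_simps power2_eq_square)
  qed (use iS iS2 in auto)
  also have "\<dots> = (\<integral>y. (norm (S y))\<^sup>2 \<partial>torus2) / (2 * s) + s / 2"
    using iS2 by (subst Bochner_Integration.integral_add) (auto simp: tor.prob_space[simplified])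
  also have "\<dots> \<le> s\<^sup>2 / (2 * s) + s / 2"
    using S2 s unfolding s_def[symmetric] by (intro add_right_mono divide_right_mono) auto
  also have "\<dots> = s" using s by (simp add: power2_eq_square)
  finally show ?thesis unfolding eq s_def by simp
qed

lemma tp_monom: "tp (\<lambda>p. a * ch k p)"
  unfolding tp_def by (intro exI[of _ "{k}"] exI[of _ "\<lambda>_. a"]) simp

lemma tp_const: "tp (\<lambda>p. a)"
  using tp_monom[of a 0] by simp

lemma tp_add_monom:
  assumes "tp T" shows "tp (\<lambda>p. T p + a * ch k p)"
proof -
  obtain K c where K: "finite K" and T: "\<And>p. T p = (\<Sum>k\<in>K. c k * ch k p)"
    using assms unfolding tp_def by blast
  \<comment> \<open>The frequency \<open>k\<close> may already occur in \<open>K\<close>; its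
    coefficients are then added.\<close>
  define c' where "c' l = (if l \<in> K then c l else 0) + (if l = k then a else 0)" for l
  have "T p + a * ch k p = (\<Sum>l\<in>insert k K. c' l * ch l p)" for p
  proof -
    have "(\<Sum>l\<in>insert k K. c' l * ch l p) =
      (\<Sum>l\<in>insert k K. (if l \<in> K then c l else 0) * ch l p) + (\<Sum>l\<in>insert k K. (if l = k then a else 0) * ch l p)"
      by (simp add: c'_def distrib_right sum.distrib del: sum.insert)
    also have "(\<Sum>l\<in>insert k K. (if l = k then a else 0) * ch l p) = (\<Sum>l\<in>insert k K. if l = k then a * ch l p else 0)"
      by (intro sum.cong) auto
    also have "\<dots> = a * ch k p" using K by (simp only: sum.delta finite_insert) auto
    also have "(\<Sum>l\<in>insert k K. (if l \<in> K then c l else 0) * ch l p) = (\<Sum>l\<in>K. (if l \<in> K then c l else 0) * ch l p)"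
      using K by (intro sum.mono_neutral_right) auto
    also have "\<dots> = T p" unfolding T by (intro sum.cong) auto
    finally show ?thesis by simp
  qed
  with K show ?thesis unfolding tp_def by (intro exI[of _ "insert k K"] exI[of _ c']) auto
qed

lemma tp_add:
  assumes "tp T" "tp U" shows "tp (\<lambda>p. T p + U p)"
proof -
  obtain K c where K: "finite K" and U: "\<And>p. U p = (\<Sum>k\<in>K. c k * ch k p)"
    using assms(2) unfolding tp_def by blast
  have "tp (\<lambda>p. T p + (\<Sum>k\<in>K. c k * ch k p))"
    using K
  proof (induction K)
    case empty
    then show ?case using assms(1) by simp
  next
    case (insert k K)
    from tp_add_monom[OF insert.IH, of "c k" k] insert.hyps show ?case by (simp add: add_ac)
  qed
  then show ?thesis by (simp add: U)
qed

lemma tp_sum: "finite I \<Longrightarrow> (\<And>i. i \<in> I \<Longrightarrow> tp (T i)) \<Longrightarrow> tp (\<lambda>p. \<Sum>i\<in>I. T i p)"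
  by (induction I rule: finite_induct) (auto intro: tp_add tp_const)

lemma tp_mult:
  assumes "tp T" "tp U" shows "tp (\<lambda>p. T p * U p)"
proof -
  obtain K c where K: "finite K" and T: "\<And>p. T p = (\<Sum>k\<in>K. c k * ch k p)"
    using assms(1) unfolding tp_def by blast
  obtain J d where J: "finite J" and U: "\<And>p. U p = (\<Sum>k\<in>J. d k * ch k p)"
    using assms(2) unfolding tp_def by blast
  have "T p * U p = (\<Sum>k\<in>K. \<Sum>l\<in>J. (c k * d l) * ch (k + l) p)" for p
    unfolding T U sum_product by (intro sum.cong refl) (simp add: ch_add mult_ac)
  then show ?thesis using K J by (auto intro!: tp_sum tp_monom)
qed

section \<open>Approximation by trigonometric polynomials\<close>

abbreviation emb :: "real \<times> real \<Rightarrow> complex \<times> complex"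
  where "emb p \<equiv> (cis (2 * pi * fst p), cis (2 * pi * snd p))"

lemma per2_emb: "per2 (\<lambda>p. g (emb p))"
proof -
  have "cis (2 * pi * (x + 1)) = cis (2 * pi * x)" for x
    using cis_multiple_2pi[of 1] by (simp add: distrib_left flip: cis_mult)
  then show ?thesis by (simp add: per2_def)
qed

text \<open>Stone-Weierstrass on the compact product of two unit circles. The real and imaginary
  parts of the two complex coordinates separate points, and their pull-backs are cosines and sines,
  hence combinations of two characters.\<close>

lemma trig_poly_dense:
  fixes f :: "complex \<times> complex \<Rightarrow> real"
  assumes "continuous_on (sphere 0 1 \<times> sphere 0 1) f" and "0 < \<epsilon>"
  obtains T :: "real \<times> real \<Rightarrow> real" where "tp (\<lambda>p. of_real (T p))" "per2 T"
    "\<And>p. \<bar>f (emb p) - T p\<bar> < \<epsilon>"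
proof -
  define S where "S = (sphere 0 1 \<times> sphere 0 1 :: (complex \<times> complex) set)"
  define R where "R = {g. continuous_on S g \<and> tp (\<lambda>p. of_real (g (emb p)))}"
  have re: "complex_of_real (cos (2 * pi * x)) = (1/2) * cis (2 * pi * x) + (1/2) * cis (2 * pi * - x)"
    and im: "complex_of_real (sin (2 * pi * x)) = (-\<i>/2) * cis (2 * pi * x) + (\<i>/2) * cis (2 * pi * - x)" for x
    by (simp_all add: complex_eq_iff)
  interpret function_ring_on R S
  proof
    show "compact S" unfolding S_def by (intro compact_Times compact_sphere)
    show "continuous_on S f" if "f \<in> R" for f using that by (simp add: R_def)
    show "(\<lambda>x. f x + g x) \<in> R" if "f \<in> R" "g \<in> R" for f g
      using that tp_add by (auto simp: R_def intro!: continuous_intros)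
    show "(\<lambda>x. f x * g x) \<in> R" if "f \<in> R" "g \<in> R" for f g
      using that tp_mult by (auto simp: R_def intro!: continuous_intros)
    show "(\<lambda>_. c) \<in> R" for c by (simp add: R_def tp_const)
    have chs: "ch (1, 0) p = cis (2 * pi * fst p)" "ch (-1, 0) p = cis (2 * pi * - fst p)"
      "ch (0, 1) p = cis (2 * pi * snd p)" "ch (0, -1) p = cis (2 * pi * - snd p)" for p
      by (simp_all add: ch_def)
    have m: "(\<lambda>q. Re (fst q)) \<in> R" "(\<lambda>q. Im (fst q)) \<in> R" "(\<lambda>q. Re (snd q)) \<in> R" "(\<lambda>q. Im (snd q)) \<in> R"
      unfolding R_def by (auto intro!: continuous_intros)
        (simp_all only: re im cis.sel chs[symmetric] fst_conv snd_conv tp_add[OF tp_monom tp_monom])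
    show "\<exists>f\<in>R. f x \<noteq> f y" if "x \<noteq> y" for x y
    proof (rule ccontr)
      assume "\<not> (\<exists>f\<in>R. f x \<noteq> f y)"
      then have e: "f x = f y" if "f \<in> R" for f using that by blast
      show False using that e[OF m(1)] e[OF m(2)] e[OF m(3)] e[OF m(4)]
        by (simp add: prod_eq_iff complex_eq_iff)
    qed
  qed
  obtain g where g: "g \<in> R" "\<And>q. q \<in> S \<Longrightarrow> \<bar>f q - g q\<bar> < \<epsilon>"
    using Stone_Weierstrass_basic[of f \<epsilon>] assms unfolding S_def[symmetric] by blast
  have "emb p \<in> S" for p by (simp add: S_def)
  with g show ?thesis by (intro that[of "\<lambda>p. g (emb p)"]) (auto simp: R_def per2_emb)
qed

lemma sets_torus [measurable]: "torus \<in> sets borel"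
proof -
  have "torus \<in> sets (borel \<Otimes>\<^sub>M borel)" unfolding torus_def by (intro pair_measureI) auto
  then show ?thesis unfolding borel_prod .
qed

lemma circ_eq_density: "circ = density lborel (indicator {0..<1})"
proof -
  have "circ = density lborel (\<lambda>x. ennreal (indicator {0..1} x))" by (simp add: unif_eq_density)
  also have "\<dots> = density lborel (indicator {0..<1})"
  proof (rule density_cong)
    show "AE x in lborel. ennreal (indicator {0..1} x) = indicator {0..<1} (x::real)"
      using AE_lborel_singleton[of 1] by eventually_elim (auto split: split_indicator)
  qed auto
  finally show ?thesis .
qed

lemma torus2_eq_density: "torus2 = density lborel (indicator torus)"
proof -
  have "sigma_finite_measure (density lborel (indicator {0..<1}) :: real measure)"
    using prob_space_imp_sigma_finite[OF prob_space_circ] unfolding circ_eq_density .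
  then have "torus2 = density (lborel \<Otimes>\<^sub>M lborel) (\<lambda>(x, y). indicator {0..<1} x * indicator {0..<1} y)"
    unfolding torus2_def circ_eq_density by (intro pair_measure_density) (auto intro: sigma_finite_lborel)
  also have "(\<lambda>(x, y). indicator {0..<1} x * indicator {0..<1} y) = (indicator torus :: real \<times> real \<Rightarrow> ennreal)"
    by (auto simp: fun_eq_iff torus_def split: split_indicator)
  finally show ?thesis by (simp only: lborel_prod)
qed

text \<open>The exceptional set is only Lebesgue null, so it is enclosed in a Borel null set. The
  lines on which a coordinate is 0 or 1 are removed as well, so that \<open>P\<close> is only to be
  checked in the open square.\<close>

lemma AE_torus2_I:
  assumes "negligible N" and "\<And>x y. (x, y) \<notin> N \<Longrightarrow> 0 < x \<Longrightarrow> x < 1 \<Longrightarrow> 0 < y \<Longrightarrow> y < 1 \<Longrightarrow> P (x, y)"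
  shows "AE p in torus2. P p"
proof -
  have "N \<in> null_sets lebesgue" using assms(1) by (simp add: negligible_iff_null_sets)
  then obtain N' where N': "N' \<in> null_sets lborel" "N \<subseteq> N'" by (auto simp: null_sets_completion_iff2)
  have b: "AE p in lborel. fst p \<noteq> a \<and> snd p \<noteq> a" for a :: real
  proof -
    have "AE p in lborel \<Otimes>\<^sub>M lborel. fst p \<noteq> a \<and> snd p \<noteq> (a :: real)"
    proof (rule AE_I')
      have "{a} \<times> UNIV \<union> UNIV \<times> {a} \<in> null_sets (lborel \<Otimes>\<^sub>M lborel :: (real \<times> real) measure)"
        by (intro null_sets.Un null_setsI) (auto simp: lborel.emeasure_pair_measure_Times)
      then show "{a} \<times> UNIV \<union> UNIV \<times> {a} \<in> null_sets (lborel \<Otimes>\<^sub>M lborel :: (real \<times> real) measure)" .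
    qed auto
    then show ?thesis by (simp only: lborel_prod)
  qed
  have "AE p in lborel. 0 < (indicator torus p :: ennreal) \<longrightarrow> P p"
  proof -
    have n: "AE p in lborel. p \<notin> N'" using N'(1) by (rule AE_not_in)
    show ?thesis using n b[of 0] b[of 1]
    proof eventually_elim
      case (elim p)
      obtain x y where p: "p = (x, y)" by (cases p)
      show ?case
      proof
        assume "0 < (indicator torus p :: ennreal)"
        then have "x \<in> {0..<1}" "y \<in> {0..<1}" by (auto simp: p torus_def split: split_indicator_asm)
        with elim show "P p" using N'(2) unfolding p by (intro assms(2)) auto
      qed
    qed
  qed
  then show ?thesis unfolding torus2_eq_density by (subst AE_density) auto
qed

text \<open>The cutoff makes the continuous approximants vanish on the boundary of the fundamental domain,
  where the argument function jumps.\<close>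

lemma continuous_on_cutoff:
  fixes h :: "real \<times> real \<Rightarrow> real"
  assumes h: "continuous_on UNIV h" and B: "\<And>p. \<bar>h p\<bar> \<le> 1" and "0 \<le> c"
  defines "k \<equiv> \<lambda>q. min 1 (c * (norm (fst q - 1) * norm (snd q - 1))) * h (Arg2pi (fst q) / (2 * pi), Arg2pi (snd q) / (2 * pi))"
  shows "continuous_on (sphere 0 1 \<times> sphere 0 1) k"
proof -
  define cf where "cf q = min 1 (c * (norm (fst q - 1) * norm (snd q - 1)))" for q :: "complex \<times> complex"
  have chi: "isCont cf q" for q unfolding cf_def by (intro continuous_intros)
  have chi0: "0 \<le> cf q" for q using \<open>0 \<le> c\<close> by (simp add: cf_def)
  have "isCont k q" if q: "q \<in> sphere 0 1 \<times> sphere 0 1" for q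
  proof (cases "fst q = 1 \<or> snd q = 1")
    case True
    then have z: "cf q = 0" "k q = 0" by (auto simp: cf_def k_def)
    \<comment> \<open>At the cut the argument function is discontinuous, but the cutoff vanishes
      there and dominates \<open>k\<close>, since \<open>h\<close> is bounded by 1.\<close>
    have "(k \<longlongrightarrow> 0) (at q)"
    proof (rule Lim_null_comparison)
      show "(cf \<longlongrightarrow> 0) (at q)" using chi[of q] z by (simp add: isCont_def)
      have "\<bar>k p\<bar> \<le> cf p" for p
      proof -
        have "\<bar>k p\<bar> \<le> cf p * 1" unfolding k_def cf_def[symmetric] abs_mult
          using chi0[of p] by (intro mult_mono B) auto
        then show ?thesis by simp
      qed
      then show "\<forall>\<^sub>F p in at q. norm (k p) \<le> cf p" by simp
    qed
    with z show ?thesis by (simp add: isCont_def)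
  next
    case False
    have nn: "z \<notin> \<real>\<^sub>\<ge>\<^sub>0" if "norm z = 1" "z \<noteq> 1" for z :: complex
    proof
      assume "z \<in> \<real>\<^sub>\<ge>\<^sub>0"
      then obtain r where "z = of_real r" "0 \<le> r" by (auto simp: nonneg_Reals_def)
      with that show False by simp
    qed
    have a: "isCont Arg2pi (fst q)" "isCont Arg2pi (snd q)"
      using q False nn[of "fst q"] nn[of "snd q"] by (auto intro!: continuous_at_Arg2pi)
    have "isCont h p" for p using h by (metis UNIV_I continuous_on_eq_continuous_at open_UNIV)
    then have "isCont (\<lambda>q. h (Arg2pi (fst q) / (2 * pi), Arg2pi (snd q) / (2 * pi))) q"
    proof (rule isCont_o2[where g = h, rotated])
      have "isCont (\<lambda>q. Arg2pi (fst q)) q" "isCont (\<lambda>q. Arg2pi (snd q)) q"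
        by (rule isCont_o2[where g = Arg2pi and f = fst, OF _ a(1)], intro continuous_intros)
           (rule isCont_o2[where g = Arg2pi and f = snd, OF _ a(2)], intro continuous_intros)
      then show "isCont (\<lambda>q. (Arg2pi (fst q) / (2 * pi), Arg2pi (snd q) / (2 * pi))) q"
        by (intro continuous_intros) auto
    qed
    then show ?thesis unfolding k_def by (intro continuous_intros)
  qed
  then show ?thesis by (simp add: continuous_at_imp_continuous_on)
qed

text \<open>A measurable function is an almost everywhere limit of continuous ones. Truncating them
  to [-1,1], cutting off at the boundary of the square and using dominated convergence gives a
  continuous function on the torus that is close in the mean; uniform density does the rest. The sup
  bound on \<open>T\<close> is kept because the operator bound for trigonometric polynomials is in
  terms of it.\<close>

lemma trig_poly_approx:
  fixes G :: "real \<times> real \<Rightarrow> real"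
  assumes [measurable]: "G \<in> borel_measurable borel" and B: "\<And>p. \<bar>G p\<bar> \<le> 1" and "0 < \<epsilon>"
  obtains T :: "real \<times> real \<Rightarrow> real" where "tp (\<lambda>p. of_real (T p))" "per2 T"
    "\<And>p. \<bar>T p\<bar> \<le> 1 + \<epsilon>" "(\<integral>p. \<bar>G p - T p\<bar> \<partial>torus2) \<le> \<epsilon>"
proof -
  interpret tor: prob_space torus2 by simp
  have "G \<in> borel_measurable lebesgue" by (intro measurable_completion) measurable
  then have "G measurable_on UNIV" by (intro lebesgue_measurable_imp_measurable_on_real) auto
  then obtain N g where N: "negligible N" and g: "\<And>n. continuous_on UNIV (g n)"
    and lim: "\<And>x. x \<notin> N \<Longrightarrow> (\<lambda>n. g n x) \<longlonglongrightarrow> G x" unfolding measurable_on_def by auto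
  define h where "h n p = max (-1) (min 1 (g n p))" for n p
  have hc: "continuous_on UNIV (h n)" for n
    unfolding h_def using g[of n] by (intro continuous_intros)
  have hB: "\<bar>h n p\<bar> \<le> 1" for n p by (auto simp: h_def)
  have hl: "(\<lambda>n. h n p) \<longlonglongrightarrow> G p" if "p \<notin> N" for p
  proof -
    have "(\<lambda>n. h n p) \<longlonglongrightarrow> max (-1) (min 1 (G p))"
      unfolding h_def by (intro tendsto_intros lim that)
    moreover have "max (-1) (min 1 (G p)) = G p" using B[of p] by auto
    ultimately show ?thesis by simp
  qed
  \<comment> \<open>The approximants transplanted to the product of circles. The cutoff tends to 1
    at every interior point of the square as \<open>n\<close> grows.\<close>
  define k where "k n q = min 1 (real n * (norm (fst q - 1) * norm (snd q - 1))) *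
      h n (Arg2pi (fst q) / (2 * pi), Arg2pi (snd q) / (2 * pi))" for n and q :: "complex \<times> complex"
  have kc: "continuous_on (sphere 0 1 \<times> sphere 0 1) (k n)" for n
    unfolding k_def by (intro continuous_on_cutoff hc hB) simp
  have kB: "\<bar>k n q\<bar> \<le> 1" for n q
    unfolding k_def abs_mult by (intro mult_le_one hB) auto
  have kE: "continuous_on UNIV (\<lambda>p. k n (emb p))" for n
    by (rule continuous_on_compose2[OF kc]) (auto simp: cis_conv_exp intro!: continuous_intros)
  have [measurable]: "(\<lambda>p. k n (emb p)) \<in> borel_measurable borel" for n
    by (rule borel_measurable_continuous_onI[OF kE])
  have "(\<lambda>n. \<integral>p. \<bar>G p - k n (emb p)\<bar> \<partial>torus2) \<longlonglongrightarrow> (\<integral>p. 0 \<partial>torus2)"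
  proof (rule integral_dominated_convergence[where w = "\<lambda>_. 2"])
    show "AE p in torus2. (\<lambda>n. \<bar>G p - k n (emb p)\<bar>) \<longlonglongrightarrow> 0"
    proof (rule AE_torus2_I[OF N])
      fix x y :: real assume xy: "(x, y) \<notin> N" "0 < x" "x < 1" "0 < y" "y < 1"
      have A: "Arg2pi (cis (2 * pi * t)) = 2 * pi * t" "cis (2 * pi * t) \<noteq> 1" if "0 < t" "t < 1" for t
      proof -
        show a: "Arg2pi (cis (2 * pi * t)) = 2 * pi * t"
          using that by (intro Arg2pi_unique[where r = 1]) (auto simp: cis_conv_exp)
        show "cis (2 * pi * t) \<noteq> 1"
        proof
          assume "cis (2 * pi * t) = 1"
          with a have "2 * pi * t = Arg2pi (of_real 1)" by simp
          then show False using that Arg2pi_of_real[of 1] by simp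
        qed
      qed
      define d where "d = norm (cis (2 * pi * x) - 1) * norm (cis (2 * pi * y) - 1)"
      have d: "0 < d" using A[of x] A[of y] xy by (simp add: d_def)
      have "(\<lambda>n. k n (emb (x, y))) \<longlonglongrightarrow> 1 * G (x, y)"
        unfolding k_def
      proof (rule tendsto_mult)
        have "filterlim (\<lambda>n. real n * d) at_top sequentially"
          using d by (intro filterlim_at_top_mult_tendsto_pos[OF tendsto_const] filterlim_real_sequentially | simp add: mult.commute)+
        then have "\<forall>\<^sub>F n in sequentially. 1 \<le> real n * d" by (simp add: filterlim_at_top)
        then show "(\<lambda>n. min 1 (real n * (norm (fst (emb (x, y)) - 1) * norm (snd (emb (x, y)) - 1)))) \<longlonglongrightarrow> 1"
          by (intro tendsto_eventually) (auto simp: d_def elim!: eventually_mono)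
        show "(\<lambda>n. h n (Arg2pi (fst (emb (x, y))) / (2 * pi), Arg2pi (snd (emb (x, y))) / (2 * pi))) \<longlonglongrightarrow> G (x, y)"
          using hl[OF xy(1)] xy by (simp add: A)
      qed
      then have "(\<lambda>n. \<bar>G (x, y) - k n (emb (x, y))\<bar>) \<longlonglongrightarrow> \<bar>G (x, y) - 1 * G (x, y)\<bar>"
        by (intro tendsto_intros)
      then show "(\<lambda>n. \<bar>G (x, y) - k n (emb (x, y))\<bar>) \<longlonglongrightarrow> 0" by simp
    qed
    show "AE p in torus2. norm \<bar>G p - k n (emb p)\<bar> \<le> 2" for n
    proof (intro always_eventually allI)
      fix p show "norm \<bar>G p - k n (emb p)\<bar> \<le> 2"
        using B[of p] kB[of n "emb p"] by (simp add: abs_le_iff)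
    qed
  qed auto
  then have "\<forall>\<^sub>F n in sequentially. (\<integral>p. \<bar>G p - k n (emb p)\<bar> \<partial>torus2) < \<epsilon> / 2"
    using \<open>0 < \<epsilon>\<close> by (intro order_tendstoD(2)) auto
  then obtain n where n: "(\<integral>p. \<bar>G p - k n (emb p)\<bar> \<partial>torus2) < \<epsilon> / 2"
    by (auto simp: eventually_sequentially)
  obtain T where T: "tp (\<lambda>p. of_real (T p))" "per2 T" "\<And>p. \<bar>k n (emb p) - T p\<bar> < \<epsilon> / 2"
    using trig_poly_dense[OF kc, of "\<epsilon> / 2" n] \<open>0 < \<epsilon>\<close> by auto
  have TB: "\<bar>T p\<bar> \<le> 1 + \<epsilon>" for p
    using T(3)[of p] kB[of n "emb p"] \<open>0 < \<epsilon>\<close> by linarith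
  have mC: "(\<lambda>p. complex_of_real (T p)) \<in> borel_measurable borel"
  proof -
    obtain K c where "\<And>p. complex_of_real (T p) = (\<Sum>k\<in>K. c k * ch k p)" using T(1) unfolding tp_def by blast
    then show ?thesis by simp
  qed
  have [measurable]: "T \<in> borel_measurable borel"
    using measurable_compose[OF mC, of Re] by simp
  have "(\<integral>p. \<bar>G p - T p\<bar> \<partial>torus2) \<le> (\<integral>p. \<bar>G p - k n (emb p)\<bar> + \<epsilon> / 2 \<partial>torus2)"
  proof (rule integral_mono)
    show "integrable torus2 (\<lambda>p. \<bar>G p - T p\<bar>)"
    proof (rule integrable_torus2_bounded)
      show "norm \<bar>G p - T p\<bar> \<le> 2 + \<epsilon>" for p using B[of p] TB[of p] by (simp add: abs_le_iff)
    qed measurable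
    show "integrable torus2 (\<lambda>p. \<bar>G p - k n (emb p)\<bar> + \<epsilon> / 2)"
    proof (rule Bochner_Integration.integrable_add)
      show "integrable torus2 (\<lambda>p. \<bar>G p - k n (emb p)\<bar>)"
      proof (rule integrable_torus2_bounded)
        show "norm \<bar>G p - k n (emb p)\<bar> \<le> 2" for p using B[of p] kB[of n "emb p"] by (simp add: abs_le_iff)
      qed measurable
    qed simp
    show "\<bar>G p - T p\<bar> \<le> \<bar>G p - k n (emb p)\<bar> + \<epsilon> / 2" for p using T(3)[of p] by linarith
  qed
  also have "\<dots> = (\<integral>p. \<bar>G p - k n (emb p)\<bar> \<partial>torus2) + \<epsilon> / 2"
  proof (subst Bochner_Integration.integral_add)
    show "integrable torus2 (\<lambda>p. \<bar>G p - k n (emb p)\<bar>)"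
    proof (rule integrable_torus2_bounded)
      show "norm \<bar>G p - k n (emb p)\<bar> \<le> 2" for p using B[of p] kB[of n "emb p"] by (simp add: abs_le_iff)
    qed measurable
  qed (simp_all add: tor.prob_space[simplified])
  finally have "(\<integral>p. \<bar>G p - T p\<bar> \<partial>torus2) \<le> \<epsilon>" using n by simp
  with T TB show ?thesis by (intro that[of T])
qed

text \<open>Although the curve may be singular, replacing \<open>G\<close> by a trigonometric
  polynomial close in the mean is harmless: after integration over the translation \<open>y\<close>
  the error along the curve equals its plain mean over the torus. The bound does not involve the
  degree of the polynomial, so the approximation error can be sent to 0.\<close>

lemma equidistribution:
  fixes G :: "real \<times> real \<Rightarrow> real"
  assumes nu: "prob_space \<nu>" and [measurable]: "\<alpha> \<in> borel_measurable \<nu>"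
    and \<rho>: "\<And>k. k \<noteq> 0 \<Longrightarrow> norm (\<integral>t. ch k (\<alpha> t) \<partial>\<nu>) \<le> \<rho>" "0 < \<rho>"
    and [measurable]: "G \<in> borel_measurable borel" and B: "\<And>p. \<bar>G p\<bar> \<le> 1" and per: "per2 G"
  shows "(\<integral>y. \<bar>(\<integral>t. G (\<alpha> t - y) \<partial>\<nu>) - (\<integral>p. G p \<partial>torus2)\<bar> \<partial>torus2) \<le> \<rho>"
proof -
  interpret nu: prob_space \<nu> by fact
  interpret tor: prob_space torus2 by simp
  interpret P: pair_sigma_finite \<nu> torus2
    by (simp add: pair_sigma_finite_def prob_space_imp_sigma_finite nu)
  have main: "(\<integral>y. \<bar>(\<integral>t. G (\<alpha> t - y) \<partial>\<nu>) - (\<integral>p. G p \<partial>torus2)\<bar> \<partial>torus2) \<le> \<rho> * (1 + \<epsilon>) + 2 * \<epsilon>"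
    if eps: "0 < \<epsilon>" for \<epsilon>
  proof -
    obtain T where T: "tp (\<lambda>p. of_real (T p))" "per2 T" "\<And>p. \<bar>T p\<bar> \<le> 1 + \<epsilon>" "(\<integral>p. \<bar>G p - T p\<bar> \<partial>torus2) \<le> \<epsilon>"
      using trig_poly_approx[of G \<epsilon>] B eps by auto
    have mC: "(\<lambda>p. complex_of_real (T p)) \<in> borel_measurable borel"
    proof -
      obtain K c where "\<And>p. complex_of_real (T p) = (\<Sum>k\<in>K. c k * ch k p)" using T(1) unfolding tp_def by blast
      then show ?thesis by simp
    qed
    have [measurable]: "T \<in> borel_measurable borel"
      using measurable_compose[OF mC, of Re] by simp
    define D where "D p = G p - T p" for p
    have [measurable]: "D \<in> borel_measurable borel" unfolding D_def by measurable
    have DB: "\<bar>D p\<bar> \<le> 2 + \<epsilon>" for p using B[of p] T(3)[of p] by (simp add: D_def abs_le_iff)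
    have perD: "per2 D" using per T(2) by (simp add: per2_def D_def)
    define A where "A y = (\<integral>t. T (\<alpha> t - y) \<partial>\<nu>) - (\<integral>p. T p \<partial>torus2)" for y
    define E where "E y = (\<integral>t. D (\<alpha> t - y) \<partial>\<nu>)" for y
    have [measurable]: "(\<lambda>(y, t). T (\<alpha> t - y)) \<in> borel_measurable (borel \<Otimes>\<^sub>M \<nu>)"
      "(\<lambda>(y, t). D (\<alpha> t - y)) \<in> borel_measurable (borel \<Otimes>\<^sub>M \<nu>)" by measurable
    have [measurable]: "A \<in> borel_measurable borel" "E \<in> borel_measurable borel"
      unfolding A_def E_def by measurable
    have "(\<integral>y. norm ((\<integral>t. complex_of_real (T (\<alpha> t - y)) \<partial>\<nu>) - (\<integral>p. complex_of_real (T p) \<partial>torus2)) \<partial>torus2) \<le> \<rho> * (1 + \<epsilon>)"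
      using eps T(3) by (intro tp_equidistribution nu \<rho> T(1)) auto
    also have "(\<lambda>y. norm ((\<integral>t. complex_of_real (T (\<alpha> t - y)) \<partial>\<nu>) - (\<integral>p. complex_of_real (T p) \<partial>torus2))) = (\<lambda>y. \<bar>A y\<bar>)"
      unfolding A_def integral_complex_of_real by (simp flip: of_real_diff)
    finally have IA: "(\<integral>y. \<bar>A y\<bar> \<partial>torus2) \<le> \<rho> * (1 + \<epsilon>)" .
    have iT: "integrable \<nu> (\<lambda>t. T (\<alpha> t - y))" for y
      by (rule nu.integrable_const_bound[where B = "1 + \<epsilon>"]) (auto simp: T)
    have iD: "integrable \<nu> (\<lambda>t. D (\<alpha> t - y))" for y
      by (rule nu.integrable_const_bound[where B = "2 + \<epsilon>"]) (auto simp: DB)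
    have iTt: "integrable torus2 T" by (rule integrable_torus2_bounded[where B = "1 + \<epsilon>"]) (auto simp: T)
    have AB: "norm (A y) \<le> (1 + \<epsilon>) + (1 + \<epsilon>)" for y
      unfolding A_def
    proof (intro order_trans[OF norm_triangle_ineq4] add_mono)
      show "norm (\<integral>t. T (\<alpha> t - y) \<partial>\<nu>) \<le> 1 + \<epsilon>"
        using T(3) by (intro order_trans[OF integral_norm_bound] nu.integral_le_const integrable_norm iT) auto
      show "norm (\<integral>p. T p \<partial>torus2) \<le> 1 + \<epsilon>"
        using T(3) by (intro order_trans[OF integral_norm_bound] tor.integral_le_const integrable_norm iTt) auto
    qed
    have EB: "norm (E y) \<le> 2 + \<epsilon>" for y
      unfolding E_def using DB
      by (intro order_trans[OF integral_norm_bound] nu.integral_le_const integrable_norm iD) auto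
    have iA: "integrable torus2 A" by (rule integrable_torus2_bounded[OF _ AB]) measurable
    have iE: "integrable torus2 E" by (rule integrable_torus2_bounded[OF _ EB]) measurable
    have iDt: "integrable torus2 D" by (rule integrable_torus2_bounded[where B = "2 + \<epsilon>"]) (auto simp: DB)
    have IE: "(\<integral>y. \<bar>E y\<bar> \<partial>torus2) \<le> \<epsilon>"
    proof -
      have "ennreal (\<integral>y. \<bar>E y\<bar> \<partial>torus2) = (\<integral>\<^sup>+y. ennreal \<bar>E y\<bar> \<partial>torus2)"
        using iE by (intro nn_integral_eq_integral[symmetric]) auto
      also have "\<dots> \<le> (\<integral>\<^sup>+y. \<integral>\<^sup>+t. ennreal \<bar>D (\<alpha> t - y)\<bar> \<partial>\<nu> \<partial>torus2)"
        unfolding E_def using integral_norm_bound_ennreal[OF iD] by (intro nn_integral_mono) simp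
      also have "\<dots> = (\<integral>\<^sup>+t. \<integral>\<^sup>+y. ennreal \<bar>D (\<alpha> t - y)\<bar> \<partial>torus2 \<partial>\<nu>)"
        by (rule P.Fubini') measurable
      \<comment> \<open>For each fixed \<open>t\<close> the reflection \<open>\<alpha> t - y\<close>
        preserves the measure of the torus, since \<open>D\<close> is periodic.\<close>
      also have "\<dots> = (\<integral>\<^sup>+t. \<integral>\<^sup>+y. ennreal \<bar>D y\<bar> \<partial>torus2 \<partial>\<nu>)"
        using perD by (intro nn_integral_cong nn_integral_torus2_reflect) (auto simp: per2_def)
      also have "\<dots> = (\<integral>\<^sup>+y. ennreal \<bar>D y\<bar> \<partial>torus2)" by (simp add: nu.emeasure_space_1)
      also have "\<dots> = ennreal (\<integral>y. \<bar>D y\<bar> \<partial>torus2)"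
        using iDt by (intro nn_integral_eq_integral) auto
      also have "\<dots> \<le> ennreal \<epsilon>" using T(4) by (intro ennreal_leI) (simp add: D_def)
      finally show ?thesis using eps by (simp add: ennreal_le_iff)
    qed
    have ID: "\<bar>\<integral>p. D p \<partial>torus2\<bar> \<le> \<epsilon>"
    proof -
      have "\<bar>\<integral>p. D p \<partial>torus2\<bar> \<le> (\<integral>p. \<bar>D p\<bar> \<partial>torus2)" by (rule integral_abs_bound)
      also have "\<dots> \<le> \<epsilon>" using T(4) by (simp add: D_def)
      finally show ?thesis .
    qed
    have eq: "(\<integral>t. G (\<alpha> t - y) \<partial>\<nu>) - (\<integral>p. G p \<partial>torus2) = A y + E y - (\<integral>p. D p \<partial>torus2)" for y
    proof -
      have "(\<integral>t. G (\<alpha> t - y) \<partial>\<nu>) = (\<integral>t. T (\<alpha> t - y) + D (\<alpha> t - y) \<partial>\<nu>)" by (simp add: D_def)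
      also have "\<dots> = (\<integral>t. T (\<alpha> t - y) \<partial>\<nu>) + (\<integral>t. D (\<alpha> t - y) \<partial>\<nu>)" by (rule Bochner_Integration.integral_add[OF iT iD])
      finally have 1: "(\<integral>t. G (\<alpha> t - y) \<partial>\<nu>) = (\<integral>t. T (\<alpha> t - y) \<partial>\<nu>) + (\<integral>t. D (\<alpha> t - y) \<partial>\<nu>)" .
      have "(\<integral>p. G p \<partial>torus2) = (\<integral>p. T p + D p \<partial>torus2)" by (simp add: D_def)
      also have "\<dots> = (\<integral>p. T p \<partial>torus2) + (\<integral>p. D p \<partial>torus2)" by (rule Bochner_Integration.integral_add[OF iTt iDt])
      finally show ?thesis using 1 by (simp add: A_def E_def)
    qed
    have "(\<integral>y. \<bar>A y + E y - (\<integral>p. D p \<partial>torus2)\<bar> \<partial>torus2) \<le> (\<integral>y. \<bar>A y\<bar> + \<bar>E y\<bar> + \<epsilon> \<partial>torus2)"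
    proof (rule integral_mono)
      show "\<bar>A y + E y - (\<integral>p. D p \<partial>torus2)\<bar> \<le> \<bar>A y\<bar> + \<bar>E y\<bar> + \<epsilon>" for y using ID by linarith
    qed (use iA iE in auto)
    also have "\<dots> = (\<integral>y. \<bar>A y\<bar> \<partial>torus2) + (\<integral>y. \<bar>E y\<bar> \<partial>torus2) + \<epsilon>"
      using iA iE by (simp add: tor.prob_space[simplified])
    also have "\<dots> \<le> \<rho> * (1 + \<epsilon>) + 2 * \<epsilon>" using IA IE by simp
    finally show ?thesis unfolding eq .
  qed
  show ?thesis
  proof (rule field_le_epsilon)
    fix e :: real assume e: "0 < e"
    define \<epsilon> where "\<epsilon> = e / (\<rho> + 2)"
    have "0 < \<epsilon>" using e \<rho>(2) by (simp add: \<epsilon>_def)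
    from main[OF this] have "(\<integral>y. \<bar>(\<integral>t. G (\<alpha> t - y) \<partial>\<nu>) - (\<integral>p. G p \<partial>torus2)\<bar> \<partial>torus2) \<le> \<rho> + \<epsilon> * (\<rho> + 2)"
      by (simp add: algebra_simps)
    also have "\<epsilon> * (\<rho> + 2) = e" using \<rho>(2) by (simp add: \<epsilon>_def)
    finally show "(\<integral>y. \<bar>(\<integral>t. G (\<alpha> t - y) \<partial>\<nu>) - (\<integral>p. G p \<partial>torus2)\<bar> \<partial>torus2) \<le> \<rho> + e" .
  qed
qed

section \<open>The two-point motion\<close>

type_synonym pair_state = "(real \<times> real) \<times> (real \<times> real)"

text \<open>One step on the universal cover, for both points with the same noise. Functions with
  \<open>per4\<close> do not see the missing reduction mod 1, and the expression is continuous in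
  the noise and the state.\<close>

definition lift :: "real \<Rightarrow> real \<Rightarrow> pair_state \<Rightarrow> pair_state"
  where "lift L \<omega> s =
    ((f_std L (fst (fst s) + \<omega>) - snd (fst s), fst (fst s) + \<omega>),
     (f_std L (fst (snd s) + \<omega>) - snd (snd s), fst (snd s) + \<omega>))"

lemma lift_simp [simp]:
  "lift L \<omega> ((x, y), (x', y')) = ((f_std L (x + \<omega>) - y, x + \<omega>), (f_std L (x' + \<omega>) - y', x' + \<omega>))"
  by (simp add: lift_def)

definition torus4 :: "pair_state measure"
  where "torus4 = torus2 \<Otimes>\<^sub>M torus2"

definition per4 :: "(pair_state \<Rightarrow> 'a) \<Rightarrow> bool"
  where "per4 \<Phi> \<longleftrightarrow> (\<forall>x y x' y'.
    \<Phi> ((x + 1, y), (x', y')) = \<Phi> ((x, y), (x', y')) \<and> \<Phi> ((x, y + 1), (x', y')) = \<Phi> ((x, y), (x', y')) \<and>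
    \<Phi> ((x, y), (x' + 1, y')) = \<Phi> ((x, y), (x', y')) \<and> \<Phi> ((x, y), (x', y' + 1)) = \<Phi> ((x, y), (x', y')))"

definition avg :: "real \<Rightarrow> real \<Rightarrow> (pair_state \<Rightarrow> real) \<Rightarrow> pair_state \<Rightarrow> real"
  where "avg L \<sigma> \<Phi> s = (\<integral>\<omega>. \<Phi> (lift L \<omega> s) \<partial>unif (-\<sigma>) \<sigma>)"

text \<open>The same average for nonnegative extended functions, where monotone bounds and exchange
  of integrals apply at once; all probability and density bounds are stated for it.\<close>

definition navg :: "real \<Rightarrow> real \<Rightarrow> (pair_state \<Rightarrow> ennreal) \<Rightarrow> pair_state \<Rightarrow> ennreal"
  where "navg L \<sigma> \<Phi> s = (\<integral>\<^sup>+\<omega>. \<Phi> (lift L \<omega> s) \<partial>unif (-\<sigma>) \<sigma>)"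

lemma f_std_add_1 [simp]: "f_std L (x + 1) = f_std L x"
  using cos_periodic[of "2 * pi * x"] by (simp add: f_std_def distrib_left)

lemma f_std_add_1' [simp]: "f_std L (x + 1 + w) = f_std L (x + w)"
  using f_std_add_1[of L "x + w"] by (simp add: add_ac)

lemma measurable_f_std [measurable]: "f_std L \<in> borel_measurable borel"
  unfolding f_std_def by measurable

lemma continuous_lift: "continuous_on UNIV (\<lambda>p. lift L (fst p) (snd p))"
  unfolding lift_def f_std_def by (intro continuous_intros)

lemma measurable_lift [measurable]:
  assumes [measurable]: "f \<in> borel_measurable M" "g \<in> borel_measurable M"
  shows "(\<lambda>x. lift L (f x) (g x)) \<in> borel_measurable M"
proof -
  have m: "(\<lambda>p. lift L (fst p) (snd p)) \<in> borel_measurable borel"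
    by (rule borel_measurable_continuous_onI[OF continuous_lift])
  have "(\<lambda>x. (f x, g x)) \<in> borel_measurable M" by measurable
  from measurable_compose[OF this m] show ?thesis by simp
qed

lemma sets_torus4 [measurable_cong, simp]: "sets torus4 = sets borel"
proof -
  have "sets torus4 = sets (borel \<Otimes>\<^sub>M borel)" unfolding torus4_def by (rule sets_pair_measure_cong) simp_all
  also have "(borel \<Otimes>\<^sub>M borel :: pair_state measure) = borel" by (rule borel_prod)
  finally show ?thesis .
qed

lemma space_torus4 [simp]: "space torus4 = UNIV"
  by (simp add: torus4_def space_pair_measure)

lemma pair_sigma_finite_torus2: "pair_sigma_finite torus2 torus2"
  by (simp add: pair_sigma_finite_def prob_space_imp_sigma_finite)

lemma prob_space_torus4 [simp]: "prob_space torus4"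
proof -
  interpret pair_prob_space torus2 torus2 by (simp add: pair_prob_space_def pair_sigma_finite_torus2)
  show ?thesis unfolding torus4_def by (rule prob_space_axioms)
qed

lemma nn_integral_torus4:
  assumes "f \<in> borel_measurable borel"
  shows "(\<integral>\<^sup>+s. f s \<partial>torus4) = (\<integral>\<^sup>+z. \<integral>\<^sup>+w. f (z, w) \<partial>torus2 \<partial>torus2)"
    and "(\<integral>\<^sup>+s. f s \<partial>torus4) = (\<integral>\<^sup>+w. \<integral>\<^sup>+z. f (z, w) \<partial>torus2 \<partial>torus2)"
proof -
  interpret pair_sigma_finite torus2 torus2 by (rule pair_sigma_finite_torus2)
  have m: "f \<in> borel_measurable (torus2 \<Otimes>\<^sub>M torus2)"
    using assms unfolding torus4_def[symmetric] by measurable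
  show "(\<integral>\<^sup>+s. f s \<partial>torus4) = (\<integral>\<^sup>+z. \<integral>\<^sup>+w. f (z, w) \<partial>torus2 \<partial>torus2)" unfolding torus4_def
    by (rule sigma_finite_measure.nn_integral_fst[OF prob_space_imp_sigma_finite[OF prob_space_torus2] m, symmetric])
  show "(\<integral>\<^sup>+s. f s \<partial>torus4) = (\<integral>\<^sup>+w. \<integral>\<^sup>+z. f (z, w) \<partial>torus2 \<partial>torus2)"
    unfolding torus4_def by (rule nn_integral_snd[OF m, symmetric])
qed

text \<open>Regroups the four coordinates into the pair of first coordinates (outer) and the pair of
  second coordinates (inner). For fixed first coordinates the noise moves along one curve, and
  averaging over the second coordinates is the translation average of
  \<open>equidistribution\<close>.\<close>

lemma nn_integral_torus4_xy:
  assumes [measurable]: "f \<in> borel_measurable borel"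
  shows "(\<integral>\<^sup>+s. f s \<partial>torus4) = (\<integral>\<^sup>+q. \<integral>\<^sup>+p. f ((fst q, fst p), (snd q, snd p)) \<partial>torus2 \<partial>torus2)"
proof -
  interpret pair_sigma_finite circ circ by (rule pair_sigma_finite_circ)
  have "(\<integral>\<^sup>+s. f s \<partial>torus4) = (\<integral>\<^sup>+x. \<integral>\<^sup>+y. \<integral>\<^sup>+x'. \<integral>\<^sup>+y'. f ((x, y), (x', y')) \<partial>circ \<partial>circ \<partial>circ \<partial>circ)"
    by (simp add: nn_integral_torus4 nn_integral_torus2)
  also have "\<dots> = (\<integral>\<^sup>+x. \<integral>\<^sup>+x'. \<integral>\<^sup>+y. \<integral>\<^sup>+y'. f ((x, y), (x', y')) \<partial>circ \<partial>circ \<partial>circ \<partial>circ)"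
    by (rule nn_integral_cong, rule Fubini') measurable
  also have "\<dots> = (\<integral>\<^sup>+q. \<integral>\<^sup>+p. f ((fst q, fst p), (snd q, snd p)) \<partial>torus2 \<partial>torus2)"
    by (simp add: nn_integral_torus2)
  finally show ?thesis .
qed

lemma integrable_torus4_bounded:
  fixes f :: "pair_state \<Rightarrow> real"
  assumes [measurable]: "f \<in> borel_measurable borel" and "\<And>x. \<bar>f x\<bar> \<le> B"
  shows "integrable torus4 f"
proof -
  interpret prob_space torus4 by simp
  show ?thesis by (rule integrable_const_bound[where B = B]) (use assms(2) in auto)
qed

text \<open>A step preserves area: for fixed first coordinate it reflects the second one, and the
  first one is shifted.\<close>

lemma nn_integral_step:
  assumes [measurable]: "h \<in> borel_measurable borel" and per: "per2 h"
  shows "(\<integral>\<^sup>+p. h (f_std L (fst p + \<omega>) - snd p, fst p + \<omega>) \<partial>torus2) = (\<integral>\<^sup>+p. h p \<partial>torus2)"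
proof -
  interpret pair_sigma_finite circ circ by (rule pair_sigma_finite_circ)
  have p2: "per1 (\<lambda>y. h (x, y))" and p1: "per1 (\<lambda>x. h (x, y))" for x y
    using per by (simp_all add: per1_def per2_def)
  have "(\<integral>\<^sup>+p. h (f_std L (fst p + \<omega>) - snd p, fst p + \<omega>) \<partial>torus2) =
      (\<integral>\<^sup>+x. \<integral>\<^sup>+y. h (f_std L (x + \<omega>) - y, x + \<omega>) \<partial>circ \<partial>circ)"
    by (subst nn_integral_torus2) auto
  also have "\<dots> = (\<integral>\<^sup>+x. \<integral>\<^sup>+y. h (y, x + \<omega>) \<partial>circ \<partial>circ)"
    by (intro nn_integral_cong nn_integral_circ_reflect p1) measurable
  also have "\<dots> = (\<integral>\<^sup>+y. \<integral>\<^sup>+x. h (y, \<omega> + x) \<partial>circ \<partial>circ)"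
    by (subst Fubini') (simp_all add: add.commute)
  also have "\<dots> = (\<integral>\<^sup>+y. \<integral>\<^sup>+x. h (y, x) \<partial>circ \<partial>circ)"
    by (intro nn_integral_cong nn_integral_circ_shift p2) measurable
  also have "\<dots> = (\<integral>\<^sup>+p. h p \<partial>torus2)" by (rule nn_integral_torus2(1)[symmetric]) measurable
  finally show ?thesis .
qed

lemma nn_integral_lift:
  assumes [measurable]: "\<Phi> \<in> borel_measurable borel" and per: "per4 \<Phi>"
  shows "(\<integral>\<^sup>+s. \<Phi> (lift L \<omega> s) \<partial>torus4) = (\<integral>\<^sup>+s. \<Phi> s \<partial>torus4)"
proof -
  let ?S = "\<lambda>p. (f_std L (fst p + \<omega>) - snd p, fst p + \<omega>)"
  have [measurable]: "?S \<in> borel_measurable borel" by measurable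
  have p: "per2 (\<lambda>w. \<Phi> (z, w))" "per2 (\<lambda>z. \<Phi> (z, w))" for z w
    using per by (cases z; cases w; simp add: per2_def per4_def)+
  have "(\<integral>\<^sup>+s. \<Phi> (lift L \<omega> s) \<partial>torus4) = (\<integral>\<^sup>+z. \<integral>\<^sup>+w. \<Phi> (?S z, ?S w) \<partial>torus2 \<partial>torus2)"
    by (subst nn_integral_torus4) (auto simp: lift_def)
  also have "\<dots> = (\<integral>\<^sup>+z. \<integral>\<^sup>+w. \<Phi> (?S z, w) \<partial>torus2 \<partial>torus2)"
    by (intro nn_integral_cong nn_integral_step p) measurable
  also have "\<dots> = (\<integral>\<^sup>+w. \<integral>\<^sup>+z. \<Phi> (?S z, w) \<partial>torus2 \<partial>torus2)"
    by (rule pair_sigma_finite.Fubini'[OF pair_sigma_finite_torus2, symmetric]) measurable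
  also have "\<dots> = (\<integral>\<^sup>+w. \<integral>\<^sup>+z. \<Phi> (z, w) \<partial>torus2 \<partial>torus2)"
    by (intro nn_integral_cong nn_integral_step p) measurable
  also have "\<dots> = (\<integral>\<^sup>+s. \<Phi> s \<partial>torus4)" by (rule nn_integral_torus4(2)[symmetric]) measurable
  finally show ?thesis .
qed

lemma per4_lift: "per4 \<Phi> \<Longrightarrow> per4 (\<lambda>s. \<Phi> (lift L \<omega> s))"
proof -
  assume p: "per4 \<Phi>"
  have P: "\<Phi> ((a + 1, b), w) = \<Phi> ((a, b), w)" "\<Phi> ((a, b + 1), w) = \<Phi> ((a, b), w)"
    "\<Phi> (w, (a + 1, b)) = \<Phi> (w, (a, b))" "\<Phi> (w, (a, b + 1)) = \<Phi> (w, (a, b))" for a b w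
    using p unfolding per4_def by (cases w, simp)+
  have e: "x + 1 + \<omega> = (x + \<omega>) + 1" "a - (y + 1) + 1 = a - y" for x a y :: real by simp_all
  have M: "\<Phi> ((a - (y + 1), b), w) = \<Phi> ((a - y, b), w)" "\<Phi> (w, (a - (y + 1), b)) = \<Phi> (w, (a - y, b))" for a y b w
    using P(1)[of "a - (y + 1)" b w] P(3)[of w "a - (y + 1)" b] unfolding e by simp_all
  show ?thesis unfolding per4_def lift_simp f_std_add_1' unfolding e(1) P M by simp
qed

lemma per4_avg: "per4 \<Phi> \<Longrightarrow> per4 (avg L \<sigma> \<Phi>)"
  and per4_navg: "per4 \<Psi> \<Longrightarrow> per4 (navg L \<sigma> \<Psi>)"
  using per4_lift[of \<Phi> L] per4_lift[of \<Psi> L] unfolding per4_def avg_def navg_def by simp_all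

lemma measurable_avg [measurable]:
  assumes [measurable]: "\<Phi> \<in> borel_measurable borel" and "0 < \<sigma>"
  shows "avg L \<sigma> \<Phi> \<in> borel_measurable borel"
proof -
  interpret prob_space "unif (-\<sigma>) \<sigma>" using assms(2) by (intro prob_space_unif) simp
  show ?thesis unfolding avg_def by measurable
qed

lemma measurable_navg [measurable]:
  assumes [measurable]: "\<Phi> \<in> borel_measurable borel" and "0 < \<sigma>"
  shows "navg L \<sigma> \<Phi> \<in> borel_measurable borel"
proof -
  interpret prob_space "unif (-\<sigma>) \<sigma>" using assms(2) by (intro prob_space_unif) simp
  show ?thesis unfolding navg_def by measurable
qed

lemma nn_integral_navg:
  assumes [measurable]: "\<Phi> \<in> borel_measurable borel" and per: "per4 \<Phi>" and "0 < \<sigma>"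
  shows "(\<integral>\<^sup>+s. navg L \<sigma> \<Phi> s \<partial>torus4) = (\<integral>\<^sup>+s. \<Phi> s \<partial>torus4)"
proof -
  interpret N: prob_space "unif (-\<sigma>) \<sigma>" using assms(3) by (intro prob_space_unif) simp
  interpret P: pair_sigma_finite "unif (-\<sigma>) \<sigma>" torus4
    by (simp add: pair_sigma_finite_def prob_space_imp_sigma_finite N.prob_space_axioms)
  have "(\<integral>\<^sup>+s. navg L \<sigma> \<Phi> s \<partial>torus4) = (\<integral>\<^sup>+\<omega>. \<integral>\<^sup>+s. \<Phi> (lift L \<omega> s) \<partial>torus4 \<partial>unif (-\<sigma>) \<sigma>)"
    unfolding navg_def by (rule P.Fubini') measurable
  also have "\<dots> = (\<integral>\<^sup>+s. \<Phi> s \<partial>torus4)"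
    by (simp add: nn_integral_lift per N.emeasure_space_1[simplified])
  finally show ?thesis .
qed

lemma integrable_avg:
  fixes \<Phi> :: "pair_state \<Rightarrow> real"
  assumes [measurable]: "\<Phi> \<in> borel_measurable borel" and "0 < \<sigma>" and B: "\<And>s. \<bar>\<Phi> s\<bar> \<le> B"
  shows "integrable (unif (-\<sigma>) \<sigma>) (\<lambda>\<omega>. \<Phi> (lift L \<omega> s))"
proof (rule integrable_unif_bounded)
  show "norm (\<Phi> (lift L \<omega> s)) \<le> B" for \<omega> using B by simp
qed (use assms(2) in auto)

lemma avg_bounded:
  assumes [measurable]: "\<Phi> \<in> borel_measurable borel" and "0 < \<sigma>" and B: "\<And>s. \<bar>\<Phi> s\<bar> \<le> B"
  shows "\<bar>avg L \<sigma> \<Phi> s\<bar> \<le> B"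
proof -
  interpret N: prob_space "unif (-\<sigma>) \<sigma>" using assms(2) by (intro prob_space_unif) simp
  show ?thesis unfolding avg_def using B
    by (intro order_trans[OF integral_abs_bound] N.integral_le_const integrable_abs integrable_avg[OF assms]) auto
qed

lemma ennreal_avg:
  assumes [measurable]: "\<Phi> \<in> borel_measurable borel" and "0 < \<sigma>" and B: "\<And>s. \<bar>\<Phi> s\<bar> \<le> B" and "\<And>s. 0 \<le> \<Phi> s"
  shows "ennreal (avg L \<sigma> \<Phi> s) = navg L \<sigma> (\<lambda>s. ennreal (\<Phi> s)) s"
  unfolding avg_def navg_def using assms(4)
  by (intro nn_integral_eq_integral[symmetric] integrable_avg[OF assms(1-3)]) auto

lemma avg_add_const:
  assumes [measurable]: "\<Phi> \<in> borel_measurable borel" and "0 < \<sigma>" and B: "\<And>s. \<bar>\<Phi> s\<bar> \<le> B"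
  shows "avg L \<sigma> (\<lambda>s. \<Phi> s + c) s = avg L \<sigma> \<Phi> s + c"
proof -
  interpret N: prob_space "unif (-\<sigma>) \<sigma>" using assms(2) by (intro prob_space_unif) simp
  show ?thesis unfolding avg_def
    by (subst Bochner_Integration.integral_add[OF integrable_avg[OF assms]])
       (auto simp: N.prob_space[simplified])
qed

lemma integral_avg:
  assumes [measurable]: "\<Phi> \<in> borel_measurable borel" and "0 < \<sigma>" and B: "\<And>s. \<bar>\<Phi> s\<bar> \<le> B" and per: "per4 \<Phi>"
  shows "(\<integral>s. avg L \<sigma> \<Phi> s \<partial>torus4) = (\<integral>s. \<Phi> s \<partial>torus4)"
proof -
  interpret T: prob_space torus4 by simp
  \<comment> \<open>Adding the bound makes the function nonnegative, so that the invariance can be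
    taken from \<open>nn_integral_navg\<close>.\<close>
  define \<Psi> where "\<Psi> s = \<Phi> s + B" for s
  have [measurable]: "\<Psi> \<in> borel_measurable borel" unfolding \<Psi>_def by measurable
  have P: "0 \<le> \<Psi> s" "\<bar>\<Psi> s\<bar> \<le> 2 * B" for s using B[of s] by (auto simp: \<Psi>_def abs_le_iff)
  have perP: "per4 (\<lambda>s. ennreal (\<Psi> s))" using per by (simp add: per4_def \<Psi>_def)
  have [measurable]: "avg L \<sigma> \<Psi> \<in> borel_measurable borel" "avg L \<sigma> \<Phi> \<in> borel_measurable borel"
    using assms(2) by measurable
  have aP: "0 \<le> avg L \<sigma> \<Psi> s" for s unfolding avg_def using P by (intro integral_nonneg_AE) auto
  have iP: "integrable torus4 (avg L \<sigma> \<Psi>)" "integrable torus4 \<Psi>" "integrable torus4 \<Phi>" "integrable torus4 (avg L \<sigma> \<Phi>)"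
    by (rule integrable_torus4_bounded[where B = "2 * B"], simp, rule avg_bounded, use assms(2) P in simp_all)
       (rule integrable_torus4_bounded[where B = "2 * B"], use P in simp_all,
        rule integrable_torus4_bounded[where B = B], use B in simp_all,
        rule integrable_torus4_bounded[where B = B], simp, rule avg_bounded, use assms(2) B in simp_all)
  have "ennreal (\<integral>s. avg L \<sigma> \<Psi> s \<partial>torus4) = (\<integral>\<^sup>+s. ennreal (avg L \<sigma> \<Psi> s) \<partial>torus4)"
    using aP by (intro nn_integral_eq_integral[symmetric] iP) auto
  also have "\<dots> = (\<integral>\<^sup>+s. navg L \<sigma> (\<lambda>s. ennreal (\<Psi> s)) s \<partial>torus4)"
    using ennreal_avg[OF _ assms(2) P(2) P(1)] by simp
  also have "\<dots> = (\<integral>\<^sup>+s. ennreal (\<Psi> s) \<partial>torus4)"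
    by (rule nn_integral_navg[OF _ perP assms(2)]) measurable
  also have "\<dots> = ennreal (\<integral>s. \<Psi> s \<partial>torus4)"
    using P by (intro nn_integral_eq_integral iP) auto
  finally have "(\<integral>s. avg L \<sigma> \<Psi> s \<partial>torus4) = (\<integral>s. \<Psi> s \<partial>torus4)"
    using aP P by (simp add: ennreal_inj integral_nonneg_AE)
  moreover have "avg L \<sigma> \<Psi> s = avg L \<sigma> \<Phi> s + B" for s
    unfolding \<Psi>_def by (rule avg_add_const[OF assms(1-3)])
  ultimately have "(\<integral>s. avg L \<sigma> \<Phi> s + B \<partial>torus4) = (\<integral>s. \<Phi> s + B \<partial>torus4)" by (simp add: \<Psi>_def)
  then show ?thesis using iP by (simp add: T.prob_space[simplified])
qed

text \<open>Moving an interval by \<open>\<tau>\<close> changes its indicator only within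
  \<open>\<bar>\<tau>\<bar>\<close> of the two end points, that is on length at most
  \<open>4 * \<bar>\<tau>\<bar>\<close>; the density is \<open>1 / (2 * \<sigma>)\<close>. This is
  the only source of regularity for averages of merely measurable functions.\<close>

lemma unif_shift:
  fixes g :: "real \<Rightarrow> real"
  assumes [measurable]: "g \<in> borel_measurable borel" and B: "\<And>x. \<bar>g x\<bar> \<le> 1" and "0 < \<sigma>"
  shows "\<bar>(\<integral>\<omega>. g (\<omega> + \<tau>) \<partial>unif (-\<sigma>) \<sigma>) - (\<integral>\<omega>. g \<omega> \<partial>unif (-\<sigma>) \<sigma>)\<bar> \<le> 2 * \<bar>\<tau>\<bar> / \<sigma>"
proof -
  let ?I = "indicator {-\<sigma>..\<sigma>} :: real \<Rightarrow> real"
  have ig: "integrable lborel (\<lambda>\<omega>. indicator {a..b} \<omega> * h \<omega>)"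
    if [measurable]: "h \<in> borel_measurable borel" and "\<And>x. \<bar>h x\<bar> \<le> 1" for a b and h :: "real \<Rightarrow> real"
  proof (rule Bochner_Integration.integrable_bound)
    show "integrable lborel (\<lambda>\<omega>. indicator {a..b} \<omega> :: real)" by (cases "a \<le> b") auto
    show "AE x in lborel. norm (indicator {a..b} x * h x) \<le> norm (indicator {a..b} x :: real)"
      using that(2) by (auto simp: abs_mult split: split_indicator)
  qed measurable
  have "(\<integral>\<omega>. ?I \<omega> * g (\<omega> + \<tau>) \<partial>lborel) = (\<integral>\<omega>. ?I (\<omega> - \<tau>) * g \<omega> \<partial>lborel)"
    by (subst lborel_integral_real_affine[where c = 1 and t = "-\<tau>"]) (auto simp: add.commute)
  moreover have i1: "integrable lborel (\<lambda>\<omega>. ?I (\<omega> - \<tau>) * g \<omega>)"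
  proof -
    have "(\<lambda>\<omega>. ?I (\<omega> - \<tau>) * g \<omega>) = (\<lambda>\<omega>. indicator {\<tau>-\<sigma>..\<tau>+\<sigma>} \<omega> * g \<omega>)"
      by (auto simp: fun_eq_iff split: split_indicator)
    then show ?thesis using ig[of g] B by simp
  qed
  moreover have i2: "integrable lborel (\<lambda>\<omega>. ?I \<omega> * g \<omega>)" using ig[of g] B by simp
  ultimately have eq: "(\<integral>\<omega>. ?I \<omega> * g (\<omega> + \<tau>) \<partial>lborel) - (\<integral>\<omega>. ?I \<omega> * g \<omega> \<partial>lborel) =
      (\<integral>\<omega>. ?I (\<omega> - \<tau>) * g \<omega> - ?I \<omega> * g \<omega> \<partial>lborel)"
    by simp
  let ?J = "\<lambda>\<omega>. indicator {-\<sigma>-\<bar>\<tau>\<bar>..-\<sigma>+\<bar>\<tau>\<bar>} \<omega> + indicator {\<sigma>-\<bar>\<tau>\<bar>..\<sigma>+\<bar>\<tau>\<bar>} \<omega> :: real"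
  have "\<bar>\<integral>\<omega>. ?I (\<omega> - \<tau>) * g \<omega> - ?I \<omega> * g \<omega> \<partial>lborel\<bar> \<le> (\<integral>\<omega>. \<bar>?I (\<omega> - \<tau>) * g \<omega> - ?I \<omega> * g \<omega>\<bar> \<partial>lborel)"
    by (rule integral_abs_bound)
  also have "\<dots> \<le> (\<integral>\<omega>. ?J \<omega> \<partial>lborel)"
  proof (rule integral_mono)
    fix \<omega>
    show "\<bar>?I (\<omega> - \<tau>) * g \<omega> - ?I \<omega> * g \<omega>\<bar> \<le> ?J \<omega>"
    proof (cases "(\<omega> - \<tau> \<in> {-\<sigma>..\<sigma>}) = (\<omega> \<in> {-\<sigma>..\<sigma>})")
      case True
      then show ?thesis by (simp add: indicator_def)
    next
      case False
      then have "\<omega> \<in> {-\<sigma>-\<bar>\<tau>\<bar>..-\<sigma>+\<bar>\<tau>\<bar>} \<or> \<omega> \<in> {\<sigma>-\<bar>\<tau>\<bar>..\<sigma>+\<bar>\<tau>\<bar>}"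
        using assms(3) by (auto simp: abs_if split: if_splits)
      then have "1 \<le> ?J \<omega>" by (auto split: split_indicator)
      moreover have "\<bar>?I (\<omega> - \<tau>) * g \<omega> - ?I \<omega> * g \<omega>\<bar> \<le> 1" using B[of \<omega>] by (auto split: split_indicator)
      ultimately show ?thesis by linarith
    qed
  qed (use i1 i2 in auto)
  also have "\<dots> = 4 * \<bar>\<tau>\<bar>" by simp
  finally have *: "\<bar>(\<integral>\<omega>. ?I \<omega> * g (\<omega> + \<tau>) \<partial>lborel) - (\<integral>\<omega>. ?I \<omega> * g \<omega> \<partial>lborel)\<bar> \<le> 4 * \<bar>\<tau>\<bar>" unfolding eq .
  have "(\<integral>\<omega>. g (\<omega> + \<tau>) \<partial>unif (-\<sigma>) \<sigma>) - (\<integral>\<omega>. g \<omega> \<partial>unif (-\<sigma>) \<sigma>) =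
     (1 / (2 * \<sigma>)) * ((\<integral>\<omega>. ?I \<omega> * g (\<omega> + \<tau>) \<partial>lborel) - (\<integral>\<omega>. ?I \<omega> * g \<omega> \<partial>lborel))"
    using assms(3) by (simp add: integral_unif right_diff_distrib)
  also have "\<bar>\<dots>\<bar> \<le> (1 / (2 * \<sigma>)) * (4 * \<bar>\<tau>\<bar>)"
    unfolding abs_mult using * assms(3) by (intro mult_mono) auto
  finally show ?thesis using assms(3) by (simp add: field_simps)
qed

lemma unif_partition:
  fixes g :: "real \<Rightarrow> real"
  assumes [measurable]: "g \<in> borel_measurable borel" and B: "\<And>x. \<bar>g x\<bar> \<le> 1" and "0 < l" "0 < n"
  shows "(\<integral>\<omega>. g \<omega> \<partial>unif a (a + real n * l)) =
    (\<Sum>j<n. \<integral>\<omega>. g \<omega> \<partial>unif (a + real j * l) (a + real j * l + l)) / real n"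
proof -
  let ?I = "\<lambda>u v. \<integral>\<omega>. indicator {u..v} \<omega> * g \<omega> \<partial>lborel"
  have ig: "integrable lborel (\<lambda>\<omega>. indicator {u..v} \<omega> * g \<omega>)" for u v
  proof (rule Bochner_Integration.integrable_bound)
    show "integrable lborel (\<lambda>\<omega>. indicator {u..v} \<omega> :: real)" by (cases "u \<le> v") auto
    show "AE x in lborel. norm (indicator {u..v} x * g x) \<le> norm (indicator {u..v} x :: real)"
      using B by (auto simp: abs_mult split: split_indicator)
  qed measurable
  have "?I a (a + real k * l) = (\<Sum>j<k. ?I (a + real j * l) (a + real j * l + l))" for k
  proof (induction k)
    case 0
    have "?I a (a + real 0 * l) = (\<integral>\<omega>. 0 \<partial>(lborel :: real measure))"
    proof (rule integral_cong_AE)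
      show "AE \<omega> in lborel. indicator {a..a + real 0 * l} \<omega> * g \<omega> = 0"
        using AE_lborel_singleton[of a] by eventually_elim (auto split: split_indicator)
    qed simp_all
    then show ?case by simp
  next
    case (Suc k)
    have m: "a \<le> a + real k * l" "a + real k * l \<le> a + real k * l + l" using assms(3) by auto
    have "?I a (a + real k * l + l) = (\<integral>\<omega>. indicator {a..a + real k * l} \<omega> * g \<omega> + indicator {a + real k * l..a + real k * l + l} \<omega> * g \<omega> \<partial>lborel)"
    proof (rule integral_cong_AE)
      show "AE \<omega> in lborel. indicator {a..a + real k * l + l} \<omega> * g \<omega> = indicator {a..a + real k * l} \<omega> * g \<omega> + indicator {a + real k * l..a + real k * l + l} \<omega> * g \<omega>"
        using AE_lborel_singleton[of "a + real k * l"]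
      proof eventually_elim
        case (elim \<omega>)
        moreover have "indicator {a..v + l} x * y = indicator {a..v} x * y + indicator {v..v + l} x * y"
          if "x \<noteq> v" "a \<le> v" "v \<le> v + l" for v x y :: real
          using that by (auto split: split_indicator)
        ultimately show ?case using m by blast
      qed
    qed measurable
    also have "\<dots> = ?I a (a + real k * l) + ?I (a + real k * l) (a + real k * l + l)"
      by (rule Bochner_Integration.integral_add[OF ig ig])
    finally show ?case using Suc by (simp add: algebra_simps)
  qed
  from this[of n] show ?thesis using assms(3,4)
    by (simp add: integral_unif sum_divide_distrib field_simps flip: sum_divide_distrib)
qed

section \<open>Mixing in the mean\<close>

text \<open>A character evaluated along the curve has phase \<open>2 * pi * L\<close> times the real
  part of \<open>z * cis (2 * pi * \<omega>)\<close>, with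
  \<open>z = m * cis (2 * pi * x) + n * cis (2 * pi * x')\<close>: a single cosine of amplitude
  \<open>norm z\<close>. It remains to bound \<open>norm z\<close> below by \<open>c\<close>,
  uniformly in the frequency.\<close>

lemma equidistribution_noise:
  fixes G :: "real \<times> real \<Rightarrow> real"
  assumes ab: "a < b" "b - a \<le> 2" and [measurable]: "G \<in> borel_measurable borel"
    and B: "\<And>p. \<bar>G p\<bar> \<le> 1" and per: "per2 G"
    and c: "0 < c" "c \<le> \<bar>sin (2 * pi * (x - x'))\<bar>" "1 \<le> L * c"
  shows "(\<integral>p. \<bar>(\<integral>\<omega>. G ((f_std L (x + \<omega>), f_std L (x' + \<omega>)) - p) \<partial>unif a b) - (\<integral>p. G p \<partial>torus2)\<bar> \<partial>torus2)
    \<le> 200 * (L * c) powr (-1/6) / (b - a)"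
proof (rule equidistribution)
  show "prob_space (unif a b)" by (rule prob_space_unif[OF ab(1)])
  have "L * c \<noteq> 0" using c(3) by auto
  then show "0 < 200 * (L * c) powr (-1/6) / (b - a)" using ab by (simp del: mult_eq_0_iff)
  fix k :: "int \<times> int" assume "k \<noteq> 0"
  obtain m n where k: "k = (m, n)" by (cases k)
  with \<open>k \<noteq> 0\<close> have mn: "m \<noteq> 0 \<or> n \<noteq> 0" by (auto simp: zero_prod_def)
  have c1: "c \<le> 1" using c(2) abs_sin_le_one order_trans by blast
  have L: "0 < L"
  proof (rule ccontr)
    assume "\<not> 0 < L"
    then have "L * c \<le> 0" using c(1) by (intro mult_nonpos_nonneg) auto
    with c(3) show False by simp
  qed
  define z where "z = of_int m * cis (2 * pi * x) + of_int n * cis (2 * pi * x')"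
  have cz: "c \<le> norm z"
  proof (cases "n = 0")
    case True
    then have "norm z = \<bar>of_int m\<bar>" by (simp add: z_def norm_mult)
    moreover have "1 \<le> \<bar>real_of_int m\<bar>" using mn True by (simp flip: of_int_abs)
    ultimately show ?thesis using c1 by simp
  next
    case False
    \<comment> \<open>After this rotation the first term is real, so the imaginary part comes from
      the second term alone and is \<open>n\<close> times a sine of modulus at least
      \<open>c\<close>.\<close>
    have "z * cis (- (2 * pi * x)) = of_int m + of_int n * cis (2 * pi * (x' - x))"
      by (simp add: z_def distrib_right mult.assoc cis_mult right_diff_distrib)
    then have "norm z = norm (of_int m + of_int n * cis (2 * pi * (x' - x)))"
      by (metis norm_cis norm_mult mult.right_neutral)
    moreover have "\<bar>Im (of_int m + of_int n * cis (2 * pi * (x' - x)))\<bar> \<le> norm (of_int m + of_int n * cis (2 * pi * (x' - x)))"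
      by (rule abs_Im_le_cmod)
    moreover have "\<bar>Im (of_int m + of_int n * cis (2 * pi * (x' - x)))\<bar> = \<bar>real_of_int n\<bar> * \<bar>sin (2 * pi * (x - x'))\<bar>"
    proof -
      have "sin (2 * pi * (x' - x)) = - sin (2 * pi * (x - x'))"
        by (simp add: right_diff_distrib flip: sin_minus)
      then show ?thesis by (simp add: abs_mult)
    qed
    moreover have "1 * \<bar>sin (2 * pi * (x - x'))\<bar> \<le> \<bar>real_of_int n\<bar> * \<bar>sin (2 * pi * (x - x'))\<bar>"
      using False by (intro mult_right_mono) (simp_all flip: of_int_abs)
    ultimately show ?thesis using c(2) by simp
  qed
  define R where "R = 2 * pi * L * norm z"
  have RL: "L * c \<le> R"
  proof -
    have "1 * (L * c) \<le> (2 * pi) * (L * norm z)"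
      using cz c L pi_gt3 by (intro mult_mono) auto
    then show ?thesis by (simp add: R_def mult_ac)
  qed
  have "ch k (f_std L (x + \<omega>), f_std L (x' + \<omega>)) = cis (R * cos (2 * pi * \<omega> + Arg z))" for \<omega>
  proof -
    have "real_of_int m * cos (2 * pi * (x + \<omega>)) + real_of_int n * cos (2 * pi * (x' + \<omega>)) = Re (z * cis (2 * pi * \<omega>))"
      by (simp add: z_def distrib_left distrib_right cos_add algebra_simps)
    also have "z * cis (2 * pi * \<omega>) = of_real (norm z) * cis (2 * pi * \<omega> + Arg z)"
    proof -
      have "z = of_real (norm z) * cis (Arg z)" using rcis_cmod_Arg[of z] by (simp add: rcis_def)
      then have "z * cis (2 * pi * \<omega>) = of_real (norm z) * (cis (Arg z) * cis (2 * pi * \<omega>))"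
        by (metis mult.assoc)
      then show ?thesis by (simp add: cis_mult add.commute)
    qed
    finally have "real_of_int m * cos (2 * pi * (x + \<omega>)) + real_of_int n * cos (2 * pi * (x' + \<omega>)) = norm z * cos (2 * pi * \<omega> + Arg z)"
      by simp
    then have "2 * pi * L * (real_of_int m * cos (2 * pi * (x + \<omega>)) + real_of_int n * cos (2 * pi * (x' + \<omega>))) = R * cos (2 * pi * \<omega> + Arg z)"
      by (simp add: R_def mult.assoc)
    then show ?thesis by (simp add: ch_def k f_std_def distrib_left mult_ac)
  qed
  then have "norm (\<integral>\<omega>. ch k (f_std L (x + \<omega>), f_std L (x' + \<omega>)) \<partial>unif a b) =
      norm (\<integral>\<omega>. cis (R * cos (2 * pi * \<omega> + Arg z)) \<partial>unif a b)" by simp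
  also have "\<dots> \<le> 200 * R powr (-1/6) / (b - a)"
    using ab RL c by (intro van_der_Corput_cos) auto
  also have "\<dots> \<le> 200 * (L * c) powr (-1/6) / (b - a)"
    using ab RL c by (intro divide_right_mono mult_left_mono powr_mono2') auto
  finally show "norm (\<integral>\<omega>. ch k (f_std L (x + \<omega>), f_std L (x' + \<omega>)) \<partial>unif a b) \<le> 200 * (L * c) powr (-1/6) / (b - a)" .
qed (use B per in auto)

text \<open>A common translation of both first coordinates is indistinguishable from a translation
  of the noise.\<close>

lemma avg_Lipschitz_x:
  assumes [measurable]: "\<Phi> \<in> borel_measurable borel" and B: "\<And>s. \<bar>\<Phi> s\<bar> \<le> 1" and "0 < \<sigma>"
  shows "\<bar>avg L \<sigma> \<Phi> ((x + \<tau>, y), (x' + \<tau>, y')) - avg L \<sigma> \<Phi> ((x, y), (x', y'))\<bar> \<le> 2 * \<bar>\<tau>\<bar> / \<sigma>"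
proof -
  have "\<bar>(\<integral>\<omega>. \<Phi> (lift L (\<omega> + \<tau>) ((x, y), (x', y'))) \<partial>unif (-\<sigma>) \<sigma>) - (\<integral>\<omega>. \<Phi> (lift L \<omega> ((x, y), (x', y'))) \<partial>unif (-\<sigma>) \<sigma>)\<bar> \<le> 2 * \<bar>\<tau>\<bar> / \<sigma>"
    by (rule unif_shift) (use B assms(3) in auto)
  then show ?thesis by (simp add: avg_def add_ac)
qed

text \<open>After one step a common translation of the second coordinates has become a common
  translation of the first coordinates in the opposite direction, so the second average provides the
  Lipschitz bound.\<close>

lemma avg2_Lipschitz_y:
  assumes [measurable]: "\<Phi> \<in> borel_measurable borel" and B: "\<And>s. \<bar>\<Phi> s\<bar> \<le> 1" and s: "0 < \<sigma>"
  shows "\<bar>avg L \<sigma> (avg L \<sigma> \<Phi>) ((x, y + \<tau>), (x', y' + \<tau>)) - avg L \<sigma> (avg L \<sigma> \<Phi>) ((x, y), (x', y'))\<bar> \<le> 2 * \<bar>\<tau>\<bar> / \<sigma>"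
proof -
  interpret N: prob_space "unif (-\<sigma>) \<sigma>" using s by (intro prob_space_unif) simp
  let ?P = "avg L \<sigma> \<Phi>"
  have [measurable]: "?P \<in> borel_measurable borel" using s by measurable
  have PB: "\<bar>?P s\<bar> \<le> 1" for s by (rule avg_bounded[OF assms(1) s B])
  have i: "integrable (unif (-\<sigma>) \<sigma>) (\<lambda>\<omega>. ?P (lift L \<omega> s))" for s
    by (rule integrable_avg[OF _ s PB]) measurable
  have 1: "avg L \<sigma> ?P ((x, y + \<tau>), (x', y' + \<tau>)) - avg L \<sigma> ?P ((x, y), (x', y')) =
      (\<integral>\<omega>. ?P (lift L \<omega> ((x, y + \<tau>), (x', y' + \<tau>))) - ?P (lift L \<omega> ((x, y), (x', y'))) \<partial>unif (-\<sigma>) \<sigma>)"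
    unfolding avg_def[of L \<sigma> ?P] by (rule Bochner_Integration.integral_diff[OF i i, symmetric])
  have 2: "(\<integral>\<omega>. \<bar>?P (lift L \<omega> ((x, y + \<tau>), (x', y' + \<tau>))) - ?P (lift L \<omega> ((x, y), (x', y')))\<bar> \<partial>unif (-\<sigma>) \<sigma>) \<le> 2 * \<bar>\<tau>\<bar> / \<sigma>"
  proof (rule N.integral_le_const)
    show "integrable (unif (-\<sigma>) \<sigma>) (\<lambda>\<omega>. \<bar>?P (lift L \<omega> ((x, y + \<tau>), (x', y' + \<tau>))) - ?P (lift L \<omega> ((x, y), (x', y')))\<bar>)"
      by (rule integrable_abs[OF Bochner_Integration.integrable_diff[OF i i]])
    have "\<bar>?P (lift L \<omega> ((x, y + \<tau>), (x', y' + \<tau>))) - ?P (lift L \<omega> ((x, y), (x', y')))\<bar> \<le> 2 * \<bar>\<tau>\<bar> / \<sigma>" for \<omega>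
      using avg_Lipschitz_x[OF assms(1) B s, of L "f_std L (x + \<omega>) - y" "- \<tau>" "x + \<omega>" "f_std L (x' + \<omega>) - y'" "x' + \<omega>"]
      by (simp add: algebra_simps)
    then show "AE \<omega> in unif (-\<sigma>) \<sigma>. \<bar>?P (lift L \<omega> ((x, y + \<tau>), (x', y' + \<tau>))) - ?P (lift L \<omega> ((x, y), (x', y')))\<bar> \<le> 2 * \<bar>\<tau>\<bar> / \<sigma>" by simp
  qed
  show ?thesis unfolding 1 by (rule order_trans[OF integral_abs_bound 2])
qed

lemma AE_unif: "a < b \<Longrightarrow> AE x in unif a b. x \<in> {a..b}"
  unfolding unif_def by (rule AE_uniform_measureI) auto

lemma nn_integral_near_resonance:
  assumes "0 \<le> c"
  shows "(\<integral>\<^sup>+q. indicator {q. \<bar>sin (2 * pi * (fst q - snd q))\<bar> \<le> c} q \<partial>torus2) \<le> ennreal c"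
proof -
  have "(\<integral>\<^sup>+q. indicator {q. \<bar>sin (2 * pi * (fst q - snd q))\<bar> \<le> c} q \<partial>torus2) =
      (\<integral>\<^sup>+x'. \<integral>\<^sup>+x. indicator {q. \<bar>sin (2 * pi * (fst q - snd q))\<bar> \<le> c} (x, x') \<partial>circ \<partial>circ)"
    by (rule nn_integral_torus2) measurable
  also have "\<dots> = (\<integral>\<^sup>+x'. \<integral>\<^sup>+x. indicator {x. \<bar>sin (2 * pi * x + - (2 * pi * x'))\<bar> \<le> c} x \<partial>circ \<partial>circ)"
    by (intro nn_integral_cong) (simp add: indicator_def right_diff_distrib)
  also have "\<dots> \<le> (\<integral>\<^sup>+x'. ennreal c \<partial>circ)"
    by (intro nn_integral_mono nn_integral_sin_small assms)
  also have "\<dots> = ennreal c" by (simp add: prob_space.emeasure_space_1[OF prob_space_circ, simplified])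
  finally show ?thesis .
qed

text \<open>Splits off the set of pairs of first coordinates that are nearly equal or antipodal, on which
  the amplitude of the phases degenerates.\<close>

lemma nn_integral_slices:
  fixes H :: "pair_state \<Rightarrow> real"
  assumes [measurable]: "H \<in> borel_measurable borel" and HB: "\<And>s. \<bar>H s\<bar> \<le> 2" and c: "0 \<le> c" and "0 \<le> e"
    and sl: "\<And>x x'. c < \<bar>sin (2 * pi * (x - x'))\<bar> \<Longrightarrow> (\<integral>p. \<bar>H ((x, fst p), (x', snd p))\<bar> \<partial>torus2) \<le> e"
  shows "(\<integral>\<^sup>+s. ennreal \<bar>H s\<bar> \<partial>torus4) \<le> ennreal (2 * c + e)"
proof -
  let ?S = "{q. \<bar>sin (2 * pi * (fst q - snd q))\<bar> \<le> c} :: (real \<times> real) set"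
  have i: "integrable torus2 (\<lambda>p. \<bar>H ((x, fst p), (x', snd p))\<bar>)" for x x'
    by (rule integrable_torus2_bounded[where B = 2]) (use HB in auto)
  have "(\<integral>\<^sup>+s. ennreal \<bar>H s\<bar> \<partial>torus4) =
      (\<integral>\<^sup>+q. \<integral>\<^sup>+p. ennreal \<bar>H ((fst q, fst p), (snd q, snd p))\<bar> \<partial>torus2 \<partial>torus2)"
    by (rule nn_integral_torus4_xy) measurable
  also have "\<dots> \<le> (\<integral>\<^sup>+q. 2 * indicator ?S q + ennreal e \<partial>torus2)"
  proof (rule nn_integral_mono)
    fix q :: "real \<times> real"
    have "(\<integral>\<^sup>+p. ennreal \<bar>H ((fst q, fst p), (snd q, snd p))\<bar> \<partial>torus2) =
        ennreal (\<integral>p. \<bar>H ((fst q, fst p), (snd q, snd p))\<bar> \<partial>torus2)"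
      by (intro nn_integral_eq_integral i) auto
    also have "\<dots> \<le> 2 * indicator ?S q + ennreal e"
    proof (cases "q \<in> ?S")
      case True
      have "(\<integral>p. \<bar>H ((fst q, fst p), (snd q, snd p))\<bar> \<partial>torus2) \<le> 2"
        using HB by (intro prob_space.integral_le_const[OF prob_space_torus2] i) auto
      then have "ennreal (\<integral>p. \<bar>H ((fst q, fst p), (snd q, snd p))\<bar> \<partial>torus2) \<le> ennreal 2" by (rule ennreal_leI)
      with True show ?thesis by (simp add: add_increasing2)
    next
      case False
      then show ?thesis using sl[of "fst q" "snd q"] by (simp add: ennreal_leI)
    qed
    finally show "(\<integral>\<^sup>+p. ennreal \<bar>H ((fst q, fst p), (snd q, snd p))\<bar> \<partial>torus2) \<le> 2 * indicator ?S q + ennreal e" .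
  qed
  also have "\<dots> = 2 * (\<integral>\<^sup>+q. indicator ?S q \<partial>torus2) + ennreal e"
  proof -
    have [measurable]: "?S \<in> sets borel" by measurable
    show ?thesis
      by (subst nn_integral_add) (auto simp: nn_integral_cmult prob_space.emeasure_space_1[OF prob_space_torus2, simplified])
  qed
  also have "\<dots> \<le> 2 * ennreal c + ennreal e"
    by (intro add_mono mult_left_mono nn_integral_near_resonance c) auto
  also have "\<dots> = ennreal (2 * c + e)" using c \<open>0 \<le> e\<close> by (simp add: ennreal_mult ennreal_plus)
  finally show ?thesis .
qed

text \<open>Two averages give the Lipschitz bound in the second coordinates. A third one brings the
  function close, in the mean, to a function \<open>W\<close> of the first coordinates only. A
  fourth one evaluates \<open>W\<close> along the equidistributed curve and leaves a
  constant.\<close>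

lemma L1_mixing:
  assumes [measurable]: "\<Phi> \<in> borel_measurable borel" and B: "\<And>s. \<bar>\<Phi> s\<bar> \<le> 1" and per: "per4 \<Phi>"
    and s: "0 < \<sigma>" "\<sigma> \<le> 1" and L: "1 \<le> L"
  shows "(\<integral>\<^sup>+s. ennreal \<bar>(avg L \<sigma> ^^ 4) \<Phi> s - (\<integral>s. \<Phi> s \<partial>torus4)\<bar> \<partial>torus4) \<le> ennreal (1300 / \<sigma> * L powr (-1/24))"
proof -
  interpret T2: prob_space torus2 by simp
  interpret T4: prob_space torus4 by simp
  define \<Psi> where "\<Psi> = avg L \<sigma> (avg L \<sigma> \<Phi>)"
  have [measurable]: "avg L \<sigma> \<Phi> \<in> borel_measurable borel" using s(1) by measurable
  have [measurable]: "\<Psi> \<in> borel_measurable borel" unfolding \<Psi>_def using s(1) by measurable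
  have PhB: "\<bar>avg L \<sigma> \<Phi> s\<bar> \<le> 1" for s by (rule avg_bounded[OF assms(1) s(1) B])
  have PsB: "\<bar>\<Psi> s\<bar> \<le> 1" for s unfolding \<Psi>_def by (rule avg_bounded[OF _ s(1) PhB]) measurable
  have perPs: "per4 \<Psi>" unfolding \<Psi>_def by (intro per4_avg per)
  define P3 where "P3 = avg L \<sigma> \<Psi>"
  have [measurable]: "P3 \<in> borel_measurable borel" unfolding P3_def using s(1) by measurable
  have P3B: "\<bar>P3 s\<bar> \<le> 1" for s unfolding P3_def by (rule avg_bounded[OF _ s(1) PsB]) measurable
  have perP3: "per4 P3" unfolding P3_def by (intro per4_avg perPs)
  \<comment> \<open>The cosine amplitude is at least \<open>L powr (1/2)\<close>, so the oscillatory
    bound is \<open>L powr (-1/12) = \<eta> * \<eta>\<close> divided by the length of the noise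
    piece. With about \<open>1 / \<eta>\<close> pieces, this quotient and the Lipschitz error on a
    piece are both of order \<open>\<eta> / \<sigma>\<close>.\<close>
  define \<eta> where "\<eta> = L powr (-1/24)"
  have eta: "0 < \<eta>" "\<eta> \<le> 1" using L powr_mono[of "-1/24" 0 L] by (simp_all add: \<eta>_def)
  define n where "n = nat \<lceil>1 / \<eta>\<rceil>"
  have n: "1 / \<eta> \<le> real n" "real n \<le> 2 / \<eta>" "0 < n"
  proof -
    have "1 \<le> 1 / \<eta>" using eta by simp
    then show "1 / \<eta> \<le> real n" "0 < n" unfolding n_def by linarith+
    have "real n \<le> 1 / \<eta> + 1" using eta unfolding n_def by (simp add: of_nat_ceiling)
    with \<open>1 \<le> 1 / \<eta>\<close> have "real n \<le> 1 / \<eta> + 1 / \<eta>" by linarith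
    then show "real n \<le> 2 / \<eta>" by simp
  qed
  define l where "l = 2 * \<sigma> / real n"
  have l: "0 < l" "l \<le> 2" "real n * l = 2 * \<sigma>"
  proof -
    show "0 < l" "real n * l = 2 * \<sigma>" using s n by (simp_all add: l_def)
    have "2 * \<sigma> / real n \<le> 2 / 1" using s n(3) by (intro frac_le) auto
    then show "l \<le> 2" by (simp add: l_def)
  qed
  define t where "t j = - \<sigma> + real j * l" for j
  \<comment> \<open>On the piece starting at \<open>t j\<close> the new second coordinates are
    frozen at their value for the left end point, and the new first coordinates are replaced by
    independent uniform ones.\<close>
  define W where "W q = (\<Sum>j<n. \<integral>p. \<Psi> ((fst p, fst q + t j), (snd p, snd q + t j)) \<partial>torus2) / real n" for q
  have [measurable]: "W \<in> borel_measurable borel"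
  proof -
    have "(\<lambda>q. \<integral>p. \<Psi> ((fst p, fst q + t j), (snd p, snd q + t j)) \<partial>torus2) \<in> borel_measurable borel" for j
      by measurable
    then show ?thesis unfolding W_def by (intro borel_measurable_divide borel_measurable_sum) auto
  qed
  have WB: "\<bar>W q\<bar> \<le> 1" for q
  proof -
    have "\<bar>\<Sum>j<n. \<integral>p. \<Psi> ((fst p, fst q + t j), (snd p, snd q + t j)) \<partial>torus2\<bar> \<le> (\<Sum>j<n. 1)"
    proof (rule order_trans[OF sum_abs sum_mono])
      fix j
      show "\<bar>\<integral>p. \<Psi> ((fst p, fst q + t j), (snd p, snd q + t j)) \<partial>torus2\<bar> \<le> 1"
        using PsB by (intro order_trans[OF integral_abs_bound] T2.integral_le_const integrable_torus2_bounded[where B = 1]) auto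
    qed
    then show ?thesis using n(3) by (simp add: W_def field_simps)
  qed
  have perW: "per2 W"
  proof -
    have "\<Psi> ((a, b + 1 + u), w) = \<Psi> ((a, b + u), w)" "\<Psi> (w, (a, b + 1 + u)) = \<Psi> (w, (a, b + u))" for a b u w
    proof -
      have e: "b + 1 + u = (b + u) + 1" by simp
      show "\<Psi> ((a, b + 1 + u), w) = \<Psi> ((a, b + u), w)" "\<Psi> (w, (a, b + 1 + u)) = \<Psi> (w, (a, b + u))"
        using perPs unfolding e by (cases w; simp add: per4_def)+
    qed
    then show ?thesis by (simp add: per2_def W_def)
  qed
  \<comment> \<open>Threshold for resonant pairs: they have measure at most \<open>c\<close>, and
    outside of them the amplitude of the phase is at least
    \<open>L * c = L powr (1/2)\<close>.\<close>
  define c where "c = L powr (-1/2)"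
  have c: "0 < c" using L by (simp add: c_def)
  have Lc: "L * c = L powr (1/2)" using L powr_add[of L 1 "-1/2"] by (simp add: c_def)
  have Lc1: "1 \<le> L * c" unfolding Lc using L by (simp add: ge_one_powr_ge_zero)
  have Lc6: "(L * c) powr (-1/6) = \<eta> * \<eta>" unfolding Lc \<eta>_def using L by (simp add: powr_powr flip: powr_add)
  have c_eta: "c \<le> \<eta>" unfolding c_def \<eta>_def using L by (intro powr_mono) auto
  have e1: "(\<integral>p. \<bar>P3 ((x, fst p), (x', snd p)) - W (x, x')\<bar> \<partial>torus2) \<le> 204 / \<sigma> * \<eta>"
    if q: "c < \<bar>sin (2 * pi * (x - x'))\<bar>" for x x'
  proof -
    define G where "G j p = \<Psi> ((fst p, x + t j), (snd p, x' + t j))" for j and p :: "real \<times> real"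
    have [measurable]: "G j \<in> borel_measurable borel" for j unfolding G_def by measurable
    have GB: "\<bar>G j p\<bar> \<le> 1" for j p using PsB by (simp add: G_def)
    have perG: "per2 (G j)" for j using perPs by (simp add: per2_def per4_def G_def)
    let ?U = "\<lambda>j. unif (t j) (t j + l)"
    define E where "E j p = (\<integral>\<omega>. G j ((f_std L (x + \<omega>), f_std L (x' + \<omega>)) - p) \<partial>?U j)" for j p
    have U: "prob_space (?U j)" for j using l by (intro prob_space_unif) simp
    have [measurable]: "E j \<in> borel_measurable borel" for j
    proof -
      interpret prob_space "?U j" by (rule U)
      show ?thesis unfolding E_def by measurable
    qed
    have EB: "\<bar>E j p\<bar> \<le> 1" for j p
      unfolding E_def using GB l
      by (intro order_trans[OF integral_abs_bound] prob_space.integral_le_const[OF U] integrable_abs integrable_unif_bounded[where B = 1]) auto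
    have Eeq: "(\<integral>p. \<bar>E j p - (\<integral>p. G j p \<partial>torus2)\<bar> \<partial>torus2) \<le> 200 * (\<eta> * \<eta>) / l" for j
      using equidistribution_noise[of "t j" "t j + l" "G j" c x x' L] l GB perG c q Lc1 unfolding E_def Lc6 by simp
    have close: "\<bar>P3 ((x, fst p), (x', snd p)) - (\<Sum>j<n. E j p) / real n\<bar> \<le> 4 / real n" for p
    proof -
      let ?s = "((x, fst p), (x', snd p))"
      let ?g = "\<lambda>\<omega>. \<Psi> (lift L \<omega> ?s)"
      have "P3 ?s = (\<integral>\<omega>. ?g \<omega> \<partial>unif (-\<sigma>) (-\<sigma> + real n * l))"
        using l(3) by (simp add: P3_def avg_def)
      also have "\<dots> = (\<Sum>j<n. \<integral>\<omega>. ?g \<omega> \<partial>?U j) / real n"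
        unfolding t_def using PsB l n by (intro unif_partition) auto
      finally have P3e: "P3 ?s = (\<Sum>j<n. \<integral>\<omega>. ?g \<omega> \<partial>?U j) / real n" .
      have d: "\<bar>(\<integral>\<omega>. ?g \<omega> \<partial>?U j) - E j p\<bar> \<le> 4 / real n" for j
      proof -
        let ?h = "\<lambda>\<omega>. G j ((f_std L (x + \<omega>), f_std L (x' + \<omega>)) - p)"
        have i: "integrable (?U j) ?g" "integrable (?U j) ?h"
          by (rule integrable_unif_bounded[where B = 1]; simp add: l PsB GB)+
        have 1: "(\<integral>\<omega>. ?g \<omega> \<partial>?U j) - E j p = (\<integral>\<omega>. ?g \<omega> - ?h \<omega> \<partial>?U j)"
          unfolding E_def by (rule Bochner_Integration.integral_diff[OF i, symmetric])
        have 2: "(\<integral>\<omega>. \<bar>?g \<omega> - ?h \<omega>\<bar> \<partial>?U j) \<le> 4 / real n"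
        proof (rule prob_space.integral_le_const[OF U[of j]])
          show "integrable (?U j) (\<lambda>\<omega>. \<bar>?g \<omega> - ?h \<omega>\<bar>)" by (rule integrable_abs[OF Bochner_Integration.integrable_diff[OF i]])
          have "AE \<omega> in ?U j. \<omega> \<in> {t j..t j + l}" using l by (intro AE_unif) simp
          then show "AE \<omega> in ?U j. \<bar>?g \<omega> - ?h \<omega>\<bar> \<le> 4 / real n"
          proof eventually_elim
            case (elim \<omega>)
            let ?a = "f_std L (x + \<omega>) - fst p" and ?a' = "f_std L (x' + \<omega>) - snd p"
            have "\<bar>\<Psi> ((?a, (x + t j) + (\<omega> - t j)), (?a', (x' + t j) + (\<omega> - t j))) - \<Psi> ((?a, x + t j), (?a', x' + t j))\<bar> \<le> 2 * \<bar>\<omega> - t j\<bar> / \<sigma>"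
              unfolding \<Psi>_def by (rule avg2_Lipschitz_y[OF assms(1) B s(1)])
            also have "2 * \<bar>\<omega> - t j\<bar> / \<sigma> \<le> 2 * l / \<sigma>" using elim s by (intro divide_right_mono) auto
            also have "2 * l / \<sigma> = 4 / real n" using s by (simp add: l_def)
            finally show ?case by (simp add: G_def)
          qed
        qed
        show ?thesis unfolding 1 by (rule order_trans[OF integral_abs_bound 2])
      qed
      have 1: "P3 ?s - (\<Sum>j<n. E j p) / real n = (\<Sum>j<n. (\<integral>\<omega>. ?g \<omega> \<partial>?U j) - E j p) / real n"
        unfolding P3e by (simp add: sum_subtractf diff_divide_distrib)
      have "\<bar>(\<Sum>j<n. (\<integral>\<omega>. ?g \<omega> \<partial>?U j) - E j p) / real n\<bar> \<le> (\<Sum>j<n. 4 / real n) / real n"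
        unfolding abs_divide using d by (intro divide_mono order_trans[OF sum_abs sum_mono]) (use n in auto)
      also have "\<dots> = 4 / real n" using n by simp
      finally show ?thesis unfolding 1 .
    qed
    have iE: "integrable torus2 (\<lambda>p. \<bar>E j p - (\<integral>p. G j p \<partial>torus2)\<bar>)" for j
      by (rule integrable_abs, rule Bochner_Integration.integrable_diff, rule integrable_torus2_bounded[where B = 1])
         (simp_all add: EB)
    have "(\<integral>p. \<bar>P3 ((x, fst p), (x', snd p)) - W (x, x')\<bar> \<partial>torus2) \<le>
        (\<integral>p. 4 / real n + (\<Sum>j<n. \<bar>E j p - (\<integral>p. G j p \<partial>torus2)\<bar>) / real n \<partial>torus2)"
    proof (rule integral_mono)
      show "integrable torus2 (\<lambda>p. \<bar>P3 ((x, fst p), (x', snd p)) - W (x, x')\<bar>)"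
        by (rule integrable_abs, rule Bochner_Integration.integrable_diff, rule integrable_torus2_bounded[where B = 1])
           (simp_all add: P3B)
      show "integrable torus2 (\<lambda>p. 4 / real n + (\<Sum>j<n. \<bar>E j p - (\<integral>p. G j p \<partial>torus2)\<bar>) / real n)"
        using iE by auto
      fix p
      have 1: "(\<Sum>j<n. E j p) / real n - W (x, x') = (\<Sum>j<n. E j p - (\<integral>p. G j p \<partial>torus2)) / real n"
        by (simp add: W_def G_def sum_subtractf diff_divide_distrib)
      have "\<bar>(\<Sum>j<n. E j p - (\<integral>p. G j p \<partial>torus2)) / real n\<bar> \<le> (\<Sum>j<n. \<bar>E j p - (\<integral>p. G j p \<partial>torus2)\<bar>) / real n"
        unfolding abs_divide by (intro divide_mono sum_abs) (use n in \<open>auto intro!: sum_nonneg\<close>)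
      then show "\<bar>P3 ((x, fst p), (x', snd p)) - W (x, x')\<bar> \<le> 4 / real n + (\<Sum>j<n. \<bar>E j p - (\<integral>p. G j p \<partial>torus2)\<bar>) / real n"
        using close[of p] unfolding 1[symmetric] by linarith
    qed
    also have "\<dots> = 4 / real n + (\<Sum>j<n. (\<integral>p. \<bar>E j p - (\<integral>p. G j p \<partial>torus2)\<bar> \<partial>torus2)) / real n"
      using iE by (subst Bochner_Integration.integral_add) (auto simp: T2.prob_space[simplified])
    also have "\<dots> \<le> 4 / real n + (\<Sum>j<n. 200 * (\<eta> * \<eta>) / l) / real n"
      by (intro add_left_mono divide_right_mono sum_mono Eeq) auto
    also have "\<dots> = 4 / real n + 100 * (\<eta> * (\<eta> * real n)) / \<sigma>" using n s by (simp add: l_def)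
    also have "\<dots> \<le> 4 * \<eta> / \<sigma> + 100 * (\<eta> * 2) / \<sigma>"
    proof (intro add_mono divide_right_mono mult_left_mono)
      have "1 \<le> real n * \<eta>" using n(1) eta by (simp add: field_simps)
      then have "4 / real n \<le> 4 * \<eta>" using n(3) by (simp add: field_simps)
      also have "\<dots> \<le> 4 * \<eta> / \<sigma>" using s eta by (simp add: field_simps)
      finally show "4 / real n \<le> 4 * \<eta> / \<sigma>" .
      show "\<eta> * real n \<le> 2" using n(2) eta by (simp add: field_simps)
    qed (use eta s in auto)
    finally show ?thesis by (simp add: field_simps)
  qed
  have E1: "(\<integral>\<^sup>+s. ennreal \<bar>P3 s - W (fst (fst s), fst (snd s))\<bar> \<partial>torus4) \<le> ennreal (2 * c + 204 / \<sigma> * \<eta>)"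
  proof (rule nn_integral_slices)
    show "\<bar>P3 s - W (fst (fst s), fst (snd s))\<bar> \<le> 2" for s
      using P3B[of s] WB[of "(fst (fst s), fst (snd s))"] by (simp add: abs_le_iff)
    show "(\<integral>p. \<bar>P3 ((x, fst p), (x', snd p)) - W (fst (fst ((x, fst p), (x', snd p))), fst (snd ((x, fst p), (x', snd p))))\<bar> \<partial>torus2) \<le> 204 / \<sigma> * \<eta>"
      if "c < \<bar>sin (2 * pi * (x - x'))\<bar>" for x x' using e1[OF that] by simp
  qed (use c eta s in auto)
  define c0 where "c0 = (\<integral>q. W q \<partial>torus2)"
  define W4 where "W4 s = W (fst (fst s), fst (snd s))" for s :: pair_state
  have [measurable]: "W4 \<in> borel_measurable borel" unfolding W4_def by measurable
  have W4B: "\<bar>W4 s\<bar> \<le> 1" for s using WB by (simp add: W4_def)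
  have perW4: "per4 W4" using perW by (simp add: per4_def per2_def W4_def)
  have [measurable]: "avg L \<sigma> W4 \<in> borel_measurable borel" "avg L \<sigma> P3 \<in> borel_measurable borel"
    using s(1) by measurable
  have c0: "\<bar>c0\<bar> \<le> 1"
    unfolding c0_def using WB by (intro order_trans[OF integral_abs_bound] T2.integral_le_const integrable_abs integrable_torus2_bounded[where B = 1]) auto
  have aW4B: "\<bar>avg L \<sigma> W4 s\<bar> \<le> 1" for s by (rule avg_bounded[OF _ s(1) W4B]) measurable
  have E2: "(\<integral>\<^sup>+s. ennreal \<bar>avg L \<sigma> W4 s - c0\<bar> \<partial>torus4) \<le> ennreal (2 * c + 100 / \<sigma> * \<eta>)"
  proof (rule nn_integral_slices)
    show "\<bar>avg L \<sigma> W4 s - c0\<bar> \<le> 2" for s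
      using aW4B[of s] c0 by (simp add: abs_le_iff)
    show "(\<integral>p. \<bar>avg L \<sigma> W4 ((x, fst p), (x', snd p)) - c0\<bar> \<partial>torus2) \<le> 100 / \<sigma> * \<eta>"
      if "c < \<bar>sin (2 * pi * (x - x'))\<bar>" for x x'
    proof -
      have "(\<integral>p. \<bar>(\<integral>\<omega>. W ((f_std L (x + \<omega>), f_std L (x' + \<omega>)) - p) \<partial>unif (-\<sigma>) \<sigma>) - (\<integral>p. W p \<partial>torus2)\<bar> \<partial>torus2)
        \<le> 200 * (L * c) powr (-1/6) / (\<sigma> - - \<sigma>)"
        using that c s Lc1 WB perW by (intro equidistribution_noise) auto
      also have "\<dots> = (100 / \<sigma> * \<eta>) * \<eta>" unfolding Lc6 by simp
      also have "\<dots> \<le> (100 / \<sigma> * \<eta>) * 1" using eta s by (intro mult_left_mono) auto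
      \<comment> \<open>Since \<open>W4\<close> ignores the second coordinates, its average is
        exactly the translated curve integral, without freezing anything.\<close>
      finally show ?thesis by (simp add: avg_def W4_def c0_def minus_prod_def)
    qed
  qed (use c eta s in auto)
  define P4 where "P4 = avg L \<sigma> P3"
  have P4e: "(avg L \<sigma> ^^ 4) \<Phi> = P4" by (simp add: P4_def P3_def \<Psi>_def numeral_eq_Suc)
  have P4B: "\<bar>P4 s\<bar> \<le> 1" for s unfolding P4_def by (rule avg_bounded[OF _ s(1) P3B]) measurable
  have [measurable]: "P4 \<in> borel_measurable borel" by (simp add: P4_def)
  define e where "e = (2 * c + 204 / \<sigma> * \<eta>) + (2 * c + 100 / \<sigma> * \<eta>)"
  have e0: "0 \<le> e" using c eta s by (simp add: e_def)
  have main: "(\<integral>\<^sup>+s. ennreal \<bar>P4 s - c0\<bar> \<partial>torus4) \<le> ennreal e"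
  proof -
    have "(\<integral>\<^sup>+s. ennreal \<bar>P4 s - c0\<bar> \<partial>torus4) \<le>
        (\<integral>\<^sup>+s. navg L \<sigma> (\<lambda>s. ennreal \<bar>P3 s - W4 s\<bar>) s + ennreal \<bar>avg L \<sigma> W4 s - c0\<bar> \<partial>torus4)"
    proof (rule nn_integral_mono)
      fix s
      have i: "integrable (unif (-\<sigma>) \<sigma>) (\<lambda>\<omega>. P3 (lift L \<omega> s))" "integrable (unif (-\<sigma>) \<sigma>) (\<lambda>\<omega>. W4 (lift L \<omega> s))"
        by (rule integrable_avg[where B = 1]; simp add: s P3B W4B)+
      have "P4 s - avg L \<sigma> W4 s = (\<integral>\<omega>. P3 (lift L \<omega> s) - W4 (lift L \<omega> s) \<partial>unif (-\<sigma>) \<sigma>)"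
        unfolding P4_def avg_def by (rule Bochner_Integration.integral_diff[OF i, symmetric])
      then have "ennreal \<bar>P4 s - avg L \<sigma> W4 s\<bar> \<le> navg L \<sigma> (\<lambda>s. ennreal \<bar>P3 s - W4 s\<bar>) s"
        unfolding navg_def using integral_norm_bound_ennreal[OF Bochner_Integration.integrable_diff[OF i]] by simp
      moreover have "ennreal \<bar>P4 s - c0\<bar> \<le> ennreal \<bar>P4 s - avg L \<sigma> W4 s\<bar> + ennreal \<bar>avg L \<sigma> W4 s - c0\<bar>"
      proof -
        have "\<bar>P4 s - c0\<bar> \<le> \<bar>P4 s - avg L \<sigma> W4 s\<bar> + \<bar>avg L \<sigma> W4 s - c0\<bar>" by linarith
        then have "ennreal \<bar>P4 s - c0\<bar> \<le> ennreal (\<bar>P4 s - avg L \<sigma> W4 s\<bar> + \<bar>avg L \<sigma> W4 s - c0\<bar>)"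
          by (rule ennreal_leI)
        then show ?thesis by (simp add: ennreal_plus)
      qed
      ultimately show "ennreal \<bar>P4 s - c0\<bar> \<le> navg L \<sigma> (\<lambda>s. ennreal \<bar>P3 s - W4 s\<bar>) s + ennreal \<bar>avg L \<sigma> W4 s - c0\<bar>"
        by (meson add_right_mono order_trans)
    qed
    also have "\<dots> = (\<integral>\<^sup>+s. navg L \<sigma> (\<lambda>s. ennreal \<bar>P3 s - W4 s\<bar>) s \<partial>torus4) + (\<integral>\<^sup>+s. ennreal \<bar>avg L \<sigma> W4 s - c0\<bar> \<partial>torus4)"
      using s(1) by (intro nn_integral_add) measurable
    also have "(\<integral>\<^sup>+s. navg L \<sigma> (\<lambda>s. ennreal \<bar>P3 s - W4 s\<bar>) s \<partial>torus4) = (\<integral>\<^sup>+s. ennreal \<bar>P3 s - W4 s\<bar> \<partial>torus4)"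
      using perP3 perW4 by (intro nn_integral_navg s) (auto simp: per4_def)
    also have "\<dots> + (\<integral>\<^sup>+s. ennreal \<bar>avg L \<sigma> W4 s - c0\<bar> \<partial>torus4) \<le> ennreal (2 * c + 204 / \<sigma> * \<eta>) + ennreal (2 * c + 100 / \<sigma> * \<eta>)"
      using E1 by (intro add_mono E2) (simp add: W4_def)
    also have "\<dots> = ennreal e" unfolding e_def using c eta s by (intro ennreal_plus[symmetric]) auto
    finally show ?thesis .
  qed
  have mean: "(\<integral>s. P4 s \<partial>torus4) = (\<integral>s. \<Phi> s \<partial>torus4)"
  proof -
    have "(\<integral>s. P4 s \<partial>torus4) = (\<integral>s. P3 s \<partial>torus4)"
      unfolding P4_def by (rule integral_avg[OF _ s(1) P3B perP3]) measurable
    also have "\<dots> = (\<integral>s. \<Psi> s \<partial>torus4)"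
      unfolding P3_def by (rule integral_avg[OF _ s(1) PsB perPs]) measurable
    also have "\<dots> = (\<integral>s. avg L \<sigma> \<Phi> s \<partial>torus4)"
      unfolding \<Psi>_def by (rule integral_avg[OF _ s(1) PhB per4_avg[OF per]]) measurable
    also have "\<dots> = (\<integral>s. \<Phi> s \<partial>torus4)"
      by (rule integral_avg[OF assms(1) s(1) B per])
    finally show ?thesis .
  qed
  have iP4: "integrable torus4 P4" by (rule integrable_torus4_bounded[OF _ P4B]) measurable
  \<comment> \<open>\<open>c0\<close> is only an auxiliary constant. By invariance of the mean it
    differs from the mean of \<open>\<Phi>\<close> by at most the error already found, so replacing
    it doubles that error.\<close>
  have dc: "\<bar>(\<integral>s. \<Phi> s \<partial>torus4) - c0\<bar> \<le> e"
  proof -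
    have "(\<integral>s. \<Phi> s \<partial>torus4) - c0 = (\<integral>s. P4 s - c0 \<partial>torus4)"
      using iP4 mean by (simp add: T4.prob_space[simplified])
    then have "ennreal \<bar>(\<integral>s. \<Phi> s \<partial>torus4) - c0\<bar> \<le> (\<integral>\<^sup>+s. ennreal \<bar>P4 s - c0\<bar> \<partial>torus4)"
      using integral_norm_bound_ennreal[of torus4 "\<lambda>s. P4 s - c0"] iP4 by simp
    also note main
    finally show ?thesis using e0 by (simp add: ennreal_le_iff)
  qed
  have "(\<integral>\<^sup>+s. ennreal \<bar>P4 s - (\<integral>s. \<Phi> s \<partial>torus4)\<bar> \<partial>torus4) \<le> (\<integral>\<^sup>+s. ennreal \<bar>P4 s - c0\<bar> + ennreal e \<partial>torus4)"
  proof (rule nn_integral_mono)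
    fix s
    have "\<bar>P4 s - (\<integral>s. \<Phi> s \<partial>torus4)\<bar> \<le> \<bar>P4 s - c0\<bar> + e" using dc by linarith
    then have "ennreal \<bar>P4 s - (\<integral>s. \<Phi> s \<partial>torus4)\<bar> \<le> ennreal (\<bar>P4 s - c0\<bar> + e)" by (rule ennreal_leI)
    then show "ennreal \<bar>P4 s - (\<integral>s. \<Phi> s \<partial>torus4)\<bar> \<le> ennreal \<bar>P4 s - c0\<bar> + ennreal e" using e0 by simp
  qed
  also have "\<dots> = (\<integral>\<^sup>+s. ennreal \<bar>P4 s - c0\<bar> \<partial>torus4) + ennreal e"
    by (subst nn_integral_add) (auto simp: T4.emeasure_space_1[simplified])
  finally have f1: "(\<integral>\<^sup>+s. ennreal \<bar>P4 s - (\<integral>s. \<Phi> s \<partial>torus4)\<bar> \<partial>torus4) \<le> ennreal e + ennreal e"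
    by (rule order_trans) (rule add_right_mono[OF main])
  have f2: "ennreal e + ennreal e = ennreal (e + e)" by (rule ennreal_plus[OF e0 e0, symmetric])
  have f3: "ennreal (e + e) \<le> ennreal (1300 / \<sigma> * \<eta>)"
  proof (rule ennreal_leI)
    define X where "X = \<eta> / \<sigma>"
    have "\<eta> * \<sigma> \<le> \<eta> * 1" using s eta by (intro mult_left_mono) auto
    then have X: "\<eta> \<le> X" using s by (simp add: X_def pos_le_divide_eq)
    have "204 / \<sigma> * \<eta> = 204 * X" "100 / \<sigma> * \<eta> = 100 * X" "1300 / \<sigma> * \<eta> = 1300 * X"
      by (simp_all add: X_def)
    then show "e + e \<le> 1300 / \<sigma> * \<eta>" unfolding e_def using c_eta X eta by linarith
  qed
  show ?thesis unfolding P4e \<eta>_def[symmetric] by (rule order_trans[OF f1[unfolded f2] f3])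
qed

section \<open>Separation and smoothing\<close>

definition hx :: "pair_state \<Rightarrow> real"
  where "hx s = nd (fst (fst s) - fst (snd s))"

definition hy :: "pair_state \<Rightarrow> real"
  where "hy s = nd (snd (fst s) - snd (snd s))"

text \<open>The sup-distance on the torus. It is comparable to \<open>torus_dist\<close>, and a step
  acts in a simple way on its two ingredients.\<close>

definition sep :: "pair_state \<Rightarrow> real"
  where "sep s = max (hx s) (hy s)"

text \<open>Amplitude and phase produced by the sum-to-product formula for the difference of the two
  cosines; see \<open>f_std_diff\<close>.\<close>

definition amp :: "real \<Rightarrow> pair_state \<Rightarrow> real"
  where "amp L s = 2 * L * sin (pi * (fst (snd s) - fst (fst s)))"

definition phase :: "pair_state \<Rightarrow> real"
  where "phase s = pi * (fst (fst s) + fst (snd s))"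

lemma measurable_hx [measurable]: "hx \<in> borel_measurable borel"
  and measurable_hy [measurable]: "hy \<in> borel_measurable borel"
  unfolding hx_def hy_def by measurable

lemma measurable_sep [measurable]: "sep \<in> borel_measurable borel"
  unfolding sep_def by measurable

lemma f_std_diff:
  "f_std L (fst (fst s) + \<omega>) - f_std L (fst (snd s) + \<omega>) = amp L s * sin (2 * pi * \<omega> + phase s)"
proof -
  let ?a = "2 * pi * (fst (fst s) + \<omega>)" and ?b = "2 * pi * (fst (snd s) + \<omega>)"
  have 1: "cos ?a - cos ?b = 2 * sin ((?a + ?b) / 2) * sin ((?b - ?a) / 2)" by (rule cos_diff_cos)
  have "?a + ?b = 2 * (2 * pi * \<omega> + phase s)" by (simp add: phase_def algebra_simps)
  then have 2: "(?a + ?b) / 2 = 2 * pi * \<omega> + phase s" by simp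
  have "?b - ?a = 2 * (pi * (fst (snd s) - fst (fst s)))" by (simp add: algebra_simps)
  then have 3: "(?b - ?a) / 2 = pi * (fst (snd s) - fst (fst s))" by simp
  have "f_std L (fst (fst s) + \<omega>) - f_std L (fst (snd s) + \<omega>) = L * (cos ?a - cos ?b)"
    by (simp add: f_std_def right_diff_distrib)
  then show ?thesis unfolding 1 2 3 by (simp add: amp_def)
qed

text \<open>The new first coordinates contain the forcing, so it is the horizontal difference that
  becomes a sine of the noise minus the old vertical difference. The old horizontal difference
  passes to the vertical one, as \<open>hy_lift\<close> states.\<close>

lemma hx_lift: "hx (lift L \<omega> s) = nd (amp L s * sin (2 * pi * \<omega> + phase s) - (snd (fst s) - snd (snd s)))"
proof -
  have "fst (fst (lift L \<omega> s)) - fst (snd (lift L \<omega> s)) =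
     (f_std L (fst (fst s) + \<omega>) - f_std L (fst (snd s) + \<omega>)) - (snd (fst s) - snd (snd s))"
    by (simp add: lift_def)
  then show ?thesis unfolding hx_def f_std_diff by simp
qed

lemma hy_lift: "hy (lift L \<omega> s) = hx s"
  by (simp add: hx_def hy_def lift_def)

lemma amp_ge: "0 \<le> L \<Longrightarrow> 4 * L * hx s \<le> \<bar>amp L s\<bar>"
proof -
  assume "0 \<le> L"
  have "2 * hx s \<le> \<bar>sin (pi * (fst (snd s) - fst (fst s)))\<bar>"
    unfolding hx_def nd_minus_commute[of "fst (fst s)"] by (rule abs_sin_ge_nd)
  then have "2 * L * (2 * hx s) \<le> 2 * L * \<bar>sin (pi * (fst (snd s) - fst (fst s)))\<bar>"
    using \<open>0 \<le> L\<close> by (intro mult_left_mono) auto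
  then show ?thesis using \<open>0 \<le> L\<close> by (simp add: amp_def abs_mult)
qed

lemma amp_le: "0 \<le> L \<Longrightarrow> \<bar>amp L s\<bar> \<le> 7 * L * hx s"
proof -
  assume L: "0 \<le> L"
  have "\<bar>sin (pi * (fst (snd s) - fst (fst s)))\<bar> \<le> pi * hx s"
    unfolding hx_def nd_minus_commute[of "fst (fst s)"] by (rule abs_sin_le_nd)
  also have "\<dots> \<le> 3.5 * hx s" using pi_approx by (intro mult_right_mono) (auto simp: hx_def)
  finally have "2 * L * \<bar>sin (pi * (fst (snd s) - fst (fst s)))\<bar> \<le> 2 * L * (3.5 * hx s)"
    using L by (intro mult_left_mono) auto
  then show ?thesis using L by (simp add: amp_def abs_mult)
qed

lemma hx_nonneg [simp]: "0 \<le> hx s" and hy_nonneg [simp]: "0 \<le> hy s" and sep_nonneg [simp]: "0 \<le> sep s"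
  and hx_le_half: "hx s \<le> 1 / 2" and hy_le_half: "hy s \<le> 1 / 2"
  using nd_le_half by (auto simp: hx_def hy_def sep_def le_max_iff_disj)

text \<open>The inverse step stretches by at most order \<open>L\<close>: the old horizontal
  difference is the new vertical one, and the old vertical difference is recovered from the new
  horizontal one up to the amplitude, which is at most \<open>7 * L\<close> times the old horizontal
  difference. This holds for every noise and controls the growth of \<open>V\<close> on bad
  events.\<close>

lemma sep_le_sep_lift:
  assumes L: "1 \<le> L" shows "sep s \<le> 8 * L * sep (lift L \<omega> s)"
proof -
  let ?s = "lift L \<omega> s"
  have 1: "hx s \<le> sep ?s" by (simp add: sep_def hy_lift)
  have "hy s = nd (amp L s * sin (2 * pi * \<omega> + phase s) + - (amp L s * sin (2 * pi * \<omega> + phase s) - (snd (fst s) - snd (snd s))))"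
    by (simp add: hy_def)
  also have "\<dots> \<le> nd (amp L s * sin (2 * pi * \<omega> + phase s)) + nd (- (amp L s * sin (2 * pi * \<omega> + phase s) - (snd (fst s) - snd (snd s))))"
    by (rule nd_triangle)
  also have "nd (- (amp L s * sin (2 * pi * \<omega> + phase s) - (snd (fst s) - snd (snd s)))) = hx ?s"
    unfolding nd_minus hx_lift ..
  also have "nd (amp L s * sin (2 * pi * \<omega> + phase s)) \<le> \<bar>amp L s\<bar> * \<bar>sin (2 * pi * \<omega> + phase s)\<bar>"
    using nd_le_abs[of "amp L s * sin (2 * pi * \<omega> + phase s)"] by (simp add: abs_mult)
  also have "\<dots> \<le> \<bar>amp L s\<bar> * 1" by (intro mult_left_mono) auto
  also have "\<bar>amp L s\<bar> * 1 \<le> 7 * L * sep ?s"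
  proof -
    have "7 * L * hx s \<le> 7 * L * sep ?s" using L by (intro mult_left_mono 1) auto
    from order_trans[OF amp_le this] L show ?thesis by simp
  qed
  finally have "hy s \<le> 7 * L * sep ?s + hx ?s" by simp
  moreover have "hx ?s \<le> 1 * sep ?s" by (simp add: sep_def)
  moreover have "1 * sep ?s \<le> L * sep ?s" using L by (intro mult_right_mono) auto
  ultimately have 2: "hy s \<le> 8 * L * sep ?s" by simp
  have "1 * sep ?s \<le> 8 * L * sep ?s" using L by (intro mult_right_mono) auto
  with 1 have "hx s \<le> 8 * L * sep ?s" by simp
  with 2 show ?thesis by (simp add: sep_def)
qed

lemma per1_sin: "sin (2 * pi * (u + 1) + \<theta>) = sin (2 * pi * u + \<theta>)" "cos (2 * pi * (u + 1) + \<theta>) = cos (2 * pi * u + \<theta>)"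
  using sin_periodic[of "2 * pi * u + \<theta>"] cos_periodic[of "2 * pi * u + \<theta>"] by (simp_all add: algebra_simps)

section \<open>Probability that a step leaves the horizontal difference small\<close>

lemma noise_emeasure_le:
  assumes s: "0 < \<sigma>" "\<sigma> \<le> 1" and [measurable]: "S \<in> sets borel" and per: "per1 (\<lambda>u. u \<in> S)"
    and c: "(\<integral>\<^sup>+u. indicator S u \<partial>circ) \<le> ennreal c" "0 \<le> c"
  shows "measure (unif (-\<sigma>) \<sigma>) S \<le> c / \<sigma>"
proof -
  interpret prob_space "unif (-\<sigma>) \<sigma>" using s by (intro prob_space_unif) simp
  have "ennreal (measure (unif (-\<sigma>) \<sigma>) S) = (\<integral>\<^sup>+u. indicator S u \<partial>unif (-\<sigma>) \<sigma>)"
    by (subst nn_integral_indicator) (auto simp: emeasure_eq_measure)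
  also have "\<dots> \<le> ennreal (1 / \<sigma>) * (\<integral>\<^sup>+u. indicator S u \<partial>circ)"
    using per by (intro nn_integral_noise_le s) (auto simp: per1_def indicator_def)
  also have "\<dots> \<le> ennreal (1 / \<sigma>) * ennreal c" by (intro mult_left_mono c) auto
  also have "\<dots> = ennreal (c / \<sigma>)" using s c by (subst ennreal_mult[symmetric]) auto
  finally show ?thesis using s c by (simp add: ennreal_le_iff)
qed

lemma hx_lift_small_prob:
  assumes s: "0 < \<sigma>" "\<sigma> \<le> 1" and e: "0 < \<epsilon>"
  shows "measure (unif (-\<sigma>) \<sigma>) {\<omega>. hx (lift L \<omega> s) < \<epsilon> * min 1 \<bar>amp L s\<bar>} \<le> 5 * sqrt \<epsilon> / \<sigma>"
proof (rule noise_emeasure_le[OF s])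
  show "{\<omega>. hx (lift L \<omega> s) < \<epsilon> * min 1 \<bar>amp L s\<bar>} \<in> sets borel" by measurable
  show "per1 (\<lambda>u. u \<in> {\<omega>. hx (lift L \<omega> s) < \<epsilon> * min 1 \<bar>amp L s\<bar>})"
    unfolding hx_lift per1_def mem_Collect_eq per1_sin by simp
  show "(\<integral>\<^sup>+u. indicator {\<omega>. hx (lift L \<omega> s) < \<epsilon> * min 1 \<bar>amp L s\<bar>} u \<partial>circ) \<le> ennreal (5 * sqrt \<epsilon>)"
    unfolding hx_lift by (rule nn_integral_nd_small[OF e])
qed (use e in simp)

lemma hx_lift_small_prob_hx:
  assumes s: "0 < \<sigma>" "\<sigma> \<le> 1" and e: "0 < \<epsilon>" and L: "1 \<le> L"
  shows "measure (unif (-\<sigma>) \<sigma>) {\<omega>. hx (lift L \<omega> s) < \<epsilon> * min 1 (L * hx s)} \<le> 5 * sqrt \<epsilon> / \<sigma>"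
proof -
  interpret prob_space "unif (-\<sigma>) \<sigma>" using s by (intro prob_space_unif) simp
  have "0 \<le> L * hx s" using L by simp
  then have "L * hx s \<le> \<bar>amp L s\<bar>" using amp_ge[of L s] L by simp
  then have "\<epsilon> * min 1 (L * hx s) \<le> \<epsilon> * min 1 \<bar>amp L s\<bar>" using e by (intro mult_left_mono) auto
  then have "{\<omega>. hx (lift L \<omega> s) < \<epsilon> * min 1 (L * hx s)} \<subseteq> {\<omega>. hx (lift L \<omega> s) < \<epsilon> * min 1 \<bar>amp L s\<bar>}"
    by auto
  then have "measure (unif (-\<sigma>) \<sigma>) {\<omega>. hx (lift L \<omega> s) < \<epsilon> * min 1 (L * hx s)} \<le>
      measure (unif (-\<sigma>) \<sigma>) {\<omega>. hx (lift L \<omega> s) < \<epsilon> * min 1 \<bar>amp L s\<bar>}"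
    by (intro finite_measure_mono) auto
  also have "\<dots> \<le> 5 * sqrt \<epsilon> / \<sigma>" by (rule hx_lift_small_prob[OF s e])
  finally show ?thesis .
qed

text \<open>Needed for pairs whose horizontal difference may vanish. If the amplitude is less than
  half of the vertical difference, no noise can cancel the latter and it simply becomes horizontal.
  Otherwise the amplitude is itself of the order of \<open>sep s\<close>, and the general estimate
  applies.\<close>

lemma hx_lift_small_prob_sep:
  assumes s: "0 < \<sigma>" "\<sigma> \<le> 1" and e: "0 < \<epsilon>" "\<epsilon> \<le> 1" and L: "1 \<le> L"
  shows "measure (unif (-\<sigma>) \<sigma>) {\<omega>. hx (lift L \<omega> s) < \<epsilon> / 2 * sep s} \<le> 5 * sqrt \<epsilon> / \<sigma>"
proof -
  interpret prob_space "unif (-\<sigma>) \<sigma>" using s by (intro prob_space_unif) simp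
  have "{\<omega>. hx (lift L \<omega> s) < \<epsilon> / 2 * sep s} \<subseteq> {\<omega>. hx (lift L \<omega> s) < \<epsilon> * min 1 \<bar>amp L s\<bar>}"
  proof (cases "\<bar>amp L s\<bar> < hy s / 2")
    case True
    have x0: "hx s \<le> \<bar>amp L s\<bar>"
    proof -
      have "1 * hx s \<le> 4 * L * hx s" using L by (intro mult_right_mono) auto
      then show ?thesis using amp_ge[of L s] L by simp
    qed
    have "\<epsilon> / 2 * sep s \<le> hx (lift L \<omega> s)" for \<omega>
    proof -
      let ?g = "amp L s * sin (2 * pi * \<omega> + phase s)" and ?h = "snd (fst s) - snd (snd s)"
      have "nd (?g + - (?g - ?h)) \<le> nd ?g + nd (- (?g - ?h))" by (rule nd_triangle)
      then have "hy s \<le> nd ?g + hx (lift L \<omega> s)" unfolding nd_minus hx_lift hy_def by simp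
      moreover have "nd ?g \<le> \<bar>amp L s\<bar> * \<bar>sin (2 * pi * \<omega> + phase s)\<bar>"
        using nd_le_abs[of ?g] by (simp add: abs_mult)
      moreover have "\<bar>amp L s\<bar> * \<bar>sin (2 * pi * \<omega> + phase s)\<bar> \<le> \<bar>amp L s\<bar> * 1" by (intro mult_left_mono) auto
      ultimately have 1: "hy s / 2 \<le> hx (lift L \<omega> s)" using True by simp
      have "sep s \<le> hy s" using True x0 hy_nonneg[of s] by (simp add: sep_def)
      then have "\<epsilon> * sep s \<le> 1 * hy s" using e by (intro mult_mono) auto
      with 1 show ?thesis by simp
    qed
    then have "{\<omega>. hx (lift L \<omega> s) < \<epsilon> / 2 * sep s} = {}" by (auto simp: not_less)
    then show ?thesis by simp
  next
    case False
    have "hx s \<le> min 1 \<bar>amp L s\<bar>"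
    proof -
      have "1 * hx s \<le> 4 * L * hx s" using L by (intro mult_right_mono) auto
      then show ?thesis using amp_ge[of L s] L hx_le_half[of s] by simp
    qed
    moreover have "hy s / 2 \<le> min 1 \<bar>amp L s\<bar>" using False hy_le_half[of s] by simp
    moreover from calculation have "hx s / 2 \<le> min 1 \<bar>amp L s\<bar>" using hx_nonneg[of s] by linarith
    ultimately have "sep s / 2 \<le> min 1 \<bar>amp L s\<bar>" by (simp add: sep_def max_def)
    then have "\<epsilon> * (sep s / 2) \<le> \<epsilon> * min 1 \<bar>amp L s\<bar>" using e by (intro mult_left_mono) auto
    then show ?thesis by auto
  qed
  then have "measure (unif (-\<sigma>) \<sigma>) {\<omega>. hx (lift L \<omega> s) < \<epsilon> / 2 * sep s} \<le>
      measure (unif (-\<sigma>) \<sigma>) {\<omega>. hx (lift L \<omega> s) < \<epsilon> * min 1 \<bar>amp L s\<bar>}"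
    by (intro finite_measure_mono) auto
  also have "\<dots> \<le> 5 * sqrt \<epsilon> / \<sigma>" by (rule hx_lift_small_prob[OF s e(1)])
  finally show ?thesis .
qed

text \<open>Average over the next step when the noisy first coordinate is replaced by a uniform
  \<open>v\<close>. The state is described by the second coordinate \<open>u\<close> of the first
  point, the vertical difference \<open>h\<close> and the horizontal difference \<open>k\<close>. In
  \<open>dens2\<close> the same replacement is made one step earlier, which makes \<open>v\<close>
  play the role of \<open>u\<close> and turns \<open>k\<close> into the vertical difference.\<close>

definition dens1 :: "real \<Rightarrow> (pair_state \<Rightarrow> ennreal) \<Rightarrow> real \<Rightarrow> real \<Rightarrow> real \<Rightarrow> ennreal"
  where "dens1 L \<Phi> u h k = (\<integral>\<^sup>+v. \<Phi> ((f_std L v - u, v), (f_std L (v - k) - u + h, v - k)) \<partial>circ)"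

definition dens2 :: "real \<Rightarrow> (pair_state \<Rightarrow> ennreal) \<Rightarrow> real \<Rightarrow> real \<Rightarrow> ennreal"
  where "dens2 L \<Phi> k h = (\<integral>\<^sup>+v. dens1 L \<Phi> v k (f_std L v - f_std L (v - k) - h) \<partial>circ)"

text \<open>Here the horizontal difference is uniform as well, as it nearly is after a push through
  the sine; \<open>k\<close> is the horizontal difference before that push and hence the vertical
  one after it.\<close>

definition dens3 :: "real \<Rightarrow> (pair_state \<Rightarrow> ennreal) \<Rightarrow> real \<Rightarrow> ennreal"
  where "dens3 L \<Phi> k = (\<integral>\<^sup>+b. dens2 L \<Phi> b k \<partial>circ)"

lemma sigma_finite_circ [simp]: "sigma_finite_measure circ"
  by (rule prob_space_imp_sigma_finite) simp

lemma measurable_dens1 [measurable (raw)]: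
  assumes [measurable]: "\<Phi> \<in> borel_measurable borel" "a \<in> borel_measurable M" "b \<in> borel_measurable M" "c \<in> borel_measurable M"
  shows "(\<lambda>x. dens1 L \<Phi> (a x) (b x) (c x)) \<in> borel_measurable M"
proof -
  interpret sigma_finite_measure circ by simp
  show ?thesis unfolding dens1_def by measurable
qed

lemma measurable_dens2 [measurable (raw)]:
  assumes [measurable]: "\<Phi> \<in> borel_measurable borel" "a \<in> borel_measurable M" "b \<in> borel_measurable M"
  shows "(\<lambda>x. dens2 L \<Phi> (a x) (b x)) \<in> borel_measurable M"
proof -
  interpret sigma_finite_measure circ by simp
  show ?thesis unfolding dens2_def by measurable
qed

lemma measurable_dens3 [measurable (raw)]:
  assumes [measurable]: "\<Phi> \<in> borel_measurable borel" "a \<in> borel_measurable M"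
  shows "(\<lambda>x. dens3 L \<Phi> (a x)) \<in> borel_measurable M"
proof -
  interpret sigma_finite_measure circ by simp
  show ?thesis unfolding dens3_def by measurable
qed

lemma per4D:
  assumes "per4 \<Phi>"
  shows "\<Phi> ((a + 1, b), w) = \<Phi> ((a, b), w)" "\<Phi> ((a, b + 1), w) = \<Phi> ((a, b), w)"
    "\<Phi> (w, (a + 1, b)) = \<Phi> (w, (a, b))" "\<Phi> (w, (a, b + 1)) = \<Phi> (w, (a, b))"
    "\<Phi> ((a - 1, b), w) = \<Phi> ((a, b), w)" "\<Phi> ((a, b - 1), w) = \<Phi> ((a, b), w)"
    "\<Phi> (w, (a - 1, b)) = \<Phi> (w, (a, b))" "\<Phi> (w, (a, b - 1)) = \<Phi> (w, (a, b))"
proof -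
  have P: "\<Phi> ((a + 1, b), w) = \<Phi> ((a, b), w)" "\<Phi> ((a, b + 1), w) = \<Phi> ((a, b), w)"
    "\<Phi> (w, (a + 1, b)) = \<Phi> (w, (a, b))" "\<Phi> (w, (a, b + 1)) = \<Phi> (w, (a, b))" for a b w
    using assms unfolding per4_def by (cases w, simp)+
  show "\<Phi> ((a + 1, b), w) = \<Phi> ((a, b), w)" "\<Phi> ((a, b + 1), w) = \<Phi> ((a, b), w)"
    "\<Phi> (w, (a + 1, b)) = \<Phi> (w, (a, b))" "\<Phi> (w, (a, b + 1)) = \<Phi> (w, (a, b))" by (fact P)+
  show "\<Phi> ((a - 1, b), w) = \<Phi> ((a, b), w)" "\<Phi> ((a, b - 1), w) = \<Phi> ((a, b), w)"
    "\<Phi> (w, (a - 1, b)) = \<Phi> (w, (a, b))" "\<Phi> (w, (a, b - 1)) = \<Phi> (w, (a, b))"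
    using P(1)[of "a - 1" b w] P(2)[of a "b - 1" w] P(3)[of w "a - 1" b] P(4)[of w a "b - 1"] by simp_all
qed

lemma f_std_diff_1 [simp]: "f_std L (x - 1) = f_std L x"
  using f_std_add_1[of L "x - 1"] by simp

lemma dens1_per:
  assumes "per4 \<Phi>"
  shows "dens1 L \<Phi> (u + 1) h k = dens1 L \<Phi> u h k" "dens1 L \<Phi> u (h + 1) k = dens1 L \<Phi> u h k"
    "dens1 L \<Phi> u h (k + 1) = dens1 L \<Phi> u h k" "dens1 L \<Phi> u h (k - 1) = dens1 L \<Phi> u h k"
proof -
  have e: "a - (u + 1) = a - u - 1" "a - u - 1 + h = (a - u + h) - 1" "a - u + (h + 1) = (a - u + h) + 1"
    "v - (k + 1) = (v - k) - 1" "v - (k - 1) = (v - k) + 1" for a u h k v :: real by simp_all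
  show "dens1 L \<Phi> (u + 1) h k = dens1 L \<Phi> u h k" "dens1 L \<Phi> u (h + 1) k = dens1 L \<Phi> u h k"
    "dens1 L \<Phi> u h (k + 1) = dens1 L \<Phi> u h k" "dens1 L \<Phi> u h (k - 1) = dens1 L \<Phi> u h k"
    unfolding dens1_def e per4D[OF assms] f_std_diff_1 f_std_add_1 by (rule refl)+
qed

lemma dens2_per:
  assumes "per4 \<Phi>"
  shows "dens2 L \<Phi> (k + 1) h = dens2 L \<Phi> k h" "dens2 L \<Phi> k (h + 1) = dens2 L \<Phi> k h"
proof -
  have e: "a - (h + 1) = a - h - 1" "v - (k + 1) = (v - k) - 1" for a h v k :: real by simp_all
  show "dens2 L \<Phi> (k + 1) h = dens2 L \<Phi> k h" "dens2 L \<Phi> k (h + 1) = dens2 L \<Phi> k h"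
    unfolding dens2_def e dens1_per[OF assms] f_std_diff_1 by (rule refl)+
qed

lemma dens3_per: "per4 \<Phi> \<Longrightarrow> dens3 L \<Phi> (k + 1) = dens3 L \<Phi> k"
  by (simp add: dens3_def dens2_per)

lemma nn_integral_noise_shift_le:
  fixes F :: "real \<Rightarrow> ennreal"
  assumes [measurable]: "F \<in> borel_measurable borel" and per: "per1 F" and s: "0 < \<sigma>" "\<sigma> \<le> 1"
  shows "(\<integral>\<^sup>+w. F (x + w) \<partial>unif (-\<sigma>) \<sigma>) \<le> ennreal (1 / \<sigma>) * (\<integral>\<^sup>+v. F v \<partial>circ)"
proof -
  have p: "per1 (\<lambda>w. F (x + w))" using per by (simp add: per1_def flip: add.assoc)
  have "(\<integral>\<^sup>+w. F (x + w) \<partial>unif (-\<sigma>) \<sigma>) \<le> ennreal (1 / \<sigma>) * (\<integral>\<^sup>+v. F (x + v) \<partial>circ)"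
    by (rule nn_integral_noise_le[OF _ p s]) measurable
  also have "(\<integral>\<^sup>+v. F (x + v) \<partial>circ) = (\<integral>\<^sup>+v. F v \<partial>circ)" by (rule nn_integral_circ_shift[OF assms(1) per])
  finally show ?thesis .
qed

text \<open>The variable \<open>v = x + w\<close> ranges over a noise interval, and its law is at
  most \<open>1 / \<sigma>\<close> times the uniform one. The differences do not depend on the noise
  and enter as parameters.\<close>

lemma navg_le_dens1:
  assumes [measurable]: "\<Phi> \<in> borel_measurable borel" and per: "per4 \<Phi>" and s: "0 < \<sigma>" "\<sigma> \<le> 1"
  shows "navg L \<sigma> \<Phi> ((x, y), (x', y')) \<le> ennreal (1 / \<sigma>) * dens1 L \<Phi> y (y - y') (x - x')"
proof -
  let ?F = "\<lambda>v. \<Phi> ((f_std L v - y, v), (f_std L (v - (x - x')) - y + (y - y'), v - (x - x')))"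
  have e: "v + 1 - k = (v - k) + 1" for v k :: real by simp
  have p: "per1 ?F" unfolding per1_def e f_std_add_1 per4D[OF per] by simp
  have "navg L \<sigma> \<Phi> ((x, y), (x', y')) = (\<integral>\<^sup>+w. ?F (x + w) \<partial>unif (-\<sigma>) \<sigma>)"
    unfolding navg_def by (intro nn_integral_cong) (simp add: add.commute)
  also have "\<dots> \<le> ennreal (1 / \<sigma>) * (\<integral>\<^sup>+v. ?F v \<partial>circ)"
    by (rule nn_integral_noise_shift_le[OF _ p s]) measurable
  finally show ?thesis by (simp add: dens1_def)
qed

lemma navg2_le_dens2:
  assumes [measurable]: "\<Phi> \<in> borel_measurable borel" and per: "per4 \<Phi>" and s: "0 < \<sigma>" "\<sigma> \<le> 1"
  shows "navg L \<sigma> (navg L \<sigma> \<Phi>) ((x, y), (x', y')) \<le> ennreal (1 / \<sigma>\<^sup>2) * dens2 L \<Phi> (x - x') (y - y')"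
proof -
  let ?k = "x - x'"
  let ?F = "\<lambda>v. dens1 L \<Phi> v ?k (f_std L v - f_std L (v - ?k) - (y - y'))"
  have e: "v + 1 - k = (v - k) + 1" for v k :: real by simp
  have p: "per1 ?F" unfolding per1_def e f_std_add_1 dens1_per[OF per] by simp
  have "navg L \<sigma> (navg L \<sigma> \<Phi>) ((x, y), (x', y')) \<le> (\<integral>\<^sup>+w. ennreal (1 / \<sigma>) * ?F (x + w) \<partial>unif (-\<sigma>) \<sigma>)"
    unfolding navg_def[of L \<sigma> "navg L \<sigma> \<Phi>"]
  proof (rule nn_integral_mono)
    fix w
    have "navg L \<sigma> \<Phi> (lift L w ((x, y), (x', y'))) \<le>
        ennreal (1 / \<sigma>) * dens1 L \<Phi> (x + w) (x + w - (x' + w)) (f_std L (x + w) - y - (f_std L (x' + w) - y'))"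
      unfolding lift_simp by (rule navg_le_dens1[OF assms])
    then show "navg L \<sigma> \<Phi> (lift L w ((x, y), (x', y'))) \<le> ennreal (1 / \<sigma>) * ?F (x + w)"
      by (simp add: algebra_simps)
  qed
  also have "\<dots> = ennreal (1 / \<sigma>) * (\<integral>\<^sup>+w. ?F (x + w) \<partial>unif (-\<sigma>) \<sigma>)"
    by (rule nn_integral_cmult) measurable
  also have "\<dots> \<le> ennreal (1 / \<sigma>) * (ennreal (1 / \<sigma>) * (\<integral>\<^sup>+v. ?F v \<partial>circ))"
  proof -
    have m: "?F \<in> borel_measurable borel" by measurable
    show ?thesis by (intro mult_left_mono nn_integral_noise_shift_le[OF m p s]) simp
  qed
  also have "\<dots> = (ennreal (1 / \<sigma>) * ennreal (1 / \<sigma>)) * dens2 L \<Phi> (x - x') (y - y')"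
    by (simp add: dens2_def mult.assoc)
  also have "ennreal (1 / \<sigma>) * ennreal (1 / \<sigma>) = ennreal (1 / \<sigma>\<^sup>2)"
    using s by (subst ennreal_mult[symmetric]) (auto simp: power2_eq_square)
  finally show ?thesis .
qed

text \<open>Three kinds of noise: the exceptional set \<open>S\<close> and the set of small cosine,
  where \<open>\<Psi>\<close> is bounded by 1, and the rest, where the new horizontal difference has
  density at most \<open>2 / (\<sigma> * \<eta>)\<close> because the amplitude is at least 1. On the
  rest \<open>\<Psi>\<close> is only known through a function \<open>F\<close> of that difference,
  up to an error \<open>d\<close>.\<close>

lemma navg_push:
  fixes \<Psi> :: "pair_state \<Rightarrow> ennreal" and F :: "real \<Rightarrow> ennreal"
  assumes [measurable]: "\<Psi> \<in> borel_measurable borel" "F \<in> borel_measurable borel" and per: "per1 F"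
    and s: "0 < \<sigma>" "\<sigma> \<le> 1" and \<eta>: "0 < \<eta>" and A: "1 \<le> \<bar>amp L s\<bar>"
    and \<Psi>1: "\<And>s. \<Psi> s \<le> 1" and S: "S \<in> sets borel" "measure (unif (-\<sigma>) \<sigma>) S \<le> c" and c: "0 \<le> c" "0 \<le> d"
    and \<Psi>F: "\<And>\<omega>. \<omega> \<notin> S \<Longrightarrow> \<Psi> (lift L \<omega> s) \<le> ennreal d +
        F (amp L s * sin (2 * pi * \<omega> + phase s) - (snd (fst s) - snd (snd s)))"
  shows "navg L \<sigma> \<Psi> s \<le> ennreal (c + \<eta> / \<sigma> + d) + ennreal (2 / (\<sigma> * \<eta>)) * (\<integral>\<^sup>+b. F b \<partial>circ)"
proof -
  note [measurable] = S(1)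
  interpret N: prob_space "unif (-\<sigma>) \<sigma>" using s by (intro prob_space_unif) simp
  let ?h = "snd (fst s) - snd (snd s)" and ?A = "amp L s" and ?th = "phase s"
  let ?C = "{u. \<bar>cos (2 * pi * u + ?th)\<bar> \<le> \<eta>}" and ?G = "{u. \<eta> \<le> \<bar>cos (2 * pi * u + ?th)\<bar>}"
  have "navg L \<sigma> \<Psi> s \<le> (\<integral>\<^sup>+\<omega>. indicator S \<omega> + indicator ?C \<omega> + ennreal d +
      indicator ?G \<omega> * F (?A * sin (2 * pi * \<omega> + ?th) - ?h) \<partial>unif (-\<sigma>) \<sigma>)"
    unfolding navg_def
  proof (rule nn_integral_mono)
    fix \<omega>
    show "\<Psi> (lift L \<omega> s) \<le> indicator S \<omega> + indicator ?C \<omega> + ennreal d + indicator ?G \<omega> * F (?A * sin (2 * pi * \<omega> + ?th) - ?h)"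
    proof (cases "\<omega> \<in> S \<or> \<omega> \<in> ?C")
      case True
      then have "1 \<le> indicator S \<omega> + (indicator ?C \<omega> :: ennreal)" by (auto split: split_indicator)
      with \<Psi>1[of "lift L \<omega> s"] show ?thesis by (meson add_increasing2 order_trans zero_le)
    next
      case False
      then have "\<omega> \<in> ?G" by auto
      with False \<Psi>F[of \<omega>] show ?thesis by simp
    qed
  qed
  also have "\<dots> = emeasure (unif (-\<sigma>) \<sigma>) S + (\<integral>\<^sup>+\<omega>. indicator ?C \<omega> \<partial>unif (-\<sigma>) \<sigma>) + ennreal d +
      (\<integral>\<^sup>+\<omega>. indicator ?G \<omega> * F (?A * sin (2 * pi * \<omega> + ?th) - ?h) \<partial>unif (-\<sigma>) \<sigma>)"
    by (simp add: nn_integral_add N.emeasure_space_1[simplified])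
  also have "\<dots> \<le> ennreal c + ennreal (\<eta> / \<sigma>) + ennreal d + ennreal (2 / (\<sigma> * \<eta>)) * (\<integral>\<^sup>+b. F b \<partial>circ)"
  proof (intro add_mono)
    show "emeasure (unif (-\<sigma>) \<sigma>) S \<le> ennreal c"
      unfolding N.emeasure_eq_measure by (intro ennreal_leI S)
    have "(\<integral>\<^sup>+\<omega>. indicator ?C \<omega> \<partial>unif (-\<sigma>) \<sigma>) \<le> ennreal (1 / \<sigma>) * (\<integral>\<^sup>+\<omega>. indicator ?C \<omega> \<partial>circ)"
    proof (rule nn_integral_noise_le[OF _ _ s])
      show "per1 (indicator ?C :: real \<Rightarrow> ennreal)" unfolding per1_def indicator_def mem_Collect_eq per1_sin by simp
    qed measurable
    also have "\<dots> \<le> ennreal (1 / \<sigma>) * ennreal \<eta>"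
      using \<eta> by (intro mult_left_mono nn_integral_cos_small) auto
    also have "\<dots> = ennreal (\<eta> / \<sigma>)" using s \<eta> by (subst ennreal_mult[symmetric]) auto
    finally show "(\<integral>\<^sup>+\<omega>. indicator ?C \<omega> \<partial>unif (-\<sigma>) \<sigma>) \<le> ennreal (\<eta> / \<sigma>)" .
    have "(\<integral>\<^sup>+\<omega>. indicator ?G \<omega> * F (?A * sin (2 * pi * \<omega> + ?th) - ?h) \<partial>unif (-\<sigma>) \<sigma>) \<le>
        ennreal (1 / \<sigma>) * (\<integral>\<^sup>+\<omega>. indicator ?G \<omega> * F (?A * sin (2 * pi * \<omega> + ?th) - ?h) \<partial>circ)"
    proof (rule nn_integral_noise_le[OF _ _ s])
      show "per1 (\<lambda>\<omega>. indicator ?G \<omega> * F (?A * sin (2 * pi * \<omega> + ?th) - ?h))"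
        unfolding per1_def indicator_def mem_Collect_eq per1_sin by simp
    qed measurable
    also have "\<dots> \<le> ennreal (1 / \<sigma>) * (ennreal ((\<bar>?A\<bar> + 1) / (\<eta> * \<bar>?A\<bar>)) * (\<integral>\<^sup>+b. F b \<partial>circ))"
      using A \<eta> by (intro mult_left_mono nn_integral_push per) auto
    also have "\<dots> = ennreal (1 / \<sigma> * ((\<bar>?A\<bar> + 1) / (\<eta> * \<bar>?A\<bar>))) * (\<integral>\<^sup>+b. F b \<partial>circ)"
      using s \<eta> by (subst mult.assoc[symmetric], subst ennreal_mult[symmetric]) auto
    also have "\<dots> \<le> ennreal (2 / (\<sigma> * \<eta>)) * (\<integral>\<^sup>+b. F b \<partial>circ)"
    proof (intro mult_right_mono ennreal_leI)
      have "(\<bar>?A\<bar> + 1) / \<bar>?A\<bar> \<le> 2" using A by (simp add: field_simps)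
      then have "1 / (\<sigma> * \<eta>) * ((\<bar>?A\<bar> + 1) / \<bar>?A\<bar>) \<le> 1 / (\<sigma> * \<eta>) * 2" using s \<eta> by (intro mult_left_mono) auto
      then show "1 / \<sigma> * ((\<bar>?A\<bar> + 1) / (\<eta> * \<bar>?A\<bar>)) \<le> 2 / (\<sigma> * \<eta>)" by (simp add: mult_ac)
    qed simp
    finally show "(\<integral>\<^sup>+\<omega>. indicator ?G \<omega> * F (?A * sin (2 * pi * \<omega> + ?th) - ?h) \<partial>unif (-\<sigma>) \<sigma>) \<le> ennreal (2 / (\<sigma> * \<eta>)) * (\<integral>\<^sup>+b. F b \<partial>circ)" .
  qed simp
  also have "ennreal c + ennreal (\<eta> / \<sigma>) + ennreal d = ennreal (c + \<eta> / \<sigma> + d)"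
    using c s \<eta> by (simp add: ennreal_plus)
  finally show ?thesis .
qed

lemma navg_le_1:
  assumes "0 < \<sigma>" and "\<And>s. \<Phi> s \<le> 1" shows "navg L \<sigma> \<Phi> s \<le> 1"
proof -
  interpret N: prob_space "unif (-\<sigma>) \<sigma>" using assms by (intro prob_space_unif) simp
  have "navg L \<sigma> \<Phi> s \<le> (\<integral>\<^sup>+\<omega>. 1 \<partial>unif (-\<sigma>) \<sigma>)" unfolding navg_def by (intro nn_integral_mono assms)
  then show ?thesis by (simp add: N.emeasure_space_1[simplified])
qed

text \<open>Averaging also over \<open>k\<close> leaves four free circle variables. In each
  coordinate of \<open>\<Phi>\<close> one of them occurs with coefficient 1 or -1, so Fubini
  followed by a shift or reflection removes the other terms, one coordinate at a time.\<close>

lemma nn_integral_dens3: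
  assumes [measurable]: "\<Phi> \<in> borel_measurable borel" and per: "per4 \<Phi>"
  shows "(\<integral>\<^sup>+k. dens3 L \<Phi> k \<partial>circ) = (\<integral>\<^sup>+s. \<Phi> s \<partial>torus4)"
proof -
  interpret pair_sigma_finite circ circ by (rule pair_sigma_finite_circ)
  note cong = nn_integral_cong
  note swap = Fubini'
  have r1: "(\<integral>\<^sup>+k. dens1 L \<Phi> v b (c - k) \<partial>circ) = (\<integral>\<^sup>+k. dens1 L \<Phi> v b k \<partial>circ)" for v b c
    by (rule nn_integral_circ_reflect) (simp_all add: per1_def dens1_per per)
  have p: "per1 (\<lambda>b. \<Phi> (z, (b, k)))" "per1 (\<lambda>v. \<integral>\<^sup>+b. \<Phi> ((v, w), (b, k)) \<partial>circ)"
    "per1 (\<lambda>k. \<integral>\<^sup>+v. \<integral>\<^sup>+b. \<Phi> ((v, w), (b, k)) \<partial>circ \<partial>circ)" for z k w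
    by (simp_all add: per1_def per4D[OF per])
  have "(\<integral>\<^sup>+k. dens3 L \<Phi> k \<partial>circ) = (\<integral>\<^sup>+k. \<integral>\<^sup>+b. \<integral>\<^sup>+v. dens1 L \<Phi> v b (f_std L v - f_std L (v - b) - k) \<partial>circ \<partial>circ \<partial>circ)"
    by (simp add: dens3_def dens2_def)
  also have "\<dots> = (\<integral>\<^sup>+b. \<integral>\<^sup>+k. \<integral>\<^sup>+v. dens1 L \<Phi> v b (f_std L v - f_std L (v - b) - k) \<partial>circ \<partial>circ \<partial>circ)"
    by (rule swap) measurable
  also have "\<dots> = (\<integral>\<^sup>+b. \<integral>\<^sup>+v. \<integral>\<^sup>+k. dens1 L \<Phi> v b (f_std L v - f_std L (v - b) - k) \<partial>circ \<partial>circ \<partial>circ)"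
    by (rule cong, rule swap) measurable
  also have "\<dots> = (\<integral>\<^sup>+b. \<integral>\<^sup>+v. \<integral>\<^sup>+k. dens1 L \<Phi> v b k \<partial>circ \<partial>circ \<partial>circ)"
    by (simp only: r1)
  also have "\<dots> = (\<integral>\<^sup>+v. \<integral>\<^sup>+b. \<integral>\<^sup>+k. dens1 L \<Phi> v b k \<partial>circ \<partial>circ \<partial>circ)"
    by (rule swap) measurable
  also have "\<dots> = (\<integral>\<^sup>+v. \<integral>\<^sup>+k. \<integral>\<^sup>+b. dens1 L \<Phi> v b k \<partial>circ \<partial>circ \<partial>circ)"
    by (rule cong, rule swap) measurable
  also have "\<dots> = (\<integral>\<^sup>+v. \<integral>\<^sup>+k. \<integral>\<^sup>+w. \<integral>\<^sup>+b. \<Phi> ((f_std L w - v, w), (f_std L (w - k) - v + b, w - k)) \<partial>circ \<partial>circ \<partial>circ \<partial>circ)"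
    unfolding dens1_def by (rule cong, rule cong, rule swap) measurable
  also have "\<dots> = (\<integral>\<^sup>+v. \<integral>\<^sup>+k. \<integral>\<^sup>+w. \<integral>\<^sup>+b. \<Phi> ((f_std L w - v, w), (b, w - k)) \<partial>circ \<partial>circ \<partial>circ \<partial>circ)"
    by (intro cong nn_integral_circ_shift p) measurable
  also have "\<dots> = (\<integral>\<^sup>+k. \<integral>\<^sup>+v. \<integral>\<^sup>+w. \<integral>\<^sup>+b. \<Phi> ((f_std L w - v, w), (b, w - k)) \<partial>circ \<partial>circ \<partial>circ \<partial>circ)"
    by (rule swap) measurable
  also have "\<dots> = (\<integral>\<^sup>+k. \<integral>\<^sup>+w. \<integral>\<^sup>+v. \<integral>\<^sup>+b. \<Phi> ((f_std L w - v, w), (b, w - k)) \<partial>circ \<partial>circ \<partial>circ \<partial>circ)"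
    by (rule cong, rule swap) measurable
  also have "\<dots> = (\<integral>\<^sup>+k. \<integral>\<^sup>+w. \<integral>\<^sup>+v. \<integral>\<^sup>+b. \<Phi> ((v, w), (b, w - k)) \<partial>circ \<partial>circ \<partial>circ \<partial>circ)"
    by (rule cong, rule cong, rule nn_integral_circ_reflect[OF _ p(2)]) measurable
  also have "\<dots> = (\<integral>\<^sup>+w. \<integral>\<^sup>+k. \<integral>\<^sup>+v. \<integral>\<^sup>+b. \<Phi> ((v, w), (b, w - k)) \<partial>circ \<partial>circ \<partial>circ \<partial>circ)"
    by (rule swap) measurable
  also have "\<dots> = (\<integral>\<^sup>+w. \<integral>\<^sup>+k. \<integral>\<^sup>+v. \<integral>\<^sup>+b. \<Phi> ((v, w), (b, k)) \<partial>circ \<partial>circ \<partial>circ \<partial>circ)"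
    by (rule cong, rule nn_integral_circ_reflect[OF _ p(3)]) measurable
  also have "\<dots> = (\<integral>\<^sup>+w. \<integral>\<^sup>+v. \<integral>\<^sup>+k. \<integral>\<^sup>+b. \<Phi> ((v, w), (b, k)) \<partial>circ \<partial>circ \<partial>circ \<partial>circ)"
    by (rule cong, rule swap) measurable
  also have "\<dots> = (\<integral>\<^sup>+s. \<Phi> s \<partial>torus4)"
    by (simp add: nn_integral_torus4(1) nn_integral_torus2(2))
  finally show ?thesis .
qed

text \<open>After four steps the law has, up to a small mass, a density of order at most a small power of
  \<open>L\<close>: the equations for the noise have of the order of \<open>L\<close> solutions, each contributing of the
  order of \<open>1 / L\<close>.\<close>

lemma navg4_le:
  assumes [measurable]: "\<Phi> \<in> borel_measurable borel" and per: "per4 \<Phi>" and \<Phi>1: "\<And>s. \<Phi> s \<le> 1"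
    and s: "0 < \<sigma>" "\<sigma> \<le> 1" and \<eta>: "0 < \<eta>" and \<tau>: "0 < \<tau>" "1 \<le> 4 * L * \<tau>" "\<tau> \<le> hx s" and L: "0 \<le> L"
  shows "(navg L \<sigma> ^^ 4) \<Phi> s \<le> ennreal (5 * sqrt \<tau> / \<sigma> + 2 * \<eta> / \<sigma>) +
    ennreal (4 / (\<sigma> ^ 4 * \<eta>\<^sup>2)) * (\<integral>\<^sup>+s. \<Phi> s \<partial>torus4)"
proof -
  note [measurable] = measurable_navg[OF _ s(1)]
  let ?P = "navg L \<sigma>"
  have amp1: "1 \<le> \<bar>amp L s\<bar>" if "\<tau> \<le> hx s" for s
    using amp_ge[OF L, of s] mult_left_mono[OF that, of "4 * L"] L \<tau>(2) by simp
  have P1: "?P \<Phi> s \<le> 1" "?P (?P \<Phi>) s \<le> 1" "?P (?P (?P \<Phi>)) s \<le> 1" for s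
    by (intro navg_le_1 s(1) \<Phi>1)+
  \<comment> \<open>The last two of the three steps are replaced by \<open>dens2\<close>; the first
    one makes the horizontal difference uniform. What remains depends only on the horizontal
    difference before these steps.\<close>
  have 3: "?P (?P (?P \<Phi>)) s \<le> ennreal (\<eta> / \<sigma>) + ennreal (2 / (\<sigma> ^ 3 * \<eta>)) * dens3 L \<Phi> (fst (fst s) - fst (snd s))"
    if "\<tau> \<le> hx s" for s
  proof -
    let ?k = "fst (fst s) - fst (snd s)"
    have "?P (?P (?P \<Phi>)) s \<le> ennreal (0 + \<eta> / \<sigma> + 0) + ennreal (2 / (\<sigma> * \<eta>)) * (\<integral>\<^sup>+b. ennreal (1 / \<sigma>\<^sup>2) * dens2 L \<Phi> b ?k \<partial>circ)"
    proof (rule navg_push[where S = "{}"])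
      show "per1 (\<lambda>b. ennreal (1 / \<sigma>\<^sup>2) * dens2 L \<Phi> b ?k)" by (simp add: per1_def dens2_per[OF per])
      fix \<omega>
      obtain x1 y1 x1' y1' where l: "lift L \<omega> s = ((x1, y1), (x1', y1'))" by (metis surj_pair)
      have "x1 - x1' = amp L s * sin (2 * pi * \<omega> + phase s) - (snd (fst s) - snd (snd s))" "y1 - y1' = ?k"
        using l f_std_diff[of L s \<omega>] by (auto simp: lift_def)
      with navg2_le_dens2[OF assms(1) per s, of L x1 y1 x1' y1']
      show "?P (?P \<Phi>) (lift L \<omega> s) \<le> ennreal 0 + ennreal (1 / \<sigma>\<^sup>2) * dens2 L \<Phi> (amp L s * sin (2 * pi * \<omega> + phase s) - (snd (fst s) - snd (snd s))) ?k"
        unfolding l by simp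
    qed (use amp1[OF that] P1 \<eta> s in auto)
    also have "(\<integral>\<^sup>+b. ennreal (1 / \<sigma>\<^sup>2) * dens2 L \<Phi> b ?k \<partial>circ) = ennreal (1 / \<sigma>\<^sup>2) * dens3 L \<Phi> ?k"
      unfolding dens3_def by (rule nn_integral_cmult) measurable
    also have "ennreal (2 / (\<sigma> * \<eta>)) * (ennreal (1 / \<sigma>\<^sup>2) * dens3 L \<Phi> ?k) = ennreal (2 / (\<sigma> ^ 3 * \<eta>)) * dens3 L \<Phi> ?k"
      using s \<eta> by (subst mult.assoc[symmetric], subst ennreal_mult[symmetric]) (auto simp: power_numeral_reduce mult_ac)
    finally show ?thesis by simp
  qed
  have "?P (?P (?P (?P \<Phi>))) s \<le> ennreal (5 * sqrt \<tau> / \<sigma> + \<eta> / \<sigma> + \<eta> / \<sigma>) +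
      ennreal (2 / (\<sigma> * \<eta>)) * (\<integral>\<^sup>+b. ennreal (2 / (\<sigma> ^ 3 * \<eta>)) * dens3 L \<Phi> b \<partial>circ)"
  proof (rule navg_push[where S = "{\<omega>. hx (lift L \<omega> s) < \<tau> * min 1 \<bar>amp L s\<bar>}"])
    show "per1 (\<lambda>b. ennreal (2 / (\<sigma> ^ 3 * \<eta>)) * dens3 L \<Phi> b)" by (simp add: per1_def dens3_per[OF per])
    show "measure (unif (-\<sigma>) \<sigma>) {\<omega>. hx (lift L \<omega> s) < \<tau> * min 1 \<bar>amp L s\<bar>} \<le> 5 * sqrt \<tau> / \<sigma>"
      by (rule hx_lift_small_prob[OF s \<tau>(1)])
    fix \<omega> assume "\<omega> \<notin> {\<omega>. hx (lift L \<omega> s) < \<tau> * min 1 \<bar>amp L s\<bar>}"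
    \<comment> \<open>The amplitude is at least 1, so the minimum is 1 and the next state is again
      separated by \<open>\<tau>\<close>; the three-step bound applies there, and its argument is
      once more a sine of the noise.\<close>
    then have "\<tau> \<le> hx (lift L \<omega> s)" using amp1[OF \<tau>(3)] by simp
    moreover have "fst (fst (lift L \<omega> s)) - fst (snd (lift L \<omega> s)) =
        amp L s * sin (2 * pi * \<omega> + phase s) - (snd (fst s) - snd (snd s))"
      unfolding f_std_diff[symmetric] by (simp add: lift_def)
    ultimately show "?P (?P (?P \<Phi>)) (lift L \<omega> s) \<le> ennreal (\<eta> / \<sigma>) +
        ennreal (2 / (\<sigma> ^ 3 * \<eta>)) * dens3 L \<Phi> (amp L s * sin (2 * pi * \<omega> + phase s) - (snd (fst s) - snd (snd s)))"
      using 3[of "lift L \<omega> s"] by simp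
  qed (use amp1[OF \<tau>(3)] P1 \<eta> s \<tau> in auto)
  also have "(\<integral>\<^sup>+b. ennreal (2 / (\<sigma> ^ 3 * \<eta>)) * dens3 L \<Phi> b \<partial>circ) = ennreal (2 / (\<sigma> ^ 3 * \<eta>)) * (\<integral>\<^sup>+s. \<Phi> s \<partial>torus4)"
    unfolding nn_integral_dens3[OF assms(1) per, of L, symmetric] by (rule nn_integral_cmult) measurable
  also have "ennreal (2 / (\<sigma> * \<eta>)) * (ennreal (2 / (\<sigma> ^ 3 * \<eta>)) * (\<integral>\<^sup>+s. \<Phi> s \<partial>torus4)) =
      ennreal (4 / (\<sigma> ^ 4 * \<eta>\<^sup>2)) * (\<integral>\<^sup>+s. \<Phi> s \<partial>torus4)"
    using s \<eta> by (subst mult.assoc[symmetric], subst ennreal_mult[symmetric]) (auto simp: power_numeral_reduce mult_ac)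
  also have "5 * sqrt \<tau> / \<sigma> + \<eta> / \<sigma> + \<eta> / \<sigma> = 5 * sqrt \<tau> / \<sigma> + 2 * \<eta> / \<sigma>" by simp
  also have "?P (?P (?P (?P \<Phi>))) = (?P ^^ 4) \<Phi>" by (simp add: numeral_eq_Suc)
  finally show ?thesis .
qed

section \<open>Equidistribution from separated points\<close>

lemma funpow_funpow: "(f ^^ a) ((f ^^ b) x) = (f ^^ (a + b)) x"
  by (simp add: funpow_add)

lemma measurable_avg_pow:
  assumes [measurable]: "\<Phi> \<in> borel_measurable borel" and "0 < \<sigma>"
  shows "(avg L \<sigma> ^^ n) \<Phi> \<in> borel_measurable borel"
  by (induction n) (auto intro!: measurable_avg assms)

lemma measurable_navg_pow:
  assumes [measurable]: "\<Phi> \<in> borel_measurable borel" and "0 < \<sigma>"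
  shows "(navg L \<sigma> ^^ n) \<Phi> \<in> borel_measurable borel"
  by (induction n) (auto intro!: measurable_navg assms)

lemma avg_pow_bounded:
  assumes "\<Phi> \<in> borel_measurable borel" and "0 < \<sigma>" and "\<And>s. \<bar>\<Phi> s\<bar> \<le> B"
  shows "\<bar>(avg L \<sigma> ^^ n) \<Phi> s\<bar> \<le> B"
proof (induction n arbitrary: s)
  case (Suc n)
  show ?case by (simp, rule avg_bounded[OF measurable_avg_pow[OF assms(1,2)] assms(2) Suc])
qed (simp add: assms)

lemma per4_avg_pow: "per4 \<Phi> \<Longrightarrow> per4 ((avg L \<sigma> ^^ n) \<Phi>)"
  by (induction n) (auto intro: per4_avg)

lemma avg_pow_minus_const:
  assumes "\<Phi> \<in> borel_measurable borel" and "0 < \<sigma>" and B: "\<And>s. \<bar>\<Phi> s\<bar> \<le> B"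
  shows "(avg L \<sigma> ^^ n) (\<lambda>s. \<Phi> s - c) = (\<lambda>s. (avg L \<sigma> ^^ n) \<Phi> s - c)"
proof (induction n)
  case (Suc n)
  have "avg L \<sigma> (\<lambda>s. (avg L \<sigma> ^^ n) \<Phi> s + - c) s = avg L \<sigma> ((avg L \<sigma> ^^ n) \<Phi>) s + - c" for s
    by (rule avg_add_const[OF measurable_avg_pow[OF assms(1,2)] assms(2) avg_pow_bounded[OF assms(1-3)]])
  then show ?case by (simp add: Suc fun_eq_iff)
qed simp

lemma ennreal_avg_pow_le:
  assumes m: "\<Phi> \<in> borel_measurable borel" and s: "0 < \<sigma>" and B: "\<And>s. \<bar>\<Phi> s\<bar> \<le> B"
  shows "ennreal \<bar>(avg L \<sigma> ^^ n) \<Phi> s\<bar> \<le> (navg L \<sigma> ^^ n) (\<lambda>s. ennreal \<bar>\<Phi> s\<bar>) s"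
proof (induction n arbitrary: s)
  case (Suc n)
  have i: "integrable (unif (-\<sigma>) \<sigma>) (\<lambda>\<omega>. (avg L \<sigma> ^^ n) \<Phi> (lift L \<omega> s))"
    by (rule integrable_avg[OF measurable_avg_pow[OF m s] s avg_pow_bounded[OF m s B]])
  have "ennreal \<bar>avg L \<sigma> ((avg L \<sigma> ^^ n) \<Phi>) s\<bar> \<le> navg L \<sigma> (\<lambda>s. ennreal \<bar>(avg L \<sigma> ^^ n) \<Phi> s\<bar>) s"
    unfolding avg_def[of L \<sigma> "(avg L \<sigma> ^^ n) \<Phi>"] navg_def using integral_norm_bound_ennreal[OF i] by simp
  also have "\<dots> \<le> navg L \<sigma> ((navg L \<sigma> ^^ n) (\<lambda>s. ennreal \<bar>\<Phi> s\<bar>)) s"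
    unfolding navg_def[of L \<sigma> "\<lambda>s. ennreal \<bar>(avg L \<sigma> ^^ n) \<Phi> s\<bar>"] navg_def[of L \<sigma> "(navg L \<sigma> ^^ n) (\<lambda>s. ennreal \<bar>\<Phi> s\<bar>)"]
    by (intro nn_integral_mono Suc)
  finally show ?case by simp
qed simp

lemma navg_le_split:
  assumes [measurable]: "\<Phi> \<in> borel_measurable borel" and s: "0 < \<sigma>" and S: "S \<in> sets borel" "measure (unif (-\<sigma>) \<sigma>) S \<le> b"
    and "\<And>s. \<Phi> s \<le> 1" and le: "\<And>\<omega>. \<omega> \<notin> S \<Longrightarrow> \<Phi> (lift L \<omega> s) \<le> e"
  shows "navg L \<sigma> \<Phi> s \<le> e + ennreal b"
proof -
  note [measurable] = S(1)
  interpret N: prob_space "unif (-\<sigma>) \<sigma>" using s by (intro prob_space_unif) simp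
  have "navg L \<sigma> \<Phi> s \<le> (\<integral>\<^sup>+\<omega>. e + indicator S \<omega> \<partial>unif (-\<sigma>) \<sigma>)"
    unfolding navg_def
  proof (rule nn_integral_mono)
    fix \<omega> show "\<Phi> (lift L \<omega> s) \<le> e + indicator S \<omega>"
      using le[of \<omega>] assms(5)[of "lift L \<omega> s"] by (cases "\<omega> \<in> S") (auto simp: add_increasing)
  qed
  also have "\<dots> = e + emeasure (unif (-\<sigma>) \<sigma>) S" by (simp add: nn_integral_add N.emeasure_space_1[simplified])
  also have "\<dots> \<le> e + ennreal b" unfolding N.emeasure_eq_measure by (intro add_left_mono ennreal_leI S)
  finally show ?thesis .
qed

lemma navg_pow_le_1: "0 < \<sigma> \<Longrightarrow> (\<And>s. \<Phi> s \<le> 1) \<Longrightarrow> (navg L \<sigma> ^^ n) \<Phi> s \<le> 1"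
  by (induction n arbitrary: s) (auto intro: navg_le_1)

text \<open>With failure probability at most \<open>5 * sqrt \<epsilon> / \<sigma>\<close> per step,
  the horizontal difference is multiplied by at least \<open>\<epsilon> * L\<close>, unless it is
  already so large that the next one is at least \<open>\<epsilon>\<close>. The failure
  probabilities add up.\<close>

lemma navg_pow_reach_hx:
  assumes [measurable]: "\<Psi> \<in> borel_measurable borel" and \<Psi>1: "\<And>s. \<Psi> s \<le> 1"
    and s: "0 < \<sigma>" "\<sigma> \<le> 1" and L: "1 \<le> L" and \<epsilon>: "0 < \<epsilon>" "1 \<le> \<epsilon> * L"
    and e: "\<And>s. \<epsilon> \<le> hx s \<Longrightarrow> \<Psi> s \<le> e"
  shows "\<epsilon> \<le> hx s * (\<epsilon> * L) ^ n \<Longrightarrow> (navg L \<sigma> ^^ n) \<Psi> s \<le> e + ennreal (real n * (5 * sqrt \<epsilon> / \<sigma>))"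
proof (induction n arbitrary: s)
  case 0
  then show ?case using e[of s] by simp
next
  case (Suc n)
  let ?b = "5 * sqrt \<epsilon> / \<sigma>"
  have "navg L \<sigma> ((navg L \<sigma> ^^ n) \<Psi>) s \<le> (e + ennreal (real n * ?b)) + ennreal ?b"
  proof (rule navg_le_split[OF measurable_navg_pow[OF assms(1) s(1)] s(1), where S = "{\<omega>. hx (lift L \<omega> s) < \<epsilon> * min 1 (L * hx s)}"])
    show "measure (unif (-\<sigma>) \<sigma>) {\<omega>. hx (lift L \<omega> s) < \<epsilon> * min 1 (L * hx s)} \<le> ?b"
      by (rule hx_lift_small_prob_hx[OF s \<epsilon>(1) L])
    show "(navg L \<sigma> ^^ n) \<Psi> s \<le> 1" for s by (rule navg_pow_le_1[OF s(1) \<Psi>1])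
    fix \<omega> assume "\<omega> \<notin> {\<omega>. hx (lift L \<omega> s) < \<epsilon> * min 1 (L * hx s)}"
    then have h: "\<epsilon> * min 1 (L * hx s) \<le> hx (lift L \<omega> s)" by simp
    have q: "1 \<le> (\<epsilon> * L) ^ n" using \<epsilon> by (intro one_le_power)
    \<comment> \<open>Once \<open>L * hx s \<ge> 1\<close> the next difference is at least
      \<open>\<epsilon>\<close>, and \<open>\<epsilon> * L \<ge> 1\<close> ensures that the
      condition for the remaining \<open>n\<close> steps holds. Otherwise one factor
      \<open>\<epsilon> * L\<close> is used up.\<close>
    have "\<epsilon> \<le> \<epsilon> * min 1 (L * hx s) * (\<epsilon> * L) ^ n"
    proof (cases "1 \<le> L * hx s")
      case True
      then show ?thesis using \<epsilon> q by simp
    next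
      case False
      then show ?thesis using Suc.prems by (simp add: mult_ac)
    qed
    also have "\<dots> \<le> hx (lift L \<omega> s) * (\<epsilon> * L) ^ n" using q by (intro mult_right_mono h) auto
    finally show "(navg L \<sigma> ^^ n) \<Psi> (lift L \<omega> s) \<le> e + ennreal (real n * ?b)" by (rule Suc.IH)
  qed measurable
  also have "\<dots> = e + ennreal (real (Suc n) * ?b)"
  proof -
    have b: "0 \<le> ?b" using s \<epsilon> by simp
    have "real (Suc n) * ?b = real n * ?b + ?b" by (simp only: of_nat_Suc distrib_right mult_1 add.commute)
    then have "ennreal (real (Suc n) * ?b) = ennreal (real n * ?b) + ennreal ?b"
      using b by (simp only: ennreal_plus mult_nonneg_nonneg of_nat_0_le_iff)
    then show ?thesis by (simp only: add.assoc)
  qed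
  finally show ?case by simp
qed

text \<open>One additional step at the start, in which a vertical difference becomes horizontal up
  to the factor \<open>\<epsilon> / 2\<close>. This explains \<open>Suc n\<close> and the 2 in the
  separation hypothesis.\<close>

lemma navg_pow_reach:
  assumes [measurable]: "\<Psi> \<in> borel_measurable borel" and \<Psi>1: "\<And>s. \<Psi> s \<le> 1"
    and s: "0 < \<sigma>" "\<sigma> \<le> 1" and L: "1 \<le> L" and \<epsilon>: "0 < \<epsilon>" "\<epsilon> \<le> 1" "1 \<le> \<epsilon> * L"
    and e: "\<And>s. \<epsilon> \<le> hx s \<Longrightarrow> \<Psi> s \<le> e" and sep: "2 \<le> sep s * (\<epsilon> * L) ^ n"
  shows "(navg L \<sigma> ^^ Suc n) \<Psi> s \<le> e + ennreal (real (Suc n) * (5 * sqrt \<epsilon> / \<sigma>))"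
proof -
  let ?b = "5 * sqrt \<epsilon> / \<sigma>"
  have "navg L \<sigma> ((navg L \<sigma> ^^ n) \<Psi>) s \<le> (e + ennreal (real n * ?b)) + ennreal ?b"
  proof (rule navg_le_split[OF measurable_navg_pow[OF assms(1) s(1)] s(1), where S = "{\<omega>. hx (lift L \<omega> s) < \<epsilon> / 2 * sep s}"])
    show "measure (unif (-\<sigma>) \<sigma>) {\<omega>. hx (lift L \<omega> s) < \<epsilon> / 2 * sep s} \<le> ?b"
      by (rule hx_lift_small_prob_sep[OF s \<epsilon>(1,2) L])
    show "(navg L \<sigma> ^^ n) \<Psi> s \<le> 1" for s by (rule navg_pow_le_1[OF s(1) \<Psi>1])
    fix \<omega> assume "\<omega> \<notin> {\<omega>. hx (lift L \<omega> s) < \<epsilon> / 2 * sep s}"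
    then have h: "\<epsilon> / 2 * sep s \<le> hx (lift L \<omega> s)" by simp
    have q: "1 \<le> (\<epsilon> * L) ^ n" using \<epsilon> by (intro one_le_power)
    have "\<epsilon> / 2 * 2 \<le> \<epsilon> / 2 * (sep s * (\<epsilon> * L) ^ n)" using \<epsilon> by (intro mult_left_mono sep) auto
    then have "\<epsilon> \<le> \<epsilon> / 2 * sep s * (\<epsilon> * L) ^ n" by simp
    also have "\<dots> \<le> hx (lift L \<omega> s) * (\<epsilon> * L) ^ n" using q by (intro mult_right_mono h) auto
    finally have "\<epsilon> \<le> hx (lift L \<omega> s) * (\<epsilon> * L) ^ n" .
    then show "(navg L \<sigma> ^^ n) \<Psi> (lift L \<omega> s) \<le> e + ennreal (real n * ?b)"
      by (intro navg_pow_reach_hx[OF assms(1) \<Psi>1 s L \<epsilon>(1,3) e])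
  qed measurable
  also have "\<dots> = e + ennreal (real (Suc n) * ?b)"
  proof -
    have b: "0 \<le> ?b" using s \<epsilon> by simp
    have "real (Suc n) * ?b = real n * ?b + ?b" by (simp only: of_nat_Suc distrib_right mult_1 add.commute)
    then have "ennreal (real (Suc n) * ?b) = ennreal (real n * ?b) + ennreal ?b"
      using b by (simp only: ennreal_plus mult_nonneg_nonneg of_nat_0_le_iff)
    then show ?thesis by (simp only: add.assoc)
  qed
  finally show ?thesis by simp
qed

lemma per4_abs: "per4 \<Phi> \<Longrightarrow> per4 (\<lambda>s. f (\<Phi> s))"
  by (simp add: per4_def)

text \<open>The count is \<open>n + 9 = (n + 1) + 4 + 4\<close>: in time, first the steps that
  separate the pair, then four after which the law has bounded density, then four for mixing in the
  mean. The bounded density converts smallness in the mean into smallness at the given starting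
  pair.\<close>

lemma avg_pow_close:
  assumes [measurable]: "\<Phi> \<in> borel_measurable borel" and B: "\<And>s. \<bar>\<Phi> s\<bar> \<le> 1" and per: "per4 \<Phi>"
    and s: "0 < \<sigma>" "\<sigma> \<le> 1" and L: "1 \<le> L" and \<epsilon>: "0 < \<epsilon>" "\<epsilon> \<le> 1" "1 \<le> \<epsilon> * L"
    and sep: "2 \<le> sep s * (\<epsilon> * L) ^ n"
  shows "\<bar>(avg L \<sigma> ^^ (n + 9)) \<Phi> s - (\<integral>s. \<Phi> s \<partial>torus4)\<bar> \<le>
    10 * real (n + 2) * sqrt \<epsilon> / \<sigma> + 4 * \<epsilon> / \<sigma> + 5200 / (\<sigma> ^ 5 * \<epsilon>\<^sup>2) * L powr (-1/24)"
proof -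
  interpret T4: prob_space torus4 by simp
  define m where "m = (\<integral>s. \<Phi> s \<partial>torus4)"
  define P4 where "P4 = (avg L \<sigma> ^^ 4) \<Phi>"
  have [measurable]: "P4 \<in> borel_measurable borel" unfolding P4_def by (rule measurable_avg_pow[OF assms(1) s(1)])
  have P4B: "\<bar>P4 s\<bar> \<le> 1" for s unfolding P4_def by (rule avg_pow_bounded[OF assms(1) s(1) B])
  have i: "integrable torus4 \<Phi>" by (rule integrable_torus4_bounded[OF assms(1) B])
  have mB: "\<bar>m\<bar> \<le> 1"
    unfolding m_def using B by (intro order_trans[OF integral_abs_bound] T4.integral_le_const integrable_abs i) auto
  \<comment> \<open>Halved so that it is bounded by 1, as the estimates with exceptional sets
    require; the factor 2 is restored at the end.\<close>
  define G where "G s = ennreal (\<bar>P4 s - m\<bar> / 2)" for s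
  have [measurable]: "G \<in> borel_measurable borel" unfolding G_def by measurable
  have G1: "G s \<le> 1" for s
  proof -
    have "\<bar>P4 s - m\<bar> \<le> \<bar>P4 s\<bar> + \<bar>m\<bar>" by (rule abs_triangle_ineq4)
    then have "\<bar>P4 s - m\<bar> / 2 \<le> 1" using P4B[of s] mB by simp
    then show ?thesis unfolding G_def by (metis ennreal_1 ennreal_leI)
  qed
  have perG: "per4 G" unfolding G_def using per4_avg_pow[OF per] unfolding P4_def by (rule per4_abs)
  have IG: "(\<integral>\<^sup>+s. G s \<partial>torus4) \<le> ennreal (650 / \<sigma> * L powr (-1/24))"
  proof -
    have "(\<integral>\<^sup>+s. G s \<partial>torus4) = (\<integral>\<^sup>+s. ennreal (1 / 2) * ennreal \<bar>P4 s - m\<bar> \<partial>torus4)"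
      unfolding G_def by (intro nn_integral_cong, subst ennreal_mult[symmetric]) auto
    also have "\<dots> = ennreal (1 / 2) * (\<integral>\<^sup>+s. ennreal \<bar>P4 s - m\<bar> \<partial>torus4)"
      by (rule nn_integral_cmult) measurable
    also have "\<dots> \<le> ennreal (1 / 2) * ennreal (1300 / \<sigma> * L powr (-1/24))"
      unfolding P4_def m_def by (intro mult_left_mono L1_mixing assms) auto
    also have "\<dots> = ennreal (650 / \<sigma> * L powr (-1/24))"
      using s by (subst ennreal_mult[symmetric]) auto
    finally show ?thesis .
  qed
  let ?K = "4 / (\<sigma> ^ 4 * \<epsilon>\<^sup>2)"
  define e where "e = 5 * sqrt \<epsilon> / \<sigma> + 2 * \<epsilon> / \<sigma> + ?K * (650 / \<sigma> * L powr (-1/24))"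
  have e0: "0 \<le> e" using s \<epsilon> by (simp add: e_def)
  have "(navg L \<sigma> ^^ Suc n) ((navg L \<sigma> ^^ 4) G) s \<le> ennreal e + ennreal (real (Suc n) * (5 * sqrt \<epsilon> / \<sigma>))"
  proof (rule navg_pow_reach[OF measurable_navg_pow[OF _ s(1)] navg_pow_le_1[OF s(1) G1] s L \<epsilon> _ sep])
    fix s assume hx: "\<epsilon> \<le> hx s"
    have "(navg L \<sigma> ^^ 4) G s \<le> ennreal (5 * sqrt \<epsilon> / \<sigma> + 2 * \<epsilon> / \<sigma>) + ennreal ?K * (\<integral>\<^sup>+s. G s \<partial>torus4)"
    proof (rule navg4_le[OF _ perG G1 s \<epsilon>(1) \<epsilon>(1) _ hx])
      have "4 * L * \<epsilon> = 4 * (\<epsilon> * L)" by simp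
      with \<epsilon>(3) show "1 \<le> 4 * L * \<epsilon>" by linarith
    qed (use L in auto)
    also have "\<dots> \<le> ennreal (5 * sqrt \<epsilon> / \<sigma> + 2 * \<epsilon> / \<sigma>) + ennreal ?K * ennreal (650 / \<sigma> * L powr (-1/24))"
      by (intro add_left_mono mult_left_mono IG) auto
    also have "ennreal ?K * ennreal (650 / \<sigma> * L powr (-1/24)) = ennreal (?K * (650 / \<sigma> * L powr (-1/24)))"
      using s \<epsilon> by (intro ennreal_mult[symmetric]) auto
    also have "ennreal (5 * sqrt \<epsilon> / \<sigma> + 2 * \<epsilon> / \<sigma>) + ennreal (?K * (650 / \<sigma> * L powr (-1/24))) = ennreal e"
      unfolding e_def using s \<epsilon> by (intro ennreal_plus[symmetric]) auto
    finally show "(navg L \<sigma> ^^ 4) G s \<le> ennreal e" .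
  qed measurable
  also have "\<dots> = ennreal (e + real (Suc n) * (5 * sqrt \<epsilon> / \<sigma>))"
    using e0 s \<epsilon> by (intro ennreal_plus[symmetric]) auto
  also have "(navg L \<sigma> ^^ Suc n) ((navg L \<sigma> ^^ 4) G) = (navg L \<sigma> ^^ (n + 5)) G"
    unfolding funpow_funpow by (simp add: add.commute)
  finally have N: "(navg L \<sigma> ^^ (n + 5)) G s \<le> ennreal (e + real (Suc n) * (5 * sqrt \<epsilon> / \<sigma>))" .
  have "(avg L \<sigma> ^^ (n + 9)) \<Phi> = (avg L \<sigma> ^^ (n + 5)) P4"
    unfolding P4_def funpow_funpow by (simp add: add.commute)
  define D where "D s = P4 s - m" for s
  have [measurable]: "D \<in> borel_measurable borel" unfolding D_def by measurable
  have "ennreal \<bar>(avg L \<sigma> ^^ (n + 5)) D s\<bar> \<le> (navg L \<sigma> ^^ (n + 5)) (\<lambda>s. ennreal \<bar>D s\<bar>) s"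
  proof (rule ennreal_avg_pow_le[OF _ s(1)])
    show "\<bar>D s\<bar> \<le> 2" for s using P4B[of s] mB by (simp add: abs_le_iff D_def)
  qed measurable
  have scale: "(navg L \<sigma> ^^ k) (\<lambda>s. 2 * G s) = (\<lambda>s. 2 * (navg L \<sigma> ^^ k) G s)" for k
  proof (induction k)
    case (Suc k)
    have mk: "(navg L \<sigma> ^^ k) G \<in> borel_measurable borel" by (rule measurable_navg_pow[OF _ s(1)]) measurable
    have "navg L \<sigma> (\<lambda>s. 2 * (navg L \<sigma> ^^ k) G s) s = 2 * navg L \<sigma> ((navg L \<sigma> ^^ k) G) s" for s
      unfolding navg_def[of L \<sigma> "\<lambda>s. 2 * (navg L \<sigma> ^^ k) G s"] navg_def[of L \<sigma> "(navg L \<sigma> ^^ k) G"]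
      by (rule nn_integral_cmult) (use mk in measurable)
    then show ?case by (simp add: Suc fun_eq_iff)
  qed simp
  have G2: "(\<lambda>s. ennreal \<bar>D s\<bar>) = (\<lambda>s. 2 * G s)"
  proof
    fix s
    have "ennreal \<bar>D s\<bar> = ennreal (2 * (\<bar>D s\<bar> / 2))" by simp
    also have "\<dots> = ennreal 2 * ennreal (\<bar>D s\<bar> / 2)" by (rule ennreal_mult) auto
    finally show "ennreal \<bar>D s\<bar> = 2 * G s" by (simp add: G_def D_def)
  qed
  have "ennreal \<bar>(avg L \<sigma> ^^ (n + 5)) D s\<bar> \<le> 2 * (navg L \<sigma> ^^ (n + 5)) G s"
    using \<open>ennreal \<bar>(avg L \<sigma> ^^ (n + 5)) D s\<bar> \<le> _\<close> unfolding G2 scale .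
  also have "\<dots> \<le> 2 * ennreal (e + real (Suc n) * (5 * sqrt \<epsilon> / \<sigma>))" by (intro mult_left_mono N) auto
  also have "\<dots> = ennreal (2 * (e + real (Suc n) * (5 * sqrt \<epsilon> / \<sigma>)))"
    using e0 s \<epsilon> by (subst ennreal_mult) auto
  finally have "\<bar>(avg L \<sigma> ^^ (n + 5)) D s\<bar> \<le> 2 * (e + real (Suc n) * (5 * sqrt \<epsilon> / \<sigma>))"
    using e0 s \<epsilon> by (subst (asm) ennreal_le_iff) auto
  also have "(avg L \<sigma> ^^ (n + 5)) D s = (avg L \<sigma> ^^ (n + 9)) \<Phi> s - m"
    unfolding D_def avg_pow_minus_const[OF \<open>P4 \<in> _\<close> s(1) P4B] \<open>(avg L \<sigma> ^^ (n + 9)) \<Phi> = _\<close> ..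
  also have "2 * (e + real (Suc n) * (5 * sqrt \<epsilon> / \<sigma>)) =
      10 * real (n + 2) * sqrt \<epsilon> / \<sigma> + 4 * \<epsilon> / \<sigma> + 5200 / (\<sigma> ^ 5 * \<epsilon>\<^sup>2) * L powr (-1/24)"
  proof -
    define B where "B = sqrt \<epsilon> / \<sigma>"
    define X where "X = 5200 / (\<sigma> ^ 5 * \<epsilon>\<^sup>2) * L powr (-1/24)"
    have "\<sigma> ^ 5 = \<sigma> ^ 4 * \<sigma>" by (simp add: power_numeral_reduce)
    then have 1: "?K * (650 / \<sigma> * L powr (-1/24)) = X / 2" by (simp add: X_def mult_ac)
    have 2: "5 * sqrt \<epsilon> / \<sigma> = 5 * B" "10 * real (n + 2) * sqrt \<epsilon> / \<sigma> = 10 * real (n + 2) * B"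
      by (simp_all add: B_def)
    show ?thesis unfolding e_def 1 2 X_def[symmetric] by (simp add: algebra_simps)
  qed
  finally show ?thesis by (simp add: m_def)
qed

section \<open>The Lyapunov function\<close>

text \<open>The infimum is attained by rounding the two coordinate differences separately.\<close>

lemma torus_dist_eq:
  "torus_dist z w = sqrt ((nd (fst z - fst w))\<^sup>2 + (nd (snd z - snd w))\<^sup>2)"
proof -
  obtain x y x' y' where zw: "z = (x, y)" "w = (x', y')" by (cases z, cases w) auto
  have d: "dist z (w + (of_int k, of_int l)) = sqrt (\<bar>(x - x') - of_int k\<bar>\<^sup>2 + \<bar>(y - y') - of_int l\<bar>\<^sup>2)" for k l
    by (simp add: zw dist_Pair_Pair dist_real_def algebra_simps)
  have bdd: "bdd_below (range (\<lambda>(k, l). dist z (w + (of_int k, of_int l))))"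
    by (intro bdd_belowI[of _ 0]) auto
  show ?thesis
  proof (rule antisym)
    have "torus_dist z w \<le> (case (round (x - x'), round (y - y')) of (k, l) \<Rightarrow> dist z (w + (of_int k, of_int l)))"
      unfolding torus_dist_def by (rule cINF_lower[OF bdd]) simp
    also have "\<dots> = sqrt ((nd (fst z - fst w))\<^sup>2 + (nd (snd z - snd w))\<^sup>2)"
      unfolding prod.case d by (simp add: nd_def zw)
    finally show "torus_dist z w \<le> sqrt ((nd (fst z - fst w))\<^sup>2 + (nd (snd z - snd w))\<^sup>2)" .
    show "sqrt ((nd (fst z - fst w))\<^sup>2 + (nd (snd z - snd w))\<^sup>2) \<le> torus_dist z w"
      unfolding torus_dist_def
    proof (rule cINF_greatest)
      fix p :: "int \<times> int"
      obtain k l where p: "p = (k, l)" by (cases p)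
      show "sqrt ((nd (fst z - fst w))\<^sup>2 + (nd (snd z - snd w))\<^sup>2) \<le> (case p of (k, l) \<Rightarrow> dist z (w + (of_int k, of_int l)))"
        unfolding p prod.case d unfolding zw fst_conv snd_conv
        by (intro real_sqrt_le_mono add_mono power_mono nd_le) auto
    qed simp
  qed
qed

definition tdist :: "pair_state \<Rightarrow> real"
  where "tdist s = torus_dist (fst s) (snd s)"

lemma tdist_eq: "tdist s = sqrt ((hx s)\<^sup>2 + (hy s)\<^sup>2)"
  by (simp add: tdist_def torus_dist_eq hx_def hy_def)

lemma measurable_tdist [measurable]: "tdist \<in> borel_measurable borel"
  unfolding tdist_eq by measurable

lemma sep_le_tdist: "sep s \<le> tdist s"
proof -
  have "hx s \<le> tdist s" "hy s \<le> tdist s" unfolding tdist_eq by (intro real_le_rsqrt; simp)+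
  then show ?thesis by (simp add: sep_def)
qed

lemma hx_le_tdist: "hx s \<le> tdist s"
  unfolding tdist_eq by (intro real_le_rsqrt) simp

lemma tdist_le_sep: "tdist s \<le> 2 * sep s"
proof -
  have "tdist s \<le> hx s + hy s" unfolding tdist_eq by (rule sqrt_sum_squares_le_sum) auto
  then show ?thesis by (auto simp: sep_def)
qed

lemma tdist_pos_iff: "0 < tdist s \<longleftrightarrow> 0 < sep s"
  using sep_le_tdist[of s] tdist_le_sep[of s] by linarith

lemma per4_tdist: "per4 tdist"
proof -
  have e: "x + 1 - x' = (x - x') + 1" "x - (x' + 1) = (x - x') - 1" for x x' :: real by simp_all
  have m: "nd (x - 1) = nd x" for x using nd_add_1[of "x - 1"] by simp
  show ?thesis unfolding per4_def tdist_eq hx_def hy_def fst_conv snd_conv e m nd_add_1 by simp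
qed

definition lyap :: "real \<Rightarrow> real \<Rightarrow> real"
  where "lyap L d = (if d \<le> 1 / L then d powr (- 1 / ln L) else 1)"

definition V :: "real \<Rightarrow> pair_state \<Rightarrow> real"
  where "V L s = lyap L (tdist s)"

lemma lyapunov_V_eq: "0 < L \<Longrightarrow> lyapunov_V 1 1 L s = V L s"
  by (cases s) (simp add: lyapunov_V_def V_def lyap_def tdist_def powr_minus_divide)

lemma measurable_V [measurable]: "V L \<in> borel_measurable borel"
  unfolding V_def lyap_def by measurable

lemma per4_V: "per4 (V L)"
  unfolding V_def by (rule per4_abs[OF per4_tdist])

lemma lyap_nonneg [simp]: "0 \<le> lyap L d"
  by (simp add: lyap_def)

lemma V_nonneg [simp]: "0 \<le> V L s"
  by (simp add: V_def)

lemma lyap_small: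
  assumes "0 < d" "d \<le> 1 / L" shows "lyap L d = exp (- ln d / ln L)"
  using assms by (simp add: lyap_def powr_def)

lemma lyap_large: "1 / L < d \<Longrightarrow> lyap L d = 1"
  by (simp add: lyap_def)

lemma ln_ratio_less_1:
  fixes L d :: real
  assumes "1 < L" "1 / L < d" shows "- ln d / ln L < 1"
proof -
  have "0 < L" using assms(1) by linarith
  then have L: "0 < L" "0 < 1 / L" by simp_all
  then have "ln (1 / L) < ln d" using assms L by (subst ln_less_cancel_iff) linarith+
  then have "- ln d < 1 * ln L" using L by (simp add: ln_div)
  moreover have "0 < ln L" using assms by simp
  ultimately show ?thesis by (subst pos_divide_less_eq)
qed

text \<open>The quantity \<open>- ln d / ln L\<close> is the \<open>a\<close> with
  \<open>d = L powr (- a)\<close>, and below the threshold \<open>lyap\<close> is its exponential.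
  Growth of the distance by a power of \<open>L\<close> thus becomes a subtraction.\<close>

lemma ln_ratio_shift:
  fixes L d1 d2 a :: real
  assumes "1 < L" "0 < d1" "0 < d2" "L powr a * d1 \<le> d2"
  shows "- ln d2 / ln L \<le> - ln d1 / ln L - a"
proof -
  have "0 < L powr a * d1" using assms by simp
  then have "ln (L powr a * d1) \<le> ln d2" using ln_le_cancel_iff[of "L powr a * d1" d2] assms by simp
  then have "a * ln L + ln d1 \<le> ln d2" using assms by (simp add: ln_mult ln_powr)
  then have "- ln d2 \<le> - ln d1 - a * ln L" by simp
  then have "- ln d2 / ln L \<le> (- ln d1 - a * ln L) / ln L" using assms by (intro divide_right_mono) auto
  also have "\<dots> = - ln d1 / ln L - a" using assms by (simp add: diff_divide_distrib)
  finally show ?thesis .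
qed

lemma lyap_ge_1:
  assumes "1 < L" "0 < d" shows "1 \<le> lyap L d"
proof (cases "d \<le> 1 / L")
  case True
  also have "1 / L \<le> 1" using assms by simp
  finally have "0 \<le> - ln d / ln L" using assms by (intro divide_nonneg_nonneg) auto
  then show ?thesis using assms True by (simp add: lyap_small)
qed (simp add: lyap_def)

text \<open>Shrinking by at most \<open>L\<^sup>2\<close> raises the exponent by at most 2. The
  third unit pays for the jump of \<open>lyap\<close> at distance \<open>1 / L\<close>: above it the
  value is 1 although the exponent may be close to 1.\<close>

lemma lyap_le_exp3:
  assumes "1 < L" "0 < d1" "0 < d2" "d1 \<le> L\<^sup>2 * d2"
  shows "lyap L d2 \<le> exp 3 * lyap L d1"
proof -
  have g: "1 \<le> lyap L d1" by (rule lyap_ge_1[OF assms(1,2)])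
  have "L powr (-2) * d1 \<le> d2"
    using assms by (simp add: powr_minus_divide pos_divide_le_eq mult.commute)
  from ln_ratio_shift[OF assms(1-3) this] have t: "- ln d2 / ln L \<le> - ln d1 / ln L + 2" by simp
  show ?thesis
  proof (cases "d2 \<le> 1 / L")
    case True
    show ?thesis
    proof (cases "d1 \<le> 1 / L")
      case d1: True
      have "exp (- ln d2 / ln L) \<le> exp 3 * exp (- ln d1 / ln L)" unfolding exp_add[symmetric] using t by simp
      then show ?thesis using lyap_small[OF assms(3) True] lyap_small[OF assms(2) d1] by simp
    next
      case False
      then have "- ln d1 / ln L < 1" using assms by (intro ln_ratio_less_1) auto
      with t have "exp (- ln d2 / ln L) \<le> exp 3" by simp
      then show ?thesis using assms True False by (simp add: lyap_small lyap_large)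
    qed
  next
    case False
    have "1 * 1 \<le> exp 3 * lyap L d1" using g by (intro mult_mono) auto
    then show ?thesis using False by (simp add: lyap_def)
  qed
qed

lemma lyap_contract:
  assumes "1 < L" "0 < d1" "L powr (1/2) * d1 \<le> d2"
  shows "lyap L d2 \<le> exp (-1/2) * lyap L d1 + 1"
proof (cases "d2 \<le> 1 / L")
  case True
  have "1 * d1 \<le> L powr (1/2) * d1" using assms by (intro mult_right_mono ge_one_powr_ge_zero) auto
  with assms have d: "d1 \<le> d2" "0 < d2" by linarith+
  have "- ln d2 / ln L \<le> - ln d1 / ln L - 1/2" using assms d by (intro ln_ratio_shift) auto
  then have "exp (- ln d2 / ln L) \<le> exp (-1/2 + - ln d1 / ln L)" by simp
  then have "exp (- ln d2 / ln L) \<le> exp (-1/2) * exp (- ln d1 / ln L)" unfolding exp_add .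
  then show ?thesis using assms d True by (simp add: lyap_small)
qed (simp add: lyap_def)

text \<open>\<open>135 \<le> exp 6\<close>, so on this sublevel set the distance is at least
  \<open>L powr (-6)\<close>. The level 135 is where the drift alone begins to halve the weight in
  \<open>contraction\<close>.\<close>

lemma lyap_le_135:
  assumes "1 < L" "0 < d" "lyap L d \<le> 135" shows "1 \<le> d * L ^ 6"
proof -
  have e6: "135 \<le> exp (6::real)"
  proof -
    have "(2.5::real) \<le> exp 1" using exp_lower_Taylor_quadratic[of "1::real"] by simp
    then have "(2.5::real) ^ 6 \<le> exp 1 ^ 6" by (intro power_mono) auto
    also have "\<dots> = exp 6" by (simp flip: exp_of_nat_mult)
    finally show ?thesis by (rule order_trans[rotated]) (simp add: power_numeral_reduce)
  qed
  have "- ln d / ln L \<le> 6"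
  proof (cases "d \<le> 1 / L")
    case True
    then have "exp (- ln d / ln L) \<le> exp 6" using lyap_small[OF assms(2)] assms(3) e6 by (metis order_trans)
    then show ?thesis by (simp only: exp_le_cancel_iff)
  next
    case False
    then show ?thesis using ln_ratio_less_1[OF assms(1), of d] by simp
  qed
  moreover have "0 < ln L" using assms by simp
  ultimately have "- ln d \<le> 6 * ln L" by (subst (asm) pos_divide_le_eq)
  then have "0 \<le> ln (d * L ^ 6)" using assms by (simp add: ln_mult ln_realpow)
  then show ?thesis using assms by simp
qed

lemma sep_lift_zero: "sep s = 0 \<Longrightarrow> sep (lift L \<omega> s) = 0"
proof -
  assume "sep s = 0"
  moreover have "hx s \<le> sep s" "hy s \<le> sep s" by (simp_all add: sep_def)
  ultimately have h: "hx s = 0" "hy s = 0" using hx_nonneg[of s] hy_nonneg[of s] by linarith+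
  have "\<bar>sin (pi * (fst (snd s) - fst (fst s)))\<bar> \<le> pi * nd (fst (snd s) - fst (fst s))" by (rule abs_sin_le_nd)
  also have "\<dots> = 0" using h(1) nd_minus_commute[of "fst (fst s)"] by (simp add: hx_def)
  finally have "amp L s = 0" by (simp add: amp_def)
  then have "hx (lift L \<omega> s) = 0" using h(2) nd_minus_commute[of "snd (fst s)" "snd (snd s)"]
    by (simp add: hx_lift hy_def)
  then show ?thesis using h by (simp add: sep_def hy_lift)
qed

text \<open>Relies on \<open>0 powr a = 0\<close>: on the diagonal \<open>V\<close> has the value 0
  instead of infinity. Statements about \<open>V\<close> therefore extend trivially to the
  diagonal.\<close>

lemma V_zero:
  assumes "0 < L" "sep s = 0" shows "V L s = 0"
proof -
  have "tdist s = 0" using sep_le_tdist[of s] tdist_le_sep[of s] assms(2) by linarith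
  then show ?thesis using assms(1) by (simp add: V_def lyap_def)
qed

text \<open>The distance shrinks at most by the factor \<open>16 * L\<close>, which
  \<open>16 \<le> L\<close> turns into \<open>L\<^sup>2\<close>. The bound holds for every noise,
  not only on average.\<close>

lemma V_lift_le:
  assumes L: "16 \<le> L" shows "V L (lift L \<omega> s) \<le> exp 3 * V L s"
proof (cases "sep s = 0")
  case True
  then show ?thesis using L by (simp add: V_zero sep_lift_zero)
next
  case False
  then have p: "0 < sep s" using sep_nonneg[of s] by linarith
  let ?s = "lift L \<omega> s"
  have 1: "sep s \<le> 8 * L * sep ?s" using L by (intro sep_le_sep_lift) simp
  have p2: "0 < sep ?s"
  proof (rule ccontr)
    assume "\<not> 0 < sep ?s"
    then have "sep ?s = 0" using sep_nonneg[of ?s] by linarith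
    with 1 p show False by simp
  qed
  have "tdist s \<le> 2 * (8 * L * sep ?s)" using tdist_le_sep[of s] 1 by linarith
  also have "\<dots> = 16 * (L * sep ?s)" by simp
  also have "\<dots> \<le> L * (L * tdist ?s)"
    using L sep_le_tdist[of ?s] p2 by (intro mult_mono mult_left_mono) auto
  finally have "tdist s \<le> L\<^sup>2 * tdist ?s" by (simp add: power2_eq_square mult.assoc)
  then show ?thesis unfolding V_def using L p p2 by (intro lyap_le_exp3) (auto simp: tdist_pos_iff)
qed

text \<open>The weighted space in Borel form, on the whole plane. Since \<open>V\<close> grows by at
  most a constant factor in a step, the class is stable under \<open>avg\<close>, and its members
  are integrable along a step.\<close>

definition dominated :: "real \<Rightarrow> (pair_state \<Rightarrow> real) \<Rightarrow> bool"
  where "dominated L \<Phi> \<longleftrightarrow> \<Phi> \<in> borel_measurable borel \<and> (\<exists>c\<ge>0. \<forall>s. \<bar>\<Phi> s\<bar> \<le> c * (1 + V L s))"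

lemma dominatedI:
  assumes "\<Phi> \<in> borel_measurable borel" "0 \<le> c" "\<And>s. \<bar>\<Phi> s\<bar> \<le> c * (1 + V L s)" shows "dominated L \<Phi>"
  using assms unfolding dominated_def by blast

lemma dominated_measurable: "dominated L \<Phi> \<Longrightarrow> \<Phi> \<in> borel_measurable borel"
  by (simp add: dominated_def)

lemma dominated_V: "dominated L (V L)"
  by (rule dominatedI[where c = 1]) auto

lemma dominated_const: "dominated L (\<lambda>_. a)"
proof (rule dominatedI[where c = "\<bar>a\<bar>"])
  show "\<bar>a\<bar> \<le> \<bar>a\<bar> * (1 + V L s)" for s using mult_left_mono[of 1 "1 + V L s" "\<bar>a\<bar>"] by simp
qed auto

lemma dominated_add:
  assumes "dominated L \<Phi>" "dominated L \<Psi>" shows "dominated L (\<lambda>s. \<Phi> s + \<Psi> s)"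
proof -
  obtain c d where c: "0 \<le> c" "\<And>s. \<bar>\<Phi> s\<bar> \<le> c * (1 + V L s)" and d: "0 \<le> d" "\<And>s. \<bar>\<Psi> s\<bar> \<le> d * (1 + V L s)"
    using assms by (auto simp: dominated_def)
  show ?thesis
  proof (rule dominatedI[where c = "c + d"])
    show "\<bar>\<Phi> s + \<Psi> s\<bar> \<le> (c + d) * (1 + V L s)" for s
      using abs_triangle_ineq[of "\<Phi> s" "\<Psi> s"] c(2)[of s] d(2)[of s] by (simp add: distrib_right)
  qed (use c d assms[THEN dominated_measurable] in auto)
qed

lemma dominated_cmult:
  assumes "dominated L \<Phi>" shows "dominated L (\<lambda>s. a * \<Phi> s)"
proof -
  obtain c where c: "0 \<le> c" "\<And>s. \<bar>\<Phi> s\<bar> \<le> c * (1 + V L s)" using assms by (auto simp: dominated_def)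
  show ?thesis
  proof (rule dominatedI[where c = "\<bar>a\<bar> * c"])
    show "\<bar>a * \<Phi> s\<bar> \<le> \<bar>a\<bar> * c * (1 + V L s)" for s
      using mult_left_mono[OF c(2), of "\<bar>a\<bar>" s] by (simp add: abs_mult mult.assoc)
  qed (use c assms[THEN dominated_measurable] in auto)
qed

lemma dominated_mono:
  assumes "dominated L \<Psi>" "\<Phi> \<in> borel_measurable borel" "\<And>s. \<bar>\<Phi> s\<bar> \<le> \<bar>\<Psi> s\<bar>" shows "dominated L \<Phi>"
  using assms unfolding dominated_def by (meson order_trans)

section \<open>Averages of dominated functions and the drift inequality\<close>

context
  fixes L \<sigma> :: real
  assumes L: "16 \<le> L" and s0: "0 < \<sigma>" and s1: "\<sigma> \<le> 1"
begin

interpretation N: prob_space "unif (-\<sigma>) \<sigma>" using s0 by (intro prob_space_unif) simp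

lemma dominated_integrable:
  assumes "dominated L \<Phi>" shows "integrable (unif (-\<sigma>) \<sigma>) (\<lambda>\<omega>. \<Phi> (lift L \<omega> s))"
proof -
  note [measurable] = dominated_measurable[OF assms]
  obtain c where c: "0 \<le> c" "\<And>s. \<bar>\<Phi> s\<bar> \<le> c * (1 + V L s)" using assms by (auto simp: dominated_def)
  show ?thesis
  proof (rule integrable_unif_bounded)
    show "norm (\<Phi> (lift L \<omega> s)) \<le> c * (1 + exp 3 * V L s)" for \<omega>
      using order_trans[OF c(2) mult_left_mono[OF add_left_mono[OF V_lift_le[OF L]] c(1)]] by simp
  qed (use s0 in auto)
qed

lemma dominated_avg:
  assumes "dominated L \<Phi>" shows "dominated L (avg L \<sigma> \<Phi>)"
proof -
  note m[measurable] = dominated_measurable[OF assms]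
  obtain c where c: "0 \<le> c" "\<And>s. \<bar>\<Phi> s\<bar> \<le> c * (1 + V L s)" using assms by (auto simp: dominated_def)
  show ?thesis
  proof (rule dominatedI[where c = "c * exp 3"])
    fix s
    have "\<bar>\<Phi> (lift L \<omega> s)\<bar> \<le> c * (1 + exp 3 * V L s)" for \<omega>
      by (rule order_trans[OF c(2) mult_left_mono[OF add_left_mono[OF V_lift_le[OF L]] c(1)]])
    moreover have "c * (1 + exp 3 * V L s) \<le> c * (exp 3 + exp 3 * V L s)" using c by (intro mult_left_mono) auto
    ultimately have b: "\<bar>\<Phi> (lift L \<omega> s)\<bar> \<le> c * exp 3 * (1 + V L s)" for \<omega>
      by (metis order_trans distrib_left mult.assoc mult.right_neutral)
    show "\<bar>avg L \<sigma> \<Phi> s\<bar> \<le> c * exp 3 * (1 + V L s)"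
      unfolding avg_def using b
      by (intro order_trans[OF integral_abs_bound] N.integral_le_const integrable_abs dominated_integrable assms) auto
  qed (use c m s0 in \<open>auto intro: measurable_avg\<close>)
qed

lemma dominated_avg_pow: "dominated L \<Phi> \<Longrightarrow> dominated L ((avg L \<sigma> ^^ n) \<Phi>)"
  by (induction n) (auto intro: dominated_avg)

lemma avg_mono:
  assumes "dominated L \<Phi>" "dominated L \<Psi>" "\<And>s. \<Phi> s \<le> \<Psi> s" shows "avg L \<sigma> \<Phi> s \<le> avg L \<sigma> \<Psi> s"
  unfolding avg_def by (intro integral_mono dominated_integrable assms)

lemma avg_pow_mono:
  assumes "dominated L \<Phi>" "dominated L \<Psi>" "\<And>s. \<Phi> s \<le> \<Psi> s"
  shows "(avg L \<sigma> ^^ n) \<Phi> s \<le> (avg L \<sigma> ^^ n) \<Psi> s"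
  by (induction n arbitrary: s) (auto intro!: avg_mono dominated_avg_pow assms)

lemma avg_pow_add:
  assumes "dominated L \<Phi>" "dominated L \<Psi>"
  shows "(avg L \<sigma> ^^ n) (\<lambda>s. \<Phi> s + \<Psi> s) = (\<lambda>s. (avg L \<sigma> ^^ n) \<Phi> s + (avg L \<sigma> ^^ n) \<Psi> s)"
proof (induction n)
  case (Suc n)
  have "avg L \<sigma> (\<lambda>s. (avg L \<sigma> ^^ n) \<Phi> s + (avg L \<sigma> ^^ n) \<Psi> s) s = avg L \<sigma> ((avg L \<sigma> ^^ n) \<Phi>) s + avg L \<sigma> ((avg L \<sigma> ^^ n) \<Psi>) s" for s
    unfolding avg_def[of L \<sigma> "\<lambda>s. (avg L \<sigma> ^^ n) \<Phi> s + (avg L \<sigma> ^^ n) \<Psi> s"] avg_def[of L \<sigma> "(avg L \<sigma> ^^ n) \<Phi>"] avg_def[of L \<sigma> "(avg L \<sigma> ^^ n) \<Psi>"]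
    by (intro Bochner_Integration.integral_add dominated_integrable dominated_avg_pow assms)
  then show ?case by (simp add: Suc fun_eq_iff)
qed simp

lemma avg_pow_affine:
  assumes "dominated L \<Phi>"
  shows "(avg L \<sigma> ^^ n) (\<lambda>s. a * \<Phi> s + c) = (\<lambda>s. a * (avg L \<sigma> ^^ n) \<Phi> s + c)"
proof (induction n)
  case (Suc n)
  have "avg L \<sigma> (\<lambda>s. a * (avg L \<sigma> ^^ n) \<Phi> s + c) s = a * avg L \<sigma> ((avg L \<sigma> ^^ n) \<Phi>) s + c" for s
  proof -
    have "integrable (unif (-\<sigma>) \<sigma>) (\<lambda>\<omega>. (avg L \<sigma> ^^ n) \<Phi> (lift L \<omega> s))"
      by (intro dominated_integrable dominated_avg_pow assms)
    then show ?thesis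
      unfolding avg_def[of L \<sigma> "\<lambda>s. a * (avg L \<sigma> ^^ n) \<Phi> s + c"] avg_def[of L \<sigma> "(avg L \<sigma> ^^ n) \<Phi>"]
      by (subst Bochner_Integration.integral_add) (auto simp: N.prob_space[simplified])
  qed
  then show ?case by (simp add: Suc fun_eq_iff)
qed simp

lemma abs_avg_pow_le:
  assumes "dominated L \<Phi>" "dominated L \<Psi>" and le: "\<And>s. \<bar>\<Phi> s\<bar> \<le> \<Psi> s"
  shows "\<bar>(avg L \<sigma> ^^ n) \<Phi> s\<bar> \<le> (avg L \<sigma> ^^ n) \<Psi> s"
proof -
  have "(avg L \<sigma> ^^ n) \<Phi> s \<le> (avg L \<sigma> ^^ n) \<Psi> s"
  proof (rule avg_pow_mono[OF assms(1,2)])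
    show "\<Phi> s \<le> \<Psi> s" for s using le[of s] by simp
  qed
  moreover have "(avg L \<sigma> ^^ n) (\<lambda>s. (-1) * \<Phi> s + 0) s \<le> (avg L \<sigma> ^^ n) \<Psi> s"
  proof (rule avg_pow_mono[OF dominated_add[OF dominated_cmult[OF assms(1)] dominated_const] assms(2)])
    show "(-1) * \<Phi> s + 0 \<le> \<Psi> s" for s using le[of s] by simp
  qed
  ultimately show ?thesis unfolding avg_pow_affine[OF assms(1)] by simp
qed

lemma integral_le_split:
  fixes h :: "real \<Rightarrow> real"
  assumes i: "integrable (unif (-\<sigma>) \<sigma>) h" and S: "S \<in> sets borel" "measure (unif (-\<sigma>) \<sigma>) S \<le> b"
    and "\<And>\<omega>. h \<omega> \<le> M" "\<And>\<omega>. \<omega> \<notin> S \<Longrightarrow> h \<omega> \<le> m" "0 \<le> m" "0 \<le> M"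
  shows "(\<integral>\<omega>. h \<omega> \<partial>unif (-\<sigma>) \<sigma>) \<le> m + b * M"
proof -
  note [measurable] = S(1)
  have "(\<integral>\<omega>. h \<omega> \<partial>unif (-\<sigma>) \<sigma>) \<le> (\<integral>\<omega>. m + M * indicator S \<omega> \<partial>unif (-\<sigma>) \<sigma>)"
  proof (rule integral_mono[OF i])
    show "integrable (unif (-\<sigma>) \<sigma>) (\<lambda>\<omega>. m + M * indicator S \<omega>)"
      by (intro Bochner_Integration.integrable_add integrable_mult_right) (auto simp: less_top[symmetric] N.emeasure_eq_measure)
    show "h \<omega> \<le> m + M * indicator S \<omega>" for \<omega>
      using assms(4)[of \<omega>] assms(5)[of \<omega>] assms(6) by (cases "\<omega> \<in> S") auto
  qed
  also have "\<dots> = m + M * measure (unif (-\<sigma>) \<sigma>) S"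
    by (subst Bochner_Integration.integral_add) (auto simp: N.emeasure_eq_measure N.prob_space[simplified])
  also have "\<dots> \<le> m + M * b" using S assms(7) by (intro add_left_mono mult_left_mono) auto
  finally show ?thesis by (simp add: mult.commute)
qed

text \<open>Except with probability at most \<open>5 * sqrt \<epsilon> / \<sigma>\<close> each, the
  first step makes the horizontal difference at least \<open>\<epsilon> / 2 * sep s\<close> and the
  second multiplies it by \<open>\<epsilon> * L\<close>; together the distance grows by
  \<open>L powr (1/2)\<close>. On the bad events \<open>V\<close> grows at most by
  \<open>exp 6\<close>. Since \<open>exp (-1/2) \<le> 0.62\<close>, the hypothesis with 0.08 yields
  the factor 0.7. The additive 1 is the value of \<open>V\<close> above the threshold.\<close>

lemma drift:
  assumes \<epsilon>: "0 < \<epsilon>" "\<epsilon> \<le> 1" "1 / L < \<epsilon>" "4 * L powr (1/2) \<le> \<epsilon>\<^sup>2 * L"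
    and b: "10 * sqrt \<epsilon> / \<sigma> * exp 6 \<le> 0.08"
  shows "avg L \<sigma> (avg L \<sigma> (V L)) s \<le> 0.7 * V L s + 1"
proof (cases "sep s = 0")
  case True
  have "avg L \<sigma> (avg L \<sigma> (V L)) s = 0" using L by (simp add: avg_def V_zero sep_lift_zero True)
  then show ?thesis by simp
next
  case False
  then have p: "0 < sep s" using sep_nonneg[of s] by linarith
  have L1: "1 \<le> L" "1 < L" using L by auto
  let ?b = "5 * sqrt \<epsilon> / \<sigma>"
  let ?M = "exp 6 * V L s"
  have e6: "exp 3 * exp 3 = (exp 6 :: real)" by (simp flip: exp_add)
  have V2: "V L (lift L \<omega>' (lift L \<omega> s)) \<le> ?M" for \<omega> \<omega>'
  proof -
    have "V L (lift L \<omega>' (lift L \<omega> s)) \<le> exp 3 * V L (lift L \<omega> s)" by (rule V_lift_le[OF L])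
    also have "\<dots> \<le> exp 3 * (exp 3 * V L s)" by (intro mult_left_mono V_lift_le L) auto
    finally show ?thesis by (simp add: e6[symmetric] mult.assoc)
  qed
  let ?m = "exp (-1/2) * V L s + 1"
  have aV: "avg L \<sigma> (V L) (lift L \<omega> s) \<le> ?M" for \<omega>
    unfolding avg_def using V2 by (intro N.integral_le_const dominated_integrable dominated_V) auto
  have good: "avg L \<sigma> (V L) (lift L \<omega> s) \<le> ?m + ?b * ?M" if g: "\<omega> \<notin> {\<omega>. hx (lift L \<omega> s) < \<epsilon> / 2 * sep s}" for \<omega>
    unfolding avg_def
  proof (rule integral_le_split[where S = "{\<omega>'. hx (lift L \<omega>' (lift L \<omega> s)) < \<epsilon> * min 1 (L * hx (lift L \<omega> s))}"])
    show "integrable (unif (-\<sigma>) \<sigma>) (\<lambda>\<omega>'. V L (lift L \<omega>' (lift L \<omega> s)))" by (intro dominated_integrable dominated_V)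
    show "measure (unif (-\<sigma>) \<sigma>) {\<omega>'. hx (lift L \<omega>' (lift L \<omega> s)) < \<epsilon> * min 1 (L * hx (lift L \<omega> s))} \<le> ?b"
      by (rule hx_lift_small_prob_hx[OF s0 s1 \<epsilon>(1) L1(1)])
    fix \<omega>' assume "\<omega>' \<notin> {\<omega>'. hx (lift L \<omega>' (lift L \<omega> s)) < \<epsilon> * min 1 (L * hx (lift L \<omega> s))}"
    then have h2: "\<epsilon> * min 1 (L * hx (lift L \<omega> s)) \<le> tdist (lift L \<omega>' (lift L \<omega> s))"
      using hx_le_tdist[of "lift L \<omega>' (lift L \<omega> s)"] by simp
    show "V L (lift L \<omega>' (lift L \<omega> s)) \<le> ?m"
    proof (cases "1 \<le> L * hx (lift L \<omega> s)")
      case True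
      then have "1 / L < tdist (lift L \<omega>' (lift L \<omega> s))" using h2 \<epsilon>(3) by simp
      then show ?thesis by (simp add: V_def lyap_large)
    next
      case False
      have "\<epsilon> * (L * (\<epsilon> / 2 * sep s)) \<le> \<epsilon> * (L * hx (lift L \<omega> s))"
        using g \<epsilon> L1 by (intro mult_left_mono) auto
      also have "\<dots> \<le> tdist (lift L \<omega>' (lift L \<omega> s))" using h2 False by simp
      finally have 1: "\<epsilon>\<^sup>2 * L / 2 * sep s \<le> tdist (lift L \<omega>' (lift L \<omega> s))" by (simp add: power2_eq_square mult_ac)
      \<comment> \<open>Of the 4 in the hypothesis, one factor 2 compares \<open>tdist\<close> with
        \<open>sep\<close> and the other is the loss in the first step.\<close>
      have "L powr (1/2) * tdist s \<le> L powr (1/2) * (2 * sep s)" by (intro mult_left_mono tdist_le_sep) auto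
      also have "\<dots> = 4 * L powr (1/2) / 2 * sep s" by simp
      also have "\<dots> \<le> \<epsilon>\<^sup>2 * L / 2 * sep s" using p by (intro mult_right_mono divide_right_mono \<epsilon>(4)) auto
      also note 1
      finally show ?thesis unfolding V_def using L1 p by (intro lyap_contract) (auto simp: tdist_pos_iff)
    qed
  qed (use V2 in auto)
  have b0: "0 \<le> ?b" using \<epsilon> s0 by simp
  have "avg L \<sigma> (avg L \<sigma> (V L)) s \<le> (?m + ?b * ?M) + ?b * ?M"
    unfolding avg_def[of L \<sigma> "avg L \<sigma> (V L)"]
  proof (rule integral_le_split[where S = "{\<omega>. hx (lift L \<omega> s) < \<epsilon> / 2 * sep s}"])
    show "integrable (unif (-\<sigma>) \<sigma>) (\<lambda>\<omega>. avg L \<sigma> (V L) (lift L \<omega> s))" by (intro dominated_integrable dominated_avg dominated_V)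
    show "measure (unif (-\<sigma>) \<sigma>) {\<omega>. hx (lift L \<omega> s) < \<epsilon> / 2 * sep s} \<le> ?b"
      by (rule hx_lift_small_prob_sep[OF s0 s1 \<epsilon>(1,2) L1(1)])
    show "0 \<le> ?m + ?b * ?M" by (intro add_nonneg_nonneg mult_nonneg_nonneg b0) auto
  qed (use aV good in auto)
  also have "\<dots> = (exp (-1/2) + 10 * sqrt \<epsilon> / \<sigma> * exp 6) * V L s + 1" by (simp add: algebra_simps)
  also have "\<dots> \<le> 0.7 * V L s + 1"
  proof (intro add_right_mono mult_right_mono)
    have "(1.625 :: real) \<le> exp (1/2)" using exp_lower_Taylor_quadratic[of "1/2::real"] by (simp add: power2_eq_square)
    then have "inverse (exp (1/2)) \<le> inverse (1.625 :: real)" by (intro le_imp_inverse_le) auto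
    then have "exp (-1/2) \<le> (0.62 :: real)" by (simp add: exp_minus)
    then show "exp (-1/2) + 10 * sqrt \<epsilon> / \<sigma> * exp 6 \<le> 0.7" using b by simp
  qed simp
  finally show ?thesis .
qed

text \<open>The constant 10/3 is the fixed point of the recursion,
  \<open>0.7 * (10 / 3) + 1 = 10 / 3\<close>.\<close>

lemma drift_pow:
  assumes "\<And>s. avg L \<sigma> (avg L \<sigma> (V L)) s \<le> 0.7 * V L s + 1"
  shows "(avg L \<sigma> ^^ (2 * j)) (V L) s \<le> 0.7 ^ j * V L s + 10 / 3"
proof (induction j arbitrary: s)
  case (Suc j)
  have "(avg L \<sigma> ^^ (2 * Suc j)) (V L) s = (avg L \<sigma> ^^ (2 * j)) (avg L \<sigma> (avg L \<sigma> (V L))) s"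
    using funpow_funpow[of "2 * j" "avg L \<sigma>" 2 "V L"] by (simp add: numeral_2_eq_2)
  also have "\<dots> \<le> (avg L \<sigma> ^^ (2 * j)) (\<lambda>s. 0.7 * V L s + 1) s"
    by (intro avg_pow_mono dominated_avg dominated_V dominated_add dominated_cmult dominated_const assms)
  also have "\<dots> = 0.7 * (avg L \<sigma> ^^ (2 * j)) (V L) s + 1" unfolding avg_pow_affine[OF dominated_V] ..
  also have "\<dots> \<le> 0.7 * (0.7 ^ j * V L s + 10 / 3) + 1" using Suc by (intro add_right_mono mult_left_mono) auto
  also have "\<dots> = 0.7 ^ Suc j * V L s + 10 / 3" by (simp add: distrib_left)
  finally show ?case .
qed simp

lemma drift_20:
  assumes "\<And>s. avg L \<sigma> (avg L \<sigma> (V L)) s \<le> 0.7 * V L s + 1"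
  shows "(avg L \<sigma> ^^ 20) (V L) s \<le> 0.1 * V L s + 4"
proof -
  have "(avg L \<sigma> ^^ (2 * 10)) (V L) s \<le> 0.7 ^ 10 * V L s + 10 / 3" by (rule drift_pow[OF assms])
  also have "\<dots> \<le> 0.1 * V L s + 4" by (intro add_mono mult_right_mono) (auto simp: power_numeral_reduce)
  finally show ?thesis by simp
qed

end

section \<open>Contraction in the weighted norm\<close>

lemma nn_integral_powr_half: "(\<integral>\<^sup>+u. ennreal (u powr (-1/2)) * indicator {0..1} u \<partial>lborel) = 2"
proof -
  have "((\<lambda>u::real. u powr (-1/2)) has_integral (1 powr (-1/2 + 1) / (-1/2 + 1))) {0..1}"
    by (rule has_integral_powr_from_0) auto
  then have "(\<integral>\<^sup>+u. ennreal (u powr (-1/2)) * indicator {0..1} u \<partial>lborel) = ennreal (1 powr (-1/2 + 1) / (-1/2 + 1))"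
    by (intro nn_integral_has_integral_lebesgue') auto
  then show ?thesis by simp
qed

text \<open>A majorant for \<open>V\<close> that does not depend on \<open>L\<close>. The value at
  integers is set to infinity because \<open>0 powr (-1/2)\<close> is 0 by convention, which would
  not be a majorant on pairs with equal first coordinates.\<close>

definition singular :: "real \<Rightarrow> ennreal"
  where "singular u = (if nd u = 0 then \<infinity> else ennreal (nd u powr (-1/2)))"

lemma measurable_singular [measurable]: "singular \<in> borel_measurable borel"
  unfolding singular_def by measurable

lemma nn_integral_singular: "(\<integral>\<^sup>+u. singular u \<partial>circ) \<le> 4"
proof -
  let ?g = "\<lambda>u::real. ennreal (u powr (-1/2)) * indicator {0..1} u"
  have "(\<integral>\<^sup>+u. singular u \<partial>circ) = (\<integral>\<^sup>+u. singular u * indicator {0..1} u \<partial>lborel)"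
    by (rule nn_integral_circ) measurable
  also have "\<dots> \<le> (\<integral>\<^sup>+u. ?g u + ?g (1 - u) \<partial>lborel)"
  proof (rule nn_integral_mono_AE)
    show "AE u in lborel. singular u * indicator {0..1} u \<le> ?g u + ?g (1 - u)"
      using AE_lborel_singleton[of 0] AE_lborel_singleton[of 1]
    proof eventually_elim
      case (elim u)
      show ?case
      proof (cases "0 < u \<and> u < 1")
        case True
        then have "round u = 0 \<or> round u = 1" unfolding round_def by linarith
        then have "nd u = u \<or> nd u = 1 - u" using True unfolding nd_def by auto
        then show ?thesis using True by (auto simp: singular_def)
      next
        case False
        with elim have "u \<notin> {0..1}" by auto
        then show ?thesis by simp
      qed
    qed
  qed
  also have "\<dots> = (\<integral>\<^sup>+u. ?g u \<partial>lborel) + (\<integral>\<^sup>+u. ?g (1 - u) \<partial>lborel)" by (rule nn_integral_add) measurable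
  also have "(\<integral>\<^sup>+u. ?g (1 - u) \<partial>lborel) = (\<integral>\<^sup>+u. ?g u \<partial>lborel)"
    by (subst (2) nn_integral_real_affine[where c = "-1" and t = 1]) auto
  also have "(\<integral>\<^sup>+u. ?g u \<partial>lborel) + (\<integral>\<^sup>+u. ?g u \<partial>lborel) = 4"
    unfolding nn_integral_powr_half by simp
  finally show ?thesis .
qed

lemma nn_integral_torus4_diff:
  fixes g :: "real \<Rightarrow> ennreal"
  assumes [measurable]: "g \<in> borel_measurable borel" and per: "per1 g"
  shows "(\<integral>\<^sup>+s. g (fst (fst s) - fst (snd s)) \<partial>torus4) = (\<integral>\<^sup>+u. g u \<partial>circ)"
proof -
  have "(\<integral>\<^sup>+s. g (fst (fst s) - fst (snd s)) \<partial>torus4) = (\<integral>\<^sup>+q. \<integral>\<^sup>+p. g (fst q - snd q) \<partial>torus2 \<partial>torus2)"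
    by (subst nn_integral_torus4_xy) auto
  also have "\<dots> = (\<integral>\<^sup>+q. g (fst q - snd q) \<partial>torus2)"
    by (simp add: prob_space.emeasure_space_1[OF prob_space_torus2, simplified])
  also have "\<dots> = (\<integral>\<^sup>+x'. \<integral>\<^sup>+x. g (x - x') \<partial>circ \<partial>circ)"
    by (subst nn_integral_torus2(2)) auto
  also have "\<dots> = (\<integral>\<^sup>+x'. \<integral>\<^sup>+u. g u \<partial>circ \<partial>circ)"
  proof (rule nn_integral_cong)
    fix x'
    show "(\<integral>\<^sup>+x. g (x - x') \<partial>circ) = (\<integral>\<^sup>+u. g u \<partial>circ)"
      using nn_integral_circ_shift[OF assms, of "- x'"] by simp
  qed
  also have "\<dots> = (\<integral>\<^sup>+u. g u \<partial>circ)"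
    by (simp add: prob_space.emeasure_space_1[OF prob_space_circ, simplified])
  finally show ?thesis .
qed

text \<open>For \<open>ln L \<ge> 2\<close> the exponent of the distance is at least -1/2, so
  \<open>V\<close> is bounded by the inverse square root of the horizontal distance plus 1. The
  singularity contributes 2 at each end of the unit interval, hence 5 in all.\<close>

lemma nn_integral_V:
  assumes L: "exp 2 \<le> L"
  shows "(\<integral>\<^sup>+s. ennreal (V L s) \<partial>torus4) \<le> 5"
proof -
  have L1: "1 < L" using L exp_gt_one[of "2::real"] by linarith
  have lnL: "2 \<le> ln L" using L L1 by (simp add: ln_ge_iff)
  have "(\<integral>\<^sup>+s. ennreal (V L s) \<partial>torus4) \<le> (\<integral>\<^sup>+s. 1 + singular (fst (fst s) - fst (snd s)) \<partial>torus4)"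
  proof (rule nn_integral_mono)
    fix s
    show "ennreal (V L s) \<le> 1 + singular (fst (fst s) - fst (snd s))"
    proof (cases "hx s = 0 \<or> 1 / L < tdist s")
      case True
      then show ?thesis by (auto simp: singular_def hx_def V_def lyap_large)
    next
      case False
      then have h: "0 < hx s" "hx s \<le> tdist s" "tdist s \<le> 1 / L"
        using hx_nonneg[of s] hx_le_tdist[of s] by linarith+
      then have d: "0 < tdist s" by linarith
      have "1 / L \<le> 1" using L1 by simp
      with h have d1: "tdist s \<le> 1" by linarith
      have "V L s = tdist s powr (- 1 / ln L)" using h by (simp add: V_def lyap_def)
      also have "\<dots> \<le> tdist s powr (-1/2)"
      proof (rule powr_mono')
        show "- 1 / 2 \<le> - 1 / ln L" using lnL by (simp add: field_simps)
      qed (use d d1 in auto)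
      also have "\<dots> \<le> hx s powr (-1/2)" using h by (intro powr_mono2') auto
      finally have "ennreal (V L s) \<le> singular (fst (fst s) - fst (snd s))"
        using h by (simp add: singular_def hx_def ennreal_leI)
      then show ?thesis by (simp add: add_increasing)
    qed
  qed
  also have "\<dots> = 1 + (\<integral>\<^sup>+s. singular (fst (fst s) - fst (snd s)) \<partial>torus4)"
    by (simp add: nn_integral_add prob_space.emeasure_space_1[OF prob_space_torus4, simplified])
  also have "(\<integral>\<^sup>+s. singular (fst (fst s) - fst (snd s)) \<partial>torus4) = (\<integral>\<^sup>+u. singular u \<partial>circ)"
    by (rule nn_integral_torus4_diff) (auto simp: per1_def singular_def)
  also have "1 + \<dots> \<le> 1 + 4" by (intro add_left_mono nn_integral_singular)
  finally show ?thesis by simp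
qed

lemma AE_torus4_sep: "AE s in torus4. 0 < sep s"
proof -
  let ?g = "indicator {u. nd u \<le> 0} :: real \<Rightarrow> ennreal"
  have "(\<integral>\<^sup>+s. indicator {s. hx s \<le> 0} s \<partial>torus4) = (\<integral>\<^sup>+s. ?g (fst (fst s) - fst (snd s)) \<partial>torus4)"
    by (simp add: hx_def indicator_def)
  also have "\<dots> = (\<integral>\<^sup>+u. ?g u \<partial>circ)"
    by (rule nn_integral_torus4_diff) (auto simp: per1_def indicator_def)
  also have "\<dots> \<le> ennreal (2 * 0)" by (rule nn_integral_nd_less) simp
  finally have "(\<integral>\<^sup>+s. indicator {s. hx s \<le> 0} s \<partial>torus4) = 0" by simp
  then have "AE s in torus4. (indicator {s. hx s \<le> 0} s :: ennreal) = 0"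
    by (subst (asm) nn_integral_0_iff_AE) auto
  then show ?thesis
  proof eventually_elim
    case (elim s)
    then have "0 < hx s" by (simp add: indicator_def not_le split: if_splits)
    then show ?case by (simp add: sep_def less_max_iff_disj)
  qed
qed

section \<open>Invariance of the mean and contraction for mean zero\<close>

context
  fixes L \<sigma> :: real
  assumes L: "16 \<le> L" and s0: "0 < \<sigma>" and s1: "\<sigma> \<le> 1" and VI: "(\<integral>\<^sup>+s. ennreal (V L s) \<partial>torus4) \<le> 5"
begin

interpretation T4: prob_space torus4 by simp

lemma integrable_V: "integrable torus4 (V L)"
proof (rule integrableI_bounded)
  have "(\<integral>\<^sup>+s. ennreal (norm (V L s)) \<partial>torus4) \<le> 5" using VI by simp
  also have "(5 :: ennreal) < \<infinity>" by simp
  finally show "(\<integral>\<^sup>+s. ennreal (norm (V L s)) \<partial>torus4) < \<infinity>" .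
qed measurable

lemma integral_V: "(\<integral>s. V L s \<partial>torus4) \<le> 5"
proof -
  have "ennreal (\<integral>s. V L s \<partial>torus4) = (\<integral>\<^sup>+s. ennreal (V L s) \<partial>torus4)"
    by (intro nn_integral_eq_integral[symmetric] integrable_V) auto
  also have "\<dots> \<le> ennreal 5" using VI by simp
  finally show ?thesis by (subst (asm) ennreal_le_iff) auto
qed

lemma dominated_integrable_torus4:
  assumes "dominated L \<Phi>" shows "integrable torus4 \<Phi>"
proof -
  obtain c where c: "0 \<le> c" "\<And>s. \<bar>\<Phi> s\<bar> \<le> c * (1 + V L s)" using assms by (auto simp: dominated_def)
  show ?thesis
  proof (rule Bochner_Integration.integrable_bound)
    show "integrable torus4 (\<lambda>s. c * (1 + V L s))" using integrable_V by auto
    show "\<Phi> \<in> borel_measurable torus4" using dominated_measurable[OF assms] by measurable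
    have "norm (\<Phi> s) \<le> norm (c * (1 + V L s))" for s
      using order_trans[OF c(2) abs_ge_self] by simp
    then show "AE s in torus4. norm (\<Phi> s) \<le> norm (c * (1 + V L s))" by simp
  qed
qed

lemma integral_avg_dominated_nonneg:
  assumes dom: "dominated L \<Phi>" and per: "per4 \<Phi>" and nn: "\<And>s. 0 \<le> \<Phi> s"
  shows "(\<integral>s. avg L \<sigma> \<Phi> s \<partial>torus4) = (\<integral>s. \<Phi> s \<partial>torus4)"
proof -
  note [measurable] = dominated_measurable[OF dom]
  have ann: "0 \<le> avg L \<sigma> \<Phi> s" for s unfolding avg_def using nn by (intro integral_nonneg_AE) auto
  have "ennreal (\<integral>s. avg L \<sigma> \<Phi> s \<partial>torus4) = (\<integral>\<^sup>+s. ennreal (avg L \<sigma> \<Phi> s) \<partial>torus4)"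
    using ann by (intro nn_integral_eq_integral[symmetric] dominated_integrable_torus4 dominated_avg[OF L s0 s1] dom) auto
  also have "\<dots> = (\<integral>\<^sup>+s. navg L \<sigma> (\<lambda>s. ennreal (\<Phi> s)) s \<partial>torus4)"
    unfolding avg_def navg_def using nn
    by (intro nn_integral_cong nn_integral_eq_integral[symmetric] dominated_integrable[OF L s0 s1] dom) auto
  also have "\<dots> = (\<integral>\<^sup>+s. ennreal (\<Phi> s) \<partial>torus4)"
    by (rule nn_integral_navg[OF _ per4_abs[OF per] s0]) measurable
  also have "\<dots> = ennreal (\<integral>s. \<Phi> s \<partial>torus4)"
    using nn by (intro nn_integral_eq_integral dominated_integrable_torus4 dom) auto
  finally show ?thesis using ann nn by (simp add: ennreal_inj integral_nonneg_AE)
qed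

lemma integral_avg_dominated:
  assumes dom: "dominated L \<Phi>" and per: "per4 \<Phi>"
  shows "(\<integral>s. avg L \<sigma> \<Phi> s \<partial>torus4) = (\<integral>s. \<Phi> s \<partial>torus4)"
proof -
  note [measurable] = dominated_measurable[OF dom]
  obtain c where c: "0 \<le> c" "\<And>s. \<bar>\<Phi> s\<bar> \<le> c * (1 + V L s)" using dom by (auto simp: dominated_def)
  \<comment> \<open>A multiple of \<open>1 + V\<close> makes the function nonnegative; the
    nonnegative case is applied to the sum and to \<open>W\<close>, and the integral of
    \<open>W\<close> cancels.\<close>
  define W where "W s = c * V L s + c" for s
  have dW: "dominated L W" unfolding W_def by (intro dominated_add dominated_cmult dominated_V dominated_const)
  have pW: "per4 W" unfolding W_def by (rule per4_abs[OF per4_V])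
  have W: "0 \<le> W s" "0 \<le> \<Phi> s + W s" for s
    using c(1) c(2)[of s] by (auto simp: W_def algebra_simps abs_le_iff)
  have d: "dominated L (\<lambda>s. \<Phi> s + W s)" by (rule dominated_add[OF dom dW])
  have p: "per4 (\<lambda>s. \<Phi> s + W s)" using per pW by (simp add: per4_def)
  have a: "avg L \<sigma> (\<lambda>s. \<Phi> s + W s) = (\<lambda>s. avg L \<sigma> \<Phi> s + avg L \<sigma> W s)"
    using avg_pow_add[OF L s0 s1 dom dW, of 1] by simp
  note i = dominated_integrable_torus4[OF dominated_avg[OF L s0 s1 dom]] dominated_integrable_torus4[OF dominated_avg[OF L s0 s1 dW]]
    dominated_integrable_torus4[OF dom] dominated_integrable_torus4[OF dW]
  have "(\<integral>s. avg L \<sigma> \<Phi> s \<partial>torus4) + (\<integral>s. avg L \<sigma> W s \<partial>torus4) = (\<integral>s. avg L \<sigma> (\<lambda>s. \<Phi> s + W s) s \<partial>torus4)"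
    unfolding a by (rule Bochner_Integration.integral_add[OF i(1,2), symmetric])
  also have "\<dots> = (\<integral>s. \<Phi> s + W s \<partial>torus4)"
    by (rule integral_avg_dominated_nonneg[OF d p W(2)])
  also have "\<dots> = (\<integral>s. \<Phi> s \<partial>torus4) + (\<integral>s. W s \<partial>torus4)"
    by (rule Bochner_Integration.integral_add[OF i(3,4)])
  also have "(\<integral>s. W s \<partial>torus4) = (\<integral>s. avg L \<sigma> W s \<partial>torus4)"
    by (rule integral_avg_dominated_nonneg[OF dW pW W(1), symmetric])
  finally show ?thesis by simp
qed

lemma integral_avg_pow_dominated:
  assumes "dominated L \<Phi>" "per4 \<Phi>"
  shows "(\<integral>s. (avg L \<sigma> ^^ n) \<Phi> s \<partial>torus4) = (\<integral>s. \<Phi> s \<partial>torus4)"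
proof (induction n)
  case (Suc n)
  then show ?case
    using integral_avg_dominated[OF dominated_avg_pow[OF L s0 s1 assms(1)] per4_avg_pow[OF assms(2)], of n] by simp
qed simp

text \<open>Orbits that start together stay together. This settles the diagonal, where
  \<open>close\<close> gives no information.\<close>

lemma avg_pow_zero:
  assumes "\<And>s. sep s = 0 \<Longrightarrow> \<Phi> s = 0" "sep s = 0" shows "(avg L \<sigma> ^^ n) \<Phi> s = 0"
  using assms(2)
proof (induction n arbitrary: s)
  case (Suc n)
  have "(avg L \<sigma> ^^ n) \<Phi> (lift L \<omega> s) = 0" for \<omega> by (rule Suc.IH[OF sep_lift_zero[OF Suc.prems]])
  then show ?case by (simp add: avg_def[of L \<sigma> "(avg L \<sigma> ^^ n) \<Phi>"])
qed (use assms in simp)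

text \<open>Off a sublevel set of \<open>V\<close> the drift contracts by itself; on it the part of \<open>\<Phi>\<close> truncated at
  level \<open>c\<close> is handled by equidistribution, and the rest is small because the weight \<open>1/100\<close> of \<open>V\<close>
  is small.\<close>

lemma contraction:
  assumes drift: "\<And>s. (avg L \<sigma> ^^ 20) (V L) s \<le> 0.1 * V L s + 4"
    and close: "\<And>\<Phi> s. \<Phi> \<in> borel_measurable borel \<Longrightarrow> (\<And>s. \<bar>\<Phi> s\<bar> \<le> 1) \<Longrightarrow> per4 \<Phi> \<Longrightarrow>
      0 < sep s \<Longrightarrow> V L s \<le> 135 \<Longrightarrow> \<bar>(avg L \<sigma> ^^ 20) \<Phi> s - (\<integral>s. \<Phi> s \<partial>torus4)\<bar> \<le> 1 / 8"
    and m[measurable]: "\<Phi> \<in> borel_measurable borel" and per: "per4 \<Phi>"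
    and b: "\<And>s. \<bar>\<Phi> s\<bar> \<le> c * (1 + V L s / 100)" and c: "0 < c"
    and mean: "(\<integral>s. \<Phi> s \<partial>torus4) = 0" and z: "\<And>s. sep s = 0 \<Longrightarrow> \<Phi> s = 0"
  shows "\<bar>(avg L \<sigma> ^^ 20) \<Phi> s\<bar> \<le> c / 2 * (1 + V L s / 100)"
proof -
  let ?P = "avg L \<sigma> ^^ 20"
  have dom: "dominated L \<Phi>"
  proof (rule dominatedI[OF m, where c = c])
    show "\<bar>\<Phi> s\<bar> \<le> c * (1 + V L s)" for s
      by (rule order_trans[OF b]) (use c in \<open>auto intro!: mult_left_mono\<close>)
  qed (use c in simp)
  have PV: "?P (\<lambda>s. a * V L s + d) s \<le> a * (0.1 * V L s + 4) + d" if "0 \<le> a" for a d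
    unfolding avg_pow_affine[OF L s0 s1 dominated_V] using drift that by (intro add_right_mono mult_left_mono)
  consider "sep s = 0" | "135 < V L s" | "0 < sep s" "V L s \<le> 135" using sep_nonneg[of s] by linarith
  then show ?thesis
  proof cases
    case 1
    then show ?thesis using c by (simp add: avg_pow_zero[OF z])
  next
    case 2
    have "\<bar>?P \<Phi> s\<bar> \<le> ?P (\<lambda>s. c / 100 * V L s + c) s"
    proof (rule abs_avg_pow_le[OF L s0 s1 dom dominated_add[OF dominated_cmult[OF dominated_V] dominated_const]])
      show "\<bar>\<Phi> s\<bar> \<le> c / 100 * V L s + c" for s using b[of s] by (simp add: algebra_simps)
    qed
    also have "\<dots> \<le> c / 100 * (0.1 * V L s + 4) + c" using c by (intro PV) simp
    also have "\<dots> = c * (1.04 + V L s / 1000)" by (simp add: algebra_simps)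
    \<comment> \<open>Here the level 135 comes from:
      \<open>1.04 + V / 1000 \<le> 1/2 + V / 200\<close> holds exactly for
      \<open>V \<ge> 135\<close>.\<close>
    also have "\<dots> \<le> c * (1 / 2 * (1 + V L s / 100))" using c 2 by (intro mult_left_mono) auto
    finally show ?thesis by simp
  next
    case 3
    \<comment> \<open>Equidistribution holds only for bounded functions, so the part of modulus
      above \<open>c\<close> is split off. That part is at most \<open>c * V / 100\<close>, because
      \<open>\<Phi>\<close> exceeds \<open>c\<close> by at most this much.\<close>
    define \<Phi>1 where "\<Phi>1 s = max (-c) (min c (\<Phi> s))" for s
    define \<Phi>2 where "\<Phi>2 s = \<Phi> s - \<Phi>1 s" for s
    have [measurable]: "\<Phi>1 \<in> borel_measurable borel" unfolding \<Phi>1_def by measurable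
    have [measurable]: "\<Phi>2 \<in> borel_measurable borel" unfolding \<Phi>2_def by measurable
    have b1: "\<bar>\<Phi>1 s\<bar> \<le> c" for s using c by (auto simp: \<Phi>1_def)
    have b2: "\<bar>\<Phi>2 s\<bar> \<le> c / 100 * V L s + 0" for s
    proof -
      have "\<bar>\<Phi> s\<bar> \<le> c + c / 100 * V L s" using b[of s] by (simp add: algebra_simps)
      moreover have "0 \<le> c / 100 * V L s" using c by simp
      ultimately show ?thesis using c unfolding \<Phi>2_def \<Phi>1_def by linarith
    qed
    have dV: "dominated L (\<lambda>s. c / 100 * V L s + 0)" by (intro dominated_add dominated_cmult dominated_V dominated_const)
    have d2: "dominated L \<Phi>2"
    proof (rule dominated_mono[OF dV])
      show "\<bar>\<Phi>2 s\<bar> \<le> \<bar>c / 100 * V L s + 0\<bar>" for s using b2[of s] by linarith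
    qed measurable
    have d1: "dominated L \<Phi>1"
    proof (rule dominated_mono[OF dominated_const[of L c]])
      show "\<bar>\<Phi>1 s\<bar> \<le> \<bar>c\<bar>" for s using b1[of s] by linarith
    qed measurable
    have per1: "per4 \<Phi>1" unfolding \<Phi>1_def by (rule per4_abs[OF per])
    have P2: "\<bar>?P \<Phi>2 s\<bar> \<le> 35 / 200 * c"
    proof -
      have "\<bar>?P \<Phi>2 s\<bar> \<le> ?P (\<lambda>s. c / 100 * V L s + 0) s" by (rule abs_avg_pow_le[OF L s0 s1 d2 dV b2])
      also have "\<dots> \<le> c / 100 * (0.1 * V L s + 4) + 0" using c by (intro PV) simp
      also have "\<dots> \<le> c / 100 * 17.5 + 0" using c 3 by (intro add_right_mono mult_left_mono) auto
      finally show ?thesis by simp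
    qed
    have I2: "\<bar>\<integral>s. \<Phi>2 s \<partial>torus4\<bar> \<le> 5 / 100 * c"
    proof -
      have "\<bar>\<integral>s. \<Phi>2 s \<partial>torus4\<bar> \<le> (\<integral>s. \<bar>\<Phi>2 s\<bar> \<partial>torus4)" by (rule integral_abs_bound)
      also have "\<dots> \<le> (\<integral>s. c / 100 * V L s + 0 \<partial>torus4)"
        by (intro integral_mono integrable_abs dominated_integrable_torus4 d2 dV b2)
      also have "\<dots> = c / 100 * (\<integral>s. V L s \<partial>torus4)" by simp
      also have "\<dots> \<le> c / 100 * 5" using c by (intro mult_left_mono integral_V) auto
      finally show ?thesis by simp
    qed
    have I12: "(\<integral>s. \<Phi>1 s \<partial>torus4) = - (\<integral>s. \<Phi>2 s \<partial>torus4)"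
    proof -
      have "(\<integral>s. \<Phi> s \<partial>torus4) = (\<integral>s. \<Phi>1 s + \<Phi>2 s \<partial>torus4)" by (simp add: \<Phi>2_def)
      also have "\<dots> = (\<integral>s. \<Phi>1 s \<partial>torus4) + (\<integral>s. \<Phi>2 s \<partial>torus4)"
        by (intro Bochner_Integration.integral_add dominated_integrable_torus4 d1 d2)
      finally show ?thesis using mean by simp
    qed
    have P1: "\<bar>?P \<Phi>1 s - (\<integral>s. \<Phi>1 s \<partial>torus4)\<bar> \<le> 1 / 8 * c"
    proof -
      have "\<bar>?P (\<lambda>s. 1 / c * \<Phi>1 s + 0) s - (\<integral>s. 1 / c * \<Phi>1 s + 0 \<partial>torus4)\<bar> \<le> 1 / 8"
      proof (rule close[OF _ _ per4_abs[OF per1] 3])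
        show "\<bar>1 / c * \<Phi>1 s + 0\<bar> \<le> 1" for s using b1[of s] c by (simp add: abs_mult)
      qed measurable
      then have "\<bar>1 / c * (?P \<Phi>1 s - (\<integral>s. \<Phi>1 s \<partial>torus4))\<bar> \<le> 1 / 8"
        unfolding avg_pow_affine[OF L s0 s1 d1] by (simp add: right_diff_distrib diff_divide_distrib)
      then show ?thesis using c by (simp add: abs_mult pos_divide_le_eq)
    qed
    have "?P \<Phi> s = ?P \<Phi>1 s + ?P \<Phi>2 s"
      using avg_pow_add[OF L s0 s1 d1 d2, of 20] by (simp add: \<Phi>2_def)
    \<comment> \<open>The budget in units of \<open>c\<close>: 1/8 from equidistribution, 5/100 from
      the mean of the truncated part, which is minus the mean of the rest, and 35/200 from the drift
      applied to the rest. The sum is 0.35.\<close>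
    then have "\<bar>?P \<Phi> s\<bar> \<le> 35 / 100 * c" using P1 P2 I12 I2 by linarith
    also have "\<dots> \<le> c / 2 * 1" using c by simp
    also have "\<dots> \<le> c / 2 * (1 + V L s / 100)" using c by (intro mult_left_mono) auto
    finally show ?thesis .
  qed
qed

text \<open>The hypotheses of \<open>contraction\<close> reproduce themselves: zero mean by
  invariance of the integral, and zero values on the diagonal by
  \<open>avg_pow_zero\<close>.\<close>

lemma contraction_pow:
  assumes drift: "\<And>s. (avg L \<sigma> ^^ 20) (V L) s \<le> 0.1 * V L s + 4"
    and close: "\<And>\<Phi> s. \<Phi> \<in> borel_measurable borel \<Longrightarrow> (\<And>s. \<bar>\<Phi> s\<bar> \<le> 1) \<Longrightarrow> per4 \<Phi> \<Longrightarrow>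
      0 < sep s \<Longrightarrow> V L s \<le> 135 \<Longrightarrow> \<bar>(avg L \<sigma> ^^ 20) \<Phi> s - (\<integral>s. \<Phi> s \<partial>torus4)\<bar> \<le> 1 / 8"
    and m: "\<Phi> \<in> borel_measurable borel" and per: "per4 \<Phi>"
    and b: "\<And>s. \<bar>\<Phi> s\<bar> \<le> c * (1 + V L s / 100)" and c: "0 < c"
    and mean: "(\<integral>s. \<Phi> s \<partial>torus4) = 0" and z: "\<And>s. sep s = 0 \<Longrightarrow> \<Phi> s = 0"
  shows "\<bar>(avg L \<sigma> ^^ (20 * k)) \<Phi> s\<bar> \<le> c / 2 ^ k * (1 + V L s / 100)"
proof (induction k arbitrary: s)
  case (Suc k)
  have dom: "dominated L \<Phi>"
  proof (rule dominatedI[OF m, where c = c])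
    show "\<bar>\<Phi> s\<bar> \<le> c * (1 + V L s)" for s
      by (rule order_trans[OF b]) (use c in \<open>auto intro!: mult_left_mono\<close>)
  qed (use c in simp)
  have "\<bar>(avg L \<sigma> ^^ 20) ((avg L \<sigma> ^^ (20 * k)) \<Phi>) s\<bar> \<le> (c / 2 ^ k) / 2 * (1 + V L s / 100)"
  proof (rule contraction[OF drift close])
    show "(\<integral>s. (avg L \<sigma> ^^ (20 * k)) \<Phi> s \<partial>torus4) = 0"
      unfolding integral_avg_pow_dominated[OF dom per] by (rule mean)
    show "(avg L \<sigma> ^^ (20 * k)) \<Phi> s = 0" if "sep s = 0" for s by (rule avg_pow_zero[OF z that])
  qed (use Suc.IH c in \<open>auto intro: measurable_avg_pow[OF m s0] per4_avg_pow[OF per]\<close>)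
  moreover have "(avg L \<sigma> ^^ 20) ((avg L \<sigma> ^^ (20 * k)) \<Phi>) = (avg L \<sigma> ^^ (20 * Suc k)) \<Phi>"
    unfolding funpow_funpow by simp
  ultimately show ?case by (simp add: mult.commute)
qed (use b in simp)

lemma avg_pow_V_le: "(avg L \<sigma> ^^ r) (V L) s \<le> exp (3 * real r) * V L s"
proof (induction r arbitrary: s)
  case (Suc r)
  have "avg L \<sigma> ((avg L \<sigma> ^^ r) (V L)) s \<le> avg L \<sigma> (\<lambda>s. exp (3 * real r) * V L s) s"
    by (intro avg_mono[OF L s0 s1] dominated_avg_pow[OF L s0 s1] dominated_V dominated_cmult Suc)
  also have "\<dots> \<le> exp (3 * real r) * (exp 3 * V L s)"
    unfolding avg_def
  proof (rule prob_space.integral_le_const[OF prob_space_unif])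
    show "integrable (unif (-\<sigma>) \<sigma>) (\<lambda>\<omega>. exp (3 * real r) * V L (lift L \<omega> s))"
      by (intro integrable_mult_right dominated_integrable[OF L s0 s1] dominated_V)
    show "AE \<omega> in unif (-\<sigma>) \<sigma>. exp (3 * real r) * V L (lift L \<omega> s) \<le> exp (3 * real r) * (exp 3 * V L s)"
      by (auto intro!: V_lift_le L)
  qed (use s0 in simp)
  also have "\<dots> = exp (3 * real (Suc r)) * V L s" by (simp add: distrib_left exp_add mult.assoc mult.commute mult.left_commute)
  finally show ?case by simp
qed simp

text \<open>Blocks of twenty steps each halve the weighted bound. The fewer than twenty remaining
  steps cost at most \<open>exp 60\<close> by the crude growth of \<open>V\<close>, and a factor 2
  covers the incomplete block in \<open>2 powr (-1/20)\<close> to the power \<open>n\<close>. The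
  weight \<open>V / 100\<close> is enlarged to \<open>V\<close> in passing.\<close>

lemma geometric_decay:
  assumes drift: "\<And>s. (avg L \<sigma> ^^ 20) (V L) s \<le> 0.1 * V L s + 4"
    and close: "\<And>\<Phi> s. \<Phi> \<in> borel_measurable borel \<Longrightarrow> (\<And>s. \<bar>\<Phi> s\<bar> \<le> 1) \<Longrightarrow> per4 \<Phi> \<Longrightarrow>
      0 < sep s \<Longrightarrow> V L s \<le> 135 \<Longrightarrow> \<bar>(avg L \<sigma> ^^ 20) \<Phi> s - (\<integral>s. \<Phi> s \<partial>torus4)\<bar> \<le> 1 / 8"
    and m: "\<Phi> \<in> borel_measurable borel" and per: "per4 \<Phi>"
    and b: "\<And>s. \<bar>\<Phi> s\<bar> \<le> c * (1 + V L s / 100)" and c: "0 < c"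
    and mean: "(\<integral>s. \<Phi> s \<partial>torus4) = 0" and z: "\<And>s. sep s = 0 \<Longrightarrow> \<Phi> s = 0"
  shows "\<bar>(avg L \<sigma> ^^ n) \<Phi> s\<bar> \<le> 2 * exp 60 * c * (2 powr (-1/20)) ^ n * (1 + V L s)"
proof -
  define k where "k = n div 20"
  define r where "r = n mod 20"
  have n: "n = r + 20 * k" "r < 20" by (simp_all add: k_def r_def)
  let ?\<gamma> = "2 powr (-1/20) :: real"
  have dom: "dominated L \<Phi>"
  proof (rule dominatedI[OF m, where c = c])
    show "\<bar>\<Phi> s\<bar> \<le> c * (1 + V L s)" for s
      by (rule order_trans[OF b]) (use c in \<open>auto intro!: mult_left_mono\<close>)
  qed (use c in simp)
  define d where "d = c / 2 ^ k"
  have d: "0 < d" using c by (simp add: d_def)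
  have "\<bar>(avg L \<sigma> ^^ r) ((avg L \<sigma> ^^ (20 * k)) \<Phi>) s\<bar> \<le> (avg L \<sigma> ^^ r) (\<lambda>s. d / 100 * V L s + d) s"
  proof (rule abs_avg_pow_le[OF L s0 s1 dominated_avg_pow[OF L s0 s1 dom] dominated_add[OF dominated_cmult[OF dominated_V] dominated_const]])
    show "\<bar>(avg L \<sigma> ^^ (20 * k)) \<Phi> s\<bar> \<le> d / 100 * V L s + d" for s
      using contraction_pow[OF drift close m per b c mean z, of k s] unfolding d_def[symmetric] by (simp add: algebra_simps)
  qed
  also have "\<dots> = d / 100 * (avg L \<sigma> ^^ r) (V L) s + d" unfolding avg_pow_affine[OF L s0 s1 dominated_V] ..
  also have "\<dots> \<le> d / 100 * (exp 60 * V L s) + d"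
  proof (intro add_right_mono mult_left_mono)
    have "exp (3 * real r) \<le> exp 60" using n by simp
    then have "exp (3 * real r) * V L s \<le> exp 60 * V L s" by (intro mult_right_mono) auto
    with avg_pow_V_le[of r s] show "(avg L \<sigma> ^^ r) (V L) s \<le> exp 60 * V L s" by linarith
  qed (use d in simp)
  also have "\<dots> \<le> d * (exp 60 * V L s) + d * exp 60"
  proof (rule add_mono)
    show "d / 100 * (exp 60 * V L s) \<le> d * (exp 60 * V L s)" using d by (intro mult_right_mono) auto
    show "d \<le> d * exp 60" using d one_le_exp_iff[of "60::real"] by simp
  qed
  also have "\<dots> = (1 / 2 ^ k) * (exp 60 * c * (1 + V L s))" by (simp add: d_def algebra_simps add_divide_distrib)
  also have "\<dots> \<le> (2 * ?\<gamma> ^ n) * (exp 60 * c * (1 + V L s))"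
  proof (rule mult_right_mono)
    have "?\<gamma> ^ 20 = ?\<gamma> powr real 20" by (rule powr_realpow[symmetric]) simp
    also have "\<dots> = 2 powr (-1/20 * real 20)" by (rule powr_powr)
    finally have g20: "?\<gamma> ^ 20 = 1 / 2" by (simp add: powr_minus_divide)
    have "1 / 2 = ?\<gamma> ^ 20" by (rule g20[symmetric])
    also have "\<dots> \<le> ?\<gamma> ^ r" using n powr_mono[of "-1/20" 0 "2::real"] by (intro power_decreasing) auto
    finally have "(1 / 2) * (1 / 2) ^ k \<le> ?\<gamma> ^ r * (1 / 2) ^ k" by (intro mult_right_mono) auto
    moreover have "?\<gamma> ^ n = ?\<gamma> ^ r * (1 / 2) ^ k" unfolding n power_add power_mult g20 by (rule refl)
    ultimately show "1 / 2 ^ k \<le> 2 * ?\<gamma> ^ n" by (simp add: power_one_over)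
  qed (use c in simp)
  finally show ?thesis unfolding n(1) funpow_funpow by (simp add: mult_ac)
qed

end

section \<open>Passage to the fundamental domain\<close>

definition wrap :: "pair_state \<Rightarrow> pair_state"
  where "wrap s = ((frac (fst (fst s)), frac (snd (fst s))), (frac (fst (snd s)), frac (snd (snd s))))"

lemma measurable_frac [measurable]: "(frac :: real \<Rightarrow> real) \<in> borel_measurable borel"
  unfolding frac_def by measurable

lemma measurable_wrap [measurable]: "wrap \<in> borel_measurable borel"
  unfolding wrap_def by measurable

lemma per4_wrap: assumes "per4 \<Phi>" shows "\<Phi> (wrap s) = \<Phi> s"
proof -
  obtain x y x' y' where s: "s = ((x, y), (x', y'))" by (metis surj_pair)
  have p: "per1 (\<lambda>x. \<Phi> ((x, b), w))" "per1 (\<lambda>y. \<Phi> ((a, y), w))" "per1 (\<lambda>x. \<Phi> (w, (x, b)))" "per1 (\<lambda>y. \<Phi> (w, (a, y)))" for a b w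
    by (simp_all add: per1_def per4D[OF assms])
  show ?thesis unfolding s wrap_def fst_conv snd_conv per1_frac[OF p(1)] per1_frac[OF p(2)] per1_frac[OF p(3)] per1_frac[OF p(4)] ..
qed

lemma per4_comp_wrap: "per4 (\<lambda>s. f (wrap s))"
  by (simp add: per4_def wrap_def frac_1_eq)

lemma f_rand_eq_wrap: "(f_rand L a (fst s), f_rand L a (snd s)) = wrap (lift L a s)"
  by (simp add: f_rand_def wrap_def lift_def case_prod_beta)

lemma nd_eq_0_iff: "nd (x - x') = 0 \<longleftrightarrow> frac x = frac x'"
proof
  assume "nd (x - x') = 0"
  then have *: "x' + of_int (round (x - x')) = x" by (simp add: nd_def)
  have "frac (x' + of_int k) = frac x'" for k
    by (rule per1_of_int) (simp add: per1_def frac_1_eq)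
  from this[of "round (x - x')"] show "frac x = frac x'" unfolding * .
next
  assume "frac x = frac x'"
  then have "x - x' - of_int (\<lfloor>x\<rfloor> - \<lfloor>x'\<rfloor>) = 0" by (simp add: frac_def)
  moreover have "nd (x - x') \<le> \<bar>x - x' - of_int (\<lfloor>x\<rfloor> - \<lfloor>x'\<rfloor>)\<bar>" by (rule nd_le)
  ultimately show "nd (x - x') = 0" using nd_nonneg[of "x - x'"] by linarith
qed

lemma sep_eq_0_iff: "sep s = 0 \<longleftrightarrow> hx s = 0 \<and> hy s = 0"
  unfolding sep_def using hx_nonneg[of s] hy_nonneg[of s] by linarith

text \<open>Identifies the pairs on the plane that represent distinct points of the torus.\<close>

lemma wrap_off_diagonal_iff: "wrap s \<in> off_diagonal \<longleftrightarrow> 0 < sep s"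
proof -
  have "wrap s \<in> off_diagonal \<longleftrightarrow> \<not> (hx s = 0 \<and> hy s = 0)"
    by (auto simp: off_diagonal_def wrap_def torus_def frac_lt_1 hx_def hy_def nd_eq_0_iff)
  also have "\<dots> \<longleftrightarrow> 0 < sep s" using sep_eq_0_iff[of s] sep_nonneg[of s] by linarith
  finally show ?thesis .
qed

lemma wrap_torus: "fst s \<in> torus \<Longrightarrow> snd s \<in> torus \<Longrightarrow> wrap s = s"
  by (auto simp: torus_def wrap_def frac_eq prod_eq_iff mem_Times_iff)

lemma wrap_off_diagonal: "s \<in> off_diagonal \<Longrightarrow> wrap s = s"
  by (rule wrap_torus) (auto simp: off_diagonal_def)

lemma sets_off_diagonal [measurable]: "off_diagonal \<in> sets borel"
proof -
  have eq: "off_diagonal = fst -` torus \<inter> space borel \<inter> (snd -` torus \<inter> space borel) \<inter> {s. fst s \<noteq> snd s}"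
    by (auto simp: off_diagonal_def)
  have "open {s :: pair_state. fst s \<noteq> snd s}"
    by (rule open_Collect_neq[OF continuous_on_fst[OF continuous_on_id] continuous_on_snd[OF continuous_on_id]])
  then show ?thesis unfolding eq
    by (intro sets.Int borel_open measurable_sets[OF measurable_fst_borel sets_torus]
      measurable_sets[OF measurable_snd_borel sets_torus])
qed

lemma space_torus_measure: "space torus_measure = torus"
  by (simp add: torus_measure_def space_restrict_space)

lemma measurable_id_torus_measure [measurable]: "(\<lambda>z. z) \<in> measurable torus_measure borel"
  unfolding torus_measure_def by (rule measurable_restrict_space1) simp

lemma distr_torus_measure: "distr torus_measure borel (\<lambda>z. z) = torus2"
proof (rule measure_eqI)
  fix A assume "A \<in> sets (distr torus_measure borel (\<lambda>z. z))"
  then have [measurable]: "A \<in> sets borel" by simp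
  have "emeasure (distr torus_measure borel (\<lambda>z. z)) A = emeasure torus_measure (A \<inter> torus)"
    by (subst emeasure_distr) (auto simp: space_torus_measure)
  also have "\<dots> = emeasure lborel (A \<inter> torus)"
    unfolding torus_measure_def by (subst emeasure_restrict_space) auto
  also have "\<dots> = emeasure torus2 A"
    unfolding torus2_eq_density by (subst emeasure_density) (auto simp: indicator_inter_arith[symmetric] mult.commute nn_integral_indicator[symmetric] Int_commute simp del: nn_integral_indicator)
  finally show "emeasure (distr torus_measure borel (\<lambda>z. z)) A = emeasure torus2 A" .
qed simp

lemma torus4_eq_distr: "torus4 = distr (torus_measure \<Otimes>\<^sub>M torus_measure) borel (\<lambda>s. s)"
proof -
  have "sigma_finite_measure (distr torus_measure borel (\<lambda>z. z))"
    unfolding distr_torus_measure by (simp add: prob_space_imp_sigma_finite)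
  then have "distr torus_measure borel (\<lambda>z. z) \<Otimes>\<^sub>M distr torus_measure borel (\<lambda>z. z) =
     distr (torus_measure \<Otimes>\<^sub>M torus_measure) (borel \<Otimes>\<^sub>M borel) (\<lambda>(x, y). (x, y))"
    by (intro pair_measure_distr) auto
  moreover have "(\<lambda>(x, y). (x, y)) = (\<lambda>s :: pair_state. s)" by auto
  ultimately show ?thesis by (simp only: distr_torus_measure torus4_def borel_prod)
qed

lemma space_torus_pair: "space (torus_measure \<Otimes>\<^sub>M torus_measure) = torus \<times> torus"
  by (simp add: space_pair_measure space_torus_measure)

lemma measurable_id_torus_pair: "(\<lambda>s. s) \<in> measurable (torus_measure \<Otimes>\<^sub>M torus_measure) borel"
proof -
  have "(\<lambda>s. (fst s, snd s)) \<in> measurable (torus_measure \<Otimes>\<^sub>M torus_measure) (borel \<Otimes>\<^sub>M borel)" by measurable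
  then show ?thesis by (simp add: borel_prod)
qed

text \<open>The periodic extension of \<open>\<phi> - m\<close> to the plane. It vanishes where the
  two points agree mod 1, for every \<open>m\<close>; this makes it Borel measurable although
  \<open>\<phi>\<close> is arbitrary on the diagonal.\<close>

definition extend :: "(pair_state \<Rightarrow> real) \<Rightarrow> real \<Rightarrow> pair_state \<Rightarrow> real"
  where "extend \<phi> m s = (if 0 < sep s then \<phi> (wrap s) - m else 0)"

text \<open>The given measurability refers to the trace of the restricted product on
  \<open>off_diagonal\<close>. The inclusion from the Borel trace is measurable into that space, and
  multiplication by the indicator extends the composition to the whole space.\<close>

lemma measurable_extend:
  assumes "\<phi> \<in> borel_measurable (restrict_space (torus_measure \<Otimes>\<^sub>M torus_measure) off_diagonal)"
  shows "extend \<phi> m \<in> borel_measurable borel"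
proof -
  have c: "(\<lambda>s. g s) \<in> measurable (restrict_space borel off_diagonal) torus_measure"
    if "g \<in> borel_measurable borel" "\<And>s. s \<in> off_diagonal \<Longrightarrow> g s \<in> torus" for g :: "pair_state \<Rightarrow> real \<times> real"
    unfolding torus_measure_def
    by (rule measurable_restrict_space2) (use that in \<open>auto simp: space_restrict_space intro: measurable_restrict_space1\<close>)
  have "(\<lambda>s. (fst s, snd s)) \<in> measurable (restrict_space borel off_diagonal) (torus_measure \<Otimes>\<^sub>M torus_measure)"
    by (intro measurable_Pair c) (auto simp: off_diagonal_def)
  then have "(\<lambda>s. s) \<in> measurable (restrict_space borel off_diagonal) (restrict_space (torus_measure \<Otimes>\<^sub>M torus_measure) off_diagonal)"
    by (intro measurable_restrict_space2) (auto simp: space_restrict_space)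
  from measurable_compose[OF this assms]
  have "(\<lambda>s. indicator off_diagonal s *\<^sub>R \<phi> s) \<in> borel_measurable borel"
    by (subst (asm) borel_measurable_restrict_space_iff) auto
  from measurable_compose[OF measurable_wrap this]
  have [measurable]: "(\<lambda>s. indicator off_diagonal (wrap s) *\<^sub>R \<phi> (wrap s)) \<in> borel_measurable borel" .
  have "extend \<phi> m = (\<lambda>s. if 0 < sep s then indicator off_diagonal (wrap s) *\<^sub>R \<phi> (wrap s) - m else 0)"
    by (auto simp: fun_eq_iff extend_def wrap_off_diagonal_iff)
  then show ?thesis by simp
qed

lemma per4_extend: "per4 (extend \<phi> m)"
proof -
  have "extend \<phi> m = (\<lambda>s. (\<lambda>w. if w \<in> off_diagonal then \<phi> w - m else 0) (wrap s))"
    by (simp add: fun_eq_iff extend_def wrap_off_diagonal_iff)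
  then show ?thesis using per4_comp_wrap[of "\<lambda>w. if w \<in> off_diagonal then \<phi> w - m else 0"] by simp
qed

lemma pair_mean_eq:
  assumes "extend \<phi> 0 \<in> borel_measurable borel"
  shows "pair_mean \<phi> = (\<integral>s. extend \<phi> 0 s \<partial>torus4)"
proof -
  have "(\<integral>s. extend \<phi> 0 s \<partial>torus4) = (\<integral>s. extend \<phi> 0 s \<partial>(torus_measure \<Otimes>\<^sub>M torus_measure))"
    unfolding torus4_eq_distr by (rule integral_distr[OF measurable_id_torus_pair assms])
  also have "\<dots> = (\<integral>s. indicator off_diagonal s *\<^sub>R \<phi> s \<partial>(torus_measure \<Otimes>\<^sub>M torus_measure))"
  proof (rule Bochner_Integration.integral_cong[OF refl])
    fix s assume "s \<in> space (torus_measure \<Otimes>\<^sub>M torus_measure)"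
    then have w: "wrap s = s" by (intro wrap_torus) (auto simp: space_torus_pair)
    show "extend \<phi> 0 s = indicator off_diagonal s *\<^sub>R \<phi> s"
      using wrap_off_diagonal_iff[of s] by (simp add: extend_def w indicator_def)
  qed
  finally show ?thesis by (simp add: pair_mean_def set_lebesgue_integral_def)
qed

lemma integral_noise_measure:
  fixes g :: "real \<Rightarrow> real"
  assumes s: "0 < \<sigma>" and [measurable]: "g \<in> borel_measurable borel"
  shows "(\<integral>\<omega>. g (\<omega> 0) \<partial>noise_measure \<sigma>) = (\<integral>a. g a \<partial>unif (-\<sigma>) \<sigma>)"
proof -
  let ?A = "{-\<sigma>..\<sigma>}" and ?R = "restrict_space lborel {-\<sigma>..\<sigma>}"
  have eA: "emeasure ?R ?A = ennreal (2 * \<sigma>)" using s by (subst emeasure_restrict_space) auto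
  have A: "?A \<in> sets ?R" by (simp add: sets_restrict_space_iff)
  have P: "prob_space (noise_marginal \<sigma>)"
    unfolding noise_marginal_def using eA s by (intro prob_space_uniform_measure) auto
  have gR: "g \<in> borel_measurable ?R" by (rule measurable_restrict_space1) measurable
  have gm: "g \<in> borel_measurable (noise_marginal \<sigma>)"
    using gR unfolding noise_marginal_def by simp
  \<comment> \<open>The integrand sees only coordinate 0 of the noise sequence, whose law is the
    marginal.\<close>
  have "(\<integral>a. g a \<partial>noise_marginal \<sigma>) = (\<integral>a. g a \<partial>distr (noise_measure \<sigma>) (noise_marginal \<sigma>) (\<lambda>\<omega>. \<omega> 0))"
    unfolding noise_measure_def by (subst distr_PiM_component) (auto simp: P)
  also have "\<dots> = (\<integral>\<omega>. g (\<omega> 0) \<partial>noise_measure \<sigma>)"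
    unfolding noise_measure_def by (rule integral_distr[OF _ gm]) measurable
  finally have 1: "(\<integral>\<omega>. g (\<omega> 0) \<partial>noise_measure \<sigma>) = (\<integral>a. g a \<partial>noise_marginal \<sigma>)" ..
  have d: "noise_marginal \<sigma> = density ?R (\<lambda>a. ennreal (1 / (2 * \<sigma>)))"
    unfolding noise_marginal_def uniform_measure_def eA
  proof (rule density_cong)
    show "AE x in ?R. indicator ?A x / ennreal (2 * \<sigma>) = ennreal (1 / (2 * \<sigma>))"
    proof (rule AE_I2)
      fix x assume "x \<in> space ?R"
      then show "indicator ?A x / ennreal (2 * \<sigma>) = ennreal (1 / (2 * \<sigma>))"
        using s divide_ennreal[of 1 "2 * \<sigma>"] by (simp add: space_restrict_space)
    qed
  qed (use A in auto)
  have "(\<integral>a. g a \<partial>noise_marginal \<sigma>) = (\<integral>a. (1 / (2 * \<sigma>)) *\<^sub>R g a \<partial>?R)"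
    unfolding d using s gR by (intro integral_density) auto
  also have "\<dots> = (\<integral>a. indicator ?A a *\<^sub>R ((1 / (2 * \<sigma>)) *\<^sub>R g a) \<partial>lborel)"
    by (rule integral_restrict_space) simp
  also have "\<dots> = (\<integral>a. (1 / (2 * \<sigma>)) * (indicator ?A a * g a) \<partial>lborel)"
    by (intro Bochner_Integration.integral_cong refl) simp
  also have "\<dots> = (1 / (2 * \<sigma>)) * (\<integral>a. indicator ?A a * g a \<partial>lborel)" by (rule integral_mult_right_zero)
  also have "\<dots> = (\<integral>a. g a \<partial>unif (-\<sigma>) \<sigma>)" using s by (simp add: integral_unif)
  finally show ?thesis using 1 by simp
qed

text \<open>A step on the torus is \<open>lift\<close> followed by \<open>wrap\<close>, and
  \<open>wrap\<close> is invisible to periodic functions. Every application of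
  \<open>koopman2\<close> integrates over a fresh noise sequence of which only coordinate 0 enters,
  so powers of the operator are powers of \<open>avg\<close>.\<close>

lemma koopman2_pow_eq:
  assumes L: "16 \<le> L" and s: "0 < noise_size L \<delta>" "noise_size L \<delta> \<le> 1"
    and dom: "dominated L (extend \<phi> m)" and p: "p \<in> off_diagonal"
  shows "(koopman2 L \<delta> ^^ n) \<phi> p = (avg L (noise_size L \<delta>) ^^ n) (extend \<phi> m) p + m"
  using p
proof (induction n arbitrary: p)
  case 0
  then show ?case using wrap_off_diagonal[OF 0] wrap_off_diagonal_iff[of p] by (simp add: extend_def)
next
  case (Suc n)
  let ?\<sigma> = "noise_size L \<delta>"
  let ?\<Psi> = "(avg L ?\<sigma> ^^ n) (extend \<phi> m)"
  have dn: "dominated L ?\<Psi>" by (rule dominated_avg_pow[OF L s dom])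
  note [measurable] = dominated_measurable[OF dn]
  interpret N: prob_space "unif (-?\<sigma>) ?\<sigma>" using s by (intro prob_space_unif) simp
  have e: "(koopman2 L \<delta> ^^ n) \<phi> (f_rand L a (fst p), f_rand L a (snd p)) = ?\<Psi> (lift L a p) + m" for a
  proof -
    have "(f_rand L a (fst p), f_rand L a (snd p)) \<in> off_diagonal"
      using Suc.prems by (intro f_rand_off_diagonal) simp
    from Suc.IH[OF this] show ?thesis
      unfolding f_rand_eq_wrap per4_wrap[OF per4_avg_pow[OF per4_extend]] .
  qed
  have "(koopman2 L \<delta> ^^ Suc n) \<phi> p = (\<integral>\<omega>. ?\<Psi> (lift L (\<omega> 0) p) + m \<partial>noise_measure ?\<sigma>)"
    by (simp add: koopman2_def[of L \<delta> "(koopman2 L \<delta> ^^ n) \<phi>"] case_prod_beta e)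
  also have "\<dots> = (\<integral>a. ?\<Psi> (lift L a p) + m \<partial>unif (-?\<sigma>) ?\<sigma>)"
    by (rule integral_noise_measure[OF s(1)]) measurable
  also have "\<dots> = (\<integral>a. ?\<Psi> (lift L a p) \<partial>unif (-?\<sigma>) ?\<sigma>) + m"
    by (subst Bochner_Integration.integral_add[OF dominated_integrable[OF L s dn]]) (auto simp: N.prob_space[simplified])
  also have "\<dots> = (avg L ?\<sigma> ^^ Suc n) (extend \<phi> m) p + m" by (simp add: avg_def[of L ?\<sigma> ?\<Psi>])
  finally show ?case .
qed

text \<open>Collects every smallness condition on \<open>\<epsilon>\<close>, \<open>\<sigma>\<close>
  and \<open>L\<close>. As \<open>1 / \<sigma> = L powr \<delta>\<close> is at most
  \<open>L powr (1/1000)\<close>, each condition reduces to a comparison of powers of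
  \<open>L\<close> alone, so one \<open>L\<^sub>0\<close> serves all small
  \<open>\<delta>\<close>.\<close>

lemma parameters:
  "\<exists>L\<^sub>0>0. \<forall>\<delta> L :: real. 0 < \<delta> \<and> \<delta> < 1 / 1000 \<and> L > L\<^sub>0 \<longrightarrow>
    (\<exists>\<epsilon>. 16 \<le> L \<and> exp 2 \<le> L \<and> 0 < noise_size L \<delta> \<and> noise_size L \<delta> \<le> 1 \<and> 0 < \<epsilon> \<and> \<epsilon> \<le> 1 \<and> 1 / L < \<epsilon> \<and> 1 \<le> \<epsilon> * L \<and>
      4 * L powr (1/2) \<le> \<epsilon>\<^sup>2 * L \<and> 10 * sqrt \<epsilon> / noise_size L \<delta> * exp 6 \<le> 0.08 \<and> 4 * L ^ 6 \<le> (\<epsilon> * L) ^ 11 \<and>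
      10 * real (11 + 2) * sqrt \<epsilon> / noise_size L \<delta> + 4 * \<epsilon> / noise_size L \<delta> +
        5200 / (noise_size L \<delta> ^ 5 * \<epsilon>\<^sup>2) * L powr (-1/24) \<le> 1 / 8)"
proof -
  \<comment> \<open>Constraints on the exponent 1/60 of \<open>\<epsilon>\<close>: half of it must
    exceed 1/1000 for \<open>sqrt \<epsilon> / \<sigma>\<close> to tend to 0, and twice it plus
    5/1000 must stay below 1/24.\<close>
  let ?e = "\<lambda>L::real. L powr (-1/60)" and ?t = "\<lambda>L::real. L powr (1/1000)"
  have "\<forall>\<^sub>F L in at_top. 16 \<le> (L::real)" "\<forall>\<^sub>F L in at_top. exp 2 \<le> (L::real)"
    "\<forall>\<^sub>F L in at_top. 1 / L < ?e L" "\<forall>\<^sub>F L in at_top. 1 \<le> ?e L * L"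
    "\<forall>\<^sub>F L in at_top. 4 * L powr (1/2) \<le> (?e L)\<^sup>2 * L"
    "\<forall>\<^sub>F L in at_top. 10 * sqrt (?e L) * ?t L * exp 6 \<le> 0.08"
    "\<forall>\<^sub>F L in at_top. 4 * L ^ 6 \<le> (?e L * L) ^ 11"
    "\<forall>\<^sub>F L in at_top. 10 * real (11 + 2) * sqrt (?e L) * ?t L + 4 * ?e L * ?t L + 5200 * ?t L ^ 5 / (?e L)\<^sup>2 * L powr (-1/24) \<le> 1 / 8"
    by real_asymp+
  then have "\<forall>\<^sub>F L in at_top. 16 \<le> L \<and> exp 2 \<le> L \<and> 1 / L < ?e L \<and> 1 \<le> ?e L * L \<and> 4 * L powr (1/2) \<le> (?e L)\<^sup>2 * L \<and>
    10 * sqrt (?e L) * ?t L * exp 6 \<le> 0.08 \<and> 4 * L ^ 6 \<le> (?e L * L) ^ 11 \<and>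
    10 * real (11 + 2) * sqrt (?e L) * ?t L + 4 * ?e L * ?t L + 5200 * ?t L ^ 5 / (?e L)\<^sup>2 * L powr (-1/24) \<le> 1 / 8"
    by eventually_elim blast
  then obtain L0 where L0: "\<And>L. L0 \<le> L \<Longrightarrow> 16 \<le> L \<and> exp 2 \<le> L \<and> 1 / L < ?e L \<and> 1 \<le> ?e L * L \<and> 4 * L powr (1/2) \<le> (?e L)\<^sup>2 * L \<and>
    10 * sqrt (?e L) * ?t L * exp 6 \<le> 0.08 \<and> 4 * L ^ 6 \<le> (?e L * L) ^ 11 \<and>
    10 * real (11 + 2) * sqrt (?e L) * ?t L + 4 * ?e L * ?t L + 5200 * ?t L ^ 5 / (?e L)\<^sup>2 * L powr (-1/24) \<le> 1 / 8"
    by (auto simp: eventually_at_top_linorder)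
  show ?thesis
  proof (rule exI[of _ "max 1 L0"], intro conjI allI impI)
    fix \<delta> L :: real assume a: "0 < \<delta> \<and> \<delta> < 1 / 1000 \<and> L > max 1 L0"
    then have L1: "1 < L" "L0 \<le> L" by auto
    note P = L0[OF L1(2)]
    let ?s = "noise_size L \<delta>"
    have s: "0 < ?s" "?s \<le> 1" using a L1 powr_mono[of "-\<delta>" 0 L] by (auto simp: noise_size_def)
    have i: "1 / ?s = L powr \<delta>" by (simp add: noise_size_def powr_minus_divide)
    have t: "1 / ?s \<le> ?t L" unfolding i using a L1 by (intro powr_mono) auto
    have e: "0 < ?e L" "?e L \<le> 1" using L1 powr_mono[of "-1/60" 0 L] by auto
    have 1: "10 * sqrt (?e L) / ?s * exp 6 \<le> 0.08"
    proof -
      have "10 * sqrt (?e L) * (1 / ?s) * exp 6 \<le> 10 * sqrt (?e L) * ?t L * exp 6"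
        using t by (intro mult_right_mono mult_left_mono) auto
      also have "\<dots> \<le> 0.08" using P by blast
      finally show ?thesis by simp
    qed
    have 2: "10 * real (11 + 2) * sqrt (?e L) / ?s + 4 * ?e L / ?s + 5200 / (?s ^ 5 * (?e L)\<^sup>2) * L powr (-1/24) \<le> 1 / 8"
    proof -
      have "10 * real (11 + 2) * sqrt (?e L) * (1 / ?s) + 4 * ?e L * (1 / ?s) + 5200 * (1 / ?s) ^ 5 / (?e L)\<^sup>2 * L powr (-1/24) \<le>
          10 * real (11 + 2) * sqrt (?e L) * ?t L + 4 * ?e L * ?t L + 5200 * ?t L ^ 5 / (?e L)\<^sup>2 * L powr (-1/24)"
        using t s e by (intro add_mono mult_right_mono mult_left_mono divide_right_mono power_mono) auto
      also have "\<dots> \<le> 1 / 8" using P by blast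
      finally show ?thesis by (simp add: power_one_over)
    qed
    show "\<exists>\<epsilon>. 16 \<le> L \<and> exp 2 \<le> L \<and> 0 < ?s \<and> ?s \<le> 1 \<and> 0 < \<epsilon> \<and> \<epsilon> \<le> 1 \<and> 1 / L < \<epsilon> \<and> 1 \<le> \<epsilon> * L \<and>
      4 * L powr (1/2) \<le> \<epsilon>\<^sup>2 * L \<and> 10 * sqrt \<epsilon> / ?s * exp 6 \<le> 0.08 \<and> 4 * L ^ 6 \<le> (\<epsilon> * L) ^ 11 \<and>
      10 * real (11 + 2) * sqrt \<epsilon> / ?s + 4 * \<epsilon> / ?s + 5200 / (?s ^ 5 * \<epsilon>\<^sup>2) * L powr (-1/24) \<le> 1 / 8"
      using P s e 1 2 by - (rule exI[of _ "?e L"], elim conjE, (intro conjI; assumption))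
  qed simp
qed

text \<open>Origin of 1400: the mean is at most \<open>6 * M\<close> since \<open>V\<close> has
  integral at most 5, so subtracting it gives \<open>7 * M\<close>; passing from the weight
  \<open>V\<close> to \<open>V / 100\<close> gives \<open>700 * M\<close>, and
  \<open>geometric_decay\<close> contributes a factor 2.\<close>

lemma pointwise_decay:
  assumes L: "16 \<le> L" "exp 2 \<le> L" and s: "0 < noise_size L \<delta>" "noise_size L \<delta> \<le> 1"
    and \<epsilon>: "0 < \<epsilon>" "\<epsilon> \<le> 1" "1 / L < \<epsilon>" "1 \<le> \<epsilon> * L" "4 * L powr (1/2) \<le> \<epsilon>\<^sup>2 * L"
      "10 * sqrt \<epsilon> / noise_size L \<delta> * exp 6 \<le> 0.08" "4 * L ^ 6 \<le> (\<epsilon> * L) ^ 11"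
      "10 * real (11 + 2) * sqrt \<epsilon> / noise_size L \<delta> + 4 * \<epsilon> / noise_size L \<delta> +
        5200 / (noise_size L \<delta> ^ 5 * \<epsilon>\<^sup>2) * L powr (-1/24) \<le> 1 / 8"
    and \<phi>: "\<phi> \<in> borel_measurable (restrict_space (torus_measure \<Otimes>\<^sub>M torus_measure) off_diagonal)"
    and M: "0 \<le> M" "\<And>p. p \<in> off_diagonal \<Longrightarrow> \<bar>\<phi> p\<bar> \<le> M * (1 + V L p)" and p: "p \<in> off_diagonal"
  shows "\<bar>(koopman2 L \<delta> ^^ n) \<phi> p - pair_mean \<phi>\<bar> \<le> 1400 * exp 60 * (2 powr (-1/20)) ^ n * (1 + V L p) * M"
proof (rule field_le_epsilon)
  fix e :: real assume e: "0 < e"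
  interpret T4: prob_space torus4 by simp
  let ?\<sigma> = "noise_size L \<delta>" and ?\<gamma> = "(2 powr (-1/20)) ^ n :: real"
  define m where "m = pair_mean \<phi>"
  have VI: "(\<integral>\<^sup>+s. ennreal (V L s) \<partial>torus4) \<le> 5" by (rule nn_integral_V[OF L(2)])
  have L1: "1 < L" "1 \<le> L" using L by auto
  have drift: "avg L ?\<sigma> (avg L ?\<sigma> (V L)) s \<le> 0.7 * V L s + 1" for s
    by (rule drift[OF L(1) s \<epsilon>(1,2,3,5,6)])
  have d20: "(avg L ?\<sigma> ^^ 20) (V L) s \<le> 0.1 * V L s + 4" for s
    by (rule drift_20[OF L(1) s drift])
  have close: "\<bar>(avg L ?\<sigma> ^^ 20) \<Phi> s - (\<integral>s. \<Phi> s \<partial>torus4)\<bar> \<le> 1 / 8"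
    if \<Phi>: "\<Phi> \<in> borel_measurable borel" "\<And>s. \<bar>\<Phi> s\<bar> \<le> 1" "per4 \<Phi>" and sp: "0 < sep s" "V L s \<le> 135" for \<Phi> s
  proof -
    have "1 \<le> tdist s * L ^ 6"
      using sp L1 unfolding V_def by (intro lyap_le_135) (auto simp: tdist_pos_iff)
    also have "\<dots> \<le> 2 * sep s * L ^ 6" using L1 by (intro mult_right_mono tdist_le_sep) auto
    finally have "2 \<le> sep s * (4 * L ^ 6)" by simp
    also have "\<dots> \<le> sep s * (\<epsilon> * L) ^ 11" by (intro mult_left_mono \<epsilon>) auto
    finally have "2 \<le> sep s * (\<epsilon> * L) ^ 11" .
    \<comment> \<open>With \<open>n = 11\<close> the closeness estimate concerns
      \<open>11 + 9 = 20\<close> steps, the same number as in the drift inequality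
      \<open>d20\<close>.\<close>
    from avg_pow_close[OF \<Phi> s L1(2) \<epsilon>(1,2,4) this] \<epsilon>(8) show ?thesis by simp
  qed
  have V0: "V L (wrap s) = V L s" for s by (rule per4_wrap[OF per4_V])
  have em: "extend \<phi> a \<in> borel_measurable borel" for a by (rule measurable_extend[OF \<phi>])
  have b0: "\<bar>extend \<phi> 0 s\<bar> \<le> M * (1 + V L s)" for s
    using M(2)[of "wrap s"] M(1) by (simp add: extend_def wrap_off_diagonal_iff V0)
  have dom0: "dominated L (extend \<phi> 0)" by (rule dominatedI[OF em M(1) b0])
  have m_eq: "m = (\<integral>s. extend \<phi> 0 s \<partial>torus4)" unfolding m_def by (rule pair_mean_eq[OF em])
  have mB: "\<bar>m\<bar> \<le> 6 * M"
  proof -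
    have "\<bar>m\<bar> \<le> (\<integral>s. \<bar>extend \<phi> 0 s\<bar> \<partial>torus4)" unfolding m_eq by (rule integral_abs_bound)
    also have "\<dots> \<le> (\<integral>s. M * (1 + V L s) \<partial>torus4)"
      using integrable_V[OF L(1) s VI] dominated_integrable_torus4[OF L(1) s VI dom0]
      by (intro integral_mono integrable_abs b0) auto
    also have "\<dots> = M * (1 + (\<integral>s. V L s \<partial>torus4))"
      using integrable_V[OF L(1) s VI] by (simp add: T4.prob_space[simplified])
    also have "\<dots> \<le> M * (1 + 5)" using integral_V[OF L(1) s VI] by (intro mult_left_mono add_left_mono M) auto
    finally show ?thesis by simp
  qed
  have b: "\<bar>extend \<phi> m s\<bar> \<le> 7 * M * (1 + V L s)" for s
  proof -
    have "\<bar>extend \<phi> m s\<bar> \<le> \<bar>extend \<phi> 0 s\<bar> + \<bar>m\<bar>" by (auto simp: extend_def)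
    moreover have "6 * M * 1 \<le> 6 * M * (1 + V L s)" using M(1) by (intro mult_left_mono) auto
    moreover have "7 * M * (1 + V L s) = M * (1 + V L s) + 6 * M * (1 + V L s)" by (simp add: algebra_simps)
    ultimately show ?thesis using b0[of s] mB by linarith
  qed
  have dom: "dominated L (extend \<phi> m)" by (rule dominatedI[OF em _ b]) (use M in simp)
  have mean: "(\<integral>s. extend \<phi> m s \<partial>torus4) = 0"
  proof -
    \<comment> \<open>The two integrands differ on the diagonal, where both extensions are 0; it is
      a null set.\<close>
    have "(\<integral>s. extend \<phi> m s \<partial>torus4) = (\<integral>s. extend \<phi> 0 s - m \<partial>torus4)"
    proof (rule integral_cong_AE)
      show "AE s in torus4. extend \<phi> m s = extend \<phi> 0 s - m"
        using AE_torus4_sep by eventually_elim (simp add: extend_def)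
    qed (use em in auto)
    also have "\<dots> = (\<integral>s. extend \<phi> 0 s \<partial>torus4) - m"
      using dominated_integrable_torus4[OF L(1) s VI dom0] by (simp add: T4.prob_space[simplified])
    finally show ?thesis by (simp add: m_eq)
  qed
  have V1: "0 < 1 + V L p" using V_nonneg[of L p] by linarith
  define K where "K = 2 * exp 60 * ?\<gamma> * (1 + V L p)"
  have K: "0 < K" using V1 by (simp add: K_def)
  \<comment> \<open>\<open>M\<close> may be 0, whereas the contraction needs a positive constant.
    The surplus \<open>e / K\<close> is scaled so that it contributes exactly \<open>e\<close> to
    the final bound.\<close>
  define c where "c = 700 * M + e / K"
  have c: "0 < c" "700 * M \<le> c" using M(1) e K by (auto simp: c_def intro!: add_nonneg_pos)
  have "\<bar>(avg L ?\<sigma> ^^ n) (extend \<phi> m) p\<bar> \<le> 2 * exp 60 * c * ?\<gamma> * (1 + V L p)"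
  proof (rule geometric_decay[OF L(1) s VI d20 close em per4_extend _ c(1) mean])
    fix s
    have "\<bar>extend \<phi> m s\<bar> \<le> 7 * M * (1 + V L s)" by (rule b)
    also have "\<dots> \<le> 7 * M * (100 * (1 + V L s / 100))" using M(1) by (intro mult_left_mono) auto
    also have "\<dots> = 700 * M * (1 + V L s / 100)" by simp
    also have "\<dots> \<le> c * (1 + V L s / 100)" using c by (intro mult_right_mono) auto
    finally show "\<bar>extend \<phi> m s\<bar> \<le> c * (1 + V L s / 100)" .
  qed (simp_all add: extend_def)
  also have "\<dots> = K * c" by (simp add: K_def mult_ac)
  also have "\<dots> = 1400 * exp 60 * ?\<gamma> * (1 + V L p) * M + e"
  proof -
    have "K * c = 700 * K * M + e" using K by (simp add: c_def distrib_left)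
    then show ?thesis by (simp add: K_def algebra_simps)
  qed
  finally show "\<bar>(koopman2 L \<delta> ^^ n) \<phi> p - pair_mean \<phi>\<bar> \<le> 1400 * exp 60 * ?\<gamma> * (1 + V L p) * M + e"
    unfolding koopman2_pow_eq[OF L(1) s dom p] m_def[symmetric] by simp
qed

theorem theorem2p4:
  shows "\<exists>C>0. \<exists>\<gamma>\<in>{0<..<1}. \<exists>\<epsilon>\<^sub>0>0. \<exists>t::nat. t \<ge> 1 \<and> (\<exists>L\<^sub>0>0. \<exists>\<delta>\<^sub>0>0.
    \<forall>\<delta> L :: real. 0 < \<delta> \<and> \<delta> < \<delta>\<^sub>0 \<and> L > L\<^sub>0 \<longrightarrow>
      (\<forall>n\<ge>1. \<forall>\<phi> \<in> weighted_Linf (lyapunov_V \<epsilon>\<^sub>0 t L).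
        weighted_norm (lyapunov_V \<epsilon>\<^sub>0 t L) (\<lambda>p. (koopman2 L \<delta> ^^ n) \<phi> p - pair_mean \<phi>)
          \<le> ennreal (C * \<gamma> ^ n) * weighted_norm (lyapunov_V \<epsilon>\<^sub>0 t L) \<phi> \<and>
        (\<forall>p \<in> off_diagonal.
          \<bar>(koopman2 L \<delta> ^^ n) \<phi> p - pair_mean \<phi>\<bar>
            \<le> C * \<gamma> ^ n * (1 + lyapunov_V \<epsilon>\<^sub>0 t L p)
                * enn2real (weighted_norm (lyapunov_V \<epsilon>\<^sub>0 t L) \<phi>))))"
proof -
  obtain L0 where L0: "0 < L0" "\<And>\<delta> L. 0 < \<delta> \<and> \<delta> < 1 / 1000 \<and> L > L0 \<Longrightarrow>
    (\<exists>\<epsilon>. 16 \<le> L \<and> exp 2 \<le> L \<and> 0 < noise_size L \<delta> \<and> noise_size L \<delta> \<le> 1 \<and> 0 < \<epsilon> \<and> \<epsilon> \<le> 1 \<and> 1 / L < \<epsilon> \<and> 1 \<le> \<epsilon> * L \<and>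
      4 * L powr (1/2) \<le> \<epsilon>\<^sup>2 * L \<and> 10 * sqrt \<epsilon> / noise_size L \<delta> * exp 6 \<le> 0.08 \<and> 4 * L ^ 6 \<le> (\<epsilon> * L) ^ 11 \<and>
      10 * real (11 + 2) * sqrt \<epsilon> / noise_size L \<delta> + 4 * \<epsilon> / noise_size L \<delta> +
        5200 / (noise_size L \<delta> ^ 5 * \<epsilon>\<^sup>2) * L powr (-1/24) \<le> 1 / 8)"
    using parameters by blast
  \<comment> \<open>The constants come from \<open>pointwise_decay\<close>. With both parameters of
    \<open>lyapunov_V\<close> equal to 1 it coincides with \<open>V\<close>.\<close>
  let ?C = "1400 * exp 60 :: real" and ?\<gamma> = "2 powr (-1/20) :: real"
  have g: "?\<gamma> \<in> {0<..<1}" using powr_less_mono[of "-1/20" 0 "2::real"] by simp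
  have main: "weighted_norm (lyapunov_V 1 1 L) (\<lambda>p. (koopman2 L \<delta> ^^ n) \<phi> p - pair_mean \<phi>)
          \<le> ennreal (?C * ?\<gamma> ^ n) * weighted_norm (lyapunov_V 1 1 L) \<phi> \<and>
        (\<forall>p \<in> off_diagonal.
          \<bar>(koopman2 L \<delta> ^^ n) \<phi> p - pair_mean \<phi>\<bar>
            \<le> ?C * ?\<gamma> ^ n * (1 + lyapunov_V 1 1 L p) * enn2real (weighted_norm (lyapunov_V 1 1 L) \<phi>))"
    if a: "0 < \<delta> \<and> \<delta> < 1 / 1000 \<and> L > L0" and \<phi>: "\<phi> \<in> weighted_Linf (lyapunov_V 1 1 L)" for \<delta> L :: real and n \<phi>
  proof -
    obtain \<epsilon> where \<epsilon>: "16 \<le> L" "exp 2 \<le> L" "0 < noise_size L \<delta>" "noise_size L \<delta> \<le> 1" "0 < \<epsilon>" "\<epsilon> \<le> 1" "1 / L < \<epsilon>" "1 \<le> \<epsilon> * L"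
      "4 * L powr (1/2) \<le> \<epsilon>\<^sup>2 * L" "10 * sqrt \<epsilon> / noise_size L \<delta> * exp 6 \<le> 0.08" "4 * L ^ 6 \<le> (\<epsilon> * L) ^ 11"
      "10 * real (11 + 2) * sqrt \<epsilon> / noise_size L \<delta> + 4 * \<epsilon> / noise_size L \<delta> +
        5200 / (noise_size L \<delta> ^ 5 * \<epsilon>\<^sup>2) * L powr (-1/24) \<le> 1 / 8"
      using L0(2)[OF a] by blast
    have Veq: "lyapunov_V 1 1 L = V L" using \<epsilon>(1) by (intro ext lyapunov_V_eq) simp
    define W where "W = weighted_norm (V L) \<phi>"
    have meas: "\<phi> \<in> borel_measurable (restrict_space (torus_measure \<Otimes>\<^sub>M torus_measure) off_diagonal)"
      and fin: "W < \<infinity>" using \<phi> unfolding Veq W_def weighted_Linf_def by auto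
    define M where "M = enn2real W"
    have WM: "W = ennreal M" "0 \<le> M" using fin by (auto simp: M_def)
    have V1: "0 < 1 + V L p" for p using V_nonneg[of L p] by linarith
    have MB: "\<bar>\<phi> p\<bar> \<le> M * (1 + V L p)" if "p \<in> off_diagonal" for p
    proof -
      have "ennreal (\<bar>\<phi> p\<bar> / (1 + V L p)) \<le> W"
        unfolding W_def weighted_norm_def using that by (rule SUP_upper)
      then have "\<bar>\<phi> p\<bar> / (1 + V L p) \<le> M" using WM by (simp add: ennreal_le_iff)
      then show ?thesis using V1[of p] by (simp add: pos_divide_le_eq)
    qed
    have pw: "\<bar>(koopman2 L \<delta> ^^ n) \<phi> p - pair_mean \<phi>\<bar> \<le> ?C * ?\<gamma> ^ n * (1 + V L p) * M" if "p \<in> off_diagonal" for p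
      by (rule pointwise_decay[OF \<epsilon> meas WM(2) MB that])
    have "weighted_norm (V L) (\<lambda>p. (koopman2 L \<delta> ^^ n) \<phi> p - pair_mean \<phi>) \<le> ennreal (?C * ?\<gamma> ^ n * M)"
      unfolding weighted_norm_def
    proof (rule SUP_least, rule ennreal_leI)
      fix p assume "p \<in> off_diagonal"
      from pw[OF this] have "\<bar>(koopman2 L \<delta> ^^ n) \<phi> p - pair_mean \<phi>\<bar> \<le> ?C * ?\<gamma> ^ n * M * (1 + V L p)" by (simp add: mult_ac)
      then show "\<bar>(koopman2 L \<delta> ^^ n) \<phi> p - pair_mean \<phi>\<bar> / (1 + V L p) \<le> ?C * ?\<gamma> ^ n * M"
        by (subst pos_divide_le_eq[OF V1])
    qed
    also have "\<dots> = ennreal (?C * ?\<gamma> ^ n) * W" unfolding WM(1) using WM(2) by (intro ennreal_mult) auto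
    finally show ?thesis using pw unfolding Veq W_def[symmetric] M_def by blast
  qed
  show ?thesis
    using main L0(1)
    by - (rule exI[of _ ?C], rule conjI, simp, rule bexI[OF _ g], rule exI[of _ "1::real"], rule conjI, simp,
      rule exI[of _ "1::nat"], rule conjI, simp, rule exI[of _ L0], rule conjI, assumption,
      rule exI[of _ "1/1000::real"], rule conjI, simp, intro allI impI ballI, blast)
qed

end
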